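(* Let $p>2$ be a prime integer, let $F$ be the field with $p$ elements, and let $G$ and $H$ be finite $p$-groups such that $FG\cong FH$ as $F$-algebras. Let $d\in\mathbb{Z}_{\geq 0}$ be such that $|G/\Phi(G)\mathrm{Z}(G)|=p^d$. If (1) $G^p\cap\gamma_2(G)\subseteq\gamma_2(G)^p\gamma_3(G)$, and (2) $|\gamma_2(G)/\gamma_2(G)^p\gamma_3(G)|=p^{\binom{d}{2}}$, then $G/\gamma_2(G)^p\gamma_4(G)\cong H/\gamma_2(H)^p\gamma_4(H)$.
   Context: For a finite $p$-group $G$: $\mathrm{Z}(G)$ is its center, $\Phi(G)$ its Frattini subgroup, and $(\gamma_i(G))_{i\geq 1}$ its lower central series, i.e. $\gamma_1(G)=G$ and $\gamma_{i+1}(G)=[\gamma_i(G),G]$, with $[a,b]=a^{-1}b^{-1}ab$. For a group $X$, $X^p$ denotes the subgroup generated by the $p$-th powers of elements of $X$. $FG$ denotes the group algebra of $G$ over $F$. *)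

theory Defs
  imports
    "HOL-Computational_Algebra.Primes"
    "HOL-Library.FuncSet"
    "HOL-Algebra.Generated_Groups"
    "HOL-Algebra.Module"
    "HOL-Algebra.QuotRing"
begin

section \<open>Subgroups of a group\<close>

definition finite_p_group :: "nat \<Rightarrow> ('a, 'm) monoid_scheme \<Rightarrow> bool" where
  "finite_p_group p G \<longleftrightarrow> group G \<and> finite (carrier G) \<and> (\<exists>n. order G = p ^ n)"

definition group_center :: "('a, 'm) monoid_scheme \<Rightarrow> 'a set" where
  "group_center G =
    {z \<in> carrier G. \<forall>x \<in> carrier G. z \<otimes>\<^bsub>G\<^esub> x = x \<otimes>\<^bsub>G\<^esub> z}"

definition maximal_subgroup :: "'a set \<Rightarrow> ('a, 'm) monoid_scheme \<Rightarrow> bool" where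
  "maximal_subgroup M G \<longleftrightarrow>
    subgroup M G \<and> M \<noteq> carrier G \<and>
    (\<forall>K. subgroup K G \<longrightarrow> M \<subseteq> K \<longrightarrow> K = M \<or> K = carrier G)"

text \<open>The intersection with the carrier gives the usual convention that the Frattini
  subgroup of a group without maximal subgroups (e.g. the trivial group) is the whole group.\<close>

definition frattini :: "('a, 'm) monoid_scheme \<Rightarrow> 'a set" where
  "frattini G = carrier G \<inter> \<Inter>{M. maximal_subgroup M G}"

definition commutator :: "('a, 'm) monoid_scheme \<Rightarrow> 'a \<Rightarrow> 'a \<Rightarrow> 'a" where
  "commutator G a b = inv\<^bsub>G\<^esub> a \<otimes>\<^bsub>G\<^esub> inv\<^bsub>G\<^esub> b \<otimes>\<^bsub>G\<^esub> a \<otimes>\<^bsub>G\<^esub> b"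

definition commutator_subgroup :: "('a, 'm) monoid_scheme \<Rightarrow> 'a set \<Rightarrow> 'a set \<Rightarrow> 'a set" where
  "commutator_subgroup G A B = generate G {commutator G a b | a b. a \<in> A \<and> b \<in> B}"

text \<open>The series is indexed from 1, so that \<open>lower_central G 1\<close> is the whole group;
  the value at index 0 has no meaning.\<close>

fun lower_central :: "('a, 'm) monoid_scheme \<Rightarrow> nat \<Rightarrow> 'a set" where
  "lower_central G 0 = carrier G"
| "lower_central G (Suc 0) = carrier G"
| "lower_central G (Suc (Suc i)) =
    commutator_subgroup G (lower_central G (Suc i)) (carrier G)"

definition power_subgroup :: "('a, 'm) monoid_scheme \<Rightarrow> nat \<Rightarrow> 'a set \<Rightarrow> 'a set" where
  "power_subgroup G n X = generate G {x [^]\<^bsub>G\<^esub> n | x. x \<in> X}"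


section \<open>Group algebras\<close>

text \<open>The group algebra of a finite group: the element \<open>\<Sum>x. f x \<cdot> x\<close> is represented by its
  coefficient function \<open>f\<close>, restricted to the carrier so that equality of elements is equality
  of functions, and multiplication is convolution. No finite-support condition is imposed,
  so this is the group algebra only when the group is finite.\<close>

definition group_algebra ::
    "('f, 'r) ring_scheme \<Rightarrow> ('a, 'm) monoid_scheme \<Rightarrow> ('f, 'a \<Rightarrow> 'f) module" where
  "group_algebra F G =
    \<lparr>carrier = carrier G \<rightarrow>\<^sub>E carrier F,
     monoid.mult = (\<lambda>f g. \<lambda>x \<in> carrier G.
       \<Oplus>\<^bsub>F\<^esub>y \<in> carrier G. f y \<otimes>\<^bsub>F\<^esub> g (inv\<^bsub>G\<^esub> y \<otimes>\<^bsub>G\<^esub> x)),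
     one = (\<lambda>x \<in> carrier G. if x = \<one>\<^bsub>G\<^esub> then \<one>\<^bsub>F\<^esub> else \<zero>\<^bsub>F\<^esub>),
     zero = (\<lambda>x \<in> carrier G. \<zero>\<^bsub>F\<^esub>),
     add = (\<lambda>f g. \<lambda>x \<in> carrier G. f x \<oplus>\<^bsub>F\<^esub> g x),
     smult = (\<lambda>c f. \<lambda>x \<in> carrier G. c \<otimes>\<^bsub>F\<^esub> f x)\<rparr>"

text \<open>The library's locale \<open>algebra\<close> requires commutativity, so isomorphisms of (unital,
  associative) algebras are introduced here as linear ring isomorphisms.\<close>

definition algebra_iso ::
    "('f, 'r) ring_scheme \<Rightarrow> ('f, 'a, 'm) module_scheme \<Rightarrow> ('f, 'b, 'n) module_scheme
      \<Rightarrow> ('a \<Rightarrow> 'b) set" where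
  "algebra_iso F A B =
    {\<phi> \<in> ring_iso A B. \<forall>c \<in> carrier F. \<forall>a \<in> carrier A. \<phi> (c \<odot>\<^bsub>A\<^esub> a) = c \<odot>\<^bsub>B\<^esub> \<phi> a}"

definition algebra_isomorphic ::
    "('f, 'r) ring_scheme \<Rightarrow> ('f, 'a, 'm) module_scheme \<Rightarrow> ('f, 'b, 'n) module_scheme
      \<Rightarrow> bool" where
  "algebra_isomorphic F A B \<longleftrightarrow> algebra_iso F A B \<noteq> {}"

end

theory Submission
  imports Defs "HOL-Library.Poly_Mapping" "HOL-Algebra.SndIsomorphismGrp" "HOL-Algebra.Group_Action"
    "HOL-Algebra.Multiplicative_Group"
begin

text \<open>Write \<open>FG \<cong> FH\<close> as \<open>R / K\<^sub>0\<close> for one ring \<open>R\<close>, and let \<open>I\<close> be its augmentation ideal, \<open>A\<close> the ideal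
  generated by the ring commutators, \<open>J = I\<^sup>2\<close>, \<open>L = IA + AI\<close> and \<open>K = AI + I\<^sup>2A\<close> (each containing \<open>K\<^sub>0\<close>).
  These ideals do not depend on the group basis, yet \<open>g - 1\<close> lies in \<open>A\<close>, \<open>L\<close>, \<open>K\<close> exactly when \<open>g\<close> lies in
  \<open>\<gamma>\<^sub>2\<close>, \<open>\<gamma>\<^sub>2\<^sup>p \<gamma>\<^sub>3\<close>, \<open>\<gamma>\<^sub>2\<^sup>p \<gamma>\<^sub>4\<close>. As \<open>p > 2\<close>, \<open>(x + u)\<^sup>q = x\<^sup>q + u\<^sup>q\<close> modulo \<open>K\<close>
  for \<open>x \<in> I\<close>, \<open>u \<in> J\<close> and \<open>q\<close> a power of \<open>p\<close>,
  and hypothesis (1) says that the span of the \<open>p\<close>-th powers of \<open>I\<close> meets \<open>A\<close> inside \<open>L\<close>, a condition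
  symmetric in \<open>G\<close> and \<open>H\<close>. It allows one to lift a ring element whose \<open>q\<close>-th power is \<open>1\<close> modulo \<open>A\<close> to a
  group element with the same class modulo \<open>J\<close> and the same \<open>q\<close>-th power modulo \<open>K\<close>. Exchanging
  generators in this way yields generators \<open>g\<^sub>i\<close> of \<open>G\<close> and \<open>h\<^sub>i\<close> of \<open>H\<close> that agree modulo \<open>J\<close>, whose powers
  \<open>p ^ k i\<close> agree modulo \<open>K\<close> and lie in \<open>1 + L\<close>, that are independent with these orders modulo \<open>\<gamma>\<^sub>2\<close>, and that
  are central modulo \<open>K\<close> from index \<open>d\<close> on.

  By hypothesis (2) the \<open>d choose 2\<close> commutators of the first \<open>d\<close> generators are independent modulo \<open>L\<close>.
  Hence the subgroup \<open>D\<close> of \<open>G \<times> H\<close> generated by the pairs \<open>(g\<^sub>i, h\<^sub>i)\<close> and by the pairs \<open>(m, m')\<close> in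
  \<open>\<gamma>\<^sub>2(G) \<times> \<gamma>\<^sub>2(H)\<close> with equal commutator coefficients and equal \<open>L\<close>-part modulo \<open>K\<close> satisfies
  \<open>x \<in> \<gamma>\<^sub>2(G)\<^sup>p \<gamma>\<^sub>4(G) \<longleftrightarrow> y \<in> \<gamma>\<^sub>2(H)\<^sup>p \<gamma>\<^sub>4(H)\<close> for all \<open>(x, y) \<in> D\<close>, and Goursat's lemma gives the isomorphism.\<close>

section \<open>Congruences in non-commutative rings\<close>

text \<open>A/AI is \<gamma>2 modulo p-th powers and commutators, written additively by m \<mapsto>
  m - 1, and left multiplication by g acts on it as conjugation; dividing further by I^2A divides by
  [\<gamma>2, G, G]. Hence the lopsided K: the symmetric L forgets \<gamma>3, whereas modulo K the
  product (g - 1)(m - 1) still records the commutator of g and m. The obstacle is that the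
  generators of the two groups can be matched only modulo J. Their commutators then agree modulo L,
  not necessarily modulo K, so elements of \<gamma>2(G) and \<gamma>2(H) cannot be compared by their
  classes modulo K alone. D therefore treats the commutators as formal symbols and compares only the
  remaining L-part; this is consistent because a combination of the symbols falls into L only if p
  divides all its coefficients. The number d choose 2 is the extreme value: the ring commutator
  induces an alternating map on I/J with values in A/L which vanishes on the image of the centre, so
  A/L is always a quotient of the exterior square of a space of dimension d.\<close>

definition add_closed :: "'r::ring_1 set \<Rightarrow> bool" where
  "add_closed S \<longleftrightarrow> 0 \<in> S \<and> (\<forall>x\<in>S. \<forall>y\<in>S. x - y \<in> S)"

definition tideal :: "'r::ring_1 set \<Rightarrow> bool" where
  "tideal J \<longleftrightarrow> add_closed J \<and> (\<forall>x\<in>J. \<forall>r. r * x \<in> J \<and> x * r \<in> J)"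

text \<open>An additive span suffices: the generating sets of the ideals below already absorb
  multiplication by ring elements, which is what \<open>tideal_aspan\<close> asks for.\<close>

inductive_set aspan :: "'r::ring_1 set \<Rightarrow> 'r set" for X where
  zero: "0 \<in> aspan X"
| incl: "x \<in> X \<Longrightarrow> x \<in> aspan X"
| diff: "x \<in> aspan X \<Longrightarrow> y \<in> aspan X \<Longrightarrow> x - y \<in> aspan X"

definition eqm :: "'r::ring_1 set \<Rightarrow> 'r \<Rightarrow> 'r \<Rightarrow> bool" where
  "eqm J x y \<longleftrightarrow> x - y \<in> J"

lemma add_closedD:
  assumes "add_closed S"
  shows "0 \<in> S" "x \<in> S \<Longrightarrow> y \<in> S \<Longrightarrow> x - y \<in> S" "x \<in> S \<Longrightarrow> - x \<in> S"
    "x \<in> S \<Longrightarrow> y \<in> S \<Longrightarrow> x + y \<in> S"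
proof -
  show 0: "0 \<in> S" and d: "\<And>x y. x \<in> S \<Longrightarrow> y \<in> S \<Longrightarrow> x - y \<in> S"
    using assms by (auto simp: add_closed_def)
  show n: "\<And>x. x \<in> S \<Longrightarrow> - x \<in> S" using d[OF 0] by simp
  show "\<And>x y. x \<in> S \<Longrightarrow> y \<in> S \<Longrightarrow> x + y \<in> S" using d[OF _ n] by simp
qed

lemma add_closed_sum:
  assumes "add_closed S" "\<And>i. i \<in> X \<Longrightarrow> f i \<in> S"
  shows "sum f X \<in> S"
  using assms(2)
  by (induction X rule: infinite_finite_induct)
    (auto simp: add_closedD(1)[OF assms(1)] intro!: add_closedD(4)[OF assms(1)])

lemma add_closed_of_nat: "add_closed S \<Longrightarrow> x \<in> S \<Longrightarrow> of_nat n * x \<in> S"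
  by (induction n) (auto simp: distrib_right add_closedD(1) intro!: add_closedD(4))

lemma add_closed_of_int: "add_closed S \<Longrightarrow> x \<in> S \<Longrightarrow> of_int n * x \<in> S"
proof (cases n rule: int_diff_cases)
  case (diff k l)
  assume "add_closed S" "x \<in> S"
  then have "of_nat k * x - of_nat l * x \<in> S"
    by (intro add_closedD(2) add_closed_of_nat)
  then show ?thesis by (simp add: diff algebra_simps)
qed

lemma add_closed_aspan [simp]: "add_closed (aspan X)"
  by (simp add: add_closed_def aspan.zero aspan.diff)

lemma aspan_least: "add_closed S \<Longrightarrow> X \<subseteq> S \<Longrightarrow> aspan X \<subseteq> S"
proof
  fix x assume "add_closed S" "X \<subseteq> S" "x \<in> aspan X"
  from this(3) show "x \<in> S"
    using add_closedD(1,2)[OF \<open>add_closed S\<close>] \<open>X \<subseteq> S\<close> by induction auto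
qed

lemma aspan_absorb_left:
  assumes "\<And>x. x \<in> X \<Longrightarrow> r * x \<in> aspan Y" "z \<in> aspan X"
  shows "r * z \<in> aspan Y"
  using assms(2) by induction (simp_all add: right_diff_distrib aspan.zero aspan.diff assms(1))

lemma aspan_absorb_right:
  assumes "\<And>x. x \<in> X \<Longrightarrow> x * r \<in> aspan Y" "z \<in> aspan X"
  shows "z * r \<in> aspan Y"
  using assms(2) by induction (simp_all add: left_diff_distrib aspan.zero aspan.diff assms(1))

lemma tideal_aspan:
  assumes "\<And>x r. x \<in> X \<Longrightarrow> r * x \<in> X" "\<And>x r. x \<in> X \<Longrightarrow> x * r \<in> X"
  shows "tideal (aspan X)"
  unfolding tideal_def
proof (intro conjI ballI allI)
  fix z r assume z: "z \<in> aspan X"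
  show "r * z \<in> aspan X" by (rule aspan_absorb_left[OF _ z]) (intro aspan.incl assms)
  show "z * r \<in> aspan X" by (rule aspan_absorb_right[OF _ z]) (intro aspan.incl assms)
qed simp

lemma tidealD:
  assumes "tideal J"
  shows "add_closed J" "0 \<in> J" "x \<in> J \<Longrightarrow> y \<in> J \<Longrightarrow> x - y \<in> J" "x \<in> J \<Longrightarrow> - x \<in> J"
    "x \<in> J \<Longrightarrow> y \<in> J \<Longrightarrow> x + y \<in> J" "x \<in> J \<Longrightarrow> r * x \<in> J" "x \<in> J \<Longrightarrow> x * r \<in> J"
proof -
  show ac: "add_closed J" using assms by (simp add: tideal_def)
  show "0 \<in> J" "x \<in> J \<Longrightarrow> y \<in> J \<Longrightarrow> x - y \<in> J" "x \<in> J \<Longrightarrow> - x \<in> J" "x \<in> J \<Longrightarrow> y \<in> J \<Longrightarrow> x + y \<in> J"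
    by (fact add_closedD[OF ac])+
  show "x \<in> J \<Longrightarrow> r * x \<in> J" "x \<in> J \<Longrightarrow> x * r \<in> J"
    using assms by (simp_all add: tideal_def)
qed

lemma tideal_pow: "tideal J \<Longrightarrow> x \<in> J \<Longrightarrow> 0 < n \<Longrightarrow> x ^ n \<in> J"
  by (cases n) (auto simp: tidealD(7))

lemma eqm_refl: "add_closed J \<Longrightarrow> eqm J x x"
  by (simp add: eqm_def add_closedD)

lemma eqm_sym: "add_closed J \<Longrightarrow> eqm J x y \<Longrightarrow> eqm J y x"
  unfolding eqm_def using add_closedD(3)[of J "x - y"] by simp

lemma eqm_trans: "add_closed J \<Longrightarrow> eqm J x y \<Longrightarrow> eqm J y z \<Longrightarrow> eqm J x z"
  unfolding eqm_def using add_closedD(4)[of J "x - y" "y - z"] by simp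

lemma eqm_add: "add_closed J \<Longrightarrow> eqm J x x' \<Longrightarrow> eqm J y y' \<Longrightarrow> eqm J (x + y) (x' + y')"
  unfolding eqm_def using add_closedD(4)[of J "x - x'" "y - y'"] by (simp add: algebra_simps)

lemma eqm_diff: "add_closed J \<Longrightarrow> eqm J x x' \<Longrightarrow> eqm J y y' \<Longrightarrow> eqm J (x - y) (x' - y')"
  unfolding eqm_def using add_closedD(2)[of J "x - x'" "y - y'"] by (simp add: algebra_simps)

lemma eqm_mult: "tideal J \<Longrightarrow> eqm J x x' \<Longrightarrow> eqm J y y' \<Longrightarrow> eqm J (x * y) (x' * y')"
  unfolding eqm_def
  using tidealD(5)[of J "(x - x') * y" "x' * (y - y')"] tidealD(6)[of J "y - y'" x']
    tidealD(7)[of J "x - x'" y]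
  by (simp add: algebra_simps)

lemma eqm_pow: "tideal J \<Longrightarrow> eqm J x y \<Longrightarrow> eqm J (x ^ n) (y ^ n)"
  by (induction n) (simp_all add: eqm_mult eqm_refl tidealD(1))

lemma eqm_sum:
  assumes "add_closed J" "\<And>i. i \<in> X \<Longrightarrow> eqm J (f i) (g i)"
  shows "eqm J (sum f X) (sum g X)"
  unfolding eqm_def sum_subtractf[symmetric]
  using assms by (intro add_closed_sum) (simp_all add: eqm_def)

lemma eqm_mono: "J \<subseteq> J' \<Longrightarrow> eqm J x y \<Longrightarrow> eqm J' x y"
  by (auto simp: eqm_def)

lemma eqm_mem: "add_closed J \<Longrightarrow> eqm J x y \<Longrightarrow> y \<in> J \<Longrightarrow> x \<in> J"
  unfolding eqm_def using add_closedD(4)[of J "x - y" y] by simp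

text \<open>Since \<open>p > 2\<close>, every reordering of a word of length \<open>p\<close> in \<open>x\<close> and \<open>u\<close> leaves a further factor next
  to the commutator \<open>c\<close>.\<close>

lemma frobenius_add:
  fixes x u :: "'r::ring_1"
  defines "c \<equiv> x * u - u * x"
  assumes J: "tideal J" and pJ: "of_nat p \<in> J" and p: "prime p" "2 < p"
    and c: "c * x \<in> J" "c * u \<in> J" "x * c \<in> J" "u * c \<in> J"
  shows "eqm J ((x + u) ^ p) (x ^ p + u ^ p)"
proof -
  note J' = tidealD[OF J] and ac = tidealD(1)[OF J]
  have e1: "eqm J (x * (u * x ^ k * u ^ l)) (x ^ Suc k * u ^ Suc l)" for k l
  proof (induction k)
    case 0 then show ?case by (simp add: eqm_refl ac)
  next
    case (Suc k)
    have "x * (u * x ^ Suc k * u ^ l) - x * (x * (u * x ^ k * u ^ l)) = - (x * c) * x ^ k * u ^ l"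
      by (simp add: c_def algebra_simps)
    moreover have "- (x * c) * x ^ k * u ^ l \<in> J"
      using J'(4,7) c(3) by blast
    ultimately have "eqm J (x * (u * x ^ Suc k * u ^ l)) (x * (x * (u * x ^ k * u ^ l)))"
      unfolding eqm_def by simp
    moreover have "eqm J (x * (x * (u * x ^ k * u ^ l))) (x * (x ^ Suc k * u ^ Suc l))"
      by (intro eqm_mult J Suc eqm_refl ac)
    ultimately show ?case
      using eqm_trans[OF ac] by (simp add: mult.assoc)
  qed
  \<comment> \<open>The bound excludes \<open>u * x\<close>, where the error is \<open>c\<close>
    alone. From k + l = 2 on, the commutator has a further \<open>x\<close> or \<open>u\<close> on
    its right.\<close>
  have e2: "eqm J (u * x ^ k * u ^ l) (x ^ k * u ^ Suc l)" if "k + l \<ge> 2" for k l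
  proof (cases k)
    case 0 then show ?thesis by (simp add: eqm_refl ac)
  next
    case (Suc k')
    have "c * x ^ k' * u ^ l \<in> J"
    proof (cases k')
      case 0
      with that Suc obtain l' where "l = Suc l'" by (cases l) auto
      then have "c * x ^ k' * u ^ l = (c * u) * u ^ l'" using 0 by (simp add: mult.assoc)
      then show ?thesis using c J'(7) by simp
    next
      case (Suc k'')
      then have "c * x ^ k' * u ^ l = (c * x) * x ^ k'' * u ^ l" by (simp add: mult.assoc)
      then show ?thesis using c J'(7) by simp
    qed
    then have "- (c * x ^ k' * u ^ l) \<in> J" by (rule J')
    moreover have "u * x ^ k * u ^ l - x * (u * x ^ k' * u ^ l) = - (c * x ^ k' * u ^ l)"
      by (simp add: c_def algebra_simps Suc)
    ultimately have "eqm J (u * x ^ k * u ^ l) (x * (u * x ^ k' * u ^ l))"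
      unfolding eqm_def by simp
    then show ?thesis using e1[of k' l] eqm_trans[OF ac] Suc by blast
  qed
  \<comment> \<open>The commutative binomial expansion, with all powers of \<open>x\<close>
    collected on the left.\<close>
  define b where "b n = (\<Sum>k\<le>n. of_nat (n choose k) * (x ^ k * u ^ (n - k)))" for n
  have bS: "eqm J ((x + u) * b n) (b (Suc n))" if "n \<ge> 2" for n
  proof -
    have "eqm J ((x + u) * b n) (x * b n + (\<Sum>k\<le>n. of_nat (n choose k) * (x ^ k * u ^ Suc (n - k))))"
    proof -
      have "u * b n = (\<Sum>k\<le>n. of_nat (n choose k) * (u * x ^ k * u ^ (n - k)))"
        unfolding b_def sum_distrib_left
        by (intro sum.cong) (auto simp: mult.assoc mult_of_nat_commute)
      then have "eqm J (u * b n) (\<Sum>k\<le>n. of_nat (n choose k) * (x ^ k * u ^ Suc (n - k)))"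
      proof (simp only:, intro eqm_sum ac)
        fix k assume "k \<in> {..n}"
        then have "eqm J (u * x ^ k * u ^ (n - k)) (x ^ k * u ^ Suc (n - k))"
          using that by (intro e2) auto
        then show "eqm J (of_nat (n choose k) * (u * x ^ k * u ^ (n - k)))
            (of_nat (n choose k) * (x ^ k * u ^ Suc (n - k)))"
          by (rule eqm_mult[OF J eqm_refl[OF ac]])
      qed
      then show ?thesis
        by (simp add: distrib_right eqm_add ac eqm_refl)
    qed
    also have "x * b n + (\<Sum>k\<le>n. of_nat (n choose k) * (x ^ k * u ^ Suc (n - k))) = b (Suc n)"
    proof -
      have "x * b n = (\<Sum>k\<le>n. of_nat (n choose k) * (x ^ Suc k * u ^ (n - k)))"
        unfolding b_def sum_distrib_left
        by (intro sum.cong) (auto simp: mult.assoc mult_of_nat_commute)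
      moreover have "(\<Sum>k\<le>n. of_nat (n choose k) * (x ^ k * u ^ Suc (n - k)))
          = (\<Sum>k\<le>Suc n. of_nat (n choose k) * (x ^ k * u ^ (Suc n - k)))"
        by (simp add: Suc_diff_le binomial_eq_0)
      moreover have "\<dots> = u ^ Suc n + (\<Sum>k\<le>n. of_nat (n choose Suc k) * (x ^ Suc k * u ^ (n - k)))"
        by (subst sum.atMost_Suc_shift) simp
      moreover have "b (Suc n) = u ^ Suc n + (\<Sum>k\<le>n. of_nat (Suc n choose Suc k) * (x ^ Suc k * u ^ (n - k)))"
        unfolding b_def by (subst sum.atMost_Suc_shift) simp
      ultimately show ?thesis
        by (simp only: binomial_Suc_Suc of_nat_add distrib_right sum.distrib add.assoc add.left_commute)
    qed
    finally show ?thesis .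
  qed
  \<comment> \<open>The comparison starts in degree three: \<open>(x + u) ^ 2\<close> differs from
    \<open>b 2\<close> by \<open>c\<close>, on which nothing is assumed, but one more factor turns
    this error into a combination of \<open>x * c\<close> and \<open>u * c\<close>.\<close>
  have b3: "eqm J ((x + u) ^ 3) (b 3)"
  proof -
    have "b 2 = (x + u) ^ 2 + c"
      by (simp add: b_def c_def power2_eq_square algebra_simps numeral_2_eq_2 atMost_Suc mult_2[symmetric])
    then have "(x + u) ^ 3 - (x + u) * b 2 = - (x * c) - (u * c)"
      by (simp add: power2_eq_square power3_eq_cube algebra_simps)
    moreover have "- (x * c) - (u * c) \<in> J" using c(3,4) J'(3,4) by blast
    ultimately have "eqm J ((x + u) ^ 3) ((x + u) * b 2)"
      unfolding eqm_def by simp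
    moreover have "eqm J ((x + u) * b 2) (b 3)" using bS[of 2] by simp
    ultimately show ?thesis using eqm_trans[OF ac] by blast
  qed
  have bn: "eqm J ((x + u) ^ n) (b n)" if "n \<ge> 3" for n
    using that
  proof (induction n rule: dec_induct)
    case base show ?case by (rule b3)
  next
    case (step n)
    have "eqm J ((x + u) * (x + u) ^ n) ((x + u) * b n)"
      by (intro eqm_mult J eqm_refl ac step)
    then show ?case using bS[of n] step eqm_trans[OF ac] by auto
  qed
  have "eqm J (b p) (x ^ p + u ^ p)"
  proof -
    obtain q where q: "p = Suc (Suc q)" using p(2) that[of "p - 2"] by simp
    have "b p = u ^ p + (\<Sum>k\<le>q. of_nat (p choose Suc k) * (x ^ Suc k * u ^ (Suc q - k))) + x ^ p"
      unfolding b_def q by (subst sum.atMost_Suc_shift) (simp add: binomial_eq_0)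
    then have "b p - (x ^ p + u ^ p) = (\<Sum>k\<le>q. of_nat (p choose Suc k) * (x ^ Suc k * u ^ (Suc q - k)))"
      by simp
    also have "\<dots> \<in> J"
    proof (intro add_closed_sum ac)
      fix k assume "k \<in> {..q}"
      then have "p dvd (p choose Suc k)"
        using q p by (intro dvd_choose_prime) auto
      then obtain m where "p choose Suc k = p * m" by blast
      then show "of_nat (p choose Suc k) * (x ^ Suc k * u ^ (Suc q - k)) \<in> J"
        using J' pJ by simp
    qed
    finally show ?thesis by (simp add: eqm_def)
  qed
  with bn[of p] p eqm_trans[OF ac] show ?thesis by simp
qed

section \<open>A tower of canonical ideals\<close>

text \<open>R / \<open>K0\<close> stands for the group algebra and \<open>I\<close> for the preimage
  of its augmentation ideal; the last assumption together with \<open>one_notin_I\<close> and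
  \<open>p_K0\<close> makes R / \<open>I\<close> the field with p elements. No group occurs, so
  everything defined in this locale is shared by all group bases.\<close>

locale ideal_tower =
  fixes K0 I :: "'r::ring_1 set" and p :: nat
  assumes tideal_K0: "tideal K0" and tideal_I: "tideal I" and K0_I: "K0 \<subseteq> I"
    and one_notin_I: "1 \<notin> I" and p_K0: "of_nat p \<in> K0"
    and prime_p: "prime p" and p_gt_2: "2 < p"
    and aug_ex: "\<exists>n::int. x - of_int n \<in> I"
begin

definition AA :: "'r set" where
  "AA = aspan (K0 \<union> {r * (x * y - y * x) * s | r x y s. True})"

definition JJ :: "'r set" where
  "JJ = aspan (K0 \<union> {x * y | x y. x \<in> I \<and> y \<in> I})"

definition LL :: "'r set" where
  "LL = aspan (K0 \<union> {x * a | x a. x \<in> I \<and> a \<in> AA} \<union> {a * x | x a. x \<in> I \<and> a \<in> AA})"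

definition KK :: "'r set" where
  "KK = aspan (K0 \<union> {a * x | x a. x \<in> I \<and> a \<in> AA} \<union> {x * y * a | x y a. x \<in> I \<and> y \<in> I \<and> a \<in> AA})"

definition cent :: "'r \<Rightarrow> bool" where
  "cent z \<longleftrightarrow> (\<forall>y. eqm KK (z * y) (y * z))"

text \<open>The elements of \<open>I\<close> whose class modulo \<open>JJ\<close> is that of a
  central element of the group algebra. This is the basis-free substitute for the image of the
  centre of the group in I/J, with which it coincides by \<open>UU_rep\<close> and
  \<open>center_UU\<close>.\<close>

definition UU :: "'r set" where
  "UU = {x. \<exists>z. (\<forall>y. z * y - y * z \<in> K0) \<and> x - z \<in> JJ \<and> z \<in> I}"

lemmas K0D = tidealD[OF tideal_K0] and ID = tidealD[OF tideal_I]

lemma tideal_AA: "tideal AA"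
  unfolding AA_def
proof (rule tideal_aspan)
  fix z q assume z: "z \<in> K0 \<union> {r * (x * y - y * x) * s | r x y s. True}"
  then consider "z \<in> K0" | r x y s where "z = r * (x * y - y * x) * s" by blast
  then show "q * z \<in> K0 \<union> {r * (x * y - y * x) * s | r x y s. True}"
  proof cases
    case 2
    then have "q * z = (q * r) * (x * y - y * x) * s" by (simp add: mult.assoc)
    then show ?thesis by blast
  qed (simp add: K0D)
  from z consider "z \<in> K0" | r x y s where "z = r * (x * y - y * x) * s" by blast
  then show "z * q \<in> K0 \<union> {r * (x * y - y * x) * s | r x y s. True}"
  proof cases
    case 2
    then have "z * q = r * (x * y - y * x) * (s * q)" by (simp add: mult.assoc)
    then show ?thesis by blast
  qed (simp add: K0D)
qed

lemmas AD = tidealD[OF tideal_AA]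

lemma tideal_JJ: "tideal JJ"
  unfolding JJ_def
proof (rule tideal_aspan)
  fix z q assume "z \<in> K0 \<union> {x * y | x y. x \<in> I \<and> y \<in> I}"
  then consider "z \<in> K0" | x y where "z = x * y" "x \<in> I" "y \<in> I" by blast
  then have "(q * z \<in> K0 \<or> (\<exists>x y. q * z = x * y \<and> x \<in> I \<and> y \<in> I)) \<and>
     (z * q \<in> K0 \<or> (\<exists>x y. z * q = x * y \<and> x \<in> I \<and> y \<in> I))"
  proof cases
    case 2
    have "q * z = (q * x) * y" "z * q = x * (y * q)" using 2 by (simp_all add: mult.assoc)
    then show ?thesis using ID(6,7) 2 by blast
  qed (simp add: K0D)
  then show "q * z \<in> K0 \<union> {x * y | x y. x \<in> I \<and> y \<in> I}" "z * q \<in> K0 \<union> {x * y | x y. x \<in> I \<and> y \<in> I}"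
    by blast+
qed

lemmas JD = tidealD[OF tideal_JJ]

lemma tideal_LL: "tideal LL"
  unfolding LL_def
proof (rule tideal_aspan)
  let ?X = "K0 \<union> {x * a | x a. x \<in> I \<and> a \<in> AA} \<union> {a * x | x a. x \<in> I \<and> a \<in> AA}"
  fix z q assume "z \<in> ?X"
  then consider "z \<in> K0" | x a where "z = x * a" "x \<in> I" "a \<in> AA"
    | x a where "z = a * x" "x \<in> I" "a \<in> AA" by blast
  then have "q * z \<in> ?X \<and> z * q \<in> ?X"
  proof cases
    case 2
    have "q * z = (q * x) * a" "z * q = x * (a * q)" using 2 by (simp_all add: mult.assoc)
    then show ?thesis using ID(6,7) AD(6,7) 2 by blast
  next
    case 3
    have "q * z = (q * a) * x" "z * q = a * (x * q)" using 3 by (simp_all add: mult.assoc)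
    then show ?thesis using ID(6,7) AD(6,7) 3 by blast
  qed (simp add: K0D)
  then show "q * z \<in> ?X" "z * q \<in> ?X" by blast+
qed

lemmas LD = tidealD[OF tideal_LL]

lemma tideal_KK: "tideal KK"
  unfolding KK_def
proof (rule tideal_aspan)
  let ?X = "K0 \<union> {a * x | x a. x \<in> I \<and> a \<in> AA} \<union> {x * y * a | x y a. x \<in> I \<and> y \<in> I \<and> a \<in> AA}"
  fix z q assume "z \<in> ?X"
  then consider "z \<in> K0" | x a where "z = a * x" "x \<in> I" "a \<in> AA"
    | x y a where "z = x * y * a" "x \<in> I" "y \<in> I" "a \<in> AA" by blast
  then have "q * z \<in> ?X \<and> z * q \<in> ?X"
  proof cases
    case 2
    have "q * z = (q * a) * x" "z * q = a * (x * q)" using 2 by (simp_all add: mult.assoc)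
    then show ?thesis using ID(6,7) AD(6,7) 2 by blast
  next
    case 3
    have "q * z = (q * x) * y * a" "z * q = x * y * (a * q)" using 3 by (simp_all add: mult.assoc)
    then show ?thesis using ID(6,7) AD(6,7) 3 by blast
  qed (simp add: K0D)
  then show "q * z \<in> ?X" "z * q \<in> ?X" by blast+
qed

lemmas KD = tidealD[OF tideal_KK]

lemma K0_KK: "K0 \<subseteq> KK"
  unfolding KK_def by (auto intro: aspan.incl)

lemma AI_KK: "a \<in> AA \<Longrightarrow> x \<in> I \<Longrightarrow> a * x \<in> KK"
  unfolding KK_def by (rule aspan.incl) blast

lemma IIA_KK: "x \<in> I \<Longrightarrow> y \<in> I \<Longrightarrow> a \<in> AA \<Longrightarrow> x * y * a \<in> KK"
  unfolding KK_def by (rule aspan.incl) blast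

lemma IA_LL: "x \<in> I \<Longrightarrow> a \<in> AA \<Longrightarrow> x * a \<in> LL"
  unfolding LL_def by (rule aspan.incl) blast

lemma AI_LL: "a \<in> AA \<Longrightarrow> x \<in> I \<Longrightarrow> a * x \<in> LL"
  unfolding LL_def by (rule aspan.incl) blast

lemma II_JJ: "x \<in> I \<Longrightarrow> y \<in> I \<Longrightarrow> x * y \<in> JJ"
  unfolding JJ_def by (rule aspan.incl) blast

lemma comm_AA: "x * y - y * x \<in> AA"
proof -
  have "x * y - y * x = 1 * (x * y - y * x) * 1" by simp
  then show ?thesis unfolding AA_def by (blast intro: aspan.incl)
qed

lemma K0_LL: "K0 \<subseteq> LL"
  unfolding LL_def by (auto intro: aspan.incl)

lemma KK_LL: "KK \<subseteq> LL"
  unfolding KK_def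
  by (intro aspan_least LD(1)) (use K0_LL AI_LL IA_LL ID(6) in blast)

lemma K0_AA: "K0 \<subseteq> AA"
  unfolding AA_def by (auto intro: aspan.incl)

lemma LL_AA: "LL \<subseteq> AA"
  unfolding LL_def
  by (intro aspan_least AD(1)) (use K0_AA AD(6,7) in blast)

lemma K0_JJ: "K0 \<subseteq> JJ"
  unfolding JJ_def by (auto intro: aspan.incl)

lemma aug_decomp: obtains n :: int and x' where "x = of_int n + x'" "x' \<in> I"
proof -
  obtain n :: int where "x - of_int n \<in> I" using aug_ex by blast
  then show ?thesis using that[of n "x - of_int n"] by simp
qed

text \<open>Integers are central, so a commutator only sees the parts of \<open>x\<close> and
  \<open>y\<close> in \<open>I\<close>, and then both products lie in I^2.\<close>

lemma AA_JJ: "AA \<subseteq> JJ"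
  unfolding AA_def
proof (intro aspan_least JD(1) Un_least K0_JJ subsetI)
  fix z :: 'r assume "z \<in> {r * (x * y - y * x) * s | r x y s. True}"
  then obtain r x y s where z: "z = r * (x * y - y * x) * s" by blast
  obtain n x' where x: "x = of_int n + x'" "x' \<in> I" by (rule aug_decomp)
  obtain m y' where y: "y = of_int m + y'" "y' \<in> I" by (rule aug_decomp)
  have "x * y - y * x = x' * y' - y' * x'"
  proof -
    have "of_int n * y = y * of_int n" "of_int m * x' = x' * of_int m"
      by (rule mult_of_int_commute)+
    then show ?thesis unfolding x y by (simp add: algebra_simps)
  qed
  also have "\<dots> \<in> JJ" by (intro JD(3) II_JJ x y)
  finally show "z \<in> JJ" unfolding z using JD(6,7) by blast
qed

lemma JJ_I: "JJ \<subseteq> I"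
  unfolding JJ_def by (intro aspan_least ID(1)) (use K0_I ID(6) in blast)

lemma AA_I: "AA \<subseteq> I" using AA_JJ JJ_I by blast

lemma KK_AA: "KK \<subseteq> AA" using KK_LL LL_AA by blast
lemma LL_JJ: "LL \<subseteq> JJ" using LL_AA AA_JJ by blast
lemma LL_I: "LL \<subseteq> I" using LL_AA AA_I by blast

lemma JA_KK: "u \<in> JJ \<Longrightarrow> a \<in> AA \<Longrightarrow> u * a \<in> KK"
proof -
  assume u: "u \<in> JJ" and a: "a \<in> AA"
  have "x * a \<in> aspan KK" if "x \<in> K0 \<union> {x * y | x y. x \<in> I \<and> y \<in> I}" for x
    using that a IIA_KK KD(7) K0_KK by (blast intro: aspan.incl)
  then have "u * a \<in> aspan KK"
    using u unfolding JJ_def by (rule aspan_absorb_right)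
  then show ?thesis using aspan_least[OF KD(1)] by blast
qed

text \<open>For a generator \<open>a * y\<close> of \<open>LL\<close> the product is
  \<open>(x * a) * y\<close>, in AI; for a generator \<open>y * a\<close> it is
  \<open>x * y * a\<close>, which is where the summand I^2A of \<open>KK\<close> enters.\<close>

lemma IL_KK: "x \<in> I \<Longrightarrow> l \<in> LL \<Longrightarrow> x * l \<in> KK"
proof -
  assume x: "x \<in> I" and l: "l \<in> LL"
  have "x * z \<in> aspan KK" if "z \<in> K0 \<union> {x * a | x a. x \<in> I \<and> a \<in> AA} \<union> {a * x | x a. x \<in> I \<and> a \<in> AA}" for z
  proof -
    from that consider "z \<in> K0" | y a where "z = y * a" "y \<in> I" "a \<in> AA"
      | y a where "z = a * y" "y \<in> I" "a \<in> AA" by blast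
    then have "x * z \<in> KK"
    proof cases
      case 1 then show ?thesis using KD(6) K0_KK by blast
    next
      case 2 then show ?thesis using IIA_KK[OF x] by (simp add: mult.assoc)
    next
      case 3 then show ?thesis using AI_KK[of "x * a" y] AD(6) by (simp add: mult.assoc)
    qed
    then show ?thesis by (rule aspan.incl)
  qed
  then have "x * l \<in> aspan KK"
    using l unfolding LL_def by (rule aspan_absorb_left)
  then show ?thesis using aspan_least[OF KD(1)] by blast
qed

lemma LI_KK: "x \<in> I \<Longrightarrow> l \<in> LL \<Longrightarrow> l * x \<in> KK"
  using LL_AA AI_KK by blast

lemma p_dvd_K0: "int p dvd n \<Longrightarrow> of_int n \<in> K0"
  using K0D(7)[OF p_K0] by (auto elim!: dvdE)

lemma of_int_I_iff: "of_int n \<in> I \<longleftrightarrow> int p dvd n"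
proof
  assume n: "of_int n \<in> I"
  show "int p dvd n"
  proof (rule ccontr)
    assume "\<not> int p dvd n"
    then have "coprime (int p) n" using prime_p by (intro prime_imp_coprime) auto
    then obtain a b where ab: "a * int p + b * n = 1"
      by (metis bezout_int coprime_iff_gcd_eq_1)
    have "(of_int a * of_nat p + of_int b * of_int n :: 'r) \<in> I"
      by (intro ID(5,6) n K0_I[THEN subsetD] p_K0)
    also have "of_int a * of_nat p + of_int b * of_int n = (of_int (a * int p + b * n) :: 'r)" by simp
    finally show False using one_notin_I by (simp add: ab)
  qed
qed (use p_dvd_K0 K0_I in blast)

text \<open>On a product \<open>a * b\<close> of two elements of \<open>I\<close> the Leibniz rule
  leaves one commutator followed by \<open>b\<close> and one preceded by \<open>a\<close>, thus an
  element of AI + IA.\<close>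

lemma comm_IJ_LL: "x \<in> I \<Longrightarrow> u \<in> JJ \<Longrightarrow> x * u - u * x \<in> LL"
proof -
  assume x: "x \<in> I" and u: "u \<in> JJ"
  from u show ?thesis unfolding JJ_def
  proof induction
    case zero then show ?case by (simp add: LD)
  next
    case (incl z)
    then consider "z \<in> K0" | a b where "z = a * b" "a \<in> I" "b \<in> I" by blast
    then show ?case
    proof cases
      case 1 then show ?thesis using K0D(3)[OF K0D(6) K0D(7)] K0_LL by blast
    next
      case 2
      have "x * z - z * x = (x * a - a * x) * b + a * (x * b - b * x)"
        by (simp add: 2 algebra_simps)
      then show ?thesis using LD(5)[OF AI_LL IA_LL, OF comm_AA] 2 comm_AA by simp
    qed
  next
    case (diff z w)
    have "x * (z - w) - (z - w) * x = (x * z - z * x) - (x * w - w * x)" by (simp add: algebra_simps)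
    then show ?case using diff LD(3) by simp
  qed
qed

section \<open>Powers with exponent p^s modulo \<open>LL\<close> and \<open>KK\<close>\<close>

lemma p_KK: "of_nat p \<in> KK" and p_LL: "of_nat p \<in> LL"
  using p_K0 K0_KK K0_LL by auto

lemma p_pow_pos: "0 < p ^ s" using p_gt_2 by simp

text \<open>One summand is taken from \<open>JJ\<close> because then the commutator of the two lies
  in \<open>LL\<close>, and both IL and LI are inside \<open>KK\<close>. For two elements of
  \<open>I\<close> the commutator is only known to lie in \<open>AA\<close>, and the same argument
  works modulo \<open>LL\<close> instead (\<open>frob_LL\<close>).\<close>

lemma frob_KK:
  assumes "x \<in> I" "u \<in> JJ"
  shows "eqm KK ((x + u) ^ (p ^ s)) (x ^ (p ^ s) + u ^ (p ^ s))"
proof (induction s)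
  case 0 then show ?case by (simp add: eqm_refl KD)
next
  case (Suc s)
  let ?x = "x ^ (p ^ s)" and ?u = "u ^ (p ^ s)"
  have xu: "?x \<in> I" "?u \<in> JJ" "?u \<in> I"
    using assms p_pow_pos JJ_I by (auto intro!: tideal_pow tideal_I tideal_JJ)
  then have c: "?x * ?u - ?u * ?x \<in> LL" by (intro comm_IJ_LL)
  have "eqm KK ((x + u) ^ (p ^ Suc s)) ((?x + ?u) ^ p)"
    using eqm_pow[OF tideal_KK Suc, of p] by (simp add: power_mult[symmetric] mult.commute)
  also have "eqm KK \<dots> (?x ^ p + ?u ^ p)"
    by (intro frobenius_add tideal_KK p_KK prime_p p_gt_2 IL_KK[OF _ c] LI_KK[OF _ c] xu)
  ultimately show ?case
    using eqm_trans[OF KD(1)] by (auto simp: power_mult[symmetric] mult.commute)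
qed

lemma frob_LL:
  assumes "x \<in> I" "y \<in> I"
  shows "eqm LL ((x + y) ^ (p ^ s)) (x ^ (p ^ s) + y ^ (p ^ s))"
proof (induction s)
  case 0 then show ?case by (simp add: eqm_refl LD)
next
  case (Suc s)
  let ?x = "x ^ (p ^ s)" and ?y = "y ^ (p ^ s)"
  have xy: "?x \<in> I" "?y \<in> I"
    using assms p_pow_pos by (auto intro!: tideal_pow tideal_I)
  have c: "?x * ?y - ?y * ?x \<in> AA" by (rule comm_AA)
  have "eqm LL ((x + y) ^ (p ^ Suc s)) ((?x + ?y) ^ p)"
    using eqm_pow[OF tideal_LL Suc, of p] by (simp add: power_mult[symmetric] mult.commute)
  also have "eqm LL \<dots> (?x ^ p + ?y ^ p)"
    by (intro frobenius_add tideal_LL p_LL prime_p p_gt_2 IA_LL[OF _ c] AI_LL[OF c] xy)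
  ultimately show ?case
    using eqm_trans[OF LD(1)] by (auto simp: power_mult[symmetric] mult.commute)
qed

text \<open>The commutator with 1 is zero, so here the identity already holds in the group
  algebra.\<close>

lemma frob_one: "eqm K0 ((1 + x) ^ (p ^ s)) (1 + x ^ (p ^ s))"
proof (induction s)
  case 0 then show ?case by (simp add: eqm_refl K0D)
next
  case (Suc s)
  have "eqm K0 ((1 + x) ^ (p ^ Suc s)) ((1 + x ^ (p ^ s)) ^ p)"
    using eqm_pow[OF tideal_K0 Suc, of p] by (simp add: power_mult[symmetric] mult.commute)
  also have "eqm K0 \<dots> (1 ^ p + (x ^ (p ^ s)) ^ p)"
    by (rule frobenius_add) (auto intro!: tideal_K0 p_K0 prime_p p_gt_2 simp: K0D)
  ultimately show ?case
    using eqm_trans[OF K0D(1)] by (auto simp: power_mult[symmetric] mult.commute)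
qed

text \<open>Whenever a \<open>b\<close> is moved to the right past an \<open>a\<close>, the final
  \<open>b\<close> of the word stays behind the commutator, so each error lies in AI.\<close>

lemma mult_pow_KK:
  assumes a: "a \<in> I" and b: "b \<in> I"
  shows "eqm KK ((a * b) ^ n) (a ^ n * b ^ n)"
proof -
  have e: "eqm KK (b * a ^ k * b ^ Suc m) (a ^ k * b ^ Suc (Suc m))" for k m
  proof (induction k)
    case 0 then show ?case by (simp add: eqm_refl KD)
  next
    case (Suc k)
    have "b * a ^ Suc k * b ^ Suc m - a * (b * a ^ k * b ^ Suc m) = (b * a - a * b) * (a ^ k * b ^ m * b)"
      by (simp add: algebra_simps power_commutes)
    also have "\<dots> \<in> KK"
      using b by (intro AI_KK comm_AA) (auto intro: ID)
    finally have "eqm KK (b * a ^ Suc k * b ^ Suc m) (a * (b * a ^ k * b ^ Suc m))"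
      by (simp add: eqm_def)
    moreover have "eqm KK (a * (b * a ^ k * b ^ Suc m)) (a * (a ^ k * b ^ Suc (Suc m)))"
      by (intro eqm_mult tideal_KK eqm_refl KD(1) Suc)
    ultimately show ?case using eqm_trans[OF KD(1)] by (simp add: mult.assoc)
  qed
  show ?thesis
  proof (induction n)
    case 0 then show ?case by (simp add: eqm_refl KD)
  next
    case (Suc n)
    have "eqm KK (a * b * (a * b) ^ n) (a * b * (a ^ n * b ^ n))"
      by (intro eqm_mult tideal_KK eqm_refl KD(1) Suc)
    moreover have "eqm KK (a * b * (a ^ n * b ^ n)) (a ^ Suc n * b ^ Suc n)"
    proof (cases n)
      case 0 then show ?thesis by (simp add: eqm_refl KD)
    next
      case (Suc m)
      have "eqm KK (a * (b * a ^ n * b ^ Suc m)) (a * (a ^ n * b ^ Suc (Suc m)))"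
        by (intro eqm_mult tideal_KK eqm_refl KD(1) e)
      then show ?thesis using Suc by (simp add: mult.assoc)
    qed
    ultimately show ?case using eqm_trans[OF KD(1)] by simp
  qed
qed

text \<open>Expanding [x^n, y] by the Leibniz rule, every summand with an \<open>x\<close> to the
  right of the commutator lies in AI. The one left over is x^(n-1) [x, y], and n - 1 \<ge> 2 puts it
  into I^2A.\<close>

lemma cent_pow_I:
  assumes x: "x \<in> I" and n: "3 \<le> n"
  shows "cent (x ^ n)"
  unfolding cent_def
proof
  fix y
  have s: "x ^ Suc m * y - y * x ^ Suc m - x ^ m * (x * y - y * x) \<in> KK" for m
  proof (induction m)
    case 0 then show ?case by (simp add: KD)
  next
    case (Suc m)
    have "x ^ Suc (Suc m) * y - y * x ^ Suc (Suc m) - x ^ Suc m * (x * y - y * x)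
      = x * (x ^ Suc m * y - y * x ^ Suc m - x ^ m * (x * y - y * x)) + (x * y - y * x) * x ^ Suc m"
      by (simp add: algebra_simps)
    also have "\<dots> \<in> KK"
      by (intro KD(5,6) Suc AI_KK comm_AA tideal_pow tideal_I x) simp
    finally show ?case .
  qed
  obtain m where m: "n = Suc (Suc (Suc m))" using n that[of "n - 3"] by simp
  have "x * x ^ Suc m * (x * y - y * x) \<in> KK"
    by (intro IIA_KK comm_AA tideal_pow tideal_I x) simp
  then have "x ^ Suc (Suc m) * (x * y - y * x) \<in> KK" by simp
  from KD(5)[OF s[of "Suc (Suc m)"] this] show "eqm KK (x ^ n * y) (y * x ^ n)"
    by (simp only: m eqm_def diff_add_cancel)
qed

end

section \<open>Normal subgroups and commutators\<close>

context group
begin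

lemma inv_cancel [simp]:
  assumes "x \<in> carrier G" "y \<in> carrier G"
  shows "inv x \<otimes> (x \<otimes> y) = y" "x \<otimes> (inv x \<otimes> y) = y"
  using assms by (simp_all add: m_assoc[symmetric])

lemma commutator_closed [simp]:
  "x \<in> carrier G \<Longrightarrow> y \<in> carrier G \<Longrightarrow> commutator G x y \<in> carrier G"
  by (simp add: commutator_def)

lemma commutator_swap:
  "x \<in> carrier G \<Longrightarrow> y \<in> carrier G \<Longrightarrow> y \<otimes> x \<otimes> commutator G x y = x \<otimes> y"
  by (simp add: commutator_def m_assoc)

lemma conj_commutator:
  assumes "g \<in> carrier G" "x \<in> carrier G" "y \<in> carrier G"
  shows "g \<otimes> commutator G x y \<otimes> inv g = commutator G (g \<otimes> x \<otimes> inv g) (g \<otimes> y \<otimes> inv g)"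
  using assms by (simp add: commutator_def m_assoc inv_mult_group)

lemma conj_nat_pow:
  assumes "g \<in> carrier G" "x \<in> carrier G"
  shows "(g \<otimes> x \<otimes> inv g) [^] (n::nat) = g \<otimes> x [^] n \<otimes> inv g"
  using assms by (induction n) (simp_all add: m_assoc)

lemma subgroup_pow_closed: "subgroup S G \<Longrightarrow> x \<in> S \<Longrightarrow> x [^] (n::nat) \<in> S"
  by (induction n) (simp_all add: subgroup.one_closed subgroup.m_closed)

lemma normal_conj: "N \<lhd> G \<Longrightarrow> g \<in> carrier G \<Longrightarrow> x \<in> N \<Longrightarrow> g \<otimes> x \<otimes> inv g \<in> N"
  by (rule normal.inv_op_closed2)

lemma normal_subset: "N \<lhd> G \<Longrightarrow> N \<subseteq> carrier G"
  by (simp add: normal_imp_subgroup subgroup.subset)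

lemma normal_carrier: "carrier G \<lhd> G"
  by (rule normal_self)

lemma commutator_subgroup_normal:
  assumes A: "A \<lhd> G" and B: "B \<lhd> G"
  shows "commutator_subgroup G A B \<lhd> G"
  unfolding commutator_subgroup_def
proof (rule normal_generateI)
  show "{commutator G a b |a b. a \<in> A \<and> b \<in> B} \<subseteq> carrier G"
    using normal_subset[OF A] normal_subset[OF B] by (auto simp: subset_iff)
next
  fix h g assume "h \<in> {commutator G a b |a b. a \<in> A \<and> b \<in> B}" and g: "g \<in> carrier G"
  then obtain a b where ab: "h = commutator G a b" "a \<in> A" "b \<in> B" by blast
  then have "g \<otimes> h \<otimes> inv g = commutator G (g \<otimes> a \<otimes> inv g) (g \<otimes> b \<otimes> inv g)"
    using conj_commutator[OF g, of a b] normal_subset[OF A] normal_subset[OF B]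
    by (simp add: subset_iff)
  then show "g \<otimes> h \<otimes> inv g \<in> {commutator G a b |a b. a \<in> A \<and> b \<in> B}"
    using normal_conj[OF A g] normal_conj[OF B g] ab by blast
qed

lemma power_subgroup_normal:
  assumes A: "A \<lhd> G"
  shows "power_subgroup G n A \<lhd> G"
  unfolding power_subgroup_def
proof (rule normal_generateI)
  show "{x [^] n |x. x \<in> A} \<subseteq> carrier G"
    using normal_subset[OF A] by auto
next
  fix h g assume "h \<in> {x [^] n |x. x \<in> A}" and g: "g \<in> carrier G"
  then obtain a where a: "h = a [^] n" "a \<in> A" by blast
  then have "g \<otimes> h \<otimes> inv g = (g \<otimes> a \<otimes> inv g) [^] n"
    using conj_nat_pow[OF g, of a n] normal_subset[OF A] by auto
  then show "g \<otimes> h \<otimes> inv g \<in> {x [^] n |x. x \<in> A}"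
    using normal_conj[OF A g] a by blast
qed

lemma lower_central_normal: "lower_central G i \<lhd> G"
proof (induction i)
  case (Suc i)
  then show ?case
    by (cases i) (simp_all add: normal_carrier commutator_subgroup_normal)
qed (simp add: normal_carrier)

lemma set_mult_normal:
  assumes N: "N \<lhd> G" and M: "M \<lhd> G"
  shows "N <#> M \<lhd> G"
proof (rule normal_invI)
  interpret second_isomorphism_grp N G M
    using N normal_imp_subgroup[OF M]
    by (simp add: second_isomorphism_grp_def second_isomorphism_grp_axioms_def)
  show "subgroup (N <#> M) G" by (rule normal_set_mult_subgroup)
next
  fix g x assume g: "g \<in> carrier G" and "x \<in> N <#> M"
  then obtain n m where nm: "n \<in> N" "m \<in> M" "x = n \<otimes> m" by (auto simp: set_mult_def)
  then have "g \<otimes> x \<otimes> inv g = (g \<otimes> n \<otimes> inv g) \<otimes> (g \<otimes> m \<otimes> inv g)"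
    using g normal_subset[OF N] normal_subset[OF M] by (simp add: m_assoc subset_iff)
  then show "g \<otimes> x \<otimes> inv g \<in> N <#> M"
    using normal_conj[OF N g nm(1)] normal_conj[OF M g nm(2)] by (auto simp: set_mult_def)
qed

lemma set_mult_least:
  "subgroup S G \<Longrightarrow> X \<subseteq> S \<Longrightarrow> Y \<subseteq> S \<Longrightarrow> X <#> Y \<subseteq> S"
  by (auto simp: set_mult_def intro: subgroup.m_closed)

lemma set_mult_upper:
  assumes "subgroup X G" "subgroup Y G"
  shows "X \<subseteq> X <#> Y" "Y \<subseteq> X <#> Y"
proof -
  show "X \<subseteq> X <#> Y"
  proof
    fix x assume x: "x \<in> X"
    then have "x \<otimes> \<one> \<in> X <#> Y"
      unfolding set_mult_def using subgroup.one_closed[OF assms(2)] by blast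
    then show "x \<in> X <#> Y" using x subgroup.subset[OF assms(1)] by (simp add: subset_iff)
  qed
  show "Y \<subseteq> X <#> Y"
  proof
    fix y assume y: "y \<in> Y"
    then have "\<one> \<otimes> y \<in> X <#> Y"
      unfolding set_mult_def using subgroup.one_closed[OF assms(1)] by blast
    then show "y \<in> X <#> Y" using y subgroup.subset[OF assms(2)] by (simp add: subset_iff)
  qed
qed

lemma generate_least: "subgroup S G \<Longrightarrow> X \<subseteq> S \<Longrightarrow> generate G X \<subseteq> S"
  by (rule generate_subgroup_incl)

abbreviation "\<gamma>2 \<equiv> lower_central G 2"

lemma gamma2_eq: "lower_central G 2 = commutator_subgroup G (carrier G) (carrier G)"
  by (simp add: numeral_2_eq_2)

lemma gamma3_eq: "lower_central G 3 = commutator_subgroup G (lower_central G 2) (carrier G)"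
  by (simp add: numeral_2_eq_2 numeral_3_eq_3)

lemma gamma4_eq: "lower_central G 4 = commutator_subgroup G (lower_central G 3) (carrier G)"
proof -
  have e: "(4::nat) = Suc (Suc (Suc (Suc 0)))" "(3::nat) = Suc (Suc (Suc 0))" by simp_all
  show ?thesis unfolding e lower_central.simps ..
qed

lemma commutator_gamma2: "x \<in> carrier G \<Longrightarrow> y \<in> carrier G \<Longrightarrow> commutator G x y \<in> \<gamma>2"
  unfolding gamma2_eq commutator_subgroup_def by (blast intro: generate.incl)

lemma gamma2_carrier: "\<gamma>2 \<subseteq> carrier G"
  by (rule normal_subset[OF lower_central_normal])

lemma commutator_subgroup_le:
  assumes A: "A \<lhd> G"
  shows "commutator_subgroup G A (carrier G) \<subseteq> A"
  unfolding commutator_subgroup_def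
proof (rule generate_least[OF normal_imp_subgroup[OF A]], safe)
  fix a b assume ab: "a \<in> A" "b \<in> carrier G"
  have aG: "a \<in> carrier G" using ab normal_subset[OF A] by blast
  have "inv b \<otimes> a \<otimes> b \<in> A" using normal_conj[OF A, of "inv b" a] ab by simp
  then have "inv a \<otimes> (inv b \<otimes> a \<otimes> b) \<in> A"
    using ab(1) subgroup.m_inv_closed[OF normal_imp_subgroup[OF A]] subgroup.m_closed[OF normal_imp_subgroup[OF A]] by blast
  then show "commutator G a b \<in> A"
    using ab aG by (simp add: commutator_def m_assoc)
qed

lemma gamma3_le: "lower_central G 3 \<subseteq> \<gamma>2"
  unfolding gamma3_eq by (rule commutator_subgroup_le[OF lower_central_normal])

lemma gamma4_le: "lower_central G 4 \<subseteq> \<gamma>2"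
  using commutator_subgroup_le[OF lower_central_normal, of 3] gamma3_le unfolding gamma4_eq by blast

lemma power_subgroup_le: "subgroup A G \<Longrightarrow> power_subgroup G n A \<subseteq> A"
  unfolding power_subgroup_def
  by (rule generate_least) (auto intro: subgroup_pow_closed)

end

section \<open>Group rings modulo p\<close>

text \<open>The map \<open>e\<close> embeds the group modulo \<open>K0\<close> only: it is
  multiplicative up to \<open>K0\<close>, and \<open>e_span\<close> with \<open>e_indep\<close> say
  that its values form a basis of R / \<open>K0\<close> over the integers modulo p. Since
  \<open>K0\<close> and \<open>I\<close> do not mention the group, a second group can be attached to
  the same tower.\<close>

locale mod_group_ring = ideal_tower K0 I p + group G
  for K0 I :: "'r::ring_1 set" and p :: nat and G :: "('a, 'm) monoid_scheme" (structure) +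
  fixes e :: "'a \<Rightarrow> 'r"
  assumes fin: "finite (carrier G)"
    and ord: "\<exists>n. order G = p ^ n"
    and e_one: "eqm K0 (e \<one>) 1"
    and e_mult: "x \<in> carrier G \<Longrightarrow> y \<in> carrier G \<Longrightarrow> eqm K0 (e (x \<otimes> y)) (e x * e y)"
    and e_I: "x \<in> carrier G \<Longrightarrow> e x - 1 \<in> I"
    and e_span: "\<exists>n. eqm K0 r (\<Sum>g\<in>carrier G. of_int (n g) * e g)"
    and e_indep: "(\<Sum>g\<in>carrier G. of_int (n g) * e g) \<in> K0 \<Longrightarrow> g \<in> carrier G \<Longrightarrow> int p dvd n g"
begin

lemmas K0_trans = eqm_trans[OF K0D(1)] and K0_sym = eqm_sym[OF K0D(1)] and K0_refl = eqm_refl[OF K0D(1)]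
lemmas K0_mult = eqm_mult[OF tideal_K0] and K0_diff = eqm_diff[OF K0D(1)] and K0_add = eqm_add[OF K0D(1)]
lemmas KK_trans = eqm_trans[OF KD(1)] and KK_sym = eqm_sym[OF KD(1)] and KK_refl = eqm_refl[OF KD(1)]
lemmas KK_mult = eqm_mult[OF tideal_KK] and KK_diff = eqm_diff[OF KD(1)] and KK_add = eqm_add[OF KD(1)]

text \<open>The coefficients are integers chosen from residue classes modulo p, which is why every
  statement about them is a divisibility.\<close>

definition cf :: "'r \<Rightarrow> 'a \<Rightarrow> int" where
  "cf x = (SOME n. eqm K0 x (\<Sum>g\<in>carrier G. of_int (n g) * e g))"

lemma cf: "eqm K0 x (\<Sum>g\<in>carrier G. of_int (cf x g) * e g)"
  unfolding cf_def by (rule someI_ex[OF e_span])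

lemma cf_unique:
  assumes "eqm K0 x (\<Sum>g\<in>carrier G. of_int (n g) * e g)" "g \<in> carrier G"
  shows "int p dvd cf x g - n g"
proof -
  have "eqm K0 (\<Sum>g\<in>carrier G. of_int (cf x g) * e g) (\<Sum>g\<in>carrier G. of_int (n g) * e g)"
    using K0_trans[OF K0_sym[OF cf] assms(1)] .
  then have "(\<Sum>g\<in>carrier G. of_int (cf x g - n g) * e g) \<in> K0"
    by (simp add: eqm_def sum_subtractf left_diff_distrib)
  from e_indep[OF this assms(2)] show ?thesis .
qed

lemma cf_diff:
  assumes "g \<in> carrier G"
  shows "int p dvd cf (x - y) g - (cf x g - cf y g)"
proof (rule cf_unique[OF _ assms])
  have "eqm K0 (x - y) ((\<Sum>g\<in>carrier G. of_int (cf x g) * e g) - (\<Sum>g\<in>carrier G. of_int (cf y g) * e g))"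
    by (intro K0_diff cf)
  then show "eqm K0 (x - y) (\<Sum>g\<in>carrier G. of_int (cf x g - cf y g) * e g)"
    by (simp add: sum_subtractf left_diff_distrib)
qed

lemma cf_K0: "x \<in> K0 \<Longrightarrow> g \<in> carrier G \<Longrightarrow> int p dvd cf x g"
  using cf_unique[of x "\<lambda>_. 0" g] by (simp add: eqm_def)

lemma cf_e:
  assumes "h \<in> carrier G" "g \<in> carrier G"
  shows "int p dvd cf (e h) g - (if g = h then 1 else 0)"
proof (rule cf_unique[OF _ assms(2)])
  have "(\<Sum>g\<in>carrier G. of_int (if g = h then 1 else 0) * e g) = (\<Sum>g\<in>carrier G. if g = h then e g else 0)"
    by (intro sum.cong) auto
  also have "\<dots> = e h" using fin assms(1) by (simp add: sum.delta)
  finally show "eqm K0 (e h) (\<Sum>g\<in>carrier G. of_int (if g = h then 1 else 0) * e g)"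
    by (simp add: K0_refl)
qed

lemma e_inj:
  assumes "eqm K0 (e x) (e y)" "x \<in> carrier G" "y \<in> carrier G"
  shows "x = y"
proof (rule ccontr)
  assume "x \<noteq> y"
  have "int p dvd cf (e x - e y) x"
    using assms by (intro cf_K0) (simp_all add: eqm_def)
  then have 1: "int p dvd cf (e x) x - cf (e y) x"
    using dvd_diff[OF _ cf_diff[OF assms(2), of "e x" "e y"]] by fastforce
  have 2: "int p dvd cf (e x) x - 1" and 3: "int p dvd cf (e y) x"
    using cf_e[OF assms(2,2)] cf_e[OF assms(3,2)] \<open>x \<noteq> y\<close> by simp_all
  from dvd_add[OF dvd_diff[OF 1 2] 3] show False using p_gt_2 by simp
qed

lemma lin_ind:
  assumes "add_closed S" "K0 \<subseteq> S" "\<And>g. g \<in> carrier G \<Longrightarrow> e g \<in> S"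
  shows "x \<in> S"
proof (rule eqm_mem[OF assms(1) eqm_mono[OF assms(2) cf]])
  show "(\<Sum>g\<in>carrier G. of_int (cf x g) * e g) \<in> S"
    by (intro add_closed_sum add_closed_of_int assms)
qed

lemma tideal_from_group:
  assumes S: "add_closed S" "K0 \<subseteq> S"
    and l: "\<And>g z. g \<in> carrier G \<Longrightarrow> z \<in> S \<Longrightarrow> e g * z \<in> S"
    and r: "\<And>g z. g \<in> carrier G \<Longrightarrow> z \<in> S \<Longrightarrow> z * e g \<in> S"
  shows "tideal S"
  unfolding tideal_def
proof (intro conjI ballI allI S(1))
  fix z x assume z: "z \<in> S"
  have "x \<in> {x. x * z \<in> S}"
  proof (rule lin_ind)
    show "add_closed {x. x * z \<in> S}"
      using add_closedD(1,2)[OF S(1)] by (simp add: add_closed_def left_diff_distrib)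
    show "K0 \<subseteq> {x. x * z \<in> S}" using S(2) K0D(7) by blast
  qed (use l z in simp)
  then show "x * z \<in> S" by simp
  have "x \<in> {x. z * x \<in> S}"
  proof (rule lin_ind)
    show "add_closed {x. z * x \<in> S}"
      using add_closedD(1,2)[OF S(1)] by (simp add: add_closed_def right_diff_distrib)
    show "K0 \<subseteq> {x. z * x \<in> S}" using S(2) K0D(6) by blast
  qed (use r z in simp)
  then show "z * x \<in> S" by simp
qed

lemma I_span: "x \<in> I \<Longrightarrow> x \<in> aspan (K0 \<union> {e g - 1 | g. g \<in> carrier G})"
proof -
  assume x: "x \<in> I"
  let ?S = "aspan (K0 \<union> {e g - 1 | g. g \<in> carrier G})"
  have K0S: "K0 \<subseteq> ?S" by (auto intro: aspan.incl)
  have "x \<in> {x. \<exists>n::int. x - of_int n \<in> ?S}"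
  proof (rule lin_ind)
    show "add_closed {x. \<exists>n::int. x - of_int n \<in> ?S}"
      unfolding add_closed_def
    proof (safe intro!: CollectI)
      show "\<exists>n::int. 0 - of_int n \<in> ?S" by (rule exI[of _ 0]) (simp add: aspan.zero)
    next
      fix x y and n m :: int assume "x - of_int n \<in> ?S" "y - of_int m \<in> ?S"
      then have "(x - of_int n) - (y - of_int m) \<in> ?S" by (rule aspan.diff)
      then show "\<exists>n::int. x - y - of_int n \<in> ?S"
        by (intro exI[of _ "n - m"]) (simp add: algebra_simps)
    qed
    show "K0 \<subseteq> {x. \<exists>n::int. x - of_int n \<in> ?S}"
      using K0S by (auto intro!: exI[of _ 0])
    show "e g \<in> {x. \<exists>n::int. x - of_int n \<in> ?S}" if "g \<in> carrier G" for g
      using that by (auto intro!: exI[of _ 1] aspan.incl)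
  qed
  then obtain n :: int where n: "x - of_int n \<in> ?S" by blast
  have "?S \<subseteq> I" by (intro aspan_least ID(1)) (use K0_I e_I in blast)
  \<comment> \<open>The integer \<open>n\<close> is the augmentation of \<open>x\<close>; it is
    divisible by p because \<open>x\<close> lies in \<open>I\<close>, and so it vanishes modulo
    \<open>K0\<close>.\<close>
  then have "of_int n \<in> I" using ID(3)[OF x, of "x - of_int n"] n by auto
  then have "of_int n \<in> ?S" using of_int_I_iff p_dvd_K0 K0S by blast
  from add_closedD(4)[OF add_closed_aspan n this] show ?thesis by simp
qed

lemma e_multJ: "K0 \<subseteq> J \<Longrightarrow> x \<in> carrier G \<Longrightarrow> y \<in> carrier G \<Longrightarrow> eqm J (e (x \<otimes> y)) (e x * e y)"
  by (rule eqm_mono[OF _ e_mult])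

lemma e_inv:
  assumes "x \<in> carrier G"
  shows "eqm K0 (e (inv x) * e x) 1" "eqm K0 (e x * e (inv x)) 1"
  using K0_trans[OF K0_sym[OF e_mult], of "inv x" x 1] K0_trans[OF K0_sym[OF e_mult], of x "inv x" 1]
    assms e_one by simp_all

lemma e_pow: "x \<in> carrier G \<Longrightarrow> eqm K0 (e (x [^] (n::nat))) (e x ^ n)"
proof (induction n)
  case (Suc n)
  have "eqm K0 (e (x [^] n \<otimes> x)) (e (x [^] n) * e x)" by (intro e_mult nat_pow_closed Suc)
  moreover have "eqm K0 (e (x [^] n) * e x) (e x ^ n * e x)" using Suc by (intro K0_mult K0_refl)
  ultimately show ?case using K0_trans by (simp add: power_commutes)
qed (simp add: e_one)

text \<open>For a power of the augmentation ideal this is a dimension subgroup. For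
  \<open>AA\<close>, \<open>LL\<close> and \<open>KK\<close> it is determined in terms of the group
  alone by \<open>Dk_AA\<close>, \<open>Dk_LL\<close> and \<open>Dk_KK\<close>.\<close>

definition Dk :: "'r set \<Rightarrow> 'a set" where
  "Dk J = {g \<in> carrier G. eqm J (e g) 1}"

lemma Dk_iff: "g \<in> Dk J \<longleftrightarrow> g \<in> carrier G \<and> e g - 1 \<in> J"
  by (simp add: Dk_def eqm_def)

lemma e_eqm_iff:
  assumes J: "tideal J" "K0 \<subseteq> J" and xy: "x \<in> carrier G" "y \<in> carrier G"
  shows "x \<otimes> inv y \<in> Dk J \<longleftrightarrow> eqm J (e x) (e y)"
proof
  note ac = tidealD(1)[OF J(1)]
  note t = eqm_trans[OF ac] and s = eqm_sym[OF ac] and r = eqm_refl[OF ac]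
  have m: "eqm J (e x * e (inv y)) (e (x \<otimes> inv y))" using s[OF e_multJ[OF J(2)]] xy by simp
  { assume "x \<otimes> inv y \<in> Dk J"
    then have "eqm J (e x * e (inv y)) 1" using t[OF m] by (simp add: Dk_def)
    then have "eqm J (e x * e (inv y) * e y) (1 * e y)" by (intro eqm_mult J r)
    then have a: "eqm J (e x * (e (inv y) * e y)) (e y)" by (simp add: mult.assoc)
    have "eqm J (e x * (e (inv y) * e y)) (e x * 1)"
      using eqm_mono[OF J(2) e_inv(1)[OF xy(2)]] by (intro eqm_mult J r)
    from t[OF s[OF this] a] show "eqm J (e x) (e y)" by simp }
  { assume "eqm J (e x) (e y)"
    then have "eqm J (e x * e (inv y)) (e y * e (inv y))" by (intro eqm_mult J r)
    from t[OF s[OF m] t[OF this eqm_mono[OF J(2) e_inv(2)[OF xy(2)]]]]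
    have "eqm J (e (x \<otimes> inv y)) 1" .
    then show "x \<otimes> inv y \<in> Dk J" using xy by (simp add: Dk_def) }
qed

lemma Dk_normal:
  assumes J: "tideal J" "K0 \<subseteq> J"
  shows "Dk J \<lhd> G"
proof (rule normal_invI)
  note ac = tidealD(1)[OF J(1)]
  note t = eqm_trans[OF ac] and s = eqm_sym[OF ac] and r = eqm_refl[OF ac]
  have e1: "eqm J (e \<one>) 1" by (rule eqm_mono[OF J(2) e_one])
  show "subgroup (Dk J) G"
  proof
    show "Dk J \<subseteq> carrier G" by (auto simp: Dk_def)
    show "\<one> \<in> Dk J" using e1 by (simp add: Dk_def)
    fix x assume x: "x \<in> Dk J"
    then have xG: "x \<in> carrier G" by (simp add: Dk_def)
    have "eqm J (e \<one>) (e x)" using x t[OF e1 s] by (simp add: Dk_def)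
    then show "inv x \<in> Dk J" using e_eqm_iff[OF J one_closed xG] xG by simp
    fix y assume y: "y \<in> Dk J"
    then have yG: "y \<in> carrier G" by (simp add: Dk_def)
    have "eqm J (e x * e y) (1 * 1)" using x y by (intro eqm_mult J) (simp_all add: Dk_def)
    then show "x \<otimes> y \<in> Dk J" using t[OF e_multJ[OF J(2) xG yG]] xG yG by (simp add: Dk_def)
  qed
  fix x g assume x: "x \<in> Dk J" and g: "g \<in> carrier G"
  then have xG: "x \<in> carrier G" by (simp add: Dk_def)
  have "eqm J (e g * e x) (e g * 1)" using x by (intro eqm_mult J r) (simp add: Dk_def)
  then have "eqm J (e (g \<otimes> x)) (e g)" using t[OF e_multJ[OF J(2) g xG]] by simp
  then show "g \<otimes> x \<otimes> inv g \<in> Dk J" using e_eqm_iff[OF J, of "g \<otimes> x" g] g xG by simp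
qed

text \<open>[x, y] - 1 = x^-1 y^-1 (xy - yx), and the ring commutator does not change when 1 is
  subtracted from both arguments. Group and ring commutators thus differ by a unit on the left
  only.\<close>

lemma e_commutator:
  assumes x: "x \<in> carrier G" and y: "y \<in> carrier G"
  shows "eqm K0 (e (commutator G x y) - 1)
    (e (inv x) * e (inv y) * ((e x - 1) * (e y - 1) - (e y - 1) * (e x - 1)))"
proof -
  have a: "eqm K0 (e (inv x) * e (inv y) * e x * e y) (e (commutator G x y))"
  proof -
    have "eqm K0 (e (inv x) * e (inv y)) (e (inv x \<otimes> inv y))" using x y by (intro K0_sym[OF e_mult]) auto
    then have "eqm K0 (e (inv x) * e (inv y) * e x) (e (inv x \<otimes> inv y) * e x)" by (intro K0_mult K0_refl)
    then have "eqm K0 (e (inv x) * e (inv y) * e x) (e (inv x \<otimes> inv y \<otimes> x))"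
      using x y by (elim K0_trans) (intro K0_sym[OF e_mult], auto)
    then have "eqm K0 (e (inv x) * e (inv y) * e x * e y) (e (inv x \<otimes> inv y \<otimes> x) * e y)"
      by (intro K0_mult K0_refl)
    then show ?thesis unfolding commutator_def
      using x y by (elim K0_trans) (intro K0_sym[OF e_mult], auto)
  qed
  have b: "eqm K0 (e (inv x) * e (inv y) * e y * e x) 1"
  proof -
    have "eqm K0 (e (inv x) * (e (inv y) * e y) * e x) (e (inv x) * 1 * e x)"
      by (intro K0_mult K0_refl e_inv y)
    from K0_trans[OF this] show ?thesis using e_inv(1)[OF x] by (simp add: mult.assoc)
  qed
  have "eqm K0 (e (inv x) * e (inv y) * e x * e y - e (inv x) * e (inv y) * e y * e x)
      (e (commutator G x y) - 1)" by (rule K0_diff[OF a b])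
  from K0_sym[OF this] show ?thesis by (simp add: algebra_simps)
qed

lemma commutator_Dk:
  assumes "tideal J" "K0 \<subseteq> J" "x \<in> carrier G" "y \<in> carrier G"
    "(e x - 1) * (e y - 1) - (e y - 1) * (e x - 1) \<in> J"
  shows "commutator G x y \<in> Dk J"
proof -
  have "e (commutator G x y) - 1 \<in> J"
    by (rule eqm_mem[OF tidealD(1)[OF assms(1)] eqm_mono[OF assms(2) e_commutator[OF assms(3,4)]]])
      (intro tidealD(6)[OF assms(1)] assms)
  then show ?thesis using assms by (simp add: Dk_iff)
qed

lemma gamma2_Dk: "\<gamma>2 \<subseteq> Dk AA"
  unfolding gamma2_eq commutator_subgroup_def
proof (rule generate_least)
  show "subgroup (Dk AA) G" by (intro normal_imp_subgroup Dk_normal tideal_AA K0_AA)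
  show "{commutator G a b |a b. a \<in> carrier G \<and> b \<in> carrier G} \<subseteq> Dk AA"
    using commutator_Dk[OF tideal_AA K0_AA] comm_AA by blast
qed

lemma gamma3_Dk: "lower_central G 3 \<subseteq> Dk LL"
  unfolding gamma3_eq commutator_subgroup_def
proof (rule generate_least)
  show "subgroup (Dk LL) G" by (intro normal_imp_subgroup Dk_normal tideal_LL K0_LL)
  show "{commutator G a b |a b. a \<in> \<gamma>2 \<and> b \<in> carrier G} \<subseteq> Dk LL"
  proof safe
    fix a b assume ab: "a \<in> \<gamma>2" "b \<in> carrier G"
    then have a: "a \<in> carrier G" "e a - 1 \<in> AA" using gamma2_Dk by (auto simp: Dk_iff)
    show "commutator G a b \<in> Dk LL"
      by (intro commutator_Dk tideal_LL K0_LL a ab LD(3) IA_LL AI_LL e_I)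
  qed
qed

lemma gamma4_Dk: "lower_central G 4 \<subseteq> Dk KK"
  unfolding gamma4_eq commutator_subgroup_def
proof (rule generate_least)
  show "subgroup (Dk KK) G" by (intro normal_imp_subgroup Dk_normal tideal_KK K0_KK)
  show "{commutator G a b |a b. a \<in> lower_central G 3 \<and> b \<in> carrier G} \<subseteq> Dk KK"
  proof safe
    fix a b assume ab: "a \<in> lower_central G 3" "b \<in> carrier G"
    then have a: "a \<in> carrier G" "e a - 1 \<in> LL" using gamma3_Dk by (auto simp: Dk_iff)
    show "commutator G a b \<in> Dk KK"
      by (intro commutator_Dk tideal_KK K0_KK a ab KD(3) IL_KK LI_KK e_I)
  qed
qed

lemma e_pow_p: "x \<in> carrier G \<Longrightarrow> eqm K0 (e (x [^] (p ^ s)) - 1) ((e x - 1) ^ (p ^ s))"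
proof -
  assume x: "x \<in> carrier G"
  have "eqm K0 (e (x [^] (p ^ s))) (e x ^ (p ^ s))" by (rule e_pow[OF x])
  moreover have "eqm K0 (e x ^ (p ^ s)) (1 + (e x - 1) ^ (p ^ s))" using frob_one[of "e x - 1" s] by simp
  ultimately have "eqm K0 (e (x [^] (p ^ s))) (1 + (e x - 1) ^ (p ^ s))" by (rule K0_trans)
  then show ?thesis by (simp add: eqm_def algebra_simps)
qed

lemma gamma2_pow_Dk: "power_subgroup G p \<gamma>2 \<subseteq> Dk KK"
  unfolding power_subgroup_def
proof (rule generate_least)
  show "subgroup (Dk KK) G" by (intro normal_imp_subgroup Dk_normal tideal_KK K0_KK)
  show "{x [^] p |x. x \<in> \<gamma>2} \<subseteq> Dk KK"
  proof safe
    fix x assume "x \<in> \<gamma>2"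
    then have x: "x \<in> carrier G" "e x - 1 \<in> AA" using gamma2_Dk by (auto simp: Dk_iff)
    obtain q where q: "p = Suc (Suc q)" using p_gt_2 that[of "p - 2"] by simp
    \<comment> \<open>One factor is kept in \<open>AA\<close> and the others are regarded as
      elements of \<open>I\<close>.\<close>
    have "(e x - 1) * (e x - 1) ^ Suc q \<in> KK"
      using x AA_I by (intro AI_KK tideal_pow tideal_I) auto
    then have "(e x - 1) ^ p \<in> KK" by (simp add: q)
    then have "e (x [^] p) - 1 \<in> KK"
      using eqm_mem[OF KD(1) eqm_mono[OF K0_KK e_pow_p[OF x(1), of 1]]] by simp
    then show "x [^] p \<in> Dk KK" using x by (simp add: Dk_iff)
  qed
qed

abbreviation "gN3 \<equiv> power_subgroup G p \<gamma>2 <#> lower_central G 3"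
abbreviation "gN4 \<equiv> power_subgroup G p \<gamma>2 <#> lower_central G 4"

lemma gN_normal: "gN3 \<lhd> G" "gN4 \<lhd> G"
  by (intro set_mult_normal power_subgroup_normal lower_central_normal)+

lemma gN_le: "gN3 \<subseteq> \<gamma>2" "gN4 \<subseteq> \<gamma>2"
  by (intro set_mult_least normal_imp_subgroup[OF lower_central_normal] power_subgroup_le gamma3_le gamma4_le)+

lemma gN3_Dk: "gN3 \<subseteq> Dk LL"
proof (intro set_mult_least gamma3_Dk)
  show "subgroup (Dk LL) G" by (intro normal_imp_subgroup Dk_normal tideal_LL K0_LL)
  show "power_subgroup G p \<gamma>2 \<subseteq> Dk LL" using gamma2_pow_Dk KK_LL by (auto simp: Dk_iff subset_iff)
qed

lemma gN4_Dk: "gN4 \<subseteq> Dk KK"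
  by (intro set_mult_least gamma4_Dk gamma2_pow_Dk normal_imp_subgroup Dk_normal tideal_KK K0_KK)

section \<open>The commutator ideal in terms of \<open>\<gamma>2\<close>\<close>

lemma gamma2_conj: "g \<in> carrier G \<Longrightarrow> m \<in> \<gamma>2 \<Longrightarrow> g \<otimes> m \<otimes> inv g \<in> \<gamma>2"
  by (rule normal_conj[OF lower_central_normal])

lemma e_conj:
  assumes g: "g \<in> carrier G" and m: "m \<in> carrier G"
  shows "eqm K0 (e g * (e m - 1)) ((e (g \<otimes> m \<otimes> inv g) - 1) * e g)"
proof -
  have "eqm K0 (e g * e m) (e (g \<otimes> m))" using e_mult[OF g m] by (rule K0_sym)
  moreover have "eqm K0 (e (g \<otimes> m \<otimes> inv g \<otimes> g)) (e (g \<otimes> m \<otimes> inv g) * e g)"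
    using g m by (intro e_mult) auto
  moreover have "g \<otimes> m \<otimes> inv g \<otimes> g = g \<otimes> m" using g m by (simp add: m_assoc)
  ultimately have "eqm K0 (e g * e m) (e (g \<otimes> m \<otimes> inv g) * e g)" using K0_trans by simp
  then have "eqm K0 (e g * e m - e g) (e (g \<otimes> m \<otimes> inv g) * e g - e g)" by (rule K0_diff[OF _ K0_refl])
  then show ?thesis by (simp add: algebra_simps)
qed

text \<open>Additive generators of the kernel of the projection from FG to the group algebra of
  G/\<gamma>2.\<close>

definition AAgen :: "'r set" where
  "AAgen = K0 \<union> {(e m - 1) * e y | m y. m \<in> \<gamma>2 \<and> y \<in> carrier G}"

lemma AAgen_left:
  assumes "g \<in> carrier G" "m \<in> \<gamma>2" "y \<in> carrier G"
  shows "eqm K0 (e g * ((e m - 1) * e y)) ((e (g \<otimes> m \<otimes> inv g) - 1) * e (g \<otimes> y))"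
proof -
  have m: "m \<in> carrier G" using assms gamma2_carrier by blast
  have "eqm K0 (e g * (e m - 1) * e y) ((e (g \<otimes> m \<otimes> inv g) - 1) * e g * e y)"
    by (intro K0_mult K0_refl e_conj assms m)
  moreover have "eqm K0 ((e (g \<otimes> m \<otimes> inv g) - 1) * (e g * e y)) ((e (g \<otimes> m \<otimes> inv g) - 1) * e (g \<otimes> y))"
    by (intro K0_mult K0_refl K0_sym[OF e_mult] assms)
  ultimately show ?thesis using K0_trans by (simp add: mult.assoc)
qed

lemma AAgen_right:
  assumes "g \<in> carrier G" "y \<in> carrier G"
  shows "eqm K0 (z * e y * e g) (z * e (y \<otimes> g))"
  unfolding mult.assoc by (intro K0_mult K0_refl K0_sym[OF e_mult] assms)

text \<open>The span is a two-sided ideal because \<gamma>2 is normal, and it contains the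
  commutators of basis elements; by bilinearity it contains all commutators, hence
  \<open>AA\<close>. The other inclusion is \<open>gamma2_Dk\<close>.\<close>

lemma AA_span: "AA = aspan AAgen"
proof
  let ?S = "aspan AAgen"
  have K0S: "K0 \<subseteq> ?S" by (auto intro: aspan.incl simp: AAgen_def)
  have gS: "(e m - 1) * e y \<in> ?S" if "m \<in> \<gamma>2" "y \<in> carrier G" for m y
    using that by (auto intro!: aspan.incl simp: AAgen_def)
  have tS: "tideal ?S"
  proof (rule tideal_from_group[OF add_closed_aspan K0S])
    fix g z assume g: "g \<in> carrier G" and z: "z \<in> ?S"
    show "e g * z \<in> ?S"
    proof (rule aspan_absorb_left[OF _ z])
      fix x assume "x \<in> AAgen"
      then consider "x \<in> K0" | m y where "x = (e m - 1) * e y" "m \<in> \<gamma>2" "y \<in> carrier G"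
        by (auto simp: AAgen_def)
      then show "e g * x \<in> ?S"
      proof cases
        case 1 then show ?thesis using K0D(6) K0S by blast
      next
        case 2
        show ?thesis unfolding 2
          by (rule eqm_mem[OF add_closed_aspan eqm_mono[OF K0S AAgen_left[OF g 2(2,3)]]])
            (intro gS gamma2_conj g m_closed 2)
      qed
    qed
    show "z * e g \<in> ?S"
    proof (rule aspan_absorb_right[OF _ z])
      fix x assume "x \<in> AAgen"
      then consider "x \<in> K0" | m y where "x = (e m - 1) * e y" "m \<in> \<gamma>2" "y \<in> carrier G"
        by (auto simp: AAgen_def)
      then show "x * e g \<in> ?S"
      proof cases
        case 1 then show ?thesis using K0D(7) K0S by blast
      next
        case 2
        show ?thesis unfolding 2
          by (rule eqm_mem[OF add_closed_aspan eqm_mono[OF K0S AAgen_right[OF g 2(3)]]])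
            (intro gS g m_closed 2)
      qed
    qed
  qed
  note SD = tidealD[OF tS]
  have c1: "e a * e b - e b * e a \<in> ?S" if ab: "a \<in> carrier G" "b \<in> carrier G" for a b
  proof -
    \<comment> \<open>The inverses turn the convention x^-1 y^-1 x y into a b a^-1 b^-1, so that
      \<open>?c\<close> stands on the left in ab = c (ba).\<close>
    let ?c = "commutator G (inv a) (inv b)"
    have c: "?c \<in> \<gamma>2" using ab by (intro commutator_gamma2) auto
    have cG: "?c \<in> carrier G" using ab by simp
    have "?c \<otimes> (b \<otimes> a) = a \<otimes> b" using ab by (simp add: commutator_def m_assoc)
    then have "eqm K0 (e (a \<otimes> b)) (e ?c * e (b \<otimes> a))" using e_mult[OF cG, of "b \<otimes> a"] ab by simp
    then have "eqm K0 (e (a \<otimes> b) - e (b \<otimes> a)) ((e ?c - 1) * e (b \<otimes> a))"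
      by (simp add: eqm_def algebra_simps)
    moreover have "eqm K0 (e a * e b - e b * e a) (e (a \<otimes> b) - e (b \<otimes> a))"
      by (intro K0_diff K0_sym[OF e_mult] ab)
    ultimately have "eqm K0 (e a * e b - e b * e a) ((e ?c - 1) * e (b \<otimes> a))"
      using K0_trans by blast
    then show ?thesis
      by (rule eqm_mem[OF add_closed_aspan eqm_mono[OF K0S]]) (intro gS c m_closed ab)
  qed
  have c2: "x * e b - e b * x \<in> ?S" if b: "b \<in> carrier G" for x b
  proof -
    have "x \<in> {x. x * e b - e b * x \<in> ?S}"
    proof (rule lin_ind)
      show "add_closed {x. x * e b - e b * x \<in> ?S}"
        unfolding add_closed_def
      proof (safe intro!: CollectI)
        fix x y assume "x * e b - e b * x \<in> ?S" "y * e b - e b * y \<in> ?S"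
        from SD(3)[OF this] show "(x - y) * e b - e b * (x - y) \<in> ?S" by (simp add: algebra_simps)
      qed (simp add: SD)
      show "K0 \<subseteq> {x. x * e b - e b * x \<in> ?S}" using K0D(3)[OF K0D(7) K0D(6)] K0S by blast
    qed (use c1 b in simp)
    then show ?thesis by simp
  qed
  have c3: "x * y - y * x \<in> ?S" for x y
  proof -
    have "y \<in> {y. x * y - y * x \<in> ?S}"
    proof (rule lin_ind)
      show "add_closed {y. x * y - y * x \<in> ?S}"
        unfolding add_closed_def
      proof (safe intro!: CollectI)
        fix y z assume "x * y - y * x \<in> ?S" "x * z - z * x \<in> ?S"
        from SD(3)[OF this] show "x * (y - z) - (y - z) * x \<in> ?S" by (simp add: algebra_simps)
      qed (simp add: SD)
      show "K0 \<subseteq> {y. x * y - y * x \<in> ?S}" using K0D(3)[OF K0D(6) K0D(7)] K0S by blast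
    qed (use c2 in simp)
    then show ?thesis by simp
  qed
  show "AA \<subseteq> ?S" unfolding AA_def
    by (intro aspan_least add_closed_aspan) (use K0S SD(6,7) c3 in blast)
  show "?S \<subseteq> AA"
    by (intro aspan_least AD(1)) (use K0_AA gamma2_Dk AD(7) in \<open>auto simp: AAgen_def Dk_iff\<close>)
qed

text \<open>mg - 1 is the sum of m - 1, g - 1 and (m - 1)(g - 1), and the last term lies in AI. On
  \<gamma>2 this makes m \<mapsto> m - 1 a homomorphism to A/K, which is onto by
  \<open>AA_rep\<close> and whose kernel is found in \<open>Dk_KK\<close>.\<close>

lemma e_AA_mult:
  assumes "m \<in> Dk AA" "g \<in> carrier G"
  shows "eqm KK (e (m \<otimes> g) - 1) ((e m - 1) + (e g - 1))"
proof -
  have m: "m \<in> carrier G" "e m - 1 \<in> AA" using assms by (auto simp: Dk_iff)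
  have "eqm KK (e (m \<otimes> g)) (e m * e g)" by (rule eqm_mono[OF K0_KK e_mult[OF m(1) assms(2)]])
  moreover have "eqm KK (e m * e g) ((e m - 1) + (e g - 1) + 1)"
  proof -
    have "e m * e g - ((e m - 1) + (e g - 1) + 1) = (e m - 1) * (e g - 1)"
      by (simp add: left_diff_distrib right_diff_distrib)
    then show ?thesis using AI_KK[OF m(2) e_I[OF assms(2)]] by (simp add: eqm_def)
  qed
  ultimately have "eqm KK (e (m \<otimes> g)) ((e m - 1) + (e g - 1) + 1)" by (rule KK_trans)
  from KK_diff[OF this KK_refl[of 1]] show ?thesis by (simp only: add_diff_cancel_right')
qed

lemma e_AA_inv:
  assumes "m \<in> Dk AA"
  shows "eqm KK (e (inv m) - 1) (- (e m - 1))"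
proof -
  have m: "m \<in> carrier G" using assms by (auto simp: Dk_iff)
  have "eqm KK (e \<one> - 1) ((e m - 1) + (e (inv m) - 1))" using e_AA_mult[OF assms, of "inv m"] m by simp
  moreover have "e \<one> - 1 \<in> KK" using e_one K0_KK by (auto simp: eqm_def)
  ultimately have "(e m - 1) + (e (inv m) - 1) \<in> KK" using eqm_mem[OF KD(1) KK_sym] by blast
  then show ?thesis by (simp add: eqm_def algebra_simps)
qed

text \<open>A generator (m - 1) y is m - 1 modulo AI, and by additivity of m \<mapsto> m - 1 the
  classes of this form are closed under differences. So an arbitrary element of \<open>AA\<close> is
  represented by a single group element and not merely by a combination.\<close>

lemma AA_rep:
  assumes "a \<in> AA"
  shows "\<exists>m\<in>\<gamma>2. eqm KK a (e m - 1)"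
proof -
  have sg: "subgroup \<gamma>2 G" by (rule normal_imp_subgroup[OF lower_central_normal])
  let ?T = "{a. \<exists>m\<in>\<gamma>2. eqm KK a (e m - 1)}"
  have e1: "eqm KK 0 (e \<one> - 1)" using KK_sym[OF eqm_mono[OF K0_KK e_one]] by (simp add: eqm_def)
  have "aspan AAgen \<subseteq> ?T"
  proof (rule aspan_least)
    show "add_closed ?T" unfolding add_closed_def
    proof (safe intro!: CollectI)
      show "\<exists>m\<in>\<gamma>2. eqm KK 0 (e m - 1)" using e1 subgroup.one_closed[OF sg] by blast
      fix x y m m' assume m: "m \<in> \<gamma>2" "eqm KK x (e m - 1)" "m' \<in> \<gamma>2" "eqm KK y (e m' - 1)"
      have m': "inv m' \<in> \<gamma>2" "m \<in> Dk AA" "m' \<in> Dk AA" "inv m' \<in> carrier G"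
        using m gamma2_Dk subgroup.m_inv_closed[OF sg] gamma2_carrier by blast+
      have "eqm KK (e (m \<otimes> inv m') - 1) ((e m - 1) + (e (inv m') - 1))"
        by (rule e_AA_mult[OF m'(2,4)])
      moreover have "eqm KK ((e m - 1) + (e (inv m') - 1)) ((e m - 1) + (- (e m' - 1)))"
        by (intro KK_add KK_refl e_AA_inv m')
      ultimately have "eqm KK (e (m \<otimes> inv m') - 1) ((e m - 1) - (e m' - 1))"
        using KK_trans by fastforce
      then have "eqm KK (x - y) (e (m \<otimes> inv m') - 1)"
        using KK_trans[OF KK_diff[OF m(2,4)] KK_sym] by blast
      then show "\<exists>m\<in>\<gamma>2. eqm KK (x - y) (e m - 1)" using m(1) m'(1) subgroup.m_closed[OF sg] by blast
    qed
    show "AAgen \<subseteq> ?T" unfolding AAgen_def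
    proof safe
      fix x assume "x \<in> K0"
      then have "eqm KK x 0" using K0_KK by (auto simp: eqm_def)
      then show "\<exists>m\<in>\<gamma>2. eqm KK x (e m - 1)" using KK_trans[OF _ e1] subgroup.one_closed[OF sg] by blast
    next
      fix m y assume m: "m \<in> \<gamma>2" "y \<in> carrier G"
      have "(e m - 1) * (e y - 1) \<in> KK" using m gamma2_Dk by (intro AI_KK e_I) (auto simp: Dk_iff)
      then have "eqm KK ((e m - 1) * e y) (e m - 1)" by (simp add: eqm_def algebra_simps)
      then show "\<exists>m'\<in>\<gamma>2. eqm KK ((e m - 1) * e y) (e m' - 1)" using m by blast
    qed
  qed
  then show ?thesis using assms AA_span by blast
qed

end

section \<open>Elementary abelian sections, and commutation in \<gamma>2 modulo \<gamma>4\<close>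

context group
begin

lemma coset_eq_iff:
  assumes "subgroup N G" "x \<in> carrier G" "y \<in> carrier G"
  shows "N #> x = N #> y \<longleftrightarrow> x \<otimes> inv y \<in> N"
proof
  assume "N #> x = N #> y"
  then have "x \<in> N #> y" using rcos_self[OF assms(2,1)] by simp
  then show "x \<otimes> inv y \<in> N" by (rule subgroup.rcos_module_imp[OF assms(1) is_group assms(3)])
next
  assume "x \<otimes> inv y \<in> N"
  then have "x \<in> N #> y" by (rule subgroup.rcos_module_rev[OF assms(1) is_group assms(3,2)])
  then show "N #> x = N #> y" using repr_independence assms by blast
qed

lemma int_pow_cong_mod:
  assumes "b \<in> carrier G" "b [^] p = \<one>" "int p dvd i - j"
  shows "b [^] i = b [^] j"
proof -
  obtain k where "i - j = int p * k" using assms(3) by blast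
  then have "i = j + int p * k" by simp
  moreover have "b [^] (int p * k) = \<one>"
    using int_pow_pow[of b "int p" k] assms by (simp add: int_pow_int)
  ultimately show ?thesis using assms by (simp add: int_pow_mult)
qed

text \<open>The quotients P/N that serve as targets of additive functionals. The condition on
  commutators yields both that \<open>N\<close> is normal in \<open>P\<close> and that the quotient
  is abelian.\<close>

lemma elementary_quotient:
  assumes P: "subgroup P G" and N: "subgroup N G" "N \<subseteq> P"
    and pw: "\<forall>x\<in>P. x [^] (p::nat) \<in> N"
    and cm: "\<forall>x\<in>P. \<forall>y\<in>P. x \<otimes> y \<otimes> inv x \<otimes> inv y \<in> N"
  defines "B \<equiv> G\<lparr>carrier := P\<rparr> Mod N"
  shows "comm_group B"
    and "\<forall>b\<in>carrier B. b [^]\<^bsub>B\<^esub> p = \<one>\<^bsub>B\<^esub>"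
    and "\<And>x. x \<in> P \<Longrightarrow> N #> x \<in> carrier B"
    and "\<And>x y. x \<in> P \<Longrightarrow> y \<in> P \<Longrightarrow> N #> (x \<otimes> y) = (N #> x) \<otimes>\<^bsub>B\<^esub> (N #> y)"
    and "\<And>x. x \<in> P \<Longrightarrow> N #> x = \<one>\<^bsub>B\<^esub> \<longleftrightarrow> x \<in> N"
proof -
  let ?P = "G\<lparr>carrier := P\<rparr>"
  have PG: "x \<in> carrier G" if "x \<in> P" for x using that P subgroup.subset by blast
  interpret P: group ?P using P subgroup.subgroup_is_group is_group by blast
  have nN: "N \<lhd> ?P"
  proof (rule P.normal_invI)
    show "subgroup N ?P" by (rule subgroup_incl[OF N(1) P N(2)])
    fix n x assume "n \<in> N" and "x \<in> carrier ?P"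
    then have x: "x \<in> P" and n: "n \<in> N" "n \<in> P" using N(2) by auto
    have "x \<otimes> n \<otimes> inv x \<otimes> inv n \<otimes> n \<in> N"
      by (intro subgroup.m_closed[OF N(1)] cm[rule_format] x n)
    moreover have "x \<otimes> n \<otimes> inv x \<otimes> inv n \<otimes> n = x \<otimes> n \<otimes> inv x"
      using PG[OF x] PG[OF n(2)] by (simp add: m_assoc)
    ultimately show "x \<otimes>\<^bsub>?P\<^esub> n \<otimes>\<^bsub>?P\<^esub> inv\<^bsub>?P\<^esub> x \<in> N" using x P by simp
  qed
  have B: "group B" unfolding B_def by (rule normal.factorgroup_is_group[OF nN])
  have cB: "carrier B = (\<lambda>x. N #> x) ` P" unfolding B_def by (simp add: carrier_FactGroup)
  show mem: "\<And>x. x \<in> P \<Longrightarrow> N #> x \<in> carrier B" by (simp add: cB)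
  show mult: "N #> (x \<otimes> y) = (N #> x) \<otimes>\<^bsub>B\<^esub> (N #> y)" if "x \<in> P" "y \<in> P" for x y
    using normal.rcos_sum[OF nN, of x y] that unfolding B_def by simp
  show one: "N #> x = \<one>\<^bsub>B\<^esub> \<longleftrightarrow> x \<in> N" if "x \<in> P" for x
    using coset_eq_iff[OF N(1) PG[OF that] one_closed] PG[OF that] N(1) unfolding B_def
    by (simp add: coset_mult_one subgroup.subset)
  show "comm_group B"
  proof (rule group.group_comm_groupI[OF B])
    fix a b assume "a \<in> carrier B" "b \<in> carrier B"
    then obtain x y where xy: "x \<in> P" "a = N #> x" "y \<in> P" "b = N #> y" by (auto simp: cB)
    have "N #> (x \<otimes> y) = N #> (y \<otimes> x)"
      using cm[rule_format, OF xy(1,3)] coset_eq_iff[OF N(1), of "x \<otimes> y" "y \<otimes> x"] PG[OF xy(1)] PG[OF xy(3)]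
      by (simp add: inv_mult_group m_assoc)
    then show "a \<otimes>\<^bsub>B\<^esub> b = b \<otimes>\<^bsub>B\<^esub> a" using xy mult by simp
  qed
  show "\<forall>b\<in>carrier B. b [^]\<^bsub>B\<^esub> p = \<one>\<^bsub>B\<^esub>"
  proof
  fix b assume "b \<in> carrier B"
  then obtain x where x: "x \<in> P" "b = N #> x" by (auto simp: cB)
  have "b [^]\<^bsub>B\<^esub> p = N #> (x [^] p)"
    using normal.FactGroup_pow[OF nN, of x p] x unfolding B_def
    by (simp add: nat_pow_consistent[symmetric])
  also have "\<dots> = \<one>\<^bsub>B\<^esub>"
    using one[of "x [^] p"] pw[rule_format, OF x(1)] subgroup_pow_closed[OF P x(1)] by simp
  finally show "b [^]\<^bsub>B\<^esub> p = \<one>\<^bsub>B\<^esub>" .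
  qed
qed

text \<open>Both \<open>x\<close> and \<open>y\<close> commute with \<open>a\<close> up to a central
  factor, so \<open>x \<otimes> y\<close> and \<open>y \<otimes> x\<close> do so with the same
  factor, and their quotient, the commutator, commutes with \<open>a\<close>.\<close>

lemma commutator_commute_central:
  assumes x: "x \<in> carrier G" and y: "y \<in> carrier G" and a: "a \<in> carrier G"
    and zx: "x \<otimes> a = z \<otimes> (a \<otimes> x)" "z \<in> carrier G" "\<And>g. g \<in> carrier G \<Longrightarrow> g \<otimes> z = z \<otimes> g"
    and zy: "y \<otimes> a = w \<otimes> (a \<otimes> y)" "w \<in> carrier G" "\<And>g. g \<in> carrier G \<Longrightarrow> g \<otimes> w = w \<otimes> g"
  shows "commutator G x y \<otimes> a = a \<otimes> commutator G x y"
proof -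
  let ?c = "commutator G x y"
  have 1: "x \<otimes> y \<otimes> a = (z \<otimes> w) \<otimes> (a \<otimes> (x \<otimes> y))"
  proof -
    have "x \<otimes> y \<otimes> a = x \<otimes> w \<otimes> (a \<otimes> y)" using x y a zy(1,2) by (simp add: m_assoc)
    also have "\<dots> = w \<otimes> (x \<otimes> a) \<otimes> y" using x y a zy(2) zy(3)[OF x] by (simp add: m_assoc[symmetric])
    also have "\<dots> = w \<otimes> z \<otimes> (a \<otimes> (x \<otimes> y))" using x y a zx(1,2) zy(2) by (simp add: m_assoc)
    also have "w \<otimes> z = z \<otimes> w" by (rule zx(3)[OF zy(2)])
    finally show ?thesis .
  qed
  have 2: "y \<otimes> x \<otimes> a = (z \<otimes> w) \<otimes> (a \<otimes> (y \<otimes> x))"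
  proof -
    have "y \<otimes> x \<otimes> a = y \<otimes> z \<otimes> (a \<otimes> x)" using x y a zx(1,2) by (simp add: m_assoc)
    also have "\<dots> = z \<otimes> (y \<otimes> a) \<otimes> x" using x y a zx(2) zx(3)[OF y] by (simp add: m_assoc[symmetric])
    also have "\<dots> = z \<otimes> w \<otimes> (a \<otimes> (y \<otimes> x))" using x y a zy(1,2) zx(2) by (simp add: m_assoc)
    finally show ?thesis .
  qed
  have c: "?c \<in> carrier G" and xy: "y \<otimes> x \<otimes> ?c = x \<otimes> y" using x y commutator_swap by auto
  have "(y \<otimes> x) \<otimes> (?c \<otimes> a) = (z \<otimes> w) \<otimes> (a \<otimes> (y \<otimes> x \<otimes> ?c))"
    using 1 xy x y a c by (simp add: m_assoc[symmetric])
  also have "\<dots> = (z \<otimes> w) \<otimes> (a \<otimes> (y \<otimes> x)) \<otimes> ?c" using x y a c zx(2) zy(2) by (simp add: m_assoc)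
  also have "\<dots> = (y \<otimes> x) \<otimes> (a \<otimes> ?c)" unfolding 2[symmetric] using x y a c by (simp add: m_assoc)
  finally show ?thesis using x y a c by (simp del: m_assoc)
qed

text \<open>Conjugation in the group ring produces h a h^-1 a^-1, which in the convention of
  \<open>commutator\<close> is the inverse of [a^-1, h^-1].\<close>

lemma conj_commutator_subgroup:
  assumes "A \<lhd> G" "a \<in> A" "h \<in> carrier G"
  shows "h \<otimes> a \<otimes> inv h \<otimes> inv a \<in> commutator_subgroup G A (carrier G)"
proof -
  have aG: "a \<in> carrier G" using assms normal_subset by blast
  have ia: "inv a \<in> A" by (rule subgroup.m_inv_closed[OF normal_imp_subgroup[OF assms(1)] assms(2)])
  have "commutator G (inv a) (inv h) \<in> commutator_subgroup G A (carrier G)"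
    unfolding commutator_subgroup_def using ia assms by (blast intro: generate.incl inv_closed)
  then have "inv (commutator G (inv a) (inv h)) \<in> commutator_subgroup G A (carrier G)"
    by (rule subgroup.m_inv_closed[OF normal_imp_subgroup[OF commutator_subgroup_normal[OF assms(1) normal_carrier]]])
  moreover have "inv (commutator G (inv a) (inv h)) = h \<otimes> a \<otimes> inv h \<otimes> inv a"
    using aG assms(3) by (simp add: commutator_def inv_mult_group m_assoc)
  ultimately show ?thesis by simp
qed

lemma gamma4_gamma3: "lower_central G 4 \<subseteq> lower_central G 3"
  unfolding gamma4_eq by (rule commutator_subgroup_le[OF lower_central_normal])

text \<open>Modulo the fourth term the third one is central, so \<open>x \<mapsto> [x, a]\<close> is a homomorphism into
  an abelian group and kills commutators.\<close>

lemma gamma2_commute: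
  assumes a: "a \<in> \<gamma>2" and b: "b \<in> \<gamma>2"
  shows "a \<otimes> b \<otimes> inv a \<otimes> inv b \<in> lower_central G 4"
proof -
  let ?Y = "lower_central G 4"
  have nY: "?Y \<lhd> G" by (rule lower_central_normal)
  have sY: "subgroup ?Y G" by (rule normal_imp_subgroup[OF nY])
  interpret Q: group "G Mod ?Y" by (rule normal.factorgroup_is_group[OF nY])
  have hom: "(\<lambda>x. ?Y #> x) \<in> hom G (G Mod ?Y)" by (rule normal.r_coset_hom_Mod[OF nY])
  interpret h: group_hom G "G Mod ?Y" "\<lambda>x. ?Y #> x"
    by (simp add: group_hom_def group_hom_axioms_def hom is_group Q.is_group)
  have bG: "b \<in> carrier G" using b gamma2_carrier by blast
  have carr: "\<exists>y\<in>carrier G. q = ?Y #> y" if "q \<in> carrier (G Mod ?Y)" for q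
    using that by (auto simp: carrier_FactGroup)
  have cent: "q \<otimes>\<^bsub>G Mod ?Y\<^esub> (?Y #> z) = (?Y #> z) \<otimes>\<^bsub>G Mod ?Y\<^esub> q"
    if z: "z \<in> lower_central G 3" and q: "q \<in> carrier (G Mod ?Y)" for z q
  proof -
    obtain y where y: "y \<in> carrier G" "q = ?Y #> y" using carr q by blast
    have zG: "z \<in> carrier G" using z gamma3_le gamma2_carrier by blast
    have "y \<otimes> z \<otimes> inv y \<otimes> inv z \<in> ?Y"
      unfolding gamma4_eq by (rule conj_commutator_subgroup[OF lower_central_normal z y(1)])
    then have "?Y #> (y \<otimes> z) = ?Y #> (z \<otimes> y)"
      using coset_eq_iff[OF sY, of "y \<otimes> z" "z \<otimes> y"] y zG by (simp add: inv_mult_group m_assoc)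
    then show ?thesis using y zG by (simp add: h.hom_mult del: mult_FactGroup)
  qed
  have key: "?Y #> (commutator G x y \<otimes> b) = ?Y #> (b \<otimes> commutator G x y)"
    if x: "x \<in> carrier G" and y: "y \<in> carrier G" for x y
  proof -
    let ?z = "\<lambda>x. x \<otimes> b \<otimes> inv x \<otimes> inv b"
    have z: "?z x \<in> lower_central G 3" if "x \<in> carrier G" for x
      unfolding gamma3_eq by (rule conj_commutator_subgroup[OF lower_central_normal b that])
    have e: "(?Y #> x) \<otimes>\<^bsub>G Mod ?Y\<^esub> (?Y #> b)
      = (?Y #> ?z x) \<otimes>\<^bsub>G Mod ?Y\<^esub> ((?Y #> b) \<otimes>\<^bsub>G Mod ?Y\<^esub> (?Y #> x))" if x: "x \<in> carrier G" for x
    proof -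
      have "?z x \<otimes> (b \<otimes> x) = x \<otimes> b" using x bG by (simp add: m_assoc)
      then show ?thesis using x bG by (simp add: h.hom_mult[symmetric] del: mult_FactGroup h.hom_mult)
    qed
    have zc: "?Y #> ?z x \<in> carrier (G Mod ?Y)" if "x \<in> carrier G" for x
      using that bG by (intro h.hom_closed) auto
    have "commutator (G Mod ?Y) (?Y #> x) (?Y #> y) \<otimes>\<^bsub>G Mod ?Y\<^esub> (?Y #> b)
      = (?Y #> b) \<otimes>\<^bsub>G Mod ?Y\<^esub> commutator (G Mod ?Y) (?Y #> x) (?Y #> y)"
      by (rule Q.commutator_commute_central[OF _ _ _ e[OF x] zc[OF x] cent[OF z[OF x]]
            e[OF y] zc[OF y] cent[OF z[OF y]]]) (use x y bG h.hom_closed in auto)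
    moreover have "commutator (G Mod ?Y) (?Y #> x) (?Y #> y) = ?Y #> commutator G x y"
      using x y by (simp add: commutator_def h.hom_mult h.hom_inv del: mult_FactGroup)
    ultimately show ?thesis using x y bG by (simp add: h.hom_mult del: mult_FactGroup)
  qed
  \<comment> \<open>The preimage of the centraliser of the class of \<open>b\<close>. It contains
    all commutators by \<open>key\<close>, hence all of \<open>\<gamma>2\<close>.\<close>
  let ?C = "{x \<in> carrier G. ?Y #> (x \<otimes> b) = ?Y #> (b \<otimes> x)}"
  have C: "?C = {x \<in> carrier G. (?Y #> x) \<otimes>\<^bsub>G Mod ?Y\<^esub> (?Y #> b) = (?Y #> b) \<otimes>\<^bsub>G Mod ?Y\<^esub> (?Y #> x)}"
    using bG by (auto simp: h.hom_mult[symmetric] simp del: mult_FactGroup h.hom_mult)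
  have "subgroup ?C G"
  proof
    show "?C \<subseteq> carrier G" by auto
    show "\<one> \<in> ?C" using bG by simp
    fix x assume x: "x \<in> ?C"
    then have xG: "x \<in> carrier G" by simp
    have "(?Y #> x) \<otimes>\<^bsub>G Mod ?Y\<^esub> (?Y #> b) = (?Y #> b) \<otimes>\<^bsub>G Mod ?Y\<^esub> (?Y #> x)" using x unfolding C by simp
    then have "inv\<^bsub>G Mod ?Y\<^esub> (?Y #> x) \<otimes>\<^bsub>G Mod ?Y\<^esub> (?Y #> b) = (?Y #> b) \<otimes>\<^bsub>G Mod ?Y\<^esub> inv\<^bsub>G Mod ?Y\<^esub> (?Y #> x)"
      using h.hom_closed[OF xG] h.hom_closed[OF bG]
      by (metis Q.inv_closed Q.inv_solve_left Q.inv_solve_right Q.m_assoc Q.m_closed)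
    then show "inv x \<in> ?C" unfolding C using xG by (simp add: h.hom_inv del: mult_FactGroup)
    fix y assume y: "y \<in> ?C"
    then have yG: "y \<in> carrier G" by simp
    have "(?Y #> y) \<otimes>\<^bsub>G Mod ?Y\<^esub> (?Y #> b) = (?Y #> b) \<otimes>\<^bsub>G Mod ?Y\<^esub> (?Y #> y)" using y unfolding C by simp
    then have "(?Y #> x) \<otimes>\<^bsub>G Mod ?Y\<^esub> (?Y #> y) \<otimes>\<^bsub>G Mod ?Y\<^esub> (?Y #> b)
      = (?Y #> b) \<otimes>\<^bsub>G Mod ?Y\<^esub> ((?Y #> x) \<otimes>\<^bsub>G Mod ?Y\<^esub> (?Y #> y))"
      using h.hom_closed[OF xG] h.hom_closed[OF bG] h.hom_closed[OF yG] \<open>(?Y #> x) \<otimes>\<^bsub>G Mod ?Y\<^esub> (?Y #> b) = _\<close>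
      by (metis Q.m_assoc)
    then show "x \<otimes> y \<in> ?C" unfolding C using xG yG by (simp add: h.hom_mult del: mult_FactGroup)
  qed
  then have "\<gamma>2 \<subseteq> ?C"
    unfolding gamma2_eq commutator_subgroup_def using key by (intro generate_least) auto
  then have "?Y #> (a \<otimes> b) = ?Y #> (b \<otimes> a)" using a by blast
  moreover have "a \<in> carrier G" using a gamma2_carrier by blast
  ultimately show ?thesis
    using coset_eq_iff[OF sY, of "a \<otimes> b" "b \<otimes> a"] bG by (simp add: inv_mult_group m_assoc)
qed

end

section \<open>Linear functionals on group rings\<close>

text \<open>The target is written multiplicatively because the targets used are sections of the
  group. Stating additivity by a difference gives the value at 0 and at differences at once, and the
  kernel is \<open>add_closed\<close>.\<close>

locale add_functional = comm_group B for B :: "('c, 'n) monoid_scheme" (structure) +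
  fixes f :: "'r::ring_1 \<Rightarrow> 'c"
  assumes f_closed [simp]: "f x \<in> carrier B"
    and f_diff: "f (x - y) \<otimes> f y = f x"
begin

lemma f_zero: "f 0 = \<one>"
  using f_diff[of 0 0] by (simp add: l_cancel_one)

lemma f_diff_one: "f (x - y) = \<one> \<longleftrightarrow> f x = f y"
  using f_diff[of x y] by (metis f_closed l_one r_cancel_one')

lemma f_diff_inv: "f (x - y) = f x \<otimes> inv (f y)"
  using f_diff[of x y] f_closed by (metis inv_solve_right)

lemma ker_closed: "add_closed {x. f x = \<one>}"
  unfolding add_closed_def by (simp add: f_zero f_diff_one)

lemma f_eqm: "(\<And>k. k \<in> K0 \<Longrightarrow> f k = \<one>) \<Longrightarrow> eqm K0 x y \<Longrightarrow> f x = f y"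
  unfolding eqm_def using f_diff_one by blast

end

lemma add_closed_vimage:
  assumes "add_closed S"
  shows "add_closed {x. c * x \<in> S}" "add_closed {x. x * c \<in> S}"
  using add_closedD(1,2)[OF assms]
  by (simp_all add: add_closed_def left_diff_distrib right_diff_distrib)

section \<open>Functionals bounding the subgroups \<open>Dk\<close> from above\<close>

context mod_group_ring
begin

text \<open>Prescribing values on the basis is possible as soon as the target has exponent p: the
  integer coefficients serve as exponents and are determined only modulo p.\<close>

lemma functional_ex:
  assumes B: "comm_group B" and pw: "\<forall>b\<in>carrier B. b [^]\<^bsub>B\<^esub> p = \<one>\<^bsub>B\<^esub>"
    and \<psi>: "\<forall>g\<in>carrier G. \<psi> g \<in> carrier B"
  obtains f :: "'r \<Rightarrow> 'c" where "add_functional B f" "\<And>k. k \<in> K0 \<Longrightarrow> f k = \<one>\<^bsub>B\<^esub>"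
    "\<And>g. g \<in> carrier G \<Longrightarrow> f (e g) = \<psi> g"
proof -
  interpret B: comm_group B by (rule B)
  define f where "f x = finprod B (\<lambda>g. \<psi> g [^]\<^bsub>B\<^esub> cf x g) (carrier G)" for x
  have pc: "(\<lambda>g. \<psi> g [^]\<^bsub>B\<^esub> (n g :: int)) \<in> carrier G \<rightarrow> carrier B" for n
    using \<psi> by auto
  have pm: "\<psi> g [^]\<^bsub>B\<^esub> i = \<psi> g [^]\<^bsub>B\<^esub> j" if "g \<in> carrier G" "int p dvd i - j" for g i j
    using B.int_pow_cong_mod pw \<psi> that by blast
  have "add_functional B f"
  proof (unfold_locales)
    show "f x \<in> carrier B" for x unfolding f_def by (intro B.finprod_closed pc)
    fix x y
    have "f (x - y) \<otimes>\<^bsub>B\<^esub> f y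
      = finprod B (\<lambda>g. \<psi> g [^]\<^bsub>B\<^esub> cf (x - y) g \<otimes>\<^bsub>B\<^esub> \<psi> g [^]\<^bsub>B\<^esub> cf y g) (carrier G)"
      unfolding f_def by (intro B.finprod_multf[symmetric] pc)
    also have "\<dots> = f x"
      unfolding f_def
    proof (intro B.finprod_cong' refl pc)
      fix g assume g: "g \<in> carrier G"
      have "\<psi> g [^]\<^bsub>B\<^esub> (cf (x - y) g + cf y g) = \<psi> g [^]\<^bsub>B\<^esub> cf x g"
        using cf_diff[OF g, of x y] by (intro pm g) (simp add: algebra_simps)
      then show "\<psi> g [^]\<^bsub>B\<^esub> cf (x - y) g \<otimes>\<^bsub>B\<^esub> \<psi> g [^]\<^bsub>B\<^esub> cf y g = \<psi> g [^]\<^bsub>B\<^esub> cf x g"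
        using B.int_pow_mult[OF \<psi>[rule_format, OF g]] by simp
    qed
    finally show "f (x - y) \<otimes>\<^bsub>B\<^esub> f y = f x" .
  qed
  moreover have "f k = \<one>\<^bsub>B\<^esub>" if "k \<in> K0" for k
    unfolding f_def
  proof (rule B.finprod_one_eqI)
    fix g assume g: "g \<in> carrier G"
    show "\<psi> g [^]\<^bsub>B\<^esub> cf k g = \<one>\<^bsub>B\<^esub>"
      using pm[OF g, of "cf k g" 0] cf_K0[OF that g] by simp
  qed
  moreover have "f (e h) = \<psi> h" if h: "h \<in> carrier G" for h
  proof -
    have "f (e h) = finprod B (\<lambda>g. if g = h then \<psi> g else \<one>\<^bsub>B\<^esub>) (carrier G)"
      unfolding f_def
    proof (intro B.finprod_cong' refl)
      show "(\<lambda>g. if g = h then \<psi> g else \<one>\<^bsub>B\<^esub>) \<in> carrier G \<rightarrow> carrier B" using \<psi> by auto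
      fix g assume g: "g \<in> carrier G"
      show "\<psi> g [^]\<^bsub>B\<^esub> cf (e h) g = (if g = h then \<psi> g else \<one>\<^bsub>B\<^esub>)"
        using pm[OF g cf_e[OF h g]] \<psi>[rule_format, OF g] by auto
    qed
    also have "\<dots> = \<psi> h" using \<psi> by (intro B.finprod_singleton_swap h fin) auto
    finally show ?thesis .
  qed
  ultimately show ?thesis using that by blast
qed

lemma I_ind:
  assumes "add_closed S" "K0 \<subseteq> S" "\<And>g. g \<in> carrier G \<Longrightarrow> e g - 1 \<in> S" "x \<in> I"
  shows "x \<in> S"
proof -
  have "aspan (K0 \<union> {e g - 1 | g. g \<in> carrier G}) \<subseteq> S"
    by (rule aspan_least[OF assms(1)]) (use assms(2,3) in blast)
  then show ?thesis using I_span[OF assms(4)] by blast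
qed

lemma AA_ind:
  assumes "add_closed S" "K0 \<subseteq> S"
    "\<And>m y. m \<in> \<gamma>2 \<Longrightarrow> y \<in> carrier G \<Longrightarrow> (e m - 1) * e y \<in> S" "a \<in> AA"
  shows "a \<in> S"
proof -
  have "aspan AAgen \<subseteq> S"
    unfolding AAgen_def by (rule aspan_least[OF assms(1)]) (use assms(2,3) in blast)
  then show ?thesis using AA_span assms(4) by blast
qed

text \<open>A representative of the coset of \<gamma>2, depending on the coset only and taken from
  \<open>P\<close> whenever the coset meets \<open>P\<close>; with \<open>P\<close> empty there is
  no preference. The preference is what \<open>span_meet_AA\<close> rests on.\<close>

definition rep :: "'a set \<Rightarrow> 'a \<Rightarrow> 'a" where
  "rep P g = (SOME x. x \<in> \<gamma>2 #> g \<and> ((\<gamma>2 #> g) \<inter> P \<noteq> {} \<longrightarrow> x \<in> P))"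

lemma gamma2_sub: "subgroup \<gamma>2 G"
  by (rule normal_imp_subgroup[OF lower_central_normal])

lemma rep:
  assumes "g \<in> carrier G"
  shows "rep P g \<in> \<gamma>2 #> g" "g \<in> P \<Longrightarrow> rep P g \<in> P"
proof -
  have g: "g \<in> \<gamma>2 #> g" by (rule rcos_self[OF assms gamma2_sub])
  then have "\<exists>x. x \<in> \<gamma>2 #> g \<and> ((\<gamma>2 #> g) \<inter> P \<noteq> {} \<longrightarrow> x \<in> P)" by blast
  then have "rep P g \<in> \<gamma>2 #> g \<and> ((\<gamma>2 #> g) \<inter> P \<noteq> {} \<longrightarrow> rep P g \<in> P)"
    unfolding rep_def by (rule someI_ex)
  then show "rep P g \<in> \<gamma>2 #> g" "g \<in> P \<Longrightarrow> rep P g \<in> P" using g by blast+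
qed

lemma rep_carrier: "g \<in> carrier G \<Longrightarrow> rep P g \<in> carrier G"
  using rep(1)[of g P] r_coset_subset_G[OF gamma2_carrier, of g] by blast

lemma rep_gamma2: "g \<in> carrier G \<Longrightarrow> g \<otimes> inv (rep P g) \<in> \<gamma>2"
  using coset_eq_iff[OF gamma2_sub, of g "rep P g"] rep_carrier
    repr_independence[OF rep(1) _ gamma2_sub, of g P] by blast

lemma rep_mult:
  assumes "m \<in> \<gamma>2" "g \<in> carrier G"
  shows "rep P (m \<otimes> g) = rep P g"
proof -
  have m: "m \<in> carrier G" using assms gamma2_carrier by blast
  have "\<gamma>2 #> (m \<otimes> g) = \<gamma>2 #> g"
    using coset_eq_iff[OF gamma2_sub, of "m \<otimes> g" g] m assms by (simp add: m_assoc)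
  then show ?thesis unfolding rep_def by simp
qed

text \<open>The functional sends \<open>e g\<close> to the class of g t^-1, where t represents the
  coset of g. As m y and y have the same representative, their values differ by the class of
  \<open>m\<close>: the functional reads \<open>m\<close> off (m - 1) y.\<close>

lemma lower_functional:
  assumes Y: "Y \<lhd> G" "Y \<subseteq> \<gamma>2" and pw: "\<forall>m\<in>\<gamma>2. m [^] p \<in> Y"
    and cm: "\<forall>a\<in>\<gamma>2. \<forall>b\<in>\<gamma>2. a \<otimes> b \<otimes> inv a \<otimes> inv b \<in> Y"
  defines "B \<equiv> G\<lparr>carrier := \<gamma>2\<rparr> Mod Y"
  obtains f :: "'r \<Rightarrow> 'a set" where "add_functional B f" "\<And>k. k \<in> K0 \<Longrightarrow> f k = \<one>\<^bsub>B\<^esub>"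
    "\<And>m y. m \<in> \<gamma>2 \<Longrightarrow> y \<in> carrier G \<Longrightarrow> f ((e m - 1) * e y) = Y #> m"
proof -
  note q = elementary_quotient[OF gamma2_sub normal_imp_subgroup[OF Y(1)] Y(2) pw cm, folded B_def]
  let ?\<psi> = "\<lambda>g. Y #> (g \<otimes> inv (rep {} g))"
  have \<psi>: "\<forall>g\<in>carrier G. ?\<psi> g \<in> carrier B"
    by (intro ballI q(3) rep_gamma2)
  obtain f :: "'r \<Rightarrow> 'a set" where f: "add_functional B f" "\<And>k. k \<in> K0 \<Longrightarrow> f k = \<one>\<^bsub>B\<^esub>"
    "\<And>g. g \<in> carrier G \<Longrightarrow> f (e g) = ?\<psi> g"
    using functional_ex[OF q(1,2) \<psi>] by metis
  interpret f: add_functional B f by (rule f(1))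
  have "f ((e m - 1) * e y) = Y #> m" if m: "m \<in> \<gamma>2" and y: "y \<in> carrier G" for m y
  proof -
    have mG: "m \<in> carrier G" using m gamma2_carrier by blast
    have "eqm K0 (e (m \<otimes> y) - e y) (e m * e y - e y)"
      by (intro K0_diff e_mult K0_refl mG y)
    then have "eqm K0 (e (m \<otimes> y) - e y) ((e m - 1) * e y)" by (simp add: algebra_simps)
    then have "f ((e m - 1) * e y) = f (e (m \<otimes> y) - e y)" using f.f_eqm[OF f(2)] by simp
    also have "\<dots> = f (e (m \<otimes> y)) \<otimes>\<^bsub>B\<^esub> inv\<^bsub>B\<^esub> (f (e y))" by (rule f.f_diff_inv)
    also have "f (e (m \<otimes> y)) = Y #> (m \<otimes> (y \<otimes> inv (rep {} y)))"
      using f(3)[of "m \<otimes> y"] mG y rep_mult[OF m y] rep_carrier[OF y] by (simp add: m_assoc)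
    also have "\<dots> = (Y #> m) \<otimes>\<^bsub>B\<^esub> f (e y)"
      using q(4)[OF m rep_gamma2[OF y]] f(3)[OF y] by simp
    also have "(Y #> m) \<otimes>\<^bsub>B\<^esub> f (e y) \<otimes>\<^bsub>B\<^esub> inv\<^bsub>B\<^esub> (f (e y)) = Y #> m"
      using q(3)[OF m] by (simp add: f.m_assoc)
    finally show ?thesis .
  qed
  then show ?thesis using that f by blast
qed

text \<open>The functional of \<open>lower_functional\<close> takes the value \<open>Y #> m\<close>
  at m - 1, so it is enough that it kills the ideal in question. It kills AI for every such
  \<open>Y\<close>, it kills IA when \<gamma>3 is inside \<open>Y\<close>, and I^2A when \<gamma>4
  is.\<close>

lemma Dk_le:
  assumes Y: "Y \<lhd> G" "Y \<subseteq> \<gamma>2" and pw: "\<forall>m\<in>\<gamma>2. m [^] p \<in> Y"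
    and cm: "\<forall>a\<in>\<gamma>2. \<forall>b\<in>\<gamma>2. a \<otimes> b \<otimes> inv a \<otimes> inv b \<in> Y"
  shows "lower_central G 3 \<subseteq> Y \<Longrightarrow> Dk LL \<inter> \<gamma>2 \<subseteq> Y"
    and "lower_central G 4 \<subseteq> Y \<Longrightarrow> Dk KK \<inter> \<gamma>2 \<subseteq> Y"
proof -
  define B where "B = G\<lparr>carrier := \<gamma>2\<rparr> Mod Y"
  have sY: "subgroup Y G" by (rule normal_imp_subgroup[OF Y(1)])
  note q = elementary_quotient[OF gamma2_sub sY Y(2) pw cm, folded B_def]
  obtain f :: "'r \<Rightarrow> 'a set" where f: "add_functional B f" "\<And>k. k \<in> K0 \<Longrightarrow> f k = \<one>\<^bsub>B\<^esub>"
    "\<And>m y. m \<in> \<gamma>2 \<Longrightarrow> y \<in> carrier G \<Longrightarrow> f ((e m - 1) * e y) = Y #> m"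
    using lower_functional[OF Y pw cm, folded B_def] by metis
  interpret f: add_functional B f by (rule f(1))
  let ?ker = "{x. f x = \<one>\<^bsub>B\<^esub>}"
  have K0k: "K0 \<subseteq> ?ker" using f(2) by blast
  have AIk: "a * x \<in> ?ker" if "a \<in> AA" "x \<in> I" for a x
  proof -
    have gen: "(e m - 1) * e y * x \<in> ?ker" if m: "m \<in> \<gamma>2" and y: "y \<in> carrier G" for m y
    proof -
      have "x \<in> {x. (e m - 1) * e y * x \<in> ?ker}"
      proof (rule I_ind[OF add_closed_vimage(1)[OF f.ker_closed] _ _ \<open>x \<in> I\<close>])
        show "K0 \<subseteq> {x. (e m - 1) * e y * x \<in> ?ker}" using K0k K0D(6) by blast
        fix g assume g: "g \<in> carrier G"
        have "f ((e m - 1) * e y * e g) = Y #> m"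
          using f.f_eqm[OF f(2) AAgen_right[OF g y, of "e m - 1"]] f(3)[OF m, of "y \<otimes> g"] y g by simp
        then have "f ((e m - 1) * e y * e g - (e m - 1) * e y) = \<one>\<^bsub>B\<^esub>"
          using f.f_diff_one f(3)[OF m y] by simp
        then show "e g - 1 \<in> {x. (e m - 1) * e y * x \<in> ?ker}" by (simp add: right_diff_distrib)
      qed
      then show ?thesis by simp
    qed
    have "a \<in> {a. a * x \<in> ?ker}"
      by (rule AA_ind[OF add_closed_vimage(2)[OF f.ker_closed] _ _ \<open>a \<in> AA\<close>])
        (use K0k K0D(7) gen in blast)+
    then show ?thesis by simp
  qed
  have left: "f (e g * ((e m - 1) * e y)) = Y #> (g \<otimes> m \<otimes> inv g)"
    if "g \<in> carrier G" "m \<in> \<gamma>2" "y \<in> carrier G" for g m y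
    using f.f_eqm[OF f(2) AAgen_left[OF that]] f(3)[OF gamma2_conj[OF that(1,2)], of "g \<otimes> y"] that by simp
  \<comment> \<open>Left multiplication by g - 1 acts on the values of the functional as m \<mapsto>
    g m g^-1 m^-1.\<close>
  have left1: "f ((e g - 1) * ((e m - 1) * e y)) = Y #> (g \<otimes> m \<otimes> inv g \<otimes> inv m)"
    if g: "g \<in> carrier G" and m: "m \<in> \<gamma>2" and y: "y \<in> carrier G" for g m y
  proof -
    have im: "inv m \<in> \<gamma>2" by (rule subgroup.m_inv_closed[OF gamma2_sub m])
    have mG: "m \<in> carrier G" using m gamma2_carrier by blast
    have "(Y #> m) \<otimes>\<^bsub>B\<^esub> (Y #> inv m) = \<one>\<^bsub>B\<^esub>"
      using q(4)[OF m im] q(5)[of \<one>] mG subgroup.one_closed[OF gamma2_sub] subgroup.one_closed[OF sY] by simp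
    then have inv: "inv\<^bsub>B\<^esub> (Y #> m) = Y #> inv m" using q(3)[OF m] q(3)[OF im]
      by (metis f.inv_equality f.m_comm)
    have "f ((e g - 1) * ((e m - 1) * e y)) = f (e g * ((e m - 1) * e y) - (e m - 1) * e y)"
      by (simp add: left_diff_distrib)
    also have "\<dots> = (Y #> (g \<otimes> m \<otimes> inv g)) \<otimes>\<^bsub>B\<^esub> (Y #> inv m)"
      unfolding f.f_diff_inv left[OF that] f(3)[OF m y] inv ..
    also have "\<dots> = Y #> (g \<otimes> m \<otimes> inv g \<otimes> inv m)"
      by (rule q(4)[OF gamma2_conj[OF g m] im, symmetric])
    finally show ?thesis .
  qed
  have final: "Dk J \<inter> \<gamma>2 \<subseteq> Y" if J: "J \<subseteq> ?ker" for J
  proof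
    fix m assume m: "m \<in> Dk J \<inter> \<gamma>2"
    then have m2: "m \<in> \<gamma>2" by blast
    have "e m - 1 \<in> ?ker" using m J by (auto simp: Dk_iff)
    moreover have "eqm K0 ((e m - 1) * e \<one>) ((e m - 1) * 1)" by (intro K0_mult K0_refl e_one)
    ultimately have "f ((e m - 1) * e \<one>) = \<one>\<^bsub>B\<^esub>" using f.f_eqm[OF f(2)] by simp
    then have "Y #> m = \<one>\<^bsub>B\<^esub>" using f(3)[OF m2 one_closed] by simp
    then show "m \<in> Y" using q(5)[OF m2] by simp
  qed
  { assume Y3: "lower_central G 3 \<subseteq> Y"
    have IAk: "x * a \<in> ?ker" if "x \<in> I" "a \<in> AA" for x a
    proof -
      have gen: "x * ((e m - 1) * e y) \<in> ?ker" if m: "m \<in> \<gamma>2" and y: "y \<in> carrier G" for m y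
      proof -
        have "x \<in> {x. x * ((e m - 1) * e y) \<in> ?ker}"
        proof (rule I_ind[OF add_closed_vimage(2)[OF f.ker_closed] _ _ \<open>x \<in> I\<close>])
          show "K0 \<subseteq> {x. x * ((e m - 1) * e y) \<in> ?ker}" using K0k K0D(7) by blast
          fix g assume g: "g \<in> carrier G"
          have "g \<otimes> m \<otimes> inv g \<otimes> inv m \<in> lower_central G 3"
            unfolding gamma3_eq by (rule conj_commutator_subgroup[OF lower_central_normal m g])
          then have "g \<otimes> m \<otimes> inv g \<otimes> inv m \<in> Y" using Y3 by blast
          then show "e g - 1 \<in> {x. x * ((e m - 1) * e y) \<in> ?ker}"
            using left1[OF g m y] q(5) Y(2) by auto
        qed
        then show ?thesis by simp
      qed
      have "a \<in> {a. x * a \<in> ?ker}"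
        by (rule AA_ind[OF add_closed_vimage(1)[OF f.ker_closed] _ _ \<open>a \<in> AA\<close>])
          (use K0k K0D(6) gen in blast)+
      then show ?thesis by simp
    qed
    have "LL \<subseteq> ?ker" unfolding LL_def
      by (rule aspan_least[OF f.ker_closed]) (use K0k AIk IAk in blast)
    then show "Dk LL \<inter> \<gamma>2 \<subseteq> Y" by (rule final) }
  { assume Y4: "lower_central G 4 \<subseteq> Y"
    \<comment> \<open>Applying h - 1 replaces m by m1 = n m with n in \<gamma>3. The value of g - 1
      on the difference compares g m1 g^-1 m1^-1 = (u n)(k n^-1) with k = g m g^-1 m^-1, and these
      agree modulo \<open>Y\<close> because u = g n g^-1 n^-1 lies in \<gamma>4 and the quotient is
      abelian.\<close>
    have key: "f ((e g - 1) * ((e h - 1) * ((e m - 1) * e y))) = \<one>\<^bsub>B\<^esub>"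
      if g: "g \<in> carrier G" and h: "h \<in> carrier G" and m: "m \<in> \<gamma>2" and y: "y \<in> carrier G" for g h m y
    proof -
      define m1 where "m1 = h \<otimes> m \<otimes> inv h"
      define n where "n = m1 \<otimes> inv m"
      have m1: "m1 \<in> \<gamma>2" unfolding m1_def by (rule gamma2_conj[OF h m])
      have n3: "n \<in> lower_central G 3"
        unfolding n_def m1_def gamma3_eq by (rule conj_commutator_subgroup[OF lower_central_normal m h])
      have n: "n \<in> \<gamma>2" using n3 gamma3_le by blast
      have G: "m \<in> carrier G" "m1 \<in> carrier G" "n \<in> carrier G"
        using m m1 n gamma2_carrier by blast+
      have m1n: "m1 = n \<otimes> m" unfolding n_def using G by (simp add: m_assoc)
      have hy: "h \<otimes> y \<in> carrier G" using h y by simp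
      let ?k = "g \<otimes> m \<otimes> inv g \<otimes> inv m" and ?u = "g \<otimes> n \<otimes> inv g \<otimes> inv n"
      have im: "inv m \<in> \<gamma>2" "inv n \<in> \<gamma>2" by (intro subgroup.m_inv_closed[OF gamma2_sub] m n)+
      have k: "?k \<in> \<gamma>2" by (intro subgroup.m_closed[OF gamma2_sub] gamma2_conj g m im)
      have u4: "?u \<in> lower_central G 4"
        unfolding gamma4_eq by (rule conj_commutator_subgroup[OF lower_central_normal n3 g])
      then have u: "?u \<in> Y" "?u \<in> \<gamma>2" using Y4 Y(2) by blast+
      have c1: "eqm K0 ((e h - 1) * ((e m - 1) * e y)) ((e m1 - 1) * e (h \<otimes> y) - (e m - 1) * e y)"
        using K0_diff[OF AAgen_left[OF h m y] K0_refl[of "(e m - 1) * e y"]]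
        by (simp add: left_diff_distrib m1_def)
      have "f ((e g - 1) * ((e h - 1) * ((e m - 1) * e y)))
          = f ((e g - 1) * ((e m1 - 1) * e (h \<otimes> y) - (e m - 1) * e y))"
        by (rule f.f_eqm[OF f(2) K0_mult[OF K0_refl c1]])
      also have "\<dots> = f ((e g - 1) * ((e m1 - 1) * e (h \<otimes> y)) - (e g - 1) * ((e m - 1) * e y))"
        by (simp add: right_diff_distrib)
      also have "\<dots> = \<one>\<^bsub>B\<^esub>"
        unfolding f.f_diff_one left1[OF g m1 hy] left1[OF g m y]
      proof -
        have "g \<otimes> m1 \<otimes> inv g \<otimes> inv m1 = (?u \<otimes> n) \<otimes> (?k \<otimes> inv n)"
          unfolding m1n using G g by (simp add: m_assoc inv_mult_group)
        moreover have "Y #> ((?u \<otimes> n) \<otimes> (?k \<otimes> inv n)) = Y #> ?k"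
        proof -
          have un: "?u \<otimes> n \<in> \<gamma>2" "?k \<otimes> inv n \<in> \<gamma>2"
            by (intro subgroup.m_closed[OF gamma2_sub] u k n im)+
          have "Y #> ((?u \<otimes> n) \<otimes> (?k \<otimes> inv n))
            = ((Y #> ?u) \<otimes>\<^bsub>B\<^esub> (Y #> n)) \<otimes>\<^bsub>B\<^esub> ((Y #> ?k) \<otimes>\<^bsub>B\<^esub> (Y #> inv n))"
            unfolding q(4)[OF un] q(4)[OF u(2) n] q(4)[OF k im(2)] ..
          also have "Y #> ?u = \<one>\<^bsub>B\<^esub>" using q(5)[OF u(2)] u(1) by simp
          also have "(\<one>\<^bsub>B\<^esub> \<otimes>\<^bsub>B\<^esub> (Y #> n)) \<otimes>\<^bsub>B\<^esub> ((Y #> ?k) \<otimes>\<^bsub>B\<^esub> (Y #> inv n))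
             = (Y #> ?k) \<otimes>\<^bsub>B\<^esub> ((Y #> n) \<otimes>\<^bsub>B\<^esub> (Y #> inv n))"
            using q(3)[OF n] q(3)[OF k] q(3)[OF im(2)] by (simp add: f.m_ac)
          also have "(Y #> n) \<otimes>\<^bsub>B\<^esub> (Y #> inv n) = \<one>\<^bsub>B\<^esub>"
            unfolding q(4)[OF n im(2), symmetric]
            using q(5)[of \<one>] G subgroup.one_closed[OF gamma2_sub] subgroup.one_closed[OF sY] by simp
          finally show ?thesis using q(3)[OF k] by simp
        qed
        ultimately show "Y #> (g \<otimes> m1 \<otimes> inv g \<otimes> inv m1) = Y #> ?k" by simp
      qed
      finally show ?thesis .
    qed
    have IIAk: "x * y * a \<in> ?ker" if x: "x \<in> I" and y: "y \<in> I" and a: "a \<in> AA" for x y a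
    proof -
      have g1: "x * (y * ((e m - 1) * e z)) \<in> ?ker" if m: "m \<in> \<gamma>2" and z: "z \<in> carrier G" for m z
      proof -
        let ?c = "(e m - 1) * e z"
        have g2: "(e g - 1) * (y * ?c) \<in> ?ker" if g: "g \<in> carrier G" for g
        proof -
          have "y \<in> {y. y * ?c \<in> {x. (e g - 1) * x \<in> ?ker}}"
          proof (rule I_ind[OF add_closed_vimage(2)[OF add_closed_vimage(1)[OF f.ker_closed]] _ _ y])
            show "K0 \<subseteq> {y. y * ?c \<in> {x. (e g - 1) * x \<in> ?ker}}" using K0k K0D(6,7) by blast
            show "e h - 1 \<in> {y. y * ?c \<in> {x. (e g - 1) * x \<in> ?ker}}" if "h \<in> carrier G" for h
              using key[OF g that m z] by simp
          qed
          then show ?thesis by simp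
        qed
        have "x \<in> {x. x * (y * ?c) \<in> ?ker}"
          by (rule I_ind[OF add_closed_vimage(2)[OF f.ker_closed] _ _ x])
            (use K0k K0D(7) g2 in blast)+
        then show ?thesis by simp
      qed
      have "a \<in> {a. x * y * a \<in> ?ker}"
      proof (rule AA_ind[OF add_closed_vimage(1)[OF f.ker_closed] _ _ a])
        show "K0 \<subseteq> {a. x * y * a \<in> ?ker}" using K0k K0D(6) by blast
      qed (use g1 in \<open>simp add: mult.assoc\<close>)
      then show ?thesis by simp
    qed
    have "KK \<subseteq> ?ker" unfolding KK_def
      by (rule aspan_least[OF f.ker_closed]) (use K0k AIk IIAk in blast)
    then show "Dk KK \<inter> \<gamma>2 \<subseteq> Y" by (rule final) }
qed

end

section \<open>Dimension subgroups\<close>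

context mod_group_ring
begin

text \<open>The linear extension of \<open>b\<close> from the basis to the whole ring. The integer
  coefficients are fixed only modulo p, so it is additive only up to \<open>K0\<close>.\<close>

definition Psi :: "('a \<Rightarrow> 'r) \<Rightarrow> 'r \<Rightarrow> 'r" where
  "Psi b x = (\<Sum>g\<in>carrier G. of_int (cf x g) * b g)"

lemma Psi_diff: "eqm K0 (Psi b (x - y)) (Psi b x - Psi b y)"
proof -
  have "Psi b (x - y) - (Psi b x - Psi b y)
    = (\<Sum>g\<in>carrier G. of_int (cf (x - y) g - (cf x g - cf y g)) * b g)"
    unfolding Psi_def by (simp add: sum_subtractf left_diff_distrib)
  also have "\<dots> \<in> K0"
    by (intro add_closed_sum K0D(1,7) p_dvd_K0 cf_diff)
  finally show ?thesis by (simp add: eqm_def)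
qed

lemma Psi_K0: "x \<in> K0 \<Longrightarrow> Psi b x \<in> K0"
  unfolding Psi_def by (intro add_closed_sum K0D(1,7) p_dvd_K0 cf_K0)

lemma Psi_e:
  assumes h: "h \<in> carrier G"
  shows "eqm K0 (Psi b (e h)) (b h)"
proof -
  have "b h = (\<Sum>g\<in>carrier G. if g = h then b g else 0)"
    using fin h by (simp add: sum.delta)
  also have "\<dots> = (\<Sum>g\<in>carrier G. of_int (if g = h then 1 else 0) * b g)"
    by (intro sum.cong) auto
  finally have "Psi b (e h) - b h = (\<Sum>g\<in>carrier G. of_int (cf (e h) g - (if g = h then 1 else 0)) * b g)"
    unfolding Psi_def by (simp add: sum_subtractf left_diff_distrib)
  also have "\<dots> \<in> K0"
    by (intro add_closed_sum K0D(1,7) p_dvd_K0 cf_e h)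
  finally show ?thesis by (simp add: eqm_def)
qed

lemma Psi_eqm:
  assumes "eqm K0 x y" shows "eqm K0 (Psi b x) (Psi b y)"
proof -
  have "Psi b (x - y) \<in> K0" using assms by (intro Psi_K0) (simp add: eqm_def)
  then have "Psi b x - Psi b y \<in> K0" by (rule eqm_mem[OF K0D(1) K0_sym[OF Psi_diff]])
  then show ?thesis by (simp add: eqm_def)
qed

lemma Psi_ker: "add_closed {x. Psi b x \<in> K0}"
  unfolding add_closed_def
proof (intro conjI ballI)
  show "0 \<in> {x. Psi b x \<in> K0}" using Psi_K0[OF K0D(2)] by simp
  fix x y assume "x \<in> {x. Psi b x \<in> K0}" "y \<in> {x. Psi b x \<in> K0}"
  then have "Psi b x - Psi b y \<in> K0" using K0D(3) by blast
  then show "x - y \<in> {x. Psi b x \<in> K0}" using eqm_mem[OF K0D(1) Psi_diff] by blast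
qed

lemma AAgen_eqm:
  "m \<in> carrier G \<Longrightarrow> y \<in> carrier G \<Longrightarrow> eqm K0 ((e m - 1) * e y) (e (m \<otimes> y) - e y)"
  using K0_diff[OF K0_sym[OF e_mult] K0_refl[of "e y"]] by (simp add: left_diff_distrib)

text \<open>Replacing each group element by its representative factors through the group algebra of
  G/\<gamma>2, so the kernel \<open>AA\<close> of that projection is annihilated.\<close>

lemma Psi_rep_AA:
  assumes "a \<in> AA"
  shows "Psi (\<lambda>g. e (rep P g)) a \<in> K0"
proof -
  let ?b = "\<lambda>g. e (rep P g)"
  have "a \<in> {x. Psi ?b x \<in> K0}"
  proof (rule AA_ind[OF Psi_ker _ _ assms])
    show "K0 \<subseteq> {x. Psi ?b x \<in> K0}" using Psi_K0 by blast
    fix m y assume m: "m \<in> \<gamma>2" and y: "y \<in> carrier G"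
    have mG: "m \<in> carrier G" using m gamma2_carrier by blast
    have "eqm K0 (Psi ?b ((e m - 1) * e y)) (Psi ?b (e (m \<otimes> y) - e y))"
      by (intro Psi_eqm AAgen_eqm mG y)
    moreover have "eqm K0 (Psi ?b (e (m \<otimes> y) - e y)) (Psi ?b (e (m \<otimes> y)) - Psi ?b (e y))"
      by (rule Psi_diff)
    moreover have "eqm K0 (Psi ?b (e (m \<otimes> y)) - Psi ?b (e y)) (?b (m \<otimes> y) - ?b y)"
      by (intro K0_diff Psi_e m_closed mG y)
    ultimately have "eqm K0 (Psi ?b ((e m - 1) * e y)) (?b (m \<otimes> y) - ?b y)"
      using K0_trans by blast
    then show "(e m - 1) * e y \<in> {x. Psi ?b x \<in> K0}"
      by (simp add: rep_mult[OF m y] eqm_def)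
  qed
  then show ?thesis by simp
qed

lemma Dk_AA: "Dk AA = \<gamma>2"
proof
  show "Dk AA \<subseteq> \<gamma>2"
  proof
    fix g assume g: "g \<in> Dk AA"
    then have gG: "g \<in> carrier G" by (simp add: Dk_iff)
    have "eqm AA (e g) (e \<one>)"
      using eqm_trans[OF AD(1)] eqm_sym[OF AD(1) eqm_mono[OF K0_AA e_one]] g by (auto simp: Dk_def)
    then have "Psi (\<lambda>g. e (rep {} g)) (e g - e \<one>) \<in> K0" by (intro Psi_rep_AA) (simp add: eqm_def)
    then have "eqm K0 (Psi (\<lambda>g. e (rep {} g)) (e g)) (Psi (\<lambda>g. e (rep {} g)) (e \<one>))"
      using eqm_mem[OF K0D(1) K0_sym[OF Psi_diff]] by (simp add: eqm_def)
    then have "eqm K0 (e (rep {} g)) (e (rep {} \<one>))"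
      using K0_trans[OF K0_sym[OF Psi_e[OF gG]] K0_trans[OF _ Psi_e[OF one_closed]]] by blast
    then have "rep {} g = rep {} \<one>"
      by (rule e_inj) (intro rep_carrier gG one_closed)+
    then have "\<gamma>2 #> g = \<gamma>2 #> \<one>"
      using repr_independence[OF rep(1)[OF gG] gG gamma2_sub]
        repr_independence[OF rep(1)[OF one_closed] one_closed gamma2_sub] by metis
    then show "g \<in> \<gamma>2" using coset_eq_iff[OF gamma2_sub gG one_closed] gG by simp
  qed
qed (rule gamma2_Dk)

lemma gamma2_pow_gN:
  assumes "m \<in> \<gamma>2"
  shows "m [^] p \<in> gN3" "m [^] p \<in> gN4"
proof -
  have "m [^] p \<in> power_subgroup G p \<gamma>2"
    unfolding power_subgroup_def using assms by (blast intro: generate.incl)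
  then show "m [^] p \<in> gN3" "m [^] p \<in> gN4"
    using set_mult_upper(1)[OF normal_imp_subgroup normal_imp_subgroup, OF power_subgroup_normal lower_central_normal,
        OF lower_central_normal] by blast+
qed

lemma gamma_le_gN: "lower_central G 3 \<subseteq> gN3" "lower_central G 4 \<subseteq> gN4"
  using set_mult_upper(2)[OF normal_imp_subgroup normal_imp_subgroup, OF power_subgroup_normal lower_central_normal,
        OF lower_central_normal] by blast+

lemma Dk_LL: "Dk LL = gN3"
proof
  have "Dk LL \<inter> \<gamma>2 \<subseteq> gN3"
    by (rule Dk_le(1)[OF gN_normal(1) gN_le(1)])
      (use gamma2_pow_gN gamma2_commute gamma4_gamma3 gamma_le_gN in blast)+
  moreover have "Dk LL \<subseteq> Dk AA" using LL_AA by (auto simp: Dk_iff)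
  ultimately show "Dk LL \<subseteq> gN3" using Dk_AA by blast
qed (rule gN3_Dk)

lemma Dk_KK: "Dk KK = gN4"
proof
  have "Dk KK \<inter> \<gamma>2 \<subseteq> gN4"
    by (rule Dk_le(2)[OF gN_normal(2) gN_le(2)])
      (use gamma2_pow_gN gamma2_commute gamma_le_gN in blast)+
  moreover have "Dk KK \<subseteq> Dk AA" using KK_AA by (auto simp: Dk_iff)
  ultimately show "Dk KK \<subseteq> gN4" using Dk_AA by blast
qed (rule gN4_Dk)

text \<open>For a subgroup \<open>P\<close> this is the square of the augmentation ideal of FP,
  enlarged by \<open>K0\<close>.\<close>

definition sq_span :: "'a set \<Rightarrow> 'r set" where
  "sq_span P = aspan (K0 \<union> {(e x - 1) * (e y - 1) | x y. x \<in> P \<and> y \<in> P})"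

text \<open>The map x \<mapsto> N x on \<open>P\<close>, continued trivially outside
  \<open>P\<close>, extends to a functional that kills (x - 1)(y - 1) = xy - x - y + 1. It is
  applied to the whole group with \<open>Phi\<close>, and in \<open>lift\<close> to the group
  generated by the p^s-th powers with \<open>pow_lift\<close>.\<close>

lemma sq_span_dim:
  assumes P: "subgroup P G" and N: "subgroup N G" "N \<subseteq> P"
    and pw: "\<forall>x\<in>P. x [^] p \<in> N"
    and cm: "\<forall>x\<in>P. \<forall>y\<in>P. x \<otimes> y \<otimes> inv x \<otimes> inv y \<in> N"
    and ab: "a \<in> P" "b \<in> P" and sq: "e a - e b \<in> sq_span P"
  shows "a \<otimes> inv b \<in> N"
proof -
  define B where "B = G\<lparr>carrier := P\<rparr> Mod N"
  note q = elementary_quotient[OF P N pw cm, folded B_def]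
  have PG: "x \<in> carrier G" if "x \<in> P" for x using that P subgroup.subset by blast
  let ?\<psi> = "\<lambda>g. if g \<in> P then N #> g else \<one>\<^bsub>B\<^esub>"
  have \<psi>: "\<forall>g\<in>carrier G. ?\<psi> g \<in> carrier B"
    using q(3) monoid.one_closed[OF group.is_monoid[OF comm_group.axioms(2)[OF q(1)]]] by auto
  obtain f :: "'r \<Rightarrow> 'a set" where f: "add_functional B f" "\<And>k. k \<in> K0 \<Longrightarrow> f k = \<one>\<^bsub>B\<^esub>"
    "\<And>g. g \<in> carrier G \<Longrightarrow> f (e g) = ?\<psi> g"
    using functional_ex[OF q(1,2) \<psi>] by metis
  interpret f: add_functional B f by (rule f(1))
  have fe: "f (e x) = N #> x" if "x \<in> P" for x using f(3)[OF PG[OF that]] that by simp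
  have f1: "f 1 = \<one>\<^bsub>B\<^esub>"
    using f.f_eqm[OF f(2) e_one] fe[OF subgroup.one_closed[OF P]] q(5)[OF subgroup.one_closed[OF P]]
      subgroup.one_closed[OF N(1)] by simp
  have "sq_span P \<subseteq> {x. f x = \<one>\<^bsub>B\<^esub>}"
    unfolding sq_span_def
  proof (intro aspan_least f.ker_closed Un_least subsetI)
    fix z assume "z \<in> {(e x - 1) * (e y - 1) | x y. x \<in> P \<and> y \<in> P}"
    then obtain x y where z: "z = (e x - 1) * (e y - 1)" "x \<in> P" "y \<in> P" by blast
    have "eqm K0 (e x * e y - e x - (e y - 1)) (e (x \<otimes> y) - e x - (e y - 1))"
      by (intro K0_diff K0_refl K0_sym[OF e_mult] PG z)
    then have "f z = f (e (x \<otimes> y) - e x - (e y - 1))"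
      using f.f_eqm[OF f(2)] by (simp add: z algebra_simps)
    also have "\<dots> = \<one>\<^bsub>B\<^esub>"
      unfolding f.f_diff_inv fe[OF z(2)] fe[OF z(3)] fe[OF subgroup.m_closed[OF P z(2,3)]] f1 q(4)[OF z(2,3)]
    proof -
      have "(N #> x) \<otimes>\<^bsub>B\<^esub> (N #> y) \<otimes>\<^bsub>B\<^esub> inv\<^bsub>B\<^esub> (N #> x) = N #> y"
        using q(3)[OF z(2)] q(3)[OF z(3)] f.m_comm[of "N #> x" "N #> y"] by (simp add: f.m_assoc)
      then show "(N #> x) \<otimes>\<^bsub>B\<^esub> (N #> y) \<otimes>\<^bsub>B\<^esub> inv\<^bsub>B\<^esub> (N #> x) \<otimes>\<^bsub>B\<^esub> inv\<^bsub>B\<^esub> ((N #> y) \<otimes>\<^bsub>B\<^esub> inv\<^bsub>B\<^esub> \<one>\<^bsub>B\<^esub>) = \<one>\<^bsub>B\<^esub>"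
        using q(3)[OF z(3)] by simp
    qed
    finally show "z \<in> {x. f x = \<one>\<^bsub>B\<^esub>}" by simp
  qed (use f(2) in simp)
  then have "f (e a) = f (e b)" using sq f.f_diff_one by blast
  then have "N #> a = N #> b" using fe ab by simp
  then show ?thesis using coset_eq_iff[OF N(1)] PG ab by blast
qed

lemma JJ_span: "JJ \<subseteq> sq_span (carrier G)"
  unfolding JJ_def
proof (intro aspan_least Un_least subsetI)
  show "add_closed (sq_span (carrier G))" unfolding sq_span_def by simp
  have K0s: "K0 \<subseteq> sq_span (carrier G)" unfolding sq_span_def by (auto intro: aspan.incl)
  then show "z \<in> sq_span (carrier G)" if "z \<in> K0" for z using that by blast
  have ac: "add_closed (sq_span (carrier G))" unfolding sq_span_def by simp
  fix z assume "z \<in> {x * y | x y. x \<in> I \<and> y \<in> I}"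
  then obtain x y where z: "z = x * y" "x \<in> I" "y \<in> I" by blast
  have 1: "(e g - 1) * y \<in> sq_span (carrier G)" if g: "g \<in> carrier G" for g
  proof -
    have "y \<in> {y. (e g - 1) * y \<in> sq_span (carrier G)}"
    proof (rule I_ind[OF add_closed_vimage(1)[OF ac] _ _ z(3)])
      show "K0 \<subseteq> {y. (e g - 1) * y \<in> sq_span (carrier G)}" using K0s K0D(6) by blast
      show "e h - 1 \<in> {y. (e g - 1) * y \<in> sq_span (carrier G)}" if "h \<in> carrier G" for h
        using that g unfolding sq_span_def by (auto intro!: aspan.incl)
    qed
    then show ?thesis by simp
  qed
  have "x \<in> {x. x * y \<in> sq_span (carrier G)}"
    by (rule I_ind[OF add_closed_vimage(2)[OF ac] _ _ z(2)]) (use K0s K0D(7) 1 in blast)+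
  then show "z \<in> sq_span (carrier G)" using z by simp
qed

text \<open>The usual description of the Frattini subgroup of a p-group; the inclusion that links it
  to the definition by maximal subgroups is \<open>frattini_Phi\<close>.\<close>

definition Phi :: "'a set" where
  "Phi = power_subgroup G p (carrier G) <#> \<gamma>2"

lemma Phi_normal: "Phi \<lhd> G"
  unfolding Phi_def by (intro set_mult_normal power_subgroup_normal normal_carrier lower_central_normal)

lemma Phi_upper: "power_subgroup G p (carrier G) \<subseteq> Phi" "\<gamma>2 \<subseteq> Phi"
  unfolding Phi_def
  by (intro set_mult_upper normal_imp_subgroup power_subgroup_normal normal_carrier lower_central_normal)+

lemma conj_comm_gamma2: "x \<in> carrier G \<Longrightarrow> y \<in> carrier G \<Longrightarrow> x \<otimes> y \<otimes> inv x \<otimes> inv y \<in> \<gamma>2"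
  using conj_commutator_subgroup[OF normal_carrier, of y x] by (simp add: gamma2_eq)

lemma pow_p_Phi: "x \<in> carrier G \<Longrightarrow> x [^] p \<in> Phi"
  using Phi_upper(1) unfolding power_subgroup_def by (blast intro: generate.incl)

lemma e_JJ_Phi:
  assumes "a \<in> carrier G" "b \<in> carrier G" "eqm JJ (e a) (e b)"
  shows "a \<otimes> inv b \<in> Phi"
proof (rule sq_span_dim[OF _ normal_imp_subgroup[OF Phi_normal] normal_subset[OF Phi_normal]])
  show "subgroup (carrier G) G" by (rule subgroup_self)
  show "e a - e b \<in> sq_span (carrier G)" using assms(3) JJ_span by (auto simp: eqm_def)
qed (use assms pow_p_Phi conj_comm_gamma2 Phi_upper(2) in blast)+

lemma e_JJ_mult:
  assumes "g \<in> carrier G" "h \<in> carrier G"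
  shows "eqm JJ (e (g \<otimes> h) - 1) ((e g - 1) + (e h - 1))"
proof -
  have "eqm JJ (e (g \<otimes> h)) (e g * e h)" by (rule eqm_mono[OF K0_JJ e_mult[OF assms]])
  moreover have "eqm JJ (e g * e h) ((e g - 1) + (e h - 1) + 1)"
  proof -
    have "e g * e h - ((e g - 1) + (e h - 1) + 1) = (e g - 1) * (e h - 1)"
      by (simp add: left_diff_distrib right_diff_distrib)
    then show ?thesis using II_JJ[OF e_I[OF assms(1)] e_I[OF assms(2)]] by (simp add: eqm_def)
  qed
  ultimately have "eqm JJ (e (g \<otimes> h)) ((e g - 1) + (e h - 1) + 1)" by (rule eqm_trans[OF JD(1)])
  from eqm_diff[OF JD(1) this eqm_refl[OF JD(1), of 1]] show ?thesis by (simp only: add_diff_cancel_right')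
qed

lemma e_JJ_inv:
  assumes "g \<in> carrier G"
  shows "eqm JJ (e (inv g) - 1) (- (e g - 1))"
proof -
  have "eqm JJ (e \<one> - 1) ((e g - 1) + (e (inv g) - 1))" using e_JJ_mult[OF assms, of "inv g"] assms by simp
  moreover have "e \<one> - 1 \<in> JJ" using e_one K0_JJ by (auto simp: eqm_def)
  ultimately have "(e g - 1) + (e (inv g) - 1) \<in> JJ" using eqm_mem[OF JD(1) eqm_sym[OF JD(1)]] by blast
  then show ?thesis by (simp add: eqm_def algebra_simps)
qed

lemma e_JJ_diff:
  assumes "g \<in> carrier G" "h \<in> carrier G"
  shows "eqm JJ ((e g - 1) - (e h - 1)) (e (g \<otimes> inv h) - 1)"
proof -
  have "eqm JJ ((e g - 1) + (e (inv h) - 1)) ((e g - 1) + - (e h - 1))"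
    by (intro eqm_add JD(1) eqm_refl e_JJ_inv assms)
  from eqm_trans[OF JD(1) e_JJ_mult this] have "eqm JJ (e (g \<otimes> inv h) - 1) ((e g - 1) + - (e h - 1))"
    using assms by simp
  from eqm_sym[OF JD(1) this] show ?thesis by simp
qed

lemma group_span_JJ:
  assumes S: "subgroup S G"
  shows "add_closed {x. \<exists>c\<in>S. eqm JJ x (e c - 1)}"
  unfolding add_closed_def
proof (safe intro!: CollectI)
  have "eqm JJ 0 (e \<one> - 1)"
    using eqm_sym[OF JD(1) eqm_mono[OF K0_JJ e_one]] by (simp add: eqm_def)
  then show "\<exists>c\<in>S. eqm JJ 0 (e c - 1)" using subgroup.one_closed[OF S] by blast
  fix x y c d assume c: "c \<in> S" "eqm JJ x (e c - 1)" and d: "d \<in> S" "eqm JJ y (e d - 1)"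
  then have cd: "c \<in> carrier G" "d \<in> carrier G" using subgroup.subset[OF S] by blast+
  have "eqm JJ (x - y) (e (c \<otimes> inv d) - 1)"
    by (rule eqm_trans[OF JD(1) eqm_diff[OF JD(1) c(2) d(2)] e_JJ_diff[OF cd]])
  moreover have "c \<otimes> inv d \<in> S"
    by (intro subgroup.m_closed[OF S] subgroup.m_inv_closed[OF S] c d)
  ultimately show "\<exists>c\<in>S. eqm JJ (x - y) (e c - 1)" by blast
qed

text \<open>Modulo \<open>JJ\<close> the element g - 1 depends additively on g, so the classes of
  this form are a subgroup containing generators of \<open>I\<close>. With \<open>e_JJ_Phi\<close>
  and \<open>Phi_Dk\<close> this identifies I/J with G modulo \<open>Phi\<close>.\<close>

lemma I_rep:
  assumes "x \<in> I"
  shows "\<exists>g\<in>carrier G. eqm JJ x (e g - 1)"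
proof -
  let ?T = "{x. \<exists>c\<in>carrier G. eqm JJ x (e c - 1)}"
  note ac = group_span_JJ[OF subgroup_self]
  have "x \<in> ?T"
  proof (rule I_ind[OF ac _ _ assms])
    show "K0 \<subseteq> ?T"
    proof
      fix k assume "k \<in> K0"
      then have "eqm JJ k 0" using K0_JJ by (auto simp: eqm_def)
      moreover obtain c where "c \<in> carrier G" "eqm JJ 0 (e c - 1)" using add_closedD(1)[OF ac] by blast
      ultimately show "k \<in> ?T" using eqm_trans[OF JD(1)] by blast
    qed
    show "e g - 1 \<in> ?T" if "g \<in> carrier G" for g using that eqm_refl[OF JD(1)] by blast
  qed
  then show ?thesis by simp
qed

text \<open>Replacing every x in \<open>P\<close> by its representative t, which lies in
  \<open>P\<close> too, changes \<open>w\<close> by a combination of elements (r - 1) t with r = x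
  t^-1 in P \<inter> \<gamma>2. The result of the replacement is zero modulo \<open>K0\<close>
  because \<open>w\<close> lies in \<open>AA\<close>.\<close>

lemma span_meet_AA:
  assumes P: "subgroup P G" and w: "w \<in> aspan (K0 \<union> e ` P)" "w \<in> AA"
  shows "w \<in> aspan (K0 \<union> {(e r - 1) * e t | r t. r \<in> P \<inter> \<gamma>2 \<and> t \<in> P})"
proof -
  let ?T = "aspan (K0 \<union> {(e r - 1) * e t | r t. r \<in> P \<inter> \<gamma>2 \<and> t \<in> P})"
  let ?b = "\<lambda>g. e (rep P g)"
  have K0T: "K0 \<subseteq> ?T" by (auto intro: aspan.incl)
  have PG: "x \<in> carrier G" if "x \<in> P" for x using that P subgroup.subset by blast
  have "aspan (K0 \<union> e ` P) \<subseteq> {w. w - Psi ?b w \<in> ?T}"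
  proof (rule aspan_least)
    show "add_closed {w. w - Psi ?b w \<in> ?T}" unfolding add_closed_def
    proof (safe intro!: CollectI)
      have "0 - Psi ?b 0 \<in> K0" using K0D(3)[OF K0D(2) Psi_K0[OF K0D(2)]] .
      then show "0 - Psi ?b 0 \<in> ?T" using K0T by blast
      fix x y assume "x - Psi ?b x \<in> ?T" "y - Psi ?b y \<in> ?T"
      then have "(x - Psi ?b x) - (y - Psi ?b y) \<in> ?T" by (rule aspan.diff)
      moreover have "eqm ?T (x - y - Psi ?b (x - y)) (x - y - (Psi ?b x - Psi ?b y))"
        by (intro eqm_mono[OF K0T] K0_diff K0_refl Psi_diff)
      ultimately show "x - y - Psi ?b (x - y) \<in> ?T"
        by (elim eqm_mem[OF add_closed_aspan]) (simp add: algebra_simps)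
    qed
    show "K0 \<union> e ` P \<subseteq> {w. w - Psi ?b w \<in> ?T}"
    proof safe
      fix k assume "k \<in> K0"
      then have "k - Psi ?b k \<in> K0" using K0D(3) Psi_K0 by blast
      then show "k - Psi ?b k \<in> ?T" using K0T by blast
    next
      fix x assume x: "x \<in> P"
      then have xG: "x \<in> carrier G" by (rule PG)
      let ?t = "rep P x"
      let ?r = "x \<otimes> inv ?t"
      have t: "?t \<in> P" "?t \<in> carrier G" using rep(2)[OF xG x] PG by blast+
      have r: "?r \<in> P \<inter> \<gamma>2"
        using subgroup.m_closed[OF P x subgroup.m_inv_closed[OF P t(1)]] rep_gamma2[OF xG] by blast
      have "?r \<otimes> ?t = x" using xG t by (simp add: m_assoc)
      then have "eqm K0 (e x - e ?t) ((e ?r - 1) * e ?t)"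
        using K0_sym[OF AAgen_eqm[of ?r ?t]] xG t by simp
      moreover have "eqm K0 (e x - Psi ?b (e x)) (e x - e ?t)"
        by (intro K0_diff K0_refl Psi_e xG)
      ultimately have "eqm K0 (e x - Psi ?b (e x)) ((e ?r - 1) * e ?t)" by (rule K0_trans[rotated])
      moreover have "(e ?r - 1) * e ?t \<in> ?T" using r t(1) by (blast intro: aspan.incl)
      ultimately show "e x - Psi ?b (e x) \<in> ?T"
        using eqm_mem[OF add_closed_aspan eqm_mono[OF K0T]] by blast
    qed
  qed
  then have "w - Psi ?b w \<in> ?T" using w(1) by blast
  moreover have "Psi ?b w \<in> ?T" using Psi_rep_AA[OF w(2)] K0T by blast
  ultimately have "w - Psi ?b w + Psi ?b w \<in> ?T" by (rule add_closedD(4)[OF add_closed_aspan])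
  then show ?thesis by simp
qed

text \<open>The non-central conjugacy classes have length divisible by \<open>p\<close>, so their sums vanish modulo \<open>J\<close>.\<close>

lemma class_sum_JJ:
  assumes "finite E" "E \<subseteq> carrier G - group_center G"
    and "\<And>g h. g \<in> E \<Longrightarrow> h \<in> carrier G \<Longrightarrow> h \<otimes> g \<otimes> inv h \<in> E"
    and F: "\<And>g h. g \<in> carrier G \<Longrightarrow> h \<in> carrier G \<Longrightarrow> eqm JJ (F (h \<otimes> g \<otimes> inv h)) (F g)"
  shows "sum F E \<in> JJ"
  using assms(1-3)
proof (induction E rule: finite_psubset_induct)
  case (psubset E)
  let ?\<phi> = "\<lambda>g. \<lambda>h\<in>carrier G. g \<otimes> h \<otimes> inv g"
  interpret c: group_action G "carrier G" ?\<phi> by (rule action_by_conjugation)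
  show ?case
  proof (cases "E = {}")
    case False
    then obtain g where g: "g \<in> E" by blast
    then have gG: "g \<in> carrier G" and gZ: "g \<notin> group_center G" using psubset.prems(1) by auto
    let ?C = "orbit G ?\<phi> g"
    have C: "?C = {h \<otimes> g \<otimes> inv h | h. h \<in> carrier G}" using gG by (auto simp: orbit_def)
    have CE: "?C \<subseteq> E" unfolding C using psubset.prems(2) g by blast
    then have finC: "finite ?C" using psubset.hyps finite_subset by blast
    have gC: "g \<in> ?C" unfolding C using gG by (auto intro!: exI[of _ \<one>])
    obtain n where n: "order G = p ^ n" using ord by blast
    have "card ?C * card (stabilizer G ?\<phi> g) = p ^ n"
      using c.orbit_stabilizer_theorem[OF gG] n by simp
    then have "card ?C dvd p ^ n" by (intro dvdI[of _ _ "card (stabilizer G ?\<phi> g)"]) simp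
    then obtain i where i: "card ?C = p ^ i" using divides_primepow_nat[OF prime_p] by blast
    have "i \<noteq> 0"
    proof
      assume "i = 0"
      then have "card ?C = 1" using i by simp
      then obtain a where "?C = {a}" by (rule card_1_singletonE)
      then have "?C = {g}" using gC by simp
      then have "h \<otimes> g \<otimes> inv h = g" if "h \<in> carrier G" for h using that unfolding C by blast
      then have "h \<otimes> g = g \<otimes> h" if "h \<in> carrier G" for h
        using inv_solve_right[of g "h \<otimes> g" h] that gG m_closed by metis
      then show False using gZ gG by (auto simp: group_center_def)
    qed
    then have pC: "int p dvd int (card ?C)" unfolding i by (simp add: dvd_power)
    have "eqm JJ (sum F ?C) (sum (\<lambda>_. F g) ?C)"
    proof (intro eqm_sum JD(1))
      fix i assume "i \<in> ?C"
      then obtain h where "h \<in> carrier G" "i = h \<otimes> g \<otimes> inv h" unfolding C by blast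
      then show "eqm JJ (F i) (F g)" using F[OF gG] by simp
    qed
    moreover have "sum (\<lambda>_. F g) ?C \<in> JJ"
      using JD(7)[OF subsetD[OF K0_JJ p_dvd_K0[OF pC]]] by simp
    ultimately have 1: "sum F ?C \<in> JJ" by (rule eqm_mem[OF JD(1)])
    have 2: "sum F (E - ?C) \<in> JJ"
    proof (rule psubset.IH)
      show "E - ?C \<subset> E" using gC CE by blast
      show "E - ?C \<subseteq> carrier G - group_center G" using psubset.prems(1) by blast
      fix x h assume x: "x \<in> E - ?C" and h: "h \<in> carrier G"
      have xG: "x \<in> carrier G" using x psubset.prems(1) by blast
      have "h \<otimes> x \<otimes> inv h \<notin> ?C"
      proof
        assume "h \<otimes> x \<otimes> inv h \<in> ?C"
        then obtain k where k: "k \<in> carrier G" "h \<otimes> x \<otimes> inv h = k \<otimes> g \<otimes> inv k" unfolding C by blast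
        have "x = inv h \<otimes> (h \<otimes> x \<otimes> inv h) \<otimes> h" using xG h by (simp add: m_assoc)
        also have "\<dots> = (inv h \<otimes> k) \<otimes> g \<otimes> inv (inv h \<otimes> k)"
          unfolding k(2) using k(1) h gG by (simp add: m_assoc inv_mult_group)
        finally have "x \<in> ?C" unfolding C using k(1) h by blast
        then show False using x by blast
      qed
      then show "h \<otimes> x \<otimes> inv h \<in> E - ?C" using psubset.prems(2) x h by blast
    qed
    have "sum F E = sum F (E - ?C) + sum F ?C" by (rule sum.subset_diff[OF CE psubset.hyps])
    then show ?thesis using JD(5)[OF 2 1] by simp
  qed (simp add: JD)
qed

lemma group_center_subgroup: "subgroup (group_center G) G"
proof
  show "group_center G \<subseteq> carrier G" by (auto simp: group_center_def)
  show "\<one> \<in> group_center G" by (simp add: group_center_def)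
  fix x assume x: "x \<in> group_center G"
  then have xG: "x \<in> carrier G" and xc: "\<And>g. g \<in> carrier G \<Longrightarrow> x \<otimes> g = g \<otimes> x"
    by (auto simp: group_center_def)
  have "inv x \<otimes> g = g \<otimes> inv x" if g: "g \<in> carrier G" for g
    using xc[OF g] xG g by (metis inv_solve_left inv_solve_right inv_closed m_closed m_assoc)
  then show "inv x \<in> group_center G" using xG by (simp add: group_center_def)
  fix y assume y: "y \<in> group_center G"
  then have yG: "y \<in> carrier G" and yc: "\<And>g. g \<in> carrier G \<Longrightarrow> y \<otimes> g = g \<otimes> y"
    by (auto simp: group_center_def)
  have "x \<otimes> y \<otimes> g = g \<otimes> (x \<otimes> y)" if g: "g \<in> carrier G" for g
  proof -
    have "x \<otimes> y \<otimes> g = x \<otimes> g \<otimes> y" using xG yG g yc[OF g] by (simp add: m_assoc)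
    also have "\<dots> = g \<otimes> (x \<otimes> y)" using xG yG g xc[OF g] by (simp add: m_assoc)
    finally show ?thesis .
  qed
  then show "x \<otimes> y \<in> group_center G" using xG yG by (simp add: group_center_def)
qed

text \<open>The coefficients of a central element are constant on conjugacy classes modulo p. The
  contribution of the non-central classes lies in \<open>JJ\<close> by \<open>class_sum_JJ\<close>,
  and what is left is a combination of elements c - 1 with c in the centre, which modulo
  \<open>JJ\<close> is again of this form.\<close>

lemma UU_rep:
  assumes "x \<in> UU"
  shows "\<exists>c\<in>group_center G. eqm JJ x (e c - 1)"
proof -
  obtain z where z: "\<And>y. z * y - y * z \<in> K0" "x - z \<in> JJ" "z \<in> I" using assms by (auto simp: UU_def)
  let ?Z = "group_center G"
  have ZG: "?Z \<subseteq> carrier G" by (auto simp: group_center_def)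
  have cl: "int p dvd cf z g - cf z (inv h \<otimes> g \<otimes> h)" if h: "h \<in> carrier G" and g: "g \<in> carrier G" for g h
  proof (rule cf_unique[OF _ g])
    have bij: "bij_betw (\<lambda>g. h \<otimes> g \<otimes> inv h) (carrier G) (carrier G)"
      by (rule bij_betw_byWitness[of _ "\<lambda>g. inv h \<otimes> g \<otimes> h"]) (use h in \<open>auto simp: m_assoc\<close>)
    have 1: "eqm K0 z (e h * z * e (inv h))"
    proof -
      have "eqm K0 (z * e h) (e h * z)" using z(1)[of "e h"] by (simp add: eqm_def)
      then have a: "eqm K0 (z * e h * e (inv h)) (e h * z * e (inv h))" by (rule K0_mult[OF _ K0_refl])
      have "eqm K0 (z * (e h * e (inv h))) (z * 1)" by (intro K0_mult K0_refl e_inv h)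
      then have "eqm K0 (z * e h * e (inv h)) z" by (simp add: mult.assoc)
      from K0_trans[OF K0_sym[OF this] a] show ?thesis .
    qed
    have 2: "eqm K0 (e h * z * e (inv h)) (e h * (\<Sum>g\<in>carrier G. of_int (cf z g) * e g) * e (inv h))"
      by (intro K0_mult K0_refl cf)
    have 3: "e h * (\<Sum>g\<in>carrier G. of_int (cf z g) * e g) * e (inv h)
      = (\<Sum>g\<in>carrier G. of_int (cf z g) * (e h * e g * e (inv h)))"
      unfolding sum_distrib_left sum_distrib_right
    proof (intro sum.cong refl)
      fix g
      have "e h * (of_int (cf z g) * e g) = of_int (cf z g) * (e h * e g)"
        using mult_of_int_commute[of "cf z g" "e h"] by (metis mult.assoc)
      then show "e h * (of_int (cf z g) * e g) * e (inv h) = of_int (cf z g) * (e h * e g * e (inv h))"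
        by (simp add: mult.assoc)
    qed
    have 4: "eqm K0 (\<Sum>g\<in>carrier G. of_int (cf z g) * (e h * e g * e (inv h)))
      (\<Sum>g\<in>carrier G. of_int (cf z g) * e (h \<otimes> g \<otimes> inv h))"
    proof (intro eqm_sum K0D(1) K0_mult[OF K0_refl])
      fix g assume g: "g \<in> carrier G"
      have "eqm K0 (e h * e g * e (inv h)) (e (h \<otimes> g) * e (inv h))"
        by (intro K0_mult K0_refl K0_sym[OF e_mult] h g)
      moreover have "eqm K0 (e (h \<otimes> g) * e (inv h)) (e (h \<otimes> g \<otimes> inv h))"
        by (intro K0_sym[OF e_mult] m_closed inv_closed h g)
      ultimately show "eqm K0 (e h * e g * e (inv h)) (e (h \<otimes> g \<otimes> inv h))" by (rule K0_trans)
    qed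
    have 5: "(\<Sum>g\<in>carrier G. of_int (cf z g) * e (h \<otimes> g \<otimes> inv h))
        = (\<Sum>g\<in>carrier G. of_int (cf z (inv h \<otimes> g \<otimes> h)) * e g)"
      by (subst sum.reindex_bij_betw[OF bij, symmetric]) (use h in \<open>auto intro!: sum.cong simp: m_assoc\<close>)
    show "eqm K0 z (\<Sum>g\<in>carrier G. of_int (cf z (inv h \<otimes> g \<otimes> h)) * e g)"
      using K0_trans[OF K0_trans[OF 1 2[unfolded 3]] 4[unfolded 5]] .
  qed
  let ?F = "\<lambda>g. of_int (cf z g) * (e g - 1)"
  have conjJ: "eqm JJ (e (h \<otimes> g \<otimes> inv h) - 1) (e g - 1)" if h: "h \<in> carrier G" and g: "g \<in> carrier G" for g h
  proof -
    have "eqm JJ (e (h \<otimes> g \<otimes> inv h) - 1) ((e (h \<otimes> g) - 1) + (e (inv h) - 1))"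
      by (intro e_JJ_mult m_closed inv_closed h g)
    moreover have "eqm JJ ((e (h \<otimes> g) - 1) + (e (inv h) - 1)) (((e h - 1) + (e g - 1)) + (- (e h - 1)))"
      by (intro eqm_add JD(1) e_JJ_mult e_JJ_inv h g)
    ultimately have "eqm JJ (e (h \<otimes> g \<otimes> inv h) - 1) (((e h - 1) + (e g - 1)) + (- (e h - 1)))"
      by (rule eqm_trans[OF JD(1)])
    then show ?thesis by simp
  qed
  have Fc: "eqm JJ (?F (h \<otimes> g \<otimes> inv h)) (?F g)" if g: "g \<in> carrier G" and h: "h \<in> carrier G" for g h
  proof -
    have "int p dvd cf z (h \<otimes> g \<otimes> inv h) - cf z g"
      using cl[OF h, of "h \<otimes> g \<otimes> inv h"] g h by (simp add: m_assoc)
    then have "(of_int (cf z (h \<otimes> g \<otimes> inv h) - cf z g) :: 'r) \<in> JJ" using p_dvd_K0 K0_JJ by blast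
    then have "eqm JJ (of_int (cf z (h \<otimes> g \<otimes> inv h))) (of_int (cf z g))" by (simp add: eqm_def)
    then show ?thesis using conjJ[OF h g] by (rule eqm_mult[OF tideal_JJ])
  qed
  have E: "sum ?F (carrier G - ?Z) \<in> JJ"
  proof (rule class_sum_JJ[OF _ order_refl _ Fc])
    show "finite (carrier G - ?Z)" using fin by simp
    fix g h assume g: "g \<in> carrier G - ?Z" and h: "h \<in> carrier G"
    have gG: "g \<in> carrier G" using g by blast
    have "h \<otimes> g \<otimes> inv h \<notin> ?Z"
    proof
      assume "h \<otimes> g \<otimes> inv h \<in> ?Z"
      then have "h \<otimes> g \<otimes> inv h \<otimes> h = h \<otimes> (h \<otimes> g \<otimes> inv h)" using h by (simp add: group_center_def)
      then have "h \<otimes> g = h \<otimes> (h \<otimes> g \<otimes> inv h)" using h gG by (simp add: m_assoc)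
      from arg_cong[OF this, of "\<lambda>t. inv h \<otimes> t"] have "g = h \<otimes> g \<otimes> inv h"
        using h gG by simp
      then show False using \<open>h \<otimes> g \<otimes> inv h \<in> ?Z\<close> g by auto
    qed
    then show "h \<otimes> g \<otimes> inv h \<in> carrier G - ?Z" using gG h by simp
  qed
  let ?T = "{x. \<exists>c\<in>?Z. eqm JJ x (e c - 1)}"
  have ac: "add_closed ?T" by (rule group_span_JJ[OF group_center_subgroup])
  have "sum ?F ?Z \<in> ?T"
  proof (intro add_closed_sum add_closed_of_int ac)
    show "e c - 1 \<in> ?T" if "c \<in> ?Z" for c using that eqm_refl[OF JD(1)] by blast
  qed
  then obtain c where c: "c \<in> ?Z" "eqm JJ (sum ?F ?Z) (e c - 1)" by blast
  have "eqm JJ z (sum ?F (carrier G))"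
  proof -
    \<comment> \<open>Subtracting 1 from each basis element costs the sum of the coefficients. That
      sum is the augmentation of \<open>z\<close>, which p divides since \<open>z\<close> lies in
      \<open>I\<close>.\<close>
    have s: "sum ?F (carrier G) = (\<Sum>g\<in>carrier G. of_int (cf z g) * e g) - of_int (\<Sum>g\<in>carrier G. cf z g)"
      by (simp add: right_diff_distrib sum_subtractf)
    have a: "eqm K0 z (\<Sum>g\<in>carrier G. of_int (cf z g) * e g)" by (rule cf)
    have "sum ?F (carrier G) \<in> I" by (intro add_closed_sum ID(1,6) e_I)
    moreover have "(\<Sum>g\<in>carrier G. of_int (cf z g) * e g) \<in> I"
      by (rule eqm_mem[OF ID(1) eqm_mono[OF K0_I K0_sym[OF a]] z(3)])
    ultimately have "(\<Sum>g\<in>carrier G. of_int (cf z g) * e g) - sum ?F (carrier G) \<in> I" by (intro ID(3))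
    then have "of_int (\<Sum>g\<in>carrier G. cf z g) \<in> I" unfolding s by simp
    then have "of_int (\<Sum>g\<in>carrier G. cf z g) \<in> K0" using of_int_I_iff p_dvd_K0 by blast
    then have "eqm K0 (\<Sum>g\<in>carrier G. of_int (cf z g) * e g) (sum ?F (carrier G))"
      unfolding s by (simp add: eqm_def)
    from K0_trans[OF a this] show ?thesis by (rule eqm_mono[OF K0_JJ])
  qed
  moreover have "sum ?F (carrier G) = sum ?F (carrier G - ?Z) + sum ?F ?Z"
    by (rule sum.subset_diff[OF ZG fin])
  moreover have "eqm JJ (sum ?F (carrier G - ?Z) + sum ?F ?Z) (0 + (e c - 1))"
    using E by (intro eqm_add JD(1) c) (simp add: eqm_def)
  ultimately have "eqm JJ z (e c - 1)" using eqm_trans[OF JD(1)] by simp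
  moreover have "eqm JJ x z" using z(2) by (simp add: eqm_def)
  ultimately show ?thesis using eqm_trans[OF JD(1)] c(1) by blast
qed

end

section \<open>Lifting elements along the group algebra\<close>

context ideal_tower
begin

text \<open>\<open>LL\<close> is included because raising to the p-th power is additive on
  \<open>I\<close> modulo \<open>LL\<close> (\<open>frob_LL\<close>). Its intersection with
  \<open>AA\<close> expresses hypothesis (1) without a group basis, see
  \<open>pow_cond_iff\<close>.\<close>

definition pow_span :: "'r set" where
  "pow_span = aspan (LL \<union> {x ^ p | x. x \<in> I})"

lemma cent_eqm:
  assumes "cent z" "eqm KK z z'"
  shows "cent z'"
  unfolding cent_def
proof
  fix y
  have "eqm KK (z' * y) (z * y)" by (intro eqm_mult[OF tideal_KK] eqm_sym[OF KD(1) assms(2)] eqm_refl KD(1))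
  moreover have "eqm KK (z * y) (y * z)" using assms(1) by (simp add: cent_def)
  moreover have "eqm KK (y * z) (y * z')" by (intro eqm_mult[OF tideal_KK] assms(2) eqm_refl KD(1))
  ultimately show "eqm KK (z' * y) (y * z')" using eqm_trans[OF KD(1)] by blast
qed

lemma cent_one_plus:
  assumes "cent z"
  shows "cent (1 + z)"
  unfolding cent_def
proof
  fix y
  have "eqm KK (y + z * y) (y + y * z)"
    using assms by (intro eqm_add eqm_refl KD(1)) (simp add: cent_def)
  then show "eqm KK ((1 + z) * y) (y * (1 + z))" by (simp add: algebra_simps)
qed

lemma cent_mult:
  assumes z: "cent z" and w: "cent w"
  shows "cent (z * w)"
  unfolding cent_def
proof
  fix y
  have "eqm KK (z * (w * y)) (z * (y * w))"
    using w by (intro eqm_mult[OF tideal_KK eqm_refl[OF KD(1)]]) (simp add: cent_def)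
  moreover have "eqm KK (z * y * w) (y * z * w)"
    using z by (intro eqm_mult[OF tideal_KK _ eqm_refl[OF KD(1)]]) (simp add: cent_def)
  ultimately show "eqm KK (z * w * y) (y * (z * w))"
    using eqm_trans[OF KD(1)] by (simp add: mult.assoc)
qed

lemma UU_add_JJ:
  assumes "x \<in> UU" "eqm JJ y x"
  shows "y \<in> UU"
proof -
  obtain z where z: "\<forall>y. z * y - y * z \<in> K0" "x - z \<in> JJ" "z \<in> I" using assms(1) by (auto simp: UU_def)
  have "y - z \<in> JJ"
    using JD(5)[OF _ z(2), of "y - x"] assms(2) by (simp add: eqm_def)
  then show ?thesis using z unfolding UU_def by blast
qed

lemma p_pow_ge: "0 < s \<Longrightarrow> 3 \<le> p ^ s"
  using p_gt_2 self_le_power[of p s] by linarith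

text \<open>a^p b^p is (ab)^p modulo \<open>KK\<close>. Closure under products is required because
  the elements of the subgroup G^p are products of p-th powers, whereas this set is an additive
  span.\<close>

lemma pow_span_mult:
  assumes x: "x \<in> pow_span" and y: "y \<in> pow_span"
  shows "x * y \<in> pow_span"
proof -
  have LLp: "LL \<subseteq> pow_span" unfolding pow_span_def by (auto intro: aspan.incl)
  have ac: "add_closed pow_span" unfolding pow_span_def by simp
  have 1: "a ^ p * y \<in> pow_span" if a: "a \<in> I" for a
  proof -
    have "z \<in> LL \<union> {x ^ p | x. x \<in> I} \<Longrightarrow> a ^ p * z \<in> aspan (LL \<union> {x ^ p | x. x \<in> I})" for z
    proof (fold pow_span_def, elim UnE CollectE exE conjE)
      assume "z \<in> LL" then show "a ^ p * z \<in> pow_span" using LD(6) LLp by blast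
    next
      fix b assume b: "z = b ^ p" "b \<in> I"
      have "eqm LL (a ^ p * b ^ p) ((a * b) ^ p)"
        by (rule eqm_sym[OF LD(1) eqm_mono[OF KK_LL mult_pow_KK[OF a b(2)]]])
      moreover have "(a * b) ^ p \<in> pow_span"
        unfolding pow_span_def using ID(6)[OF b(2), of a] by (blast intro: aspan.incl)
      ultimately show "a ^ p * z \<in> pow_span" using eqm_mem[OF ac eqm_mono[OF LLp]] b(1) by blast
    qed
    then show ?thesis using aspan_absorb_left y unfolding pow_span_def by blast
  qed
  have "z \<in> LL \<union> {x ^ p | x. x \<in> I} \<Longrightarrow> z * y \<in> aspan (LL \<union> {x ^ p | x. x \<in> I})" for z
    using LD(7) LLp 1 unfolding pow_span_def[symmetric] by blast
  then show ?thesis using aspan_absorb_right x unfolding pow_span_def by blast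
qed

end

section \<open>Elements central modulo \<open>KK\<close>, and the lifting of powers\<close>

context mod_group_ring
begin

lemma e_inv_cong:
  assumes J: "tideal J" "K0 \<subseteq> J" and xy: "x \<in> carrier G" "y \<in> carrier G" and eq: "eqm J (e x) (e y)"
  shows "eqm J (e (inv x)) (e (inv y))"
proof -
  have N: "Dk J \<lhd> G" by (rule Dk_normal[OF J])
  have "x \<otimes> inv y \<in> Dk J" using e_eqm_iff[OF J xy] eq by simp
  then have "inv (x \<otimes> inv y) \<in> Dk J" by (rule subgroup.m_inv_closed[OF normal_imp_subgroup[OF N]])
  then have "inv y \<otimes> inv (x \<otimes> inv y) \<otimes> inv (inv y) \<in> Dk J"
    using normal_conj[OF N, of "inv y"] xy by simp
  then have "inv x \<otimes> inv (inv y) \<in> Dk J" using xy by (simp add: inv_mult_group m_assoc)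
  then show ?thesis using e_eqm_iff[OF J, of "inv x" "inv y"] xy by simp
qed

lemma cent_inv:
  assumes k: "k \<in> carrier G" and c: "cent (e k)"
  shows "cent (e (inv k))"
  unfolding cent_def
proof
  fix y
  let ?i = "e (inv k)"
  have a: "eqm KK (?i * e k) 1" "eqm KK (e k * ?i) 1" using e_inv[OF k] eqm_mono[OF K0_KK] by blast+
  have "eqm KK (y * e k) (e k * y)" using c KK_sym by (simp add: cent_def)
  then have 1: "eqm KK (?i * (y * e k) * ?i) (?i * (e k * y) * ?i)"
    by (intro KK_mult[OF KK_mult[OF KK_refl] KK_refl])
  have "eqm KK (?i * y * (e k * ?i)) (?i * y * 1)" by (rule KK_mult[OF KK_refl a(2)])
  then have 2: "eqm KK (?i * (y * e k) * ?i) (?i * y)" by (simp add: mult.assoc)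
  have "eqm KK ((?i * e k) * (y * ?i)) (1 * (y * ?i))" by (rule KK_mult[OF a(1) KK_refl])
  then have 3: "eqm KK (?i * (e k * y) * ?i) (y * ?i)" by (simp add: mult.assoc)
  show "eqm KK (?i * y) (y * ?i)" by (rule KK_trans[OF KK_sym[OF 2] KK_trans[OF 1 3]])
qed

text \<open>Contains the centre (\<open>center_Zk\<close>) and, because p \<ge> 3, all p-th powers
  (\<open>pow_Zk\<close>). A factor from this subgroup can be pulled out of a power modulo
  \<open>KK\<close> (\<open>Zk_mult_pow\<close>), which permits corrections of an element whose
  effect on its power is under control.\<close>

definition Zk :: "'a set" where
  "Zk = {k \<in> carrier G. cent (e k)}"

lemma Zk_subgroup: "subgroup Zk G"
proof
  show "Zk \<subseteq> carrier G" by (auto simp: Zk_def)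
  have "cent 1" by (simp add: cent_def KK_refl)
  then show "\<one> \<in> Zk"
    using cent_eqm[OF _ KK_sym[OF eqm_mono[OF K0_KK e_one]]] by (simp add: Zk_def)
  show "inv x \<in> Zk" if "x \<in> Zk" for x using that cent_inv by (simp add: Zk_def)
  show "x \<otimes> y \<in> Zk" if "x \<in> Zk" "y \<in> Zk" for x y
    using that cent_eqm[OF cent_mult KK_sym[OF eqm_mono[OF K0_KK e_mult]]] by (simp add: Zk_def)
qed

lemma center_comm:
  assumes c: "c \<in> group_center G"
  shows "eqm K0 (e c * y) (y * e c)"
proof -
  have cG: "c \<in> carrier G" using c by (simp add: group_center_def)
  have "y \<in> {y. e c * y - y * e c \<in> K0}"
  proof (rule lin_ind)
    show "add_closed {y. e c * y - y * e c \<in> K0}"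
      unfolding add_closed_def
    proof (safe intro!: CollectI)
      fix x y assume "e c * x - x * e c \<in> K0" "e c * y - y * e c \<in> K0"
      from K0D(3)[OF this] show "e c * (x - y) - (x - y) * e c \<in> K0" by (simp add: algebra_simps)
    qed (simp add: K0D)
    show "K0 \<subseteq> {y. e c * y - y * e c \<in> K0}" using K0D(3)[OF K0D(6) K0D(7)] by blast
    fix g assume g: "g \<in> carrier G"
    have "c \<otimes> g = g \<otimes> c" using c g by (simp add: group_center_def)
    then have "eqm K0 (e c * e g) (e g * e c)"
      using K0_trans[OF K0_sym[OF e_mult[OF cG g]]] e_mult[OF g cG] by simp
    then show "e g \<in> {y. e c * y - y * e c \<in> K0}" by (simp add: eqm_def)
  qed
  then show ?thesis by (simp add: eqm_def)
qed

lemma center_Zk: "group_center G \<subseteq> Zk"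
  using eqm_mono[OF K0_KK center_comm] by (auto simp: Zk_def cent_def group_center_def)

lemma pow_Zk:
  assumes x: "x \<in> carrier G" and s: "0 < s"
  shows "x [^] (p ^ s) \<in> Zk"
proof -
  have "cent (1 + (e x - 1) ^ (p ^ s))" by (intro cent_one_plus cent_pow_I e_I x p_pow_ge s)
  moreover have "eqm K0 (1 + (e x - 1) ^ (p ^ s)) (e (x [^] (p ^ s)))"
    using K0_sym[OF e_pow_p[OF x, of s]] by (simp add: eqm_def algebra_simps)
  ultimately have "cent (e (x [^] (p ^ s)))" using cent_eqm eqm_mono[OF K0_KK] by blast
  then show ?thesis using x by (simp add: Zk_def)
qed

lemma Zk_mult_pow:
  assumes k: "k \<in> Zk" and y: "y \<in> carrier G"
  shows "eqm KK (e ((k \<otimes> y) [^] (n::nat))) (e (k [^] n) * e (y [^] n))"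
proof -
  have kG: "k \<in> carrier G" and c: "\<And>y. eqm KK (e k * y) (y * e k)" using k by (auto simp: Zk_def cent_def)
  note eK = eqm_mono[OF K0_KK e_mult]
  show ?thesis
  proof (induction n)
    case 0
    have "eqm KK (e \<one> * e \<one>) (1 * e \<one>)" by (rule KK_mult[OF eqm_mono[OF K0_KK e_one] KK_refl])
    then show ?case by (simp add: KK_sym)
  next
    case (Suc n)
    have 1: "eqm KK (e ((k \<otimes> y) [^] n \<otimes> (k \<otimes> y))) (e ((k \<otimes> y) [^] n) * e (k \<otimes> y))"
      using kG y by (intro eK) auto
    have 2: "eqm KK (e ((k \<otimes> y) [^] n) * e (k \<otimes> y)) (e (k [^] n) * e (y [^] n) * (e k * e y))"
      by (intro KK_mult[OF Suc] eK kG y)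
    have 3: "eqm KK (e (k [^] n) * (e (y [^] n) * e k) * e y) (e (k [^] n) * (e k * e (y [^] n)) * e y)"
      by (intro KK_mult KK_refl KK_sym[OF c])
    have 4: "eqm KK ((e (k [^] n) * e k) * (e (y [^] n) * e y)) (e (k [^] n \<otimes> k) * e (y [^] n \<otimes> y))"
      using kG y by (intro KK_mult KK_sym[OF eK]) auto
    show ?case
      using KK_trans[OF KK_trans[OF 1 2]] KK_trans[OF 3[unfolded mult.assoc] 4[unfolded mult.assoc]]
      by (simp add: mult.assoc)
  qed
qed

lemma pow_p_JJ: "x \<in> carrier G \<Longrightarrow> eqm JJ (e (x [^] p)) 1"
proof -
  assume x: "x \<in> carrier G"
  obtain q where q: "p = Suc (Suc q)" using p_gt_2 that[of "p - 2"] by simp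
  have "(e x - 1) * (e x - 1) ^ Suc q \<in> JJ"
    by (intro II_JJ tideal_pow tideal_I e_I x) simp
  then have "(e x - 1) ^ p \<in> JJ" by (simp add: q)
  then have "e (x [^] p) - 1 \<in> JJ"
    using eqm_mem[OF JD(1) eqm_mono[OF K0_JJ e_pow_p[OF x, of 1]]] by simp
  then show ?thesis by (simp add: eqm_def)
qed

abbreviation "pG s \<equiv> power_subgroup G (p ^ s) (carrier G)"

lemma pG_subgroup: "subgroup (pG s) G"
  by (rule normal_imp_subgroup[OF power_subgroup_normal[OF normal_carrier]])

lemma pG_carrier: "pG s \<subseteq> carrier G"
  by (rule subgroup.subset[OF pG_subgroup])

lemma pG_pow: "x \<in> carrier G \<Longrightarrow> x [^] (p ^ s) \<in> pG s"
  unfolding power_subgroup_def by (blast intro: generate.incl)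

lemma pG_Zk: "0 < s \<Longrightarrow> pG s \<subseteq> Zk"
  by (subst power_subgroup_def, rule generate_least[OF Zk_subgroup]) (use pow_Zk in blast)

lemma pG_le: "0 < s \<Longrightarrow> pG s \<subseteq> pG 1"
proof (subst power_subgroup_def, rule generate_least[OF pG_subgroup])
  assume s: "0 < s"
  then obtain s' where s': "s = Suc s'" using not0_implies_Suc by blast
  show "{x [^] (p ^ s) |x. x \<in> carrier G} \<subseteq> pG 1"
  proof safe
    fix x assume x: "x \<in> carrier G"
    have "x [^] (p ^ s) = (x [^] (p ^ s')) [^] (p ^ 1)"
      using x by (simp add: s' nat_pow_pow mult.commute)
    then show "x [^] (p ^ s) \<in> pG 1" using pG_pow[of "x [^] (p ^ s')" 1] x by simp
  qed
qed

text \<open>The corrections available to \<open>lift\<close>: multiplying h by such a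
  \<open>k\<close> does not change its class modulo \<open>JJ\<close>, and it multiplies the p^s-th
  power of h by \<open>r\<close> modulo \<open>KK\<close>.\<close>

definition pow_lift :: "nat \<Rightarrow> 'a set" where
  "pow_lift s = {r \<in> pG s. \<exists>k\<in>Zk. eqm JJ (e k) 1 \<and> eqm KK (e (k [^] (p ^ s))) (e r)}"

lemma pow_lift_subgroup:
  shows "subgroup (pow_lift s) G"
proof
  show "pow_lift s \<subseteq> carrier G" using pG_carrier by (auto simp: pow_lift_def)
  show "\<one> \<in> pow_lift s"
    unfolding pow_lift_def
    using subgroup.one_closed[OF pG_subgroup] subgroup.one_closed[OF Zk_subgroup] eqm_mono[OF K0_JJ e_one] KK_refl
    by (auto intro!: bexI[of _ \<one>])
  fix x assume "x \<in> pow_lift s"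
  then obtain k where x: "x \<in> pG s" and k: "k \<in> Zk" "eqm JJ (e k) 1" "eqm KK (e (k [^] (p ^ s))) (e x)"
    by (auto simp: pow_lift_def)
  have kG: "k \<in> carrier G" and xG: "x \<in> carrier G" using k x pG_carrier by (auto simp: Zk_def)
  have "k \<in> Dk JJ" using k kG by (simp add: Dk_def)
  then have "inv k \<in> Dk JJ" by (rule subgroup.m_inv_closed[OF normal_imp_subgroup[OF Dk_normal[OF tideal_JJ K0_JJ]]])
  then have 1: "eqm JJ (e (inv k)) 1" by (simp add: Dk_def)
  have "eqm KK (e (inv (k [^] (p ^ s)))) (e (inv x))"
    by (intro e_inv_cong tideal_KK K0_KK k xG nat_pow_closed kG)
  then have "eqm KK (e (inv k [^] (p ^ s))) (e (inv x))" using kG by (simp add: nat_pow_inv)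
  then show "inv x \<in> pow_lift s"
    unfolding pow_lift_def
    using subgroup.m_inv_closed[OF pG_subgroup x] subgroup.m_inv_closed[OF Zk_subgroup k(1)] 1 by blast
  fix y assume "y \<in> pow_lift s"
  then obtain l where y: "y \<in> pG s" and l: "l \<in> Zk" "eqm JJ (e l) 1" "eqm KK (e (l [^] (p ^ s))) (e y)"
    by (auto simp: pow_lift_def)
  have lG: "l \<in> carrier G" and yG: "y \<in> carrier G" using l y pG_carrier by (auto simp: Zk_def)
  have "l \<in> Dk JJ" using l lG by (simp add: Dk_def)
  with \<open>k \<in> Dk JJ\<close> have "k \<otimes> l \<in> Dk JJ"
    by (rule subgroup.m_closed[OF normal_imp_subgroup[OF Dk_normal[OF tideal_JJ K0_JJ]]])
  then have 2: "eqm JJ (e (k \<otimes> l)) 1" by (simp add: Dk_def)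
  have "eqm KK (e ((k \<otimes> l) [^] (p ^ s))) (e (k [^] (p ^ s)) * e (l [^] (p ^ s)))"
    by (rule Zk_mult_pow[OF k(1) lG])
  moreover have "eqm KK (e (k [^] (p ^ s)) * e (l [^] (p ^ s))) (e x * e y)" by (rule KK_mult[OF k(3) l(3)])
  moreover have "eqm KK (e x * e y) (e (x \<otimes> y))" by (intro KK_sym[OF eqm_mono[OF K0_KK e_mult]] xG yG)
  ultimately have "eqm KK (e ((k \<otimes> l) [^] (p ^ s))) (e (x \<otimes> y))" using KK_trans by blast
  then show "x \<otimes> y \<in> pow_lift s"
    unfolding pow_lift_def
    using subgroup.m_closed[OF pG_subgroup x y] subgroup.m_closed[OF Zk_subgroup k(1) l(1)] 2 by blast
qed

lemma pow_lift_eqm: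
  "r \<in> pow_lift s \<Longrightarrow> r' \<in> pG s \<Longrightarrow> eqm KK (e r) (e r') \<Longrightarrow> r' \<in> pow_lift s"
  unfolding pow_lift_def using KK_trans by blast

text \<open>For a generator g^(p^s) the p-th power is the p^s-th power of g^p, which is in
  \<open>Zk\<close> and is 1 modulo \<open>JJ\<close>. The property passes to products because p-th
  powers are multiplicative modulo \<open>KK\<close> on a subgroup that is central modulo
  \<open>KK\<close>. With \<open>pow_lift_comm\<close> the quotient by \<open>pow_lift s\<close> is
  elementary abelian.\<close>

lemma pow_lift_pow:
  assumes s: "0 < s" and x: "x \<in> pG s"
  shows "x [^] p \<in> pow_lift s"
proof -
  let ?S = "{x \<in> pG s. x [^] p \<in> pow_lift s}"
  have "pG s \<subseteq> ?S"
  proof (subst power_subgroup_def, rule generate_least)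
    show "subgroup ?S G"
    proof
      show "?S \<subseteq> carrier G" using pG_carrier by blast
      show "\<one> \<in> ?S" using subgroup.one_closed[OF pG_subgroup] subgroup.one_closed[OF pow_lift_subgroup] by simp
      fix x assume x: "x \<in> ?S"
      then have xG: "x \<in> carrier G" using pG_carrier by blast
      have "inv (x [^] p) \<in> pow_lift s" using x subgroup.m_inv_closed[OF pow_lift_subgroup] by blast
      then show "inv x \<in> ?S" using x subgroup.m_inv_closed[OF pG_subgroup] xG by (simp add: nat_pow_inv)
      fix y assume y: "y \<in> ?S"
      then have yG: "y \<in> carrier G" using pG_carrier by blast
      have xk: "x \<in> Zk" using x pG_Zk[OF s] by blast
      have m: "x \<otimes> y \<in> pG s" using x y subgroup.m_closed[OF pG_subgroup] by blast
      have xy: "x [^] p \<otimes> y [^] p \<in> pow_lift s" using x y subgroup.m_closed[OF pow_lift_subgroup] by blast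
      have "eqm KK (e ((x \<otimes> y) [^] p)) (e (x [^] p) * e (y [^] p))" by (rule Zk_mult_pow[OF xk yG])
      moreover have "eqm KK (e (x [^] p \<otimes> y [^] p)) (e (x [^] p) * e (y [^] p))"
        by (intro eqm_mono[OF K0_KK e_mult] nat_pow_closed xG yG)
      ultimately have "eqm KK (e (x [^] p \<otimes> y [^] p)) (e ((x \<otimes> y) [^] p))"
        using KK_trans[OF _ KK_sym] by blast
      then have "(x \<otimes> y) [^] p \<in> pow_lift s"
        by (rule pow_lift_eqm[OF xy subgroup_pow_closed[OF pG_subgroup m]])
      then show "x \<otimes> y \<in> ?S" using m by blast
    qed
    show "{x [^] (p ^ s) |x. x \<in> carrier G} \<subseteq> ?S"
    proof safe
      fix g assume g: "g \<in> carrier G"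
      show "g [^] (p ^ s) \<in> pG s" by (rule pG_pow[OF g])
      have "(g [^] (p ^ s)) [^] p = (g [^] p) [^] (p ^ s)" using g by (simp add: nat_pow_pow mult.commute)
      moreover have "(g [^] p) [^] (p ^ s) \<in> pG s" using g by (intro pG_pow) auto
      moreover have "g [^] p \<in> Zk" using pow_Zk[OF g, of 1] by simp
      ultimately show "(g [^] (p ^ s)) [^] p \<in> pow_lift s"
        unfolding pow_lift_def using pow_p_JJ[OF g] KK_refl by auto
    qed
  qed
  then show ?thesis using x by blast
qed

lemma pow_lift_comm:
  assumes s: "0 < s" and x: "x \<in> pG s" and y: "y \<in> pG s"
  shows "x \<otimes> y \<otimes> inv x \<otimes> inv y \<in> pow_lift s"
proof (rule pow_lift_eqm[OF subgroup.one_closed[OF pow_lift_subgroup]])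
  have G: "x \<in> carrier G" "y \<in> carrier G" using x y pG_carrier by blast+
  show "x \<otimes> y \<otimes> inv x \<otimes> inv y \<in> pG s"
    by (intro subgroup.m_closed[OF pG_subgroup] subgroup.m_inv_closed[OF pG_subgroup] x y)
  have "eqm KK (e x * e y) (e y * e x)" using pG_Zk[OF s] x by (auto simp: Zk_def cent_def)
  then have "eqm KK (e (x \<otimes> y)) (e (y \<otimes> x))"
    using KK_trans[OF eqm_mono[OF K0_KK e_mult] KK_trans[OF _ KK_sym[OF eqm_mono[OF K0_KK e_mult]]]] G by blast
  then have "(x \<otimes> y) \<otimes> inv (y \<otimes> x) \<in> Dk KK" using e_eqm_iff[OF tideal_KK K0_KK] G by simp
  then have "x \<otimes> y \<otimes> inv x \<otimes> inv y \<in> Dk KK" using G by (simp add: inv_mult_group m_assoc)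
  then show "eqm KK (e \<one>) (e (x \<otimes> y \<otimes> inv x \<otimes> inv y))"
    using KK_trans[OF eqm_mono[OF K0_KK e_one] KK_sym] by (simp add: Dk_def)
qed

definition aug_span :: "'a set \<Rightarrow> 'r set" where
  "aug_span P = aspan (K0 \<union> {e a - 1 | a. a \<in> P})"

text \<open>Additivity modulo \<open>LL\<close> reduces this to x = g - 1, whose power is g^(p^s) -
  1. So these powers lie, up to \<open>LL\<close>, in the augmentation ideal of the group algebra of
  the subgroup \<open>pG s\<close>.\<close>

lemma frob_span_LL:
  assumes "x \<in> I"
  shows "\<exists>w\<in>aug_span (pG s). eqm LL (x ^ (p ^ s)) w"
proof -
  let ?T = "{x. x \<in> I \<and> (\<exists>w\<in>aug_span (pG s). eqm LL (x ^ (p ^ s)) w)}"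
  have z: "0 \<in> aug_span (pG s)" by (simp add: aug_span_def aspan.zero)
  have K0T: "k \<in> ?T" if "k \<in> K0" for k
  proof -
    have "k ^ (p ^ s) \<in> LL" using that K0_LL p_pow_pos by (blast intro: tideal_pow[OF tideal_LL])
    then show ?thesis using z that K0_I by (auto simp: eqm_def intro!: bexI[of _ 0])
  qed
  have "x \<in> ?T"
  proof (rule I_ind[OF _ _ _ assms])
    show "add_closed ?T" unfolding add_closed_def
    proof (intro conjI ballI)
      show "0 \<in> ?T" by (rule K0T[OF K0D(2)])
      fix x y assume x: "x \<in> ?T" and y: "y \<in> ?T"
      then obtain v w where v: "v \<in> aug_span (pG s)" "eqm LL (x ^ (p ^ s)) v"
        and w: "w \<in> aug_span (pG s)" "eqm LL (y ^ (p ^ s)) w" by blast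
      have xy: "x - y \<in> I" using x y ID(3) by blast
      have "eqm LL (x ^ (p ^ s)) ((x - y) ^ (p ^ s) + y ^ (p ^ s))"
        using frob_LL[OF xy, of y s] y by simp
      from eqm_diff[OF LD(1) this eqm_refl[OF LD(1), of "y ^ (p ^ s)"]]
      have "eqm LL ((x - y) ^ (p ^ s)) (x ^ (p ^ s) - y ^ (p ^ s))"
        by (simp add: eqm_sym[OF LD(1)])
      then have "eqm LL ((x - y) ^ (p ^ s)) (v - w)"
        using eqm_trans[OF LD(1) _ eqm_diff[OF LD(1) v(2) w(2)]] by blast
      moreover have "v - w \<in> aug_span (pG s)" using v w unfolding aug_span_def by (blast intro: aspan.diff)
      ultimately show "x - y \<in> ?T" using xy by blast
    qed
    show "K0 \<subseteq> ?T" using K0T by blast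
    fix g assume g: "g \<in> carrier G"
    have "eqm LL ((e g - 1) ^ (p ^ s)) (e (g [^] (p ^ s)) - 1)"
      by (rule eqm_mono[OF K0_LL K0_sym[OF e_pow_p[OF g]]])
    moreover have "e (g [^] (p ^ s)) - 1 \<in> aug_span (pG s)"
      unfolding aug_span_def using pG_pow[OF g] by (blast intro: aspan.incl)
    ultimately show "e g - 1 \<in> ?T" using e_I[OF g] by blast
  qed
  then show ?thesis by blast
qed

lemma K0_sq_span: "K0 \<subseteq> sq_span P"
  unfolding sq_span_def by (auto intro: aspan.incl)

lemma add_closed_sq_span: "add_closed (sq_span P)"
  unfolding sq_span_def by simp

lemma aug_span_mult:
  assumes v: "v \<in> aug_span P" and w: "w \<in> aug_span P"
  shows "v * w \<in> sq_span P"
proof -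
  have 1: "(e a - 1) * w \<in> sq_span P" if a: "a \<in> P" for a
  proof -
    have "z \<in> K0 \<union> {e a - 1 | a. a \<in> P} \<Longrightarrow> (e a - 1) * z \<in> sq_span P" for z
      using K0D(6) a unfolding sq_span_def by (blast intro: aspan.incl)
    then show ?thesis using aspan_absorb_left w unfolding aug_span_def sq_span_def by blast
  qed
  have "z \<in> K0 \<union> {e a - 1 | a. a \<in> P} \<Longrightarrow> z * w \<in> sq_span P" for z
    using K0D(7) K0_sq_span 1 by blast
  then show ?thesis using aspan_absorb_right v unfolding aug_span_def sq_span_def by blast
qed

text \<open>For u = xy the power is x^q y^q modulo \<open>KK\<close>, with q = p^s. Each factor lies
  in the augmentation ideal of the subgroup only up to \<open>LL\<close>, but these errors are
  multiplied by an element of \<open>I\<close> and disappear, since IL and LI are inside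
  \<open>KK\<close>.\<close>

lemma frob_span_KK:
  assumes "u \<in> JJ"
  shows "\<exists>w\<in>sq_span (pG s). eqm KK (u ^ (p ^ s)) w"
proof -
  let ?T = "{u. u \<in> JJ \<and> (\<exists>w\<in>sq_span (pG s). eqm KK (u ^ (p ^ s)) w)}"
  have z: "0 \<in> sq_span (pG s)" by (simp add: sq_span_def aspan.zero)
  have K0T: "k \<in> ?T" if "k \<in> K0" for k
  proof -
    have "k ^ (p ^ s) \<in> KK" using that K0_KK p_pow_pos by (blast intro: tideal_pow[OF tideal_KK])
    then show ?thesis using z that K0_JJ by (auto simp: eqm_def intro!: bexI[of _ 0])
  qed
  have "JJ \<subseteq> ?T"
    unfolding JJ_def
  proof (rule aspan_least, fold JJ_def)
    show "add_closed ?T" unfolding add_closed_def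
    proof (intro conjI ballI)
      show "0 \<in> ?T" by (rule K0T[OF K0D(2)])
      fix x y assume x: "x \<in> ?T" and y: "y \<in> ?T"
      then obtain v w where v: "v \<in> sq_span (pG s)" "eqm KK (x ^ (p ^ s)) v"
        and w: "w \<in> sq_span (pG s)" "eqm KK (y ^ (p ^ s)) w" by blast
      have xy: "x - y \<in> JJ" using x y JD(3) by blast
      have "eqm KK (x ^ (p ^ s)) ((x - y) ^ (p ^ s) + y ^ (p ^ s))"
        using frob_KK[OF subsetD[OF JJ_I xy], of y s] y by simp
      from KK_diff[OF this KK_refl[of "y ^ (p ^ s)"]]
      have "eqm KK ((x - y) ^ (p ^ s)) (x ^ (p ^ s) - y ^ (p ^ s))"
        by (simp add: KK_sym)
      then have "eqm KK ((x - y) ^ (p ^ s)) (v - w)"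
        using KK_trans[OF _ KK_diff[OF v(2) w(2)]] by blast
      moreover have "v - w \<in> sq_span (pG s)" using v w unfolding sq_span_def by (blast intro: aspan.diff)
      ultimately show "x - y \<in> ?T" using xy by blast
    qed
    show "K0 \<union> {x * y | x y. x \<in> I \<and> y \<in> I} \<subseteq> ?T"
    proof (intro Un_least subsetI)
      show "z \<in> ?T" if "z \<in> K0" for z by (rule K0T[OF that])
      fix z assume "z \<in> {x * y | x y. x \<in> I \<and> y \<in> I}"
      then obtain x y where xy: "z = x * y" "x \<in> I" "y \<in> I" by blast
      let ?x = "x ^ (p ^ s)" and ?y = "y ^ (p ^ s)"
      obtain v where v: "v \<in> aug_span (pG s)" "eqm LL ?x v" using frob_span_LL[OF xy(2)] by blast
      obtain w where w: "w \<in> aug_span (pG s)" "eqm LL ?y w" using frob_span_LL[OF xy(3)] by blast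
      have yI: "?y \<in> I" and xI: "?x \<in> I" using xy p_pow_pos by (auto intro: tideal_pow[OF tideal_I])
      have vI: "v \<in> I" by (rule eqm_mem[OF ID(1) eqm_mono[OF LL_I eqm_sym[OF LD(1) v(2)]] xI])
      have "(?x - v) * ?y + v * (?y - w) \<in> KK"
        using v(2) w(2) by (intro KD(5) LI_KK IL_KK yI vI) (simp_all add: eqm_def)
      then have "eqm KK (?x * ?y) (v * w)" by (simp add: eqm_def algebra_simps)
      then have "eqm KK (z ^ (p ^ s)) (v * w)" using KK_trans[OF mult_pow_KK[OF xy(2,3)]] xy(1) by simp
      moreover have "v * w \<in> sq_span (pG s)" by (rule aug_span_mult[OF v(1) w(1)])
      moreover have "z \<in> JJ" using II_JJ xy by simp
      ultimately show "z \<in> ?T" by blast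
    qed
  qed
  then show ?thesis using assms by blast
qed

lemma one_span: "subgroup P G \<Longrightarrow> 1 \<in> aspan (K0 \<union> e ` P)"
proof -
  assume P: "subgroup P G"
  have "e \<one> \<in> aspan (K0 \<union> e ` P)" using subgroup.one_closed[OF P] by (blast intro: aspan.incl)
  moreover have "e \<one> - 1 \<in> aspan (K0 \<union> e ` P)" using e_one by (auto simp: eqm_def intro: aspan.incl)
  ultimately have "e \<one> - (e \<one> - 1) \<in> aspan (K0 \<union> e ` P)" by (rule aspan.diff)
  then show ?thesis by simp
qed

lemma sq_span_le:
  assumes P: "subgroup P G"
  shows "sq_span P \<subseteq> aspan (K0 \<union> e ` P)"
  unfolding sq_span_def
proof (intro aspan_least add_closed_aspan Un_least subsetI)
  let ?S = "aspan (K0 \<union> e ` P)"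
  note ac = add_closedD[OF add_closed_aspan[of "K0 \<union> e ` P"]]
  show "z \<in> ?S" if "z \<in> K0" for z using that by (blast intro: aspan.incl)
  fix z assume "z \<in> {(e x - 1) * (e y - 1) | x y. x \<in> P \<and> y \<in> P}"
  then obtain x y where z: "z = (e x - 1) * (e y - 1)" "x \<in> P" "y \<in> P" by blast
  have PG: "x \<in> carrier G" "y \<in> carrier G" using z P subgroup.subset by blast+
  have "e x * e y - e (x \<otimes> y) \<in> ?S"
    using K0_sym[OF e_mult[OF PG]] by (auto simp: eqm_def intro: aspan.incl)
  moreover have "e (x \<otimes> y) \<in> ?S" "e x \<in> ?S" "e y \<in> ?S"
    using z subgroup.m_closed[OF P] by (auto intro: aspan.incl)
  ultimately have "(e x * e y - e (x \<otimes> y)) + e (x \<otimes> y) - e x - (e y - 1) \<in> ?S"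
    using one_span[OF P] ac(2)[OF ac(2)[OF ac(4)] ac(2)] by blast
  then show "z \<in> ?S" unfolding z by (simp add: algebra_simps)
qed

lemma aug_span_le:
  assumes P: "subgroup P G"
  shows "aug_span P \<subseteq> aspan (K0 \<union> e ` P)"
  unfolding aug_span_def
  by (intro aspan_least add_closed_aspan) (use one_span[OF P] in \<open>auto intro: aspan.intros\<close>)

text \<open>The error terms (r - 1)(t - 1) lie in AI and at the same time in the square of the
  augmentation ideal of FP. Both congruences must hold for the same \<open>r\<close>: the first
  compares ring elements, the second is turned into a statement on the group \<open>P\<close> by
  \<open>sq_span_dim\<close>.\<close>

lemma meet_rep:
  assumes P: "subgroup P G"
    and W: "W \<in> aspan (K0 \<union> {(e r - 1) * e t | r t. r \<in> P \<inter> \<gamma>2 \<and> t \<in> P})"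
  shows "\<exists>r\<in>P \<inter> \<gamma>2. W - (e r - 1) \<in> KK \<inter> sq_span P"
proof -
  let ?T = "KK \<inter> sq_span P" and ?Q = "P \<inter> \<gamma>2"
  let ?S = "{W. \<exists>r\<in>?Q. W - (e r - 1) \<in> ?T}"
  have acT: "add_closed ?T"
    using add_closedD(1,2)[OF add_closed_sq_span] KD(2,3) unfolding add_closed_def by blast
  note T = add_closedD[OF acT]
  have K0T: "K0 \<subseteq> ?T" using K0_KK K0_sq_span by blast
  have Q: "subgroup ?Q G" by (rule subgroups_Inter_pair[OF P gamma2_sub])
  have QG: "r \<in> carrier G" "e r - 1 \<in> AA" if "r \<in> ?Q" for r
    using that gamma2_Dk gamma2_carrier by (auto simp: Dk_iff)
  have PG: "x \<in> carrier G" if "x \<in> P" for x using that P subgroup.subset by blast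
  have prodT: "(e r - 1) * (e t - 1) \<in> ?T" if "r \<in> ?Q" "t \<in> P" for r t
    using AI_KK[OF QG(2)[OF that(1)] e_I[OF PG[OF that(2)]]] that
    unfolding sq_span_def by (blast intro: aspan.incl)
  have "aspan (K0 \<union> {(e r - 1) * e t | r t. r \<in> ?Q \<and> t \<in> P}) \<subseteq> ?S"
  proof (rule aspan_least)
    have one: "W \<in> ?S" if "W \<in> K0" for W
    proof -
      have "W - (e \<one> - 1) \<in> K0" using K0D(3)[OF that] e_one by (simp add: eqm_def)
      then show ?thesis using subgroup.one_closed[OF Q] K0T by blast
    qed
    show "add_closed ?S" unfolding add_closed_def
    proof (intro conjI ballI)
      show "0 \<in> ?S" by (rule one[OF K0D(2)])
      fix x y assume "x \<in> ?S" "y \<in> ?S"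
      then obtain r t where r: "r \<in> ?Q" "x - (e r - 1) \<in> ?T" and t: "t \<in> ?Q" "y - (e t - 1) \<in> ?T" by blast
      have it: "inv t \<in> ?Q" by (rule subgroup.m_inv_closed[OF Q t(1)])
      have k1: "e (r \<otimes> inv t) - e r * e (inv t) \<in> ?T"
        using e_mult[OF QG(1)[OF r(1)] QG(1)[OF it]] K0T by (auto simp: eqm_def)
      have k2: "e (inv t) * e t - 1 \<in> ?T"
        using e_inv(1)[OF QG(1)[OF t(1)]] K0T by (auto simp: eqm_def)
      have p1: "(e r - 1) * (e (inv t) - 1) \<in> ?T" using prodT r(1) it by blast
      have p2: "(e (inv t) - 1) * (e t - 1) \<in> ?T" using prodT t(1) it by blast
      have "(x - y) - (e (r \<otimes> inv t) - 1) = (x - (e r - 1)) - (y - (e t - 1))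
        - (e (r \<otimes> inv t) - e r * e (inv t)) - (e r - 1) * (e (inv t) - 1)
        + (e (inv t) - 1) * (e t - 1) - (e (inv t) * e t - 1)"
        by (simp add: left_diff_distrib right_diff_distrib)
      also have "\<dots> \<in> ?T" by (intro T(2,4) r t k1 k2 p1 p2)
      finally show "x - y \<in> ?S" using subgroup.m_closed[OF Q r(1) it] by blast
    qed
    show "K0 \<union> {(e r - 1) * e t | r t. r \<in> ?Q \<and> t \<in> P} \<subseteq> ?S"
    proof (intro Un_least subsetI)
      show "z \<in> ?S" if "z \<in> K0" for z by (rule one[OF that])
      fix z assume "z \<in> {(e r - 1) * e t | r t. r \<in> ?Q \<and> t \<in> P}"
      then obtain r t where z: "z = (e r - 1) * e t" "r \<in> ?Q" "t \<in> P" by blast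
      have "z - (e r - 1) = (e r - 1) * (e t - 1)" unfolding z by (simp add: algebra_simps)
      then show "z \<in> ?S" using prodT[OF z(2,3)] z(2) by (metis (mono_tags, lifting) mem_Collect_eq)
    qed
  qed
  then show ?thesis using W by blast
qed

definition pow_cond :: bool where
  "pow_cond \<longleftrightarrow> pG 1 \<inter> \<gamma>2 \<subseteq> Dk LL"

text \<open>Take h congruent to \<open>Y\<close> modulo \<open>JJ\<close> and q = p^s. Then Y^q is
  h^q plus an element of the squared augmentation ideal of the subgroup generated by the q-th
  powers. Lying in 1 + A, it is congruent modulo \<open>KK\<close> to an element \<open>r\<close> of
  that subgroup and of \<gamma>2, which \<open>pow_cond\<close> places in 1 + L. Moreover r h^(-q)
  is in \<open>pow_lift\<close>, so a correction of h produces the power \<open>r\<close> exactly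
  modulo \<open>KK\<close>.\<close>

lemma lift:
  assumes pc: "pow_cond" and Y: "Y - 1 \<in> I" and s: "0 < s" and YA: "Y ^ (p ^ s) - 1 \<in> AA"
  shows "Y ^ (p ^ s) - 1 \<in> LL"
    and "\<exists>h\<in>carrier G. eqm JJ (e h) Y \<and> eqm KK (e (h [^] (p ^ s))) (Y ^ (p ^ s))"
proof -
  let ?q = "p ^ s" and ?P = "pG s"
  obtain h where h: "h \<in> carrier G" "eqm JJ (Y - 1) (e h - 1)" using I_rep[OF Y] by blast
  define u where "u = Y - e h"
  have u: "u \<in> JJ" using h(2) by (simp add: u_def eqm_def)
  obtain w where w: "w \<in> sq_span ?P" "eqm KK (u ^ ?q) w" using frob_span_KK[OF u] by blast
  \<comment> \<open>Modulo \<open>KK\<close> this is Y^q - 1, but unlike that element it lies in the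
    span of the subgroup \<open>?P\<close> and \<open>K0\<close>, so that
    \<open>span_meet_AA\<close> applies.\<close>
  define W where "W = e (h [^] ?q) - 1 + w"
  have "eqm KK (Y ^ ?q) (1 + (Y - 1) ^ ?q)" using eqm_mono[OF K0_KK frob_one[of "Y - 1" s]] by simp
  moreover have "eqm KK (1 + (Y - 1) ^ ?q) (1 + ((e h - 1) ^ ?q + u ^ ?q))"
  proof -
    have "Y - 1 = (e h - 1) + u" by (simp add: u_def)
    then show ?thesis using frob_KK[OF e_I[OF h(1)] u, of s] by (intro KK_add KK_refl) (simp only:)
  qed
  moreover have "eqm KK (1 + ((e h - 1) ^ ?q + u ^ ?q)) (1 + W)"
    unfolding W_def by (intro KK_add KK_refl w eqm_mono[OF K0_KK K0_sym[OF e_pow_p]] h)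
  ultimately have YW: "eqm KK (Y ^ ?q) (1 + W)" using KK_trans by blast
  then have YW1: "eqm KK W (Y ^ ?q - 1)" using KK_sym by (simp add: eqm_def algebra_simps)
  have WA: "W \<in> AA" by (rule eqm_mem[OF AD(1) eqm_mono[OF KK_AA YW1] YA])
  note P = pG_subgroup[of s]
  have hP: "h [^] ?q \<in> ?P" by (rule pG_pow[OF h(1)])
  have "W \<in> aspan (K0 \<union> e ` ?P)"
    unfolding W_def using w(1) sq_span_le[OF P] hP
    by (intro add_closedD(4)[OF add_closed_aspan] aspan.diff one_span[OF P]) (auto intro: aspan.incl)
  from meet_rep[OF P span_meet_AA[OF P this WA]] obtain r
    where r: "r \<in> ?P \<inter> \<gamma>2" "W - (e r - 1) \<in> KK" "W - (e r - 1) \<in> sq_span ?P" by blast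
  have rL: "e r - 1 \<in> LL" using pc r(1) pG_le[OF s] by (auto simp: pow_cond_def Dk_iff)
  have rG: "r \<in> carrier G" using r(1) gamma2_carrier by blast
  have Wr: "eqm KK (e r) (1 + W)"
    using KD(4)[OF r(2)] by (simp add: eqm_def algebra_simps)
  then have rY: "eqm KK (e r) (Y ^ ?q)" using KK_trans KK_sym[OF YW] by blast
  show "Y ^ ?q - 1 \<in> LL"
  proof (rule eqm_mem[OF LD(1) _ rL])
    show "eqm LL (Y ^ ?q - 1) (e r - 1)"
      by (intro eqm_diff LD(1) eqm_refl eqm_mono[OF KK_LL KK_sym[OF rY]])
  qed
  \<comment> \<open>The difference collapses to \<open>e r\<close> minus the basis element of the
    q-th power of \<open>h\<close>, both taken from \<open>?P\<close>.\<close>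
  have "w - (W - (e r - 1)) \<in> sq_span ?P"
    by (rule add_closedD(2)[OF add_closed_sq_span w(1) r(3)])
  then have "e r - e (h [^] ?q) \<in> sq_span ?P" by (simp add: W_def algebra_simps)
  then have "r \<otimes> inv (h [^] ?q) \<in> pow_lift s"
    using pow_lift_pow[OF s] pow_lift_comm[OF s] r(1) hP
    by (intro sq_span_dim[OF P pow_lift_subgroup]) (auto simp: pow_lift_def)
  then obtain k where k: "k \<in> Zk" "eqm JJ (e k) 1" "eqm KK (e (k [^] ?q)) (e (r \<otimes> inv (h [^] ?q)))"
    by (auto simp: pow_lift_def)
  have kG: "k \<in> carrier G" using k(1) by (simp add: Zk_def)
  have hq: "h [^] ?q \<in> carrier G" using h(1) by simp
  have "eqm KK (e ((k \<otimes> h) [^] ?q)) (e (k [^] ?q) * e (h [^] ?q))" by (rule Zk_mult_pow[OF k(1) h(1)])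
  moreover have "eqm KK (e (k [^] ?q) * e (h [^] ?q)) (e (r \<otimes> inv (h [^] ?q)) * e (h [^] ?q))"
    by (rule KK_mult[OF k(3) KK_refl])
  moreover have "eqm KK (e (r \<otimes> inv (h [^] ?q)) * e (h [^] ?q)) (e (r \<otimes> inv (h [^] ?q) \<otimes> h [^] ?q))"
    using rG hq by (intro KK_sym[OF eqm_mono[OF K0_KK e_mult]]) auto
  moreover have "r \<otimes> inv (h [^] ?q) \<otimes> h [^] ?q = r" using rG hq by (simp add: m_assoc)
  ultimately have "eqm KK (e ((k \<otimes> h) [^] ?q)) (e r)" using KK_trans by metis
  then have 1: "eqm KK (e ((k \<otimes> h) [^] ?q)) (Y ^ ?q)" using KK_trans rY by blast
  have "eqm JJ (e (k \<otimes> h)) (e k * e h)" by (rule eqm_mono[OF K0_JJ e_mult[OF kG h(1)]])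
  moreover have "eqm JJ (e k * e h) (1 * e h)" by (rule eqm_mult[OF tideal_JJ k(2) eqm_refl[OF JD(1)]])
  moreover have "eqm JJ (e h) Y" using JD(4)[OF u] by (simp add: u_def eqm_def)
  ultimately have 2: "eqm JJ (e (k \<otimes> h)) Y" using eqm_trans[OF JD(1)] by (metis mult_1)
  show "\<exists>h\<in>carrier G. eqm JJ (e h) Y \<and> eqm KK (e (h [^] ?q)) (Y ^ ?q)"
    using 1 2 kG h(1) by (intro bexI[of _ "k \<otimes> h"]) auto
qed

text \<open>The lift h agrees with a central c modulo \<open>JJ\<close>, so h = k m c with k in G^p
  and m in \<gamma>2. Dropping m gives an element of \<open>Zk\<close>; the change lies in
  \<open>AA\<close>, which is invisible modulo \<open>JJ\<close>, and the q-th power of the change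
  lies in AI, so the q-th power of h is preserved modulo \<open>KK\<close>.\<close>

lemma lift_central:
  assumes pc: "pow_cond" and Y: "Y - 1 \<in> I" and s: "0 < s" and YA: "Y ^ (p ^ s) - 1 \<in> AA"
    and YU: "Y - 1 \<in> UU"
  shows "\<exists>h\<in>Zk. eqm JJ (e h) Y \<and> eqm KK (e (h [^] (p ^ s))) (Y ^ (p ^ s))"
proof -
  let ?q = "p ^ s"
  obtain h where h: "h \<in> carrier G" "eqm JJ (e h) Y" "eqm KK (e (h [^] ?q)) (Y ^ ?q)"
    using lift(2)[OF pc Y s YA] by blast
  have "e h - 1 \<in> UU"
    by (rule UU_add_JJ[OF YU]) (intro eqm_diff JD(1) h eqm_refl)
  then obtain c where c: "c \<in> group_center G" "eqm JJ (e h - 1) (e c - 1)" using UU_rep by blast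
  have cG: "c \<in> carrier G" using c(1) by (simp add: group_center_def)
  have hc: "eqm JJ (e h) (e c)" using c(2) by (simp add: eqm_def)
  have "h \<otimes> inv c \<in> Phi" by (rule e_JJ_Phi[OF h(1) cG hc])
  then obtain k m where km: "k \<in> pG 1" "m \<in> \<gamma>2" "h \<otimes> inv c = k \<otimes> m"
    by (auto simp: Phi_def set_mult_def)
  have kZ: "k \<in> Zk" using km(1) pG_Zk[of 1] by auto
  have kG: "k \<in> carrier G" and mG: "m \<in> carrier G" and mA: "e m - 1 \<in> AA"
    using kZ km gamma2_carrier gamma2_Dk by (auto simp: Zk_def Dk_iff)
  have "h = h \<otimes> inv c \<otimes> c" using h(1) cG by (simp add: m_assoc)
  then have hk: "h = k \<otimes> m \<otimes> c" using km(3) by simp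
  let ?h = "k \<otimes> c"
  have hG: "?h \<in> carrier G" using kG cG by simp
  have hZ: "?h \<in> Zk" by (rule subgroup.m_closed[OF Zk_subgroup kZ]) (use c center_Zk in blast)
  have "eqm AA (e h) (e ?h)"
  proof -
    have "eqm K0 (e h) (e k * e m * e c)"
      unfolding hk by (rule K0_trans[OF e_mult[OF m_closed[OF kG mG] cG] K0_mult[OF e_mult[OF kG mG] K0_refl]])
    then have "eqm AA (e h) (e k * e m * e c)" by (rule eqm_mono[OF K0_AA])
    moreover have "eqm AA (e k * e m * e c) (e k * 1 * e c)"
      using mA by (intro eqm_mult[OF tideal_AA] eqm_refl AD(1)) (simp add: eqm_def)
    moreover have "eqm AA (e k * e c) (e ?h)"
      by (rule eqm_mono[OF K0_AA K0_sym[OF e_mult[OF kG cG]]])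
    ultimately show ?thesis using eqm_trans[OF AD(1)] by (metis mult.right_neutral)
  qed
  then have a: "e h - e ?h \<in> AA" by (simp add: eqm_def)
  obtain q' where q': "?q = Suc (Suc q')" using p_pow_ge[OF s] that[of "?q - 2"] by simp
  have "(e h - e ?h) * (e h - e ?h) ^ Suc q' \<in> KK"
    using a AA_I by (intro AI_KK tideal_pow tideal_I) auto
  then have aq: "(e h - e ?h) ^ ?q \<in> KK" by (simp add: q')
  have "eqm KK (e (h [^] ?q) - 1) ((e h - 1) ^ ?q)" by (rule eqm_mono[OF K0_KK e_pow_p[OF h(1)]])
  moreover have "eqm KK ((e h - 1) ^ ?q) ((e ?h - 1) ^ ?q + (e h - e ?h) ^ ?q)"
    using frob_KK[OF e_I[OF hG] subsetD[OF AA_JJ a], of s] by simp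
  moreover have "eqm KK ((e ?h - 1) ^ ?q + (e h - e ?h) ^ ?q) ((e (?h [^] ?q) - 1) + 0)"
    using aq by (intro KK_add eqm_mono[OF K0_KK K0_sym[OF e_pow_p]] hG) (simp add: eqm_def)
  ultimately have "eqm KK (e (h [^] ?q) - 1) ((e (?h [^] ?q) - 1) + 0)" using KK_trans by blast
  then have "eqm KK (e (h [^] ?q)) (e (?h [^] ?q))" by (simp add: eqm_def)
  then have "eqm KK (e (?h [^] ?q)) (Y ^ ?q)" using KK_trans[OF KK_sym h(3)] by blast
  moreover have "eqm JJ (e ?h) Y"
    using eqm_trans[OF JD(1) eqm_sym[OF JD(1)] h(2)] \<open>eqm AA (e h) (e ?h)\<close> eqm_mono[OF AA_JJ] by blast
  ultimately show ?thesis using hZ by blast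
qed

text \<open>Moves hypothesis (1) from one group basis to the other, the right-hand side being free
  of the basis. From left to right, an element of the span is modulo \<open>LL\<close> in the
  augmentation ideal of the group algebra of G^p, and \<open>span_meet_AA\<close> describes its
  intersection with \<open>AA\<close>. From right to left, r - 1 is in \<open>pow_span\<close> for
  every \<open>r\<close> in G^p, because \<open>pow_span\<close> is closed under products.\<close>

lemma pow_cond_iff: "pow_cond \<longleftrightarrow> pow_span \<inter> AA \<subseteq> LL"
proof
  assume pc: "pow_cond"
  let ?P = "pG 1"
  note P = pG_subgroup[of 1]
  show "pow_span \<inter> AA \<subseteq> LL"
  proof
    fix w assume w: "w \<in> pow_span \<inter> AA"
    let ?T = "{w. \<exists>v\<in>aug_span ?P. eqm LL w v}"
    have "pow_span \<subseteq> ?T"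
      unfolding pow_span_def
    proof (intro aspan_least Un_least subsetI)
      show "add_closed ?T" unfolding add_closed_def
      proof (intro conjI ballI)
        show "0 \<in> ?T" using eqm_refl[OF LD(1)] by (auto simp: aug_span_def intro!: bexI[of _ 0] aspan.zero)
        fix x y assume "x \<in> ?T" "y \<in> ?T"
        then obtain v v' where v: "v \<in> aug_span ?P" "eqm LL x v" "v' \<in> aug_span ?P" "eqm LL y v'" by blast
        have "v - v' \<in> aug_span ?P" using v(1,3) unfolding aug_span_def by (rule aspan.diff)
        moreover have "eqm LL (x - y) (v - v')" by (rule eqm_diff[OF LD(1) v(2,4)])
        ultimately show "x - y \<in> ?T" by blast
      qed
      show "z \<in> ?T" if "z \<in> LL" for z
        using that by (auto simp: aug_span_def eqm_def intro!: bexI[of _ 0] aspan.zero)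
      show "z \<in> ?T" if z: "z \<in> {x ^ p | x. x \<in> I}" for z
      proof -
        obtain x where "z = x ^ p" "x \<in> I" using z by blast
        then show ?thesis using frob_span_LL[of x 1] by auto
      qed
    qed
    then obtain v where v: "v \<in> aug_span ?P" "eqm LL w v" using w by blast
    have vA: "v \<in> AA"
      by (rule eqm_mem[OF AD(1) eqm_mono[OF LL_AA eqm_sym[OF LD(1) v(2)]]]) (use w in blast)
    have "v \<in> aspan (K0 \<union> {(e r - 1) * e t | r t. r \<in> ?P \<inter> \<gamma>2 \<and> t \<in> ?P})"
      using span_meet_AA[OF P _ vA] aug_span_le[OF P] v(1) by blast
    also have "\<dots> \<subseteq> LL"
    proof (intro aspan_least LD(1) Un_least K0_LL subsetI)
      fix z assume "z \<in> {(e r - 1) * e t | r t. r \<in> ?P \<inter> \<gamma>2 \<and> t \<in> ?P}"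
      then obtain r t where "z = (e r - 1) * e t" "r \<in> ?P \<inter> \<gamma>2" by blast
      then show "z \<in> LL" using pc LD(7) by (auto simp: pow_cond_def Dk_iff)
    qed
    finally show "w \<in> LL" using eqm_mem[OF LD(1) v(2)] by blast
  qed
next
  assume C: "pow_span \<inter> AA \<subseteq> LL"
  have acw: "add_closed pow_span" unfolding pow_span_def by simp
  have K0w: "K0 \<subseteq> pow_span" unfolding pow_span_def using K0_LL by (auto intro: aspan.incl)
  have gen: "e (x [^] p) - 1 \<in> pow_span" if "x \<in> carrier G" for x
  proof (rule eqm_mem[OF acw eqm_mono[OF K0w e_pow_p[OF that, of 1, simplified]]])
    show "(e x - 1) ^ p \<in> pow_span" unfolding pow_span_def using e_I[OF that] by (blast intro: aspan.incl)
  qed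
  have "e r - 1 \<in> pow_span" if "r \<in> generate G {x [^] p | x. x \<in> carrier G}" for r
    using that
  proof (induction r rule: generate.induct)
    case one
    then show ?case using e_one K0w by (auto simp: eqm_def)
  next
    case (incl h)
    then show ?case using gen by blast
  next
    case (inv h)
    then obtain x where x: "h = x [^] p" "x \<in> carrier G" by blast
    then have "inv h = (inv x) [^] p" by (simp add: nat_pow_inv)
    then show ?case using gen[of "inv x"] x by simp
  next
    case (eng h1 h2)
    have sub: "{x [^] p | x. x \<in> carrier G} \<subseteq> carrier G" by auto
    have G: "h1 \<in> carrier G" "h2 \<in> carrier G" using eng generate_in_carrier[OF sub] by blast+
    have "eqm K0 (e (h1 \<otimes> h2) - 1) ((e h1 - 1) * (e h2 - 1) + (e h1 - 1) + (e h2 - 1))"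
      using e_mult[OF G] by (simp add: eqm_def left_diff_distrib right_diff_distrib)
    then show ?case
      by (rule eqm_mem[OF acw eqm_mono[OF K0w]])
        (intro add_closedD(4)[OF acw] pow_span_mult eng.IH)
  qed
  then show pow_cond using C gamma2_Dk by (auto simp: pow_cond_def Dk_iff power_subgroup_def subset_iff)
qed

end

section \<open>Generators\<close>

primrec gprod :: "('a, 'm) monoid_scheme \<Rightarrow> (nat \<Rightarrow> 'a) \<Rightarrow> (nat \<Rightarrow> nat) \<Rightarrow> nat \<Rightarrow> 'a" where
  "gprod G g a 0 = \<one>\<^bsub>G\<^esub>"
| "gprod G g a (Suc r) = gprod G g a r \<otimes>\<^bsub>G\<^esub> g r [^]\<^bsub>G\<^esub> a r"

context group
begin

lemma gprod_closed: "\<forall>i<r. g i \<in> carrier G \<Longrightarrow> gprod G g a r \<in> carrier G"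
  by (induction r) auto

lemma gprod_subgroup:
  assumes "subgroup S G"
  shows "\<forall>i<r. g i [^] a i \<in> S \<Longrightarrow> gprod G g a r \<in> S"
  by (induction r) (auto simp: subgroup.one_closed[OF assms] subgroup.m_closed[OF assms])

lemma gprod_cong: "\<forall>i<r. g i [^] a i = g' i [^] b i \<Longrightarrow> gprod G g a r = gprod G g' b r"
  by (induction r) auto

lemma gprod_zero: "\<forall>i<r. a i = 0 \<Longrightarrow> gprod G g a r = \<one>"
  by (induction r) auto

lemma commute_pow:
  assumes "x \<in> carrier G" "y \<in> carrier G" "x \<otimes> y = y \<otimes> x"
  shows "x [^] (n::nat) \<otimes> y = y \<otimes> x [^] n"
proof (induction n)
  case (Suc n)
  have "x [^] Suc n \<otimes> y = x [^] n \<otimes> y \<otimes> x" using assms by (simp add: m_assoc)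
  also have "\<dots> = y \<otimes> x [^] Suc n" unfolding Suc using assms by (simp add: m_assoc)
  finally show ?case .
qed (use assms in simp)

lemma gprod_commute:
  assumes y: "y \<in> carrier G"
  shows "\<forall>i<r. g i \<in> carrier G \<and> g i \<otimes> y = y \<otimes> g i \<Longrightarrow> gprod G g a r \<otimes> y = y \<otimes> gprod G g a r"
proof (induction r)
  case (Suc r)
  have g: "g r \<in> carrier G" and gp: "gprod G g a r \<in> carrier G"
    using Suc.prems gprod_closed[of r g a] by auto
  have c: "g r [^] a r \<otimes> y = y \<otimes> g r [^] a r" using Suc.prems y by (intro commute_pow) auto
  have "gprod G g a (Suc r) \<otimes> y = gprod G g a r \<otimes> y \<otimes> g r [^] a r" using g gp y c by (simp add: m_assoc)
  also have "gprod G g a r \<otimes> y = y \<otimes> gprod G g a r" using Suc by simp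
  finally show ?case using g gp y by (simp add: m_assoc)
qed (use y in simp)

lemma gprod_mult:
  assumes "\<forall>i<r. g i \<in> carrier G" "\<forall>i<r. \<forall>j<r. g i \<otimes> g j = g j \<otimes> g i"
  shows "gprod G g a r \<otimes> gprod G g b r = gprod G g (\<lambda>i. a i + b i) r"
  using assms
proof (induction r)
  case (Suc r)
  have g: "g r \<in> carrier G" and gp: "gprod G g a r \<in> carrier G" "gprod G g b r \<in> carrier G"
    using Suc.prems gprod_closed[of r g] by auto
  have "gprod G g b r \<otimes> g r [^] a r = g r [^] a r \<otimes> gprod G g b r"
  proof (rule gprod_commute)
    show "\<forall>i<r. g i \<in> carrier G \<and> g i \<otimes> g r [^] a r = g r [^] a r \<otimes> g i"
      using Suc.prems commute_pow[OF g] by (metis less_Suc_eq)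
  qed (use g in simp)
  then have "gprod G g a (Suc r) \<otimes> gprod G g b (Suc r)
    = gprod G g a r \<otimes> gprod G g b r \<otimes> (g r [^] a r \<otimes> g r [^] b r)"
    using g gp by (simp add: m_assoc) (metis m_assoc nat_pow_closed)
  also have "gprod G g a r \<otimes> gprod G g b r = gprod G g (\<lambda>i. a i + b i) r" using Suc by simp
  finally show ?case using g by (simp add: nat_pow_mult)
qed simp

lemma gprod_pow:
  assumes "\<forall>i<r. g i \<in> carrier G" "\<forall>i<r. \<forall>j<r. g i \<otimes> g j = g j \<otimes> g i"
  shows "gprod G g a r [^] (n::nat) = gprod G g (\<lambda>i. n * a i) r"
proof (induction n)
  case 0 show ?case by (simp add: gprod_zero)
next
  case (Suc n)
  then show ?case using gprod_mult[OF assms, of "\<lambda>i. n * a i" a] by (simp add: add.commute)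
qed

lemma gprod_unit:
  "\<lbrakk>\<forall>i<r. g i \<in> carrier G; j < r\<rbrakk> \<Longrightarrow> gprod G g (\<lambda>i. if i = j then n else 0) r = g j [^] n"
proof (induction r)
  case (Suc r)
  show ?case
  proof (cases "j = r")
    case True
    then have "gprod G g (\<lambda>i. if i = j then n else 0) r = \<one>" by (intro gprod_zero) auto
    then show ?thesis using Suc.prems True by simp
  qed (use Suc in simp)
qed simp

lemma normal_above_gamma2:
  assumes S: "subgroup S G" "\<gamma>2 \<subseteq> S"
  shows "S \<lhd> G"
proof (rule normal_invI[OF S(1)])
  fix g s assume g: "g \<in> carrier G" and s: "s \<in> S"
  have sG: "s \<in> carrier G" using s S subgroup.subset by blast
  have "g \<otimes> s \<otimes> inv g \<otimes> inv s \<in> S"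
    using conj_commutator_subgroup[OF normal_carrier sG g] S(2) unfolding gamma2_eq by blast
  then have "g \<otimes> s \<otimes> inv g \<otimes> inv s \<otimes> s \<in> S" using s by (rule subgroup.m_closed[OF S(1)])
  then show "g \<otimes> s \<otimes> inv g \<in> S" using g sG by (simp add: m_assoc)
qed

lemma quotient_above_gamma2:
  assumes S: "subgroup S G" "\<gamma>2 \<subseteq> S"
  shows "comm_group (G Mod S)" "group_hom G (G Mod S) (\<lambda>x. S #> x)"
    "\<And>x. x \<in> carrier G \<Longrightarrow> S #> x = \<one>\<^bsub>G Mod S\<^esub> \<longleftrightarrow> x \<in> S"
    "\<And>q. q \<in> carrier (G Mod S) \<Longrightarrow> \<exists>x\<in>carrier G. q = S #> x"
proof -
  have N: "S \<lhd> G" by (rule normal_above_gamma2[OF S])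
  have Q: "group (G Mod S)" by (rule normal.factorgroup_is_group[OF N])
  show hom: "group_hom G (G Mod S) (\<lambda>x. S #> x)"
    using normal.r_coset_hom_Mod[OF N] Q is_group by (simp add: group_hom_def group_hom_axioms_def)
  show one: "S #> x = \<one>\<^bsub>G Mod S\<^esub> \<longleftrightarrow> x \<in> S" if "x \<in> carrier G" for x
    using coset_eq_iff[OF S(1) that one_closed] that subgroup.subset[OF S(1)] by (simp add: coset_mult_one)
  show ex: "\<exists>x\<in>carrier G. q = S #> x" if "q \<in> carrier (G Mod S)" for q
    using that by (auto simp: carrier_FactGroup)
  show "comm_group (G Mod S)"
  proof (rule group.group_comm_groupI[OF Q])
    fix q q' assume "q \<in> carrier (G Mod S)" "q' \<in> carrier (G Mod S)"
    then obtain x y where xy: "x \<in> carrier G" "q = S #> x" "y \<in> carrier G" "q' = S #> y" using ex by meson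
    have "x \<otimes> y \<otimes> inv x \<otimes> inv y \<in> S"
      using conj_commutator_subgroup[OF normal_carrier xy(3,1)] S(2) unfolding gamma2_eq by blast
    then have "S #> (x \<otimes> y) = S #> (y \<otimes> x)"
      using coset_eq_iff[OF S(1), of "x \<otimes> y" "y \<otimes> x"] xy by (simp add: inv_mult_group m_assoc)
    then show "q \<otimes>\<^bsub>G Mod S\<^esub> q' = q' \<otimes>\<^bsub>G Mod S\<^esub> q"
      using xy by (simp add: group_hom.hom_mult[OF hom, symmetric] del: mult_FactGroup)
  qed
qed

end

lemma (in group_hom) hom_gprod:
  "\<forall>i<r. g i \<in> carrier G \<Longrightarrow> h (gprod G g a r) = gprod H (\<lambda>i. h (g i)) a r"
proof (induction r)
  case (Suc r)
  then show ?case using G.gprod_closed[of r g a] by (simp add: hom_nat_pow)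
qed simp

section \<open>Families spanning \<open>I\<close> modulo \<open>JJ\<close>, and generation of the
  group\<close>

context ideal_tower
begin

definition spans :: "(nat \<Rightarrow> 'r) \<Rightarrow> nat \<Rightarrow> bool" where
  "spans v r \<longleftrightarrow> (\<forall>x\<in>I. \<exists>n::nat \<Rightarrow> int. eqm JJ x (\<Sum>i<r. of_int (n i) * v i))"

end

context mod_group_ring
begin

text \<open>A subgroup \<open>M\<close> that is maximal among those containing \<open>Phi\<close>
  and avoiding \<open>x\<close> is a maximal subgroup: if y is outside \<open>M\<close>, then
  \<open>M\<close> and y generate a subgroup containing \<open>x\<close>, so \<open>x\<close> is y^k
  modulo \<open>M\<close> with k prime to p, and y is in turn a power of \<open>x\<close> modulo
  \<open>M\<close>. Every subgroup properly above \<open>M\<close> contains \<open>x\<close>, hence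
  everything.\<close>

lemma frattini_Phi: "frattini G \<subseteq> Phi"
proof
  fix x assume x: "x \<in> frattini G"
  then have xG: "x \<in> carrier G" by (simp add: frattini_def)
  show "x \<in> Phi"
  proof (rule ccontr)
    assume nx: "x \<notin> Phi"
    let ?F = "{M. subgroup M G \<and> Phi \<subseteq> M \<and> x \<notin> M}"
    have finF: "finite ?F" by (rule finite_subset[of _ "Pow (carrier G)"]) (use fin subgroup.subset in auto)
    have "Phi \<in> ?F" using nx normal_imp_subgroup[OF Phi_normal] by blast
    then obtain M where M: "M \<in> ?F" "\<And>K. K \<in> ?F \<Longrightarrow> M \<subseteq> K \<Longrightarrow> M = K"
      using finite_has_maximal2[OF finF] by (metis (no_types, lifting))
    have sM: "subgroup M G" "\<gamma>2 \<subseteq> M" "Phi \<subseteq> M" "x \<notin> M" using M(1) Phi_upper(2) by blast+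
    note q = quotient_above_gamma2[OF sM(1,2)]
    interpret Q: comm_group "G Mod M" by (rule q(1))
    interpret \<pi>: group_hom G "G Mod M" "\<lambda>x. M #> x" by (rule q(2))
    have "maximal_subgroup M G"
      unfolding maximal_subgroup_def
    proof (intro conjI allI impI sM(1))
      show "M \<noteq> carrier G" using xG sM(4) by blast
      fix K assume K: "subgroup K G" "M \<subseteq> K"
      show "K = M \<or> K = carrier G"
      proof (cases "K = M")
        case False
        then have xK: "x \<in> K" using M K sM(3) by blast
        have "y \<in> K" if y: "y \<in> carrier G" for y
        proof (cases "y \<in> M")
          case False
          let ?N = "{z \<in> carrier G. \<exists>k::int. M #> z = (M #> y) [^]\<^bsub>G Mod M\<^esub> k}"
          have Y: "M #> y \<in> carrier (G Mod M)" by (rule \<pi>.hom_closed[OF y])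
          have sN: "subgroup ?N G"
          proof
            show "?N \<subseteq> carrier G" by blast
            have "M #> \<one> = (M #> y) [^]\<^bsub>G Mod M\<^esub> (0::int)" using \<pi>.hom_one by simp
            then show "\<one> \<in> ?N" using one_closed by blast
            fix u assume "u \<in> ?N"
            then obtain k :: int where u: "u \<in> carrier G" "M #> u = (M #> y) [^]\<^bsub>G Mod M\<^esub> k" by blast
            have "M #> inv u = (M #> y) [^]\<^bsub>G Mod M\<^esub> (-k)"
              using \<pi>.hom_inv[OF u(1)] u(2) Q.int_pow_neg[OF Y] by simp
            then show "inv u \<in> ?N" using u(1) by blast
            fix v assume "v \<in> ?N"
            then obtain l :: int where v: "v \<in> carrier G" "M #> v = (M #> y) [^]\<^bsub>G Mod M\<^esub> l" by blast
            have "M #> (u \<otimes> v) = (M #> y) [^]\<^bsub>G Mod M\<^esub> (k + l)"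
              using \<pi>.hom_mult[OF u(1) v(1)] u(2) v(2) Q.int_pow_mult[OF Y] by simp
            then show "u \<otimes> v \<in> ?N" using u(1) v(1) by blast
          qed
          have MN: "M \<subseteq> ?N"
          proof
            fix m assume m: "m \<in> M"
            then have mG: "m \<in> carrier G" using sM(1) subgroup.subset by blast
            have "M #> m = (M #> y) [^]\<^bsub>G Mod M\<^esub> (0::int)" using q(3)[OF mG] m by simp
            then show "m \<in> ?N" using mG by blast
          qed
          have "M #> y = (M #> y) [^]\<^bsub>G Mod M\<^esub> (1::int)" using Y Q.int_pow_1 by simp
          then have "y \<in> ?N" using y by blast
          then have "M \<noteq> ?N" using False by blast
          then have "x \<in> ?N" using M(2)[of ?N] MN sN sM(3) by blast
          then obtain k :: int where k: "M #> x = (M #> y) [^]\<^bsub>G Mod M\<^esub> k" by blast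
          have yp: "(M #> y) [^]\<^bsub>G Mod M\<^esub> p = \<one>\<^bsub>G Mod M\<^esub>"
          proof -
            have "y [^] p \<in> M" using pow_p_Phi[OF y] sM(3) by blast
            then have "M #> (y [^] p) = \<one>\<^bsub>G Mod M\<^esub>" using q(3)[of "y [^] p"] y by simp
            then show ?thesis using \<pi>.hom_nat_pow[OF y, of p] by simp
          qed
          have "\<not> int p dvd k"
          proof
            assume "int p dvd k"
            then have "(M #> y) [^]\<^bsub>G Mod M\<^esub> k = (M #> y) [^]\<^bsub>G Mod M\<^esub> (0::int)"
              by (intro Q.int_pow_cong_mod[OF Y yp]) simp
            then show False using k q(3)[OF xG] sM(4) by simp
          qed
          then have "coprime (int p) k" using prime_p by (intro prime_imp_coprime) auto
          then obtain a b where "a * int p + b * k = 1" by (metis bezout_int coprime_iff_gcd_eq_1)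
          then have "1 - k * b = int p * a" by (simp add: algebra_simps)
          then have "int p dvd 1 - k * b" by simp
          then have "(M #> y) [^]\<^bsub>G Mod M\<^esub> (1::int) = (M #> y) [^]\<^bsub>G Mod M\<^esub> (k * b)"
            by (intro Q.int_pow_cong_mod[OF Y yp])
          also have "\<dots> = (M #> x) [^]\<^bsub>G Mod M\<^esub> b" using Q.int_pow_pow[OF Y, of k b] k by simp
          also have "\<dots> = M #> (x [^] b)" by (rule \<pi>.hom_int_pow[OF xG, symmetric])
          finally have "M #> y = M #> (x [^] b)" using Q.int_pow_1[OF Y] by simp
          then have "y \<otimes> inv (x [^] b) \<in> K"
            using coset_eq_iff[OF sM(1) y, of "x [^] b"] xG K(2) by auto
          then have "y \<otimes> inv (x [^] b) \<otimes> x [^] b \<in> K"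
            by (rule subgroup.m_closed[OF K(1)]) (rule subgroup_int_pow_closed[OF K(1) xK])
          then show ?thesis using y xG by (simp add: m_assoc)
        qed (use K(2) in blast)
        then show ?thesis using K(1) subgroup.subset by blast
      qed simp
    qed
    then show False using x sM(4) by (auto simp: frattini_def)
  qed
qed

text \<open>All subgroup orders are powers of p, so adjoining an outside element multiplies the
  order by at least p, and d such steps exhaust the group.\<close>

lemma few_generators:
  "\<lbrakk>subgroup S G; order G \<le> p ^ d * card S\<rbrakk> \<Longrightarrow>
   \<exists>x. (\<forall>i<d. x i \<in> carrier G) \<and> (\<forall>T. subgroup T G \<longrightarrow> S \<subseteq> T \<longrightarrow> (\<forall>i<d. x i \<in> T) \<longrightarrow> T = carrier G)"
proof (induction d arbitrary: S)
  case 0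
  have "S = carrier G"
    using 0 fin subgroup.subset[OF 0(1)] by (intro card_seteq) (auto simp: order_def)
  then show ?case by (auto dest: subgroup.subset)
next
  case (Suc d)
  show ?case
  proof (cases "S = carrier G")
    case True
    then show ?thesis by (intro exI[of _ "\<lambda>_. \<one>"]) (auto dest: subgroup.subset)
  next
    case False
    then obtain y where y: "y \<in> carrier G" "y \<notin> S" using subgroup.subset[OF Suc.prems(1)] by blast
    let ?S = "generate G (insert y S)"
    have sub: "insert y S \<subseteq> carrier G" using y subgroup.subset[OF Suc.prems(1)] by blast
    have S': "subgroup ?S G" by (rule generate_is_subgroup[OF sub])
    have yS: "y \<in> ?S" "S \<subseteq> ?S" by (auto intro: generate.incl)
    obtain n where n: "order G = p ^ n" using ord by blast
    have "card S dvd p ^ n" using lagrange[OF Suc.prems(1)] n by (metis dvd_triv_right)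
    moreover have "card ?S dvd p ^ n" using lagrange[OF S'] n by (metis dvd_triv_right)
    ultimately obtain i j where ij: "card S = p ^ i" "card ?S = p ^ j"
      using divides_primepow_nat[OF prime_p] by metis
    have "card S < card ?S"
      using yS y(2) subgroup.subset[OF S'] fin by (intro psubset_card_mono) (auto intro: finite_subset)
    then have "i < j" using ij p_gt_2 by simp
    then have "p ^ Suc i \<le> p ^ j" using p_gt_2 by (intro power_increasing) auto
    then have "p * card S \<le> card ?S" using ij by simp
    then have "p ^ d * (p * card S) \<le> p ^ d * card ?S" by (rule mult_le_mono2)
    moreover have "p ^ Suc d * card S = p ^ d * (p * card S)" by simp
    ultimately have "order G \<le> p ^ d * card ?S" using Suc.prems(2) by linarith
    then obtain x where x: "\<forall>i<d. x i \<in> carrier G"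
      "\<And>T. subgroup T G \<Longrightarrow> ?S \<subseteq> T \<Longrightarrow> \<forall>i<d. x i \<in> T \<Longrightarrow> T = carrier G" using Suc.IH[OF S'] by metis
    show ?thesis
    proof (intro exI[of _ "x(d := y)"] conjI allI impI)
      show "(x(d := y)) i \<in> carrier G" if "i < Suc d" for i using that x(1) y by auto
      fix T assume T: "subgroup T G" "S \<subseteq> T" "\<forall>i<Suc d. (x(d := y)) i \<in> T"
      have "y \<in> T" using T(3) by auto
      then have "?S \<subseteq> T" using T by (intro generate_least) auto
      moreover have "\<forall>i<d. x i \<in> T" using T(3) by (metis fun_upd_apply less_SucI nat_neq_iff)
      ultimately show "T = carrier G" using x(2) T(1) by blast
    qed
  qed
qed

text \<open>G/S is abelian, so the p-th powers form a subgroup of it, and the assumption makes every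
  element a p-th power modulo \<open>S\<close>. Iterating, every element is modulo \<open>S\<close>
  a power whose exponent is the order of the group.\<close>

lemma burnside_basis:
  assumes S: "subgroup S G" "\<gamma>2 \<subseteq> S" and gen: "\<And>x. x \<in> carrier G \<Longrightarrow> \<exists>s\<in>S. x \<otimes> inv s \<in> Phi"
  shows "S = carrier G"
proof -
  note q = quotient_above_gamma2[OF S]
  interpret Q: comm_group "G Mod S" by (rule q(1))
  interpret \<pi>: group_hom G "G Mod S" "\<lambda>x. S #> x" by (rule q(2))
  let ?R = "{x \<in> carrier G. \<exists>y\<in>carrier G. S #> x = S #> (y [^] p)}"
  have sR: "subgroup ?R G"
  proof
    show "?R \<subseteq> carrier G" by blast
    have "S #> \<one> = S #> (\<one> [^] p)" by simp
    then show "\<one> \<in> ?R" using one_closed by blast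
    fix u assume "u \<in> ?R"
    then obtain y where u: "u \<in> carrier G" "y \<in> carrier G" "S #> u = S #> (y [^] p)" by blast
    have "S #> inv u = S #> ((inv y) [^] p)"
      using u \<pi>.hom_inv[OF u(1)] \<pi>.hom_inv[of "y [^] p"] by (simp add: nat_pow_inv)
    then show "inv u \<in> ?R" using u by blast
    fix v assume "v \<in> ?R"
    then obtain z where v: "v \<in> carrier G" "z \<in> carrier G" "S #> v = S #> (z [^] p)" by blast
    have "S #> (u \<otimes> v) = S #> ((y \<otimes> z) [^] p)"
      using u v \<pi>.hom_closed[OF u(2)] \<pi>.hom_closed[OF v(2)]
      by (simp add: \<pi>.hom_mult \<pi>.hom_nat_pow Q.pow_mult_distrib Q.m_comm del: mult_FactGroup)
    then show "u \<otimes> v \<in> ?R" using u v by blast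
  qed
  have "power_subgroup G p (carrier G) \<subseteq> ?R"
    unfolding power_subgroup_def by (rule generate_least[OF sR]) auto
  moreover have SR: "S \<subseteq> ?R"
  proof
    fix s assume s: "s \<in> S"
    then have sG: "s \<in> carrier G" using S(1) subgroup.subset by blast
    have "S #> s = S #> (\<one> [^] p)" using q(3)[OF sG] q(3)[OF one_closed] s subgroup.one_closed[OF S(1)] by simp
    then show "s \<in> ?R" using sG one_closed by blast
  qed
  ultimately have PR: "Phi \<subseteq> ?R"
    unfolding Phi_def using S(2) by (intro set_mult_least[OF sR]) auto
  have all: "\<exists>y\<in>carrier G. S #> x = S #> (y [^] p)" if x: "x \<in> carrier G" for x
  proof -
    obtain s where s: "s \<in> S" "x \<otimes> inv s \<in> Phi" using gen[OF x] by blast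
    have sG: "s \<in> carrier G" using s S(1) subgroup.subset by blast
    have "x \<otimes> inv s \<otimes> s \<in> ?R"
      by (rule subgroup.m_closed[OF sR]) (use s PR SR in blast)+
    then show ?thesis using x sG by (simp add: m_assoc)
  qed
  have it: "\<exists>y\<in>carrier G. S #> x = S #> (y [^] (p ^ n))" if x: "x \<in> carrier G" for x n
  proof (induction n)
    case 0 show ?case using x by (intro bexI[of _ x]) auto
  next
    case (Suc n)
    then obtain y where y: "y \<in> carrier G" "S #> x = S #> (y [^] (p ^ n))" by blast
    obtain z where z: "z \<in> carrier G" "S #> y = S #> (z [^] p)" using all[OF y(1)] by blast
    have "S #> (y [^] (p ^ n)) = S #> ((z [^] p) [^] (p ^ n))"
      using \<pi>.hom_nat_pow[OF y(1)] \<pi>.hom_nat_pow[of "z [^] p"] z by simp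
    then show ?case using y z by (auto simp: nat_pow_pow)
  qed
  obtain n where n: "order G = p ^ n" using ord by blast
  show ?thesis
  proof
    show "S \<subseteq> carrier G" by (rule subgroup.subset[OF S(1)])
    show "carrier G \<subseteq> S"
    proof
      fix x assume x: "x \<in> carrier G"
      obtain y where y: "y \<in> carrier G" "S #> x = S #> (y [^] (p ^ n))" using it[OF x] by blast
      have "y [^] (p ^ n) = \<one>" using pow_order_eq_1[OF y(1)] n by simp
      then show "x \<in> S" using y(2) q(3)[OF x] q(3)[OF one_closed] subgroup.one_closed[OF S(1)] by simp
    qed
  qed
qed

lemma e_JJ_pow:
  assumes g: "g \<in> carrier G"
  shows "eqm JJ (e (g [^] (n::nat)) - 1) (of_nat n * (e g - 1))"
proof (induction n)
  case 0 show ?case using eqm_mono[OF K0_JJ e_one] by (simp add: eqm_def)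
next
  case (Suc n)
  have "eqm JJ (e (g [^] n \<otimes> g) - 1) ((e (g [^] n) - 1) + (e g - 1))" using g by (intro e_JJ_mult) auto
  moreover have "eqm JJ ((e (g [^] n) - 1) + (e g - 1)) (of_nat n * (e g - 1) + (e g - 1))"
    by (rule eqm_add[OF JD(1) Suc eqm_refl[OF JD(1)]])
  ultimately have "eqm JJ (e (g [^] Suc n) - 1) (of_nat n * (e g - 1) + (e g - 1))"
    using eqm_trans[OF JD(1)] by simp
  then show ?case by (simp add: distrib_right add.commute)
qed

lemma e_JJ_gprod:
  "\<forall>i<r. g i \<in> carrier G \<Longrightarrow> eqm JJ (e (gprod G g a r) - 1) (\<Sum>i<r. of_nat (a i) * (e (g i) - 1))"
proof (induction r)
  case 0 show ?case using eqm_mono[OF K0_JJ e_one] by (simp add: eqm_def)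
next
  case (Suc r)
  have g: "g r \<in> carrier G" "gprod G g a r \<in> carrier G" using Suc.prems gprod_closed[of r g a] by auto
  have "eqm JJ (e (gprod G g a r \<otimes> g r [^] a r) - 1) ((e (gprod G g a r) - 1) + (e (g r [^] a r) - 1))"
    using g by (intro e_JJ_mult) auto
  moreover have "eqm JJ ((e (gprod G g a r) - 1) + (e (g r [^] a r) - 1))
      ((\<Sum>i<r. of_nat (a i) * (e (g i) - 1)) + of_nat (a r) * (e (g r) - 1))"
    using Suc by (intro eqm_add[OF JD(1)] e_JJ_pow g) auto
  ultimately show ?case using eqm_trans[OF JD(1)] by simp
qed

lemma spans_generate:
  assumes g: "\<forall>i<r. g i \<in> carrier G" and sp: "spans (\<lambda>i. e (g i) - 1) r"
    and S: "subgroup S G" "\<gamma>2 \<subseteq> S" "\<forall>i<r. g i \<in> S"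
  shows "S = carrier G"
proof (rule burnside_basis[OF S(1,2)])
  fix x assume x: "x \<in> carrier G"
  obtain n :: "nat \<Rightarrow> int" where n: "eqm JJ (e x - 1) (\<Sum>i<r. of_int (n i) * (e (g i) - 1))"
    using sp e_I[OF x] unfolding spans_def by blast
  define a where "a i = nat (n i mod int p)" for i
  let ?s = "gprod G g a r"
  have pp: "int p > 0" using p_gt_2 by simp
  have "eqm JJ (\<Sum>i<r. of_int (n i) * (e (g i) - 1)) (\<Sum>i<r. of_nat (a i) * (e (g i) - 1))"
  proof (intro eqm_sum JD(1) eqm_mult[OF tideal_JJ _ eqm_refl[OF JD(1)]])
    fix i
    have "of_nat (a i) = (of_int (n i mod int p) :: 'r)"
      using pp by (simp add: a_def of_nat_nat)
    moreover have "int p dvd n i - n i mod int p" by (simp add: minus_mod_eq_mult_div)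
    then have "(of_int (n i - n i mod int p) :: 'r) \<in> JJ" using p_dvd_K0 K0_JJ by blast
    ultimately show "eqm JJ (of_int (n i)) (of_nat (a i) :: 'r)" by (simp add: eqm_def)
  qed
  then have "eqm JJ (e x - 1) (e ?s - 1)"
    using eqm_trans[OF JD(1) eqm_trans[OF JD(1) n] eqm_sym[OF JD(1) e_JJ_gprod[OF g]]] by blast
  then have "eqm JJ (e x) (e ?s)" by (simp add: eqm_def)
  then have "x \<otimes> inv ?s \<in> Phi" by (rule e_JJ_Phi[OF x gprod_closed[OF g]])
  moreover have "?s \<in> S"
    using S(3) subgroup_pow_closed[OF S(1)] by (intro gprod_subgroup[OF S(1)]) auto
  ultimately show "\<exists>s\<in>S. x \<otimes> inv s \<in> Phi" by blast
qed

subsection \<open>The commutator form\<close>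

text \<open>The unit on the left in \<open>e_commutator\<close> is 1 modulo \<open>I\<close>, so it
  disappears modulo IA.\<close>

lemma comm_form:
  assumes x: "x \<in> carrier G" and y: "y \<in> carrier G"
  shows "eqm LL (e (commutator G x y) - 1) ((e x - 1) * (e y - 1) - (e y - 1) * (e x - 1))"
proof -
  let ?c = "(e x - 1) * (e y - 1) - (e y - 1) * (e x - 1)" and ?u = "e (inv x) * e (inv y)"
  have "eqm LL (e (commutator G x y) - 1) (?u * ?c)" by (rule eqm_mono[OF K0_LL e_commutator[OF x y]])
  moreover have "eqm LL (?u * ?c) ?c"
  proof -
    have "?u - 1 = (e (inv x) - 1) * e (inv y) + (e (inv y) - 1)" by (simp add: algebra_simps)
    also have "\<dots> \<in> I" using x y by (intro ID(5,7) e_I) auto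
    finally have "(?u - 1) * ?c \<in> LL" by (rule IA_LL[OF _ comm_AA])
    then show ?thesis by (simp add: eqm_def left_diff_distrib)
  qed
  ultimately show ?thesis by (rule eqm_trans[OF LD(1)])
qed

definition Idx :: "nat \<Rightarrow> (nat \<times> nat) set" where
  "Idx d = {(i, j). i < j \<and> j < d}"

lemma Idx: "finite (Idx d)" "card (Idx d) = d choose 2"
proof -
  have "finite (Idx d) \<and> card (Idx d) = d choose 2"
  proof (induction d)
    case 0 then show ?case by (simp add: Idx_def)
  next
    case (Suc d)
    have e: "Idx (Suc d) = Idx d \<union> (\<lambda>i. (i, d)) ` {..<d}" by (auto simp: Idx_def)
    have "card (Idx (Suc d)) = card (Idx d) + card ((\<lambda>i. (i, d)) ` {..<d})"
      unfolding e using Suc by (intro card_Un_disjoint) (auto simp: Idx_def)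
    also have "card ((\<lambda>i. (i, d)) ` {..<d}) = d" by (subst card_image) (auto simp: inj_on_def)
    finally have c: "card (Idx (Suc d)) = (d choose 2) + d" using Suc by simp
    have "finite (Idx (Suc d))" unfolding e using Suc by simp
    then show ?case using c by (simp add: numeral_2_eq_2)
  qed
  then show "finite (Idx d)" "card (Idx d) = d choose 2" by auto
qed

definition Cm :: "(nat \<Rightarrow> 'a) \<Rightarrow> nat \<times> nat \<Rightarrow> 'r" where
  "Cm g ij = e (commutator G (g (fst ij)) (g (snd ij))) - 1"

lemma UU_comm_LL:
  assumes "x \<in> UU" "y \<in> I"
  shows "x * y - y * x \<in> LL"
proof -
  obtain z where z: "z * y - y * z \<in> K0" "x - z \<in> JJ" using assms(1) by (auto simp: UU_def)
  have "- (y * (x - z) - (x - z) * y) + (z * y - y * z) \<in> LL"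
    by (rule LD(5)[OF LD(4)[OF comm_IJ_LL[OF assms(2) z(2)]] subsetD[OF K0_LL z(1)]])
  also have "- (y * (x - z) - (x - z) * y) + (z * y - y * z) = x * y - y * x"
    by (simp add: algebra_simps)
  finally show ?thesis .
qed

lemma int_comb_add_closed:
  assumes J: "tideal J"
  shows "add_closed {a. \<exists>n::'i \<Rightarrow> int. eqm J a (\<Sum>i\<in>X. of_int (n i) * v i)}"
  unfolding add_closed_def
proof (intro conjI ballI)
  show "0 \<in> {a. \<exists>n::'i \<Rightarrow> int. eqm J a (\<Sum>i\<in>X. of_int (n i) * v i)}"
    by (auto intro!: exI[of _ "\<lambda>_. 0"] eqm_refl tidealD(1)[OF J])
  fix a b assume "a \<in> {a. \<exists>n::'i \<Rightarrow> int. eqm J a (\<Sum>i\<in>X. of_int (n i) * v i)}"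
    "b \<in> {a. \<exists>n::'i \<Rightarrow> int. eqm J a (\<Sum>i\<in>X. of_int (n i) * v i)}"
  then obtain n m :: "'i \<Rightarrow> int" where "eqm J a (\<Sum>i\<in>X. of_int (n i) * v i)" "eqm J b (\<Sum>i\<in>X. of_int (m i) * v i)"
    by blast
  from eqm_diff[OF tidealD(1)[OF J] this]
  have "eqm J (a - b) (\<Sum>i\<in>X. of_int (n i - m i) * v i)"
    by (simp add: sum_subtractf left_diff_distrib)
  then show "a - b \<in> {a. \<exists>n::'i \<Rightarrow> int. eqm J a (\<Sum>i\<in>X. of_int (n i) * v i)}"
    by (auto intro: exI[of _ "\<lambda>i. n i - m i"])
qed

lemma comm_int_comb:
  fixes v :: "'i \<Rightarrow> 'r"
  shows "x * (\<Sum>i\<in>X. of_int (n i) * v i) - (\<Sum>i\<in>X. of_int (n i) * v i) * x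
    = (\<Sum>i\<in>X. of_int (n i) * (x * v i - v i * x))"
proof -
  have "x * (of_int (n i) * v i) = of_int (n i) * (x * v i)" for i
    using mult_of_int_commute[of "n i" x] by (metis mult.assoc)
  then show ?thesis
    by (simp only: sum_distrib_left sum_distrib_right sum_subtractf[symmetric] right_diff_distrib mult.assoc)
qed

text \<open>By \<open>comm_IJ_LL\<close> the ring commutator is a bilinear alternating map on I/J
  with values in A/L, so its values are combinations of the values on pairs of the spanning family.
  A pair with an index \<ge> d contributes nothing by \<open>UU_comm_LL\<close>. Through
  \<open>comm_form\<close> and the additivity of m \<mapsto> m - 1 this reaches all of \<gamma>2,
  and through \<open>AA_rep\<close> all of \<open>AA\<close>.\<close>

lemma commutators_span:
  assumes g: "\<forall>i<r. g i \<in> carrier G" and sp: "spans (\<lambda>i. e (g i) - 1) r" and dr: "d \<le> r"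
    and U: "\<forall>i<r. d \<le> i \<longrightarrow> e (g i) - 1 \<in> UU" and a: "a \<in> AA"
  shows "\<exists>n::nat \<times> nat \<Rightarrow> int. eqm LL a (\<Sum>ij\<in>Idx d. of_int (n ij) * Cm g ij)"
proof -
  let ?V = "{a. \<exists>n::nat \<times> nat \<Rightarrow> int. eqm LL a (\<Sum>ij\<in>Idx d. of_int (n ij) * Cm g ij)}"
  have acV: "add_closed ?V" by (rule int_comb_add_closed[OF tideal_LL])
  note V = add_closedD[OF acV]
  have Veq: "x \<in> ?V" if "eqm LL x y" "y \<in> ?V" for x y using that eqm_trans[OF LD(1)] by blast
  have LV: "x \<in> ?V" if "x \<in> LL" for x using Veq[of x 0] that V(1) by (simp add: eqm_def)
  let ?v = "\<lambda>i. e (g i) - 1"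
  let ?b = "\<lambda>x y. x * y - y * x"
  have vI: "?v i \<in> I" if "i < r" for i using g that e_I by blast
  have bU: "?b x y \<in> ?V" if "x \<in> UU" "y \<in> I" for x y using UU_comm_LL[OF that] by (rule LV)
  have sw: "?b y x \<in> ?V" if "?b x y \<in> ?V" for x y using V(3)[OF that] by simp
  have b0: "?b (?v i) (?v j) \<in> ?V" if ij: "i < j" "j < r" for i j
  proof (cases "j < d")
    case True
    then have m: "(i, j) \<in> Idx d" using ij by (simp add: Idx_def)
    have "Cm g (i, j) = (\<Sum>kl\<in>Idx d. if kl = (i, j) then Cm g kl else 0)"
      using m Idx(1) by (simp add: sum.delta)
    also have "\<dots> = (\<Sum>kl\<in>Idx d. of_int (if kl = (i, j) then 1 else 0) * Cm g kl)"
      by (intro sum.cong) auto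
    finally have "eqm LL (Cm g (i, j)) (\<Sum>kl\<in>Idx d. of_int (if kl = (i, j) then 1 else 0) * Cm g kl)"
      using eqm_refl[OF LD(1)] by metis
    then have "Cm g (i, j) \<in> ?V"
      by (intro CollectI exI[of _ "\<lambda>kl. if kl = (i, j) then 1 else 0"])
    moreover have "eqm LL (?b (?v i) (?v j)) (Cm g (i, j))"
      unfolding Cm_def using comm_form[of "g i" "g j"] g ij eqm_sym[OF LD(1)] by simp
    ultimately show ?thesis using Veq by blast
  next
    case False
    then show ?thesis using U ij vI[of i] by (intro sw[OF bU]) auto
  qed
  have b1: "?b (?v i) (?v j) \<in> ?V" if ij: "i < r" "j < r" for i j
    using b0[of i j] sw[OF b0[of j i]] ij V(1) by (cases i j rule: linorder_cases) auto
  have bJ: "?b x y \<in> ?V" if "x \<in> I" "y \<in> JJ" for x y by (rule LV[OF comm_IJ_LL[OF that]])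
  have ext: "?b x y \<in> ?V" if x: "x \<in> I" and y: "y \<in> I" and bv: "\<And>j. j < r \<Longrightarrow> ?b x (?v j) \<in> ?V" for x y
  proof -
    obtain n :: "nat \<Rightarrow> int" where n: "eqm JJ y (\<Sum>i<r. of_int (n i) * ?v i)"
      using sp y unfolding spans_def by blast
    let ?s = "\<Sum>i<r. of_int (n i) * ?v i"
    have "?b x ?s = (\<Sum>i<r. of_int (n i) * ?b x (?v i))"
      by (rule comm_int_comb)
    also have "\<dots> \<in> ?V" by (intro add_closed_sum[OF acV] add_closed_of_int[OF acV] bv) simp
    finally have 1: "?b x ?s \<in> ?V" .
    have 2: "?b x (y - ?s) \<in> ?V" by (rule bJ[OF x n[unfolded eqm_def]])
    have "?b x y = ?b x w + ?b x (y - w)" for w by (simp add: algebra_simps)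
    then show ?thesis using V(4)[OF 1 2] by metis
  qed
  have b2: "?b x y \<in> ?V" if x: "x \<in> I" and y: "y \<in> I" for x y
    by (rule ext[OF x y], rule sw, rule ext[OF _ x]) (use vI b1 in auto)
  let ?M = "{m \<in> \<gamma>2. e m - 1 \<in> ?V}"
  have Mm: "e m - 1 \<in> ?V \<Longrightarrow> e m' - 1 \<in> ?V \<Longrightarrow> e (m \<otimes> m') - 1 \<in> ?V" if "m \<in> \<gamma>2" "m' \<in> \<gamma>2" for m m'
    using Veq[OF eqm_mono[OF KK_LL e_AA_mult] V(4)] that gamma2_Dk gamma2_carrier by blast
  have "subgroup ?M G"
  proof
    show "?M \<subseteq> carrier G" using gamma2_carrier by blast
    show "\<one> \<in> ?M" using subgroup.one_closed[OF gamma2_sub] LV K0_LL e_one by (auto simp: eqm_def)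
    show "inv x \<in> ?M" if "x \<in> ?M" for x
      using that Veq[OF eqm_mono[OF KK_LL e_AA_inv] V(3)] gamma2_Dk subgroup.m_inv_closed[OF gamma2_sub] by blast
    show "x \<otimes> y \<in> ?M" if "x \<in> ?M" "y \<in> ?M" for x y
      using that Mm subgroup.m_closed[OF gamma2_sub] by blast
  qed
  moreover have "{commutator G a b |a b. a \<in> carrier G \<and> b \<in> carrier G} \<subseteq> ?M"
    using commutator_gamma2 Veq[OF comm_form b2[OF e_I e_I]] by blast
  ultimately have "\<gamma>2 \<subseteq> ?M" unfolding gamma2_eq commutator_subgroup_def by (rule generate_least)
  moreover obtain m where "m \<in> \<gamma>2" "eqm KK a (e m - 1)" using AA_rep[OF a] by blast
  ultimately have "a \<in> ?V" using Veq[OF eqm_mono[OF KK_LL]] by blast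
  then show ?thesis by blast
qed

lemma mod_p_eqm:
  fixes n m :: "'i \<Rightarrow> int"
  assumes J: "tideal J" "K0 \<subseteq> J" and nm: "\<And>i. i \<in> X \<Longrightarrow> int p dvd n i - m i"
  shows "eqm J (\<Sum>i\<in>X. of_int (n i) * v i) (\<Sum>i\<in>X. of_int (m i) * v i)"
proof (intro eqm_sum tidealD(1)[OF J(1)] eqm_mult[OF J(1) _ eqm_refl[OF tidealD(1)[OF J(1)]]])
  fix i assume "i \<in> X"
  then have "(of_int (n i - m i) :: 'r) \<in> J" using p_dvd_K0[OF nm] J(2) by blast
  then show "eqm J (of_int (n i)) (of_int (m i) :: 'r)" by (simp add: eqm_def)
qed

text \<open>A/L corresponds to \<gamma>2 modulo \<open>gN3\<close>, which by hypothesis (2) has as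
  many elements as there are coefficient vectors modulo p. These vectors already reach every class,
  so distinct ones give distinct classes.\<close>

lemma commutators_indep:
  assumes g: "\<forall>i<r. g i \<in> carrier G" and sp: "spans (\<lambda>i. e (g i) - 1) r" and dr: "d \<le> r"
    and U: "\<forall>i<r. d \<le> i \<longrightarrow> e (g i) - 1 \<in> UU"
    and crd: "order (G\<lparr>carrier := \<gamma>2\<rparr> Mod gN3) = p ^ (d choose 2)"
    and n: "(\<Sum>ij\<in>Idx d. of_int (n ij) * Cm g ij) \<in> LL" and ij: "ij \<in> Idx d"
  shows "int p dvd n ij"
proof -
  let ?c = "\<lambda>n::nat \<times> nat \<Rightarrow> int. \<Sum>ij\<in>Idx d. of_int (n ij) * Cm g ij"
  have pp: "int p > 0" using p_gt_2 by simp
  have gG: "g i \<in> carrier G" if "i < d" for i using g that dr by simp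
  have CA: "Cm g ij \<in> AA" if "ij \<in> Idx d" for ij
  proof -
    have "commutator G (g (fst ij)) (g (snd ij)) \<in> \<gamma>2"
      using that by (intro commutator_gamma2 gG) (auto simp: Idx_def)
    then show ?thesis using gamma2_Dk by (auto simp: Cm_def Dk_iff)
  qed
  have cA: "?c n \<in> AA" for n by (intro add_closed_sum AD(1,6) CA)
  define m where "m n = (SOME x. x \<in> \<gamma>2 \<and> eqm KK (?c n) (e x - 1))" for n
  have m: "m n \<in> \<gamma>2" "eqm KK (?c n) (e (m n) - 1)" for n
  proof -
    have "\<exists>x. x \<in> \<gamma>2 \<and> eqm KK (?c n) (e x - 1)" using AA_rep[OF cA] by blast
    then have "m n \<in> \<gamma>2 \<and> eqm KK (?c n) (e (m n) - 1)" unfolding m_def by (rule someI_ex)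
    then show "m n \<in> \<gamma>2" "eqm KK (?c n) (e (m n) - 1)" by auto
  qed
  have mG: "m n \<in> carrier G" for n using m(1) gamma2_carrier by blast
  have sN: "subgroup gN3 G" by (rule normal_imp_subgroup[OF gN_normal(1)])
  have coset: "gN3 #> x = gN3 #> m n \<longleftrightarrow> eqm LL (e x - 1) (?c n)" if x: "x \<in> carrier G" for x n
  proof -
    have "gN3 #> x = gN3 #> m n \<longleftrightarrow> eqm LL (e x) (e (m n))"
      using coset_eq_iff[OF sN x mG] e_eqm_iff[OF tideal_LL K0_LL x mG] Dk_LL by simp
    also have "\<dots> \<longleftrightarrow> eqm LL (e x - 1) (e (m n) - 1)" by (simp add: eqm_def)
    also have "\<dots> \<longleftrightarrow> eqm LL (e x - 1) (?c n)"
      using eqm_mono[OF KK_LL m(2)[of n]] eqm_trans[OF LD(1)] eqm_sym[OF LD(1)] by meson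
    finally show ?thesis .
  qed
  \<comment> \<open>Coefficient vectors reduced modulo p and undefined outside \<open>Idx d\<close>,
    so that their number is exactly p^(d choose 2).\<close>
  let ?F = "PiE (Idx d) (\<lambda>_. {0..<int p})"
  let ?B = "carrier (G\<lparr>carrier := \<gamma>2\<rparr> Mod gN3)"
  have cB: "?B = (\<lambda>x. gN3 #> x) ` \<gamma>2" by (simp add: carrier_FactGroup)
  define red where "red n = restrict (\<lambda>ij. n ij mod int p) (Idx d)" for n :: "nat \<times> nat \<Rightarrow> int"
  have red: "red n \<in> ?F" for n unfolding red_def using pp by auto
  have cred: "eqm LL (?c n) (?c (red n))" for n
    by (rule mod_p_eqm[OF tideal_LL K0_LL]) (simp add: red_def minus_mod_eq_mult_div)
  have surj: "(\<lambda>n. gN3 #> m n) ` ?F = ?B"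
  proof
    show "(\<lambda>n. gN3 #> m n) ` ?F \<subseteq> ?B" unfolding cB using m(1) by blast
    show "?B \<subseteq> (\<lambda>n. gN3 #> m n) ` ?F"
      unfolding cB
    proof
      fix y assume "y \<in> (\<lambda>x. gN3 #> x) ` \<gamma>2"
      then obtain x where x: "x \<in> \<gamma>2" "y = gN3 #> x" by blast
      have xG: "x \<in> carrier G" "e x - 1 \<in> AA" using x gamma2_carrier gamma2_Dk by (auto simp: Dk_iff)
      obtain n where "eqm LL (e x - 1) (?c n)" using commutators_span[OF g sp dr U xG(2)] by blast
      then have "eqm LL (e x - 1) (?c (red n))" by (rule eqm_trans[OF LD(1) _ cred])
      then have "y = gN3 #> m (red n)" using coset[OF xG(1)] x(2) by simp
      then show "y \<in> (\<lambda>n. gN3 #> m n) ` ?F" using red by blast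
    qed
  qed
  have finF: "finite ?F" by (intro finite_PiE Idx(1)) simp
  have "card ?F = p ^ (d choose 2)" by (subst card_PiE[OF Idx(1)]) (simp add: Idx(2))
  then have "card ((\<lambda>n. gN3 #> m n) ` ?F) = card ?F" unfolding surj using crd by (simp add: order_def)
  then have inj: "inj_on (\<lambda>n. gN3 #> m n) ?F" by (rule eq_card_imp_inj_on[OF finF])
  have z: "?c (red (\<lambda>_. 0)) = 0" by (intro sum.neutral) (simp add: red_def)
  have "eqm LL (e (m (red n)) - 1) (?c (red (\<lambda>_. 0)))"
  proof -
    have "eqm LL (e (m (red n)) - 1) (?c (red n))" by (rule eqm_sym[OF LD(1) eqm_mono[OF KK_LL m(2)]])
    then have "eqm LL (e (m (red n)) - 1) (?c n)" by (rule eqm_trans[OF LD(1) _ eqm_sym[OF LD(1) cred]])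
    then show ?thesis unfolding z using n eqm_mem[OF LD(1)] by (simp add: eqm_def)
  qed
  then have "gN3 #> m (red n) = gN3 #> m (red (\<lambda>_. 0))" using coset[OF mG] by simp
  then have "red n = red (\<lambda>_. 0)" using inj_onD[OF inj] red by blast
  then have "red n ij = red (\<lambda>_. 0) ij" by simp
  then show ?thesis using ij by (simp add: red_def mod_eq_0_iff_dvd)
qed

end

section \<open>Two groups with the same group algebra\<close>

context ideal_tower
begin

lemma eqm_UU: "eqm JJ x y \<Longrightarrow> y \<in> UU \<Longrightarrow> x \<in> UU"
  by (rule UU_add_JJ)

lemma JJ_UU: "x \<in> JJ \<Longrightarrow> x \<in> UU"
  unfolding UU_def by (auto intro!: exI[of _ 0] simp: K0D ID)

lemma add_closed_UU: "add_closed UU"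
  unfolding add_closed_def
proof (intro conjI ballI)
  show "0 \<in> UU" by (rule JJ_UU[OF JD(2)])
  fix x y assume "x \<in> UU" "y \<in> UU"
  then obtain z w where z: "\<And>y. z * y - y * z \<in> K0" "x - z \<in> JJ" "z \<in> I"
    and w: "\<And>y. w * y - y * w \<in> K0" "y - w \<in> JJ" "w \<in> I" by (auto simp: UU_def)
  have "(z - w) * v - v * (z - w) \<in> K0" for v
    using K0D(3)[OF z(1) w(1), of v v] by (simp add: algebra_simps)
  moreover have "x - y - (z - w) \<in> JJ" using JD(3)[OF z(2) w(2)] by (simp add: algebra_simps)
  moreover have "z - w \<in> I" by (rule ID(3)[OF z(3) w(3)])
  ultimately show "x - y \<in> UU" unfolding UU_def by blast
qed

text \<open>The exchange step of linear algebra in I/J: the coefficient of the replaced vector is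
  invertible modulo p.\<close>

lemma spans_exchange:
  assumes sp: "spans v r" and j: "j < r" "\<not> p dvd b j"
    and w: "eqm JJ w (\<Sum>i<r. of_nat (b i) * v i)"
  shows "spans (v(j := w)) r"
  unfolding spans_def
proof
  fix x assume "x \<in> I"
  then obtain n :: "nat \<Rightarrow> int" where n: "eqm JJ x (\<Sum>i<r. of_int (n i) * v i)"
    using sp unfolding spans_def by blast
  have "\<not> int p dvd int (b j)" using j by simp
  then have "coprime (int p) (int (b j))" using prime_p by (intro prime_imp_coprime) auto
  then obtain c' c where cc: "c' * int p + c * int (b j) = 1" by (metis bezout_int coprime_iff_gcd_eq_1)
  \<comment> \<open>\<open>c\<close> inverts \<open>b j\<close> modulo p, so \<open>t * w\<close>
    contributes \<open>n j\<close> at position \<open>j\<close>; what it adds at the other positions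
    is subtracted in \<open>m\<close>.\<close>
  define t where "t = n j * c"
  define m where "m i = (if i = j then t else n i - t * int (b i))" for i
  let ?R = "{..<r} - {j}"
  have split: "(\<Sum>i<r. F i) = F j + (\<Sum>i\<in>?R. F i)" for F :: "nat \<Rightarrow> 'r"
    using j by (intro sum.remove) auto
  have 1: "(\<Sum>i<r. of_int (m i) * (v(j := w)) i) = of_int t * w + (\<Sum>i\<in>?R. of_int (n i - t * int (b i)) * v i)"
    unfolding split by (intro arg_cong2[of _ _ _ _ "(+)"] sum.cong) (auto simp: m_def)
  have 2: "eqm JJ (of_int t * w) (of_int t * (\<Sum>i<r. of_nat (b i) * v i))"
    by (intro eqm_mult[OF tideal_JJ eqm_refl[OF JD(1)]] w)
  have 3: "of_int t * (\<Sum>i<r. of_nat (b i) * v i) + (\<Sum>i\<in>?R. of_int (n i - t * int (b i)) * v i)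
     = of_int (t * int (b j)) * v j + (\<Sum>i\<in>?R. of_int (n i) * v i)"
    unfolding split
    by (simp add: distrib_left sum_distrib_left left_diff_distrib sum_subtractf mult.assoc)
  have "eqm JJ (\<Sum>i<r. of_int (m i) * (v(j := w)) i) (of_int (t * int (b j)) * v j + (\<Sum>i\<in>?R. of_int (n i) * v i))"
    unfolding 1 3[symmetric] by (intro eqm_add[OF JD(1) 2] eqm_refl JD(1))
  moreover have "eqm JJ (of_int (t * int (b j)) * v j) (of_int (n j) * v j)"
  proof (intro eqm_mult[OF tideal_JJ _ eqm_refl[OF JD(1)]])
    have "t * int (b j) - n j = n j * (c * int (b j) - 1)" by (simp add: t_def algebra_simps)
    also have "c * int (b j) - 1 = - (c' * int p)" using cc by linarith
    finally have "int p dvd t * int (b j) - n j" by simp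
    then have "(of_int (t * int (b j) - n j) :: 'r) \<in> JJ" using p_dvd_K0 K0_JJ by blast
    then show "eqm JJ (of_int (t * int (b j))) (of_int (n j) :: 'r)" by (simp add: eqm_def)
  qed
  ultimately have "eqm JJ (\<Sum>i<r. of_int (m i) * (v(j := w)) i) (\<Sum>i<r. of_int (n i) * v i)"
    unfolding split[of "\<lambda>i. of_int (n i) * v i"]
    using eqm_trans[OF JD(1) _ eqm_add[OF JD(1) _ eqm_refl[OF JD(1)]]] by blast
  then show "\<exists>n::nat \<Rightarrow> int. eqm JJ x (\<Sum>i<r. of_int (n i) * (v(j := w)) i)"
    using eqm_trans[OF JD(1) n eqm_sym[OF JD(1)]] by blast
qed

lemma spans_cong:
  assumes sp: "spans v r" and vw: "\<And>i. i < r \<Longrightarrow> eqm JJ (v i) (w i)"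
  shows "spans w r"
  unfolding spans_def
proof
  fix x assume "x \<in> I"
  then obtain n :: "nat \<Rightarrow> int" where n: "eqm JJ x (\<Sum>i<r. of_int (n i) * v i)"
    using sp unfolding spans_def by blast
  have "eqm JJ (\<Sum>i<r. of_int (n i) * v i) (\<Sum>i<r. of_int (n i) * w i)"
    by (intro eqm_sum JD(1) eqm_mult[OF tideal_JJ eqm_refl[OF JD(1)]] vw) simp
  then show "\<exists>n::nat \<Rightarrow> int. eqm JJ x (\<Sum>i<r. of_int (n i) * w i)" using eqm_trans[OF JD(1) n] by blast
qed

end

lemma max_prime_power_dvd:
  fixes a :: "nat \<Rightarrow> nat"
  assumes "1 < p" "j < r" "a j \<noteq> 0"
  obtains s b where "\<forall>i<r. a i = p ^ s * b i" "\<exists>i<r. \<not> p dvd b i"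
proof -
  define P where "P s \<longleftrightarrow> (\<forall>i<r. p ^ s dvd a i)" for s
  have bd: "\<forall>s. P s \<longrightarrow> s \<le> a j"
  proof (intro allI impI)
    fix s assume "P s"
    then have "p ^ s \<le> a j" using assms unfolding P_def by (intro dvd_imp_le) auto
    moreover have "s < p ^ s" using power_gt_expt[of p s] assms(1) by simp
    ultimately show "s \<le> a j" by simp
  qed
  have "P 0" by (simp add: P_def)
  then have P: "P (Greatest P)" using GreatestI_nat[of P 0 "a j"] bd by blast
  have nP: "\<not> P (Suc (Greatest P))"
  proof
    assume "P (Suc (Greatest P))"
    then have "Suc (Greatest P) \<le> Greatest P" using Greatest_le_nat[of P _ "a j"] bd by blast
    then show False by simp
  qed
  define s where "s = Greatest P"
  define b where "b i = a i div p ^ s" for i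
  have ab: "\<forall>i<r. a i = p ^ s * b i" using P by (simp add: b_def s_def P_def)
  have "\<exists>i<r. \<not> p dvd b i"
  proof (rule ccontr)
    assume "\<not> (\<exists>i<r. \<not> p dvd b i)"
    then have "\<forall>i<r. p ^ Suc s dvd a i" using ab by (auto simp: mult_dvd_mono mult.commute)
    then show False using nP by (simp add: s_def P_def)
  qed
  then show ?thesis using that ab by blast
qed

text \<open>The assumption is hypothesis (1) in its basis-free form. The locale is therefore
  symmetric in the two groups, and each of its lemmas can be used with the groups exchanged
  (\<open>swap\<close>).\<close>

locale group_ring_pair =
  ideal_tower K0 I p + G: mod_group_ring K0 I p G e + H: mod_group_ring K0 I p H f
  for K0 I :: "'r::ring_1 set" and p :: nat
    and G :: "('a, 'm) monoid_scheme" and H :: "('b, 'n) monoid_scheme"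
    and e :: "'a \<Rightarrow> 'r" and f :: "'b \<Rightarrow> 'r" +
  assumes pow: "pow_span \<inter> AA \<subseteq> LL"
begin

text \<open>\<open>p ^ k i\<close> is some exponent that works, not an order: independence is not
  demanded here but results from minimising the sum of the \<open>k i\<close>. On the tail from
  \<open>d\<close> on, centrality is asked only modulo \<open>KK\<close> together with membership in
  \<open>UU\<close>, because an exchange may multiply central elements by p-th powers.\<close>

definition good :: "nat \<Rightarrow> nat \<Rightarrow> (nat \<Rightarrow> 'a) \<Rightarrow> (nat \<Rightarrow> 'b) \<Rightarrow> (nat \<Rightarrow> nat) \<Rightarrow> bool" where
  "good r d g h k \<longleftrightarrow>
    (\<forall>i<r. g i \<in> carrier G \<and> h i \<in> carrier H \<and> eqm JJ (e (g i)) (f (h i)) \<and>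
       e (g i [^]\<^bsub>G\<^esub> (p ^ k i)) - 1 \<in> LL \<and>
       eqm KK (e (g i [^]\<^bsub>G\<^esub> (p ^ k i))) (f (h i [^]\<^bsub>H\<^esub> (p ^ k i))) \<and>
       (d \<le> i \<longrightarrow> e (g i) - 1 \<in> UU \<and> g i \<in> G.Zk \<and> h i \<in> H.Zk)) \<and>
    spans (\<lambda>i. e (g i) - 1) r"

lemma swap: "group_ring_pair K0 I p H G f e"
  by unfold_locales (rule pow)

lemma good_swap:
  assumes "good r d g h k"
  shows "group_ring_pair.good K0 I p H G f e r d h g k"
proof -
  interpret sw: group_ring_pair K0 I p H G f e by (rule swap)
  have g: "\<And>i. i < r \<Longrightarrow> g i \<in> carrier G \<and> h i \<in> carrier H \<and> eqm JJ (e (g i)) (f (h i)) \<and>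
       e (g i [^]\<^bsub>G\<^esub> (p ^ k i)) - 1 \<in> LL \<and>
       eqm KK (e (g i [^]\<^bsub>G\<^esub> (p ^ k i))) (f (h i [^]\<^bsub>H\<^esub> (p ^ k i))) \<and>
       (d \<le> i \<longrightarrow> e (g i) - 1 \<in> UU \<and> g i \<in> G.Zk \<and> h i \<in> H.Zk)"
    and sp: "spans (\<lambda>i. e (g i) - 1) r" using assms by (auto simp: good_def)
  show ?thesis
    unfolding sw.good_def
  proof (intro conjI allI impI)
    fix i assume i: "i < r"
    show "h i \<in> carrier H" "g i \<in> carrier G" using g[OF i] by auto
    have ef: "eqm JJ (e (g i)) (f (h i))" using g[OF i] by simp
    show fe: "eqm JJ (f (h i)) (e (g i))" by (rule eqm_sym[OF JD(1) ef])
    have k: "eqm KK (e (g i [^]\<^bsub>G\<^esub> (p ^ k i))) (f (h i [^]\<^bsub>H\<^esub> (p ^ k i)))" using g[OF i] by simp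
    show k': "eqm KK (f (h i [^]\<^bsub>H\<^esub> (p ^ k i))) (e (g i [^]\<^bsub>G\<^esub> (p ^ k i)))" by (rule eqm_sym[OF KD(1) k])
    have "eqm LL (f (h i [^]\<^bsub>H\<^esub> (p ^ k i)) - 1) (e (g i [^]\<^bsub>G\<^esub> (p ^ k i)) - 1)"
      by (intro eqm_diff LD(1) eqm_refl eqm_mono[OF KK_LL k'])
    then show "f (h i [^]\<^bsub>H\<^esub> (p ^ k i)) - 1 \<in> LL" using eqm_mem[OF LD(1)] g[OF i] by blast
    assume d: "d \<le> i"
    have "eqm JJ (f (h i) - 1) (e (g i) - 1)" by (intro eqm_diff JD(1) eqm_refl fe)
    then show "f (h i) - 1 \<in> UU" using eqm_UU g[OF i] d by blast
    show "h i \<in> H.Zk" "g i \<in> G.Zk" using g[OF i] d by auto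
  next
    show "spans (\<lambda>i. f (h i) - 1) r"
      by (rule spans_cong[OF sp]) (use g in \<open>auto intro!: eqm_diff JD(1) eqm_refl\<close>)
  qed
qed

text \<open>Extracting the largest common power p^s from the exponents writes the relation modulo
  \<gamma>2 as y^(p^s), where some exponent of y is prime to p. By exchange y can replace the
  corresponding generator, with the smaller exponent s; its partner in the other group comes from
  \<open>lift\<close> or \<open>lift_central\<close>.\<close>

lemma good_reduce:
  assumes gd: "good r d g h k" and a: "\<forall>i<r. a i < p ^ k i" and j: "j < r" "a j \<noteq> 0"
    and ga: "gprod G g a r \<in> lower_central G 2"
  shows "\<exists>g' h' k'. good r d g' h' k' \<and> (\<Sum>i<r. k' i) < (\<Sum>i<r. k i)"
proof -
  have gG: "\<forall>i<r. g i \<in> carrier G" and sp: "spans (\<lambda>i. e (g i) - 1) r"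
    and gU: "\<And>i. i < r \<Longrightarrow> d \<le> i \<Longrightarrow> e (g i) - 1 \<in> UU \<and> g i \<in> G.Zk"
    using gd by (auto simp: good_def)
  obtain s b where ab: "\<forall>i<r. a i = p ^ s * b i" and ex: "\<exists>i<r. \<not> p dvd b i"
    using max_prime_power_dvd[of p j r a] j p_gt_2 by auto
  \<comment> \<open>An index below \<open>d\<close> is preferred. If only the tail offers one, all
    exponents below \<open>d\<close> are divisible by p, and this keeps y in \<open>UU\<close> and
    central modulo \<open>KK\<close>.\<close>
  obtain l where l: "l < r" "\<not> p dvd b l" "d \<le> l \<Longrightarrow> \<forall>i<r. i < d \<longrightarrow> p dvd b i"
    using ex by (metis leD)
  have "b l \<noteq> 0" using l(2) by (metis dvd_0_right)
  then have "p ^ s \<le> a l" using ab l(1) by simp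
  then have "p ^ s < p ^ k l" using a l(1) by (metis le_less_trans)
  then have skl: "s < k l" using p_gt_2 by (simp add: power_strict_increasing_iff)
  define y where "y = gprod G g b r"
  have yG: "y \<in> carrier G" unfolding y_def by (rule G.gprod_closed[OF gG])
  have yb: "eqm JJ (e y - 1) (\<Sum>i<r. of_nat (b i) * (e (g i) - 1))"
    unfolding y_def by (rule G.e_JJ_gprod[OF gG])
  have ys: "y [^]\<^bsub>G\<^esub> (p ^ s) \<in> lower_central G 2"
  proof -
    note q = G.quotient_above_gamma2[OF G.gamma2_sub order_refl]
    let ?\<pi> = "\<lambda>x. lower_central G 2 #>\<^bsub>G\<^esub> x"
    interpret Q: comm_group "G Mod lower_central G 2" by (rule q(1))
    interpret \<pi>: group_hom G "G Mod lower_central G 2" ?\<pi> by (rule q(2))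
    have c: "\<forall>i<r. ?\<pi> (g i) \<in> carrier (G Mod lower_central G 2)" using gG \<pi>.hom_closed by blast
    have "?\<pi> (y [^]\<^bsub>G\<^esub> (p ^ s)) = gprod (G Mod lower_central G 2) (\<lambda>i. ?\<pi> (g i)) b r [^]\<^bsub>G Mod lower_central G 2\<^esub> (p ^ s)"
      unfolding y_def using \<pi>.hom_nat_pow[OF G.gprod_closed[OF gG]] \<pi>.hom_gprod[OF gG] by simp
    also have "\<dots> = gprod (G Mod lower_central G 2) (\<lambda>i. ?\<pi> (g i)) (\<lambda>i. p ^ s * b i) r"
      by (rule Q.gprod_pow[OF c]) (use c Q.m_comm in blast)
    also have "\<dots> = gprod (G Mod lower_central G 2) (\<lambda>i. ?\<pi> (g i)) a r"
      by (rule Q.gprod_cong) (use ab in simp)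
    also have "\<dots> = ?\<pi> (gprod G g a r)" by (rule \<pi>.hom_gprod[OF gG, symmetric])
    also have "\<dots> = \<one>\<^bsub>G Mod lower_central G 2\<^esub>" using q(3)[OF G.gprod_closed[OF gG]] ga by blast
    finally show ?thesis using q(3)[of "y [^]\<^bsub>G\<^esub> (p ^ s)"] yG by simp
  qed
  have yU: "e y - 1 \<in> UU \<and> y \<in> G.Zk" if dl: "d \<le> l"
  proof
    have "(\<Sum>i<r. of_nat (b i) * (e (g i) - 1)) \<in> UU"
    proof (intro add_closed_sum add_closed_UU)
      fix i assume "i \<in> {..<r}"
      then have i: "i < r" by simp
      show "of_nat (b i) * (e (g i) - 1) \<in> UU"
      proof (cases "d \<le> i")
        case True
        then show ?thesis by (intro add_closed_of_nat[OF add_closed_UU]) (use gU i in blast)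
      next
        case False
        then have "int p dvd int (b i)" using l(3)[OF dl] i by simp
        then have "of_int (int (b i)) * (e (g i) - 1) \<in> JJ" by (intro JD(7) subsetD[OF K0_JJ p_dvd_K0])
        then show ?thesis using JJ_UU by simp
      qed
    qed
    then show "e y - 1 \<in> UU" using eqm_UU[OF yb] by blast
    show "y \<in> G.Zk"
      unfolding y_def
    proof (rule G.gprod_subgroup[OF G.Zk_subgroup], intro allI impI)
      fix i assume i: "i < r"
      show "g i [^]\<^bsub>G\<^esub> b i \<in> G.Zk"
      proof (cases "d \<le> i")
        case True
        then show ?thesis using G.subgroup_pow_closed[OF G.Zk_subgroup] gU i by blast
      next
        case False
        then obtain c where c: "b i = c * p" using l(3)[OF dl] i by (metis dvdE mult.commute not_le)
        have "(g i [^]\<^bsub>G\<^esub> c) [^]\<^bsub>G\<^esub> (p ^ 1) \<in> G.Zk" using gG i by (intro G.pow_Zk) auto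
        then show ?thesis using gG i by (simp add: c G.nat_pow_pow)
      qed
    qed
  qed
  have pair: "\<exists>y0 h0. y0 \<in> carrier G \<and> h0 \<in> carrier H \<and> eqm JJ (e y0) (f h0) \<and>
     e (y0 [^]\<^bsub>G\<^esub> (p ^ s)) - 1 \<in> LL \<and> eqm KK (e (y0 [^]\<^bsub>G\<^esub> (p ^ s))) (f (h0 [^]\<^bsub>H\<^esub> (p ^ s))) \<and>
     (d \<le> l \<longrightarrow> e y0 - 1 \<in> UU \<and> y0 \<in> G.Zk \<and> h0 \<in> H.Zk) \<and> eqm JJ (e y0) (e y)"
  proof (cases "s = 0")
    \<comment> \<open>Here y itself lies in \<gamma>2, so its class modulo \<open>JJ\<close> is zero
      and the identity elements can take its place; \<open>lift\<close> requires a positive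
      exponent.\<close>
    case True
    have e1: "e \<one>\<^bsub>G\<^esub> - 1 \<in> K0" and f1: "f \<one>\<^bsub>H\<^esub> - 1 \<in> K0" using G.e_one H.e_one by (auto simp: eqm_def)
    have ef: "eqm K0 (e \<one>\<^bsub>G\<^esub>) (f \<one>\<^bsub>H\<^esub>)" using K0D(3)[OF e1 f1] by (simp add: eqm_def)
    have "y \<in> lower_central G 2" using ys True yG by simp
    then have "e y - 1 \<in> JJ" using G.gamma2_Dk AA_JJ by (auto simp: G.Dk_iff subset_iff)
    then have "e \<one>\<^bsub>G\<^esub> - 1 - (e y - 1) \<in> JJ" by (rule JD(3)[OF subsetD[OF K0_JJ e1]])
    then have "eqm JJ (e \<one>\<^bsub>G\<^esub>) (e y)" by (simp add: eqm_def)
    moreover have "e \<one>\<^bsub>G\<^esub> - 1 \<in> UU" "e \<one>\<^bsub>G\<^esub> - 1 \<in> LL" using e1 K0_JJ JJ_UU K0_LL by blast+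
    ultimately show ?thesis
      using True eqm_mono[OF K0_JJ ef] eqm_mono[OF K0_KK ef]
        subgroup.one_closed[OF G.Zk_subgroup] subgroup.one_closed[OF H.Zk_subgroup]
      by (intro exI[of _ "\<one>\<^bsub>G\<^esub>"] exI[of _ "\<one>\<^bsub>H\<^esub>"]) simp
  next
    case False
    then have s: "0 < s" by simp
    have pcH: "H.pow_cond" using H.pow_cond_iff pow by blast
    have yI: "e y - 1 \<in> I" by (rule G.e_I[OF yG])
    have eys: "eqm K0 (e (y [^]\<^bsub>G\<^esub> (p ^ s))) (e y ^ (p ^ s))" by (rule G.e_pow[OF yG])
    have "e (y [^]\<^bsub>G\<^esub> (p ^ s)) - 1 \<in> AA" using ys G.gamma2_Dk by (auto simp: G.Dk_iff)
    moreover have "eqm AA (e y ^ (p ^ s) - 1) (e (y [^]\<^bsub>G\<^esub> (p ^ s)) - 1)"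
      by (intro eqm_diff AD(1) eqm_refl eqm_mono[OF K0_AA eqm_sym[OF K0D(1) eys]])
    ultimately have yA: "e y ^ (p ^ s) - 1 \<in> AA" using eqm_mem[OF AD(1)] by blast
    have "e y ^ (p ^ s) - 1 \<in> LL" by (rule H.lift(1)[OF pcH yI s yA])
    moreover have "eqm LL (e (y [^]\<^bsub>G\<^esub> (p ^ s)) - 1) (e y ^ (p ^ s) - 1)"
      by (intro eqm_diff LD(1) eqm_refl eqm_mono[OF K0_LL eys])
    ultimately have yL: "e (y [^]\<^bsub>G\<^esub> (p ^ s)) - 1 \<in> LL" using eqm_mem[OF LD(1)] by blast
    have "\<exists>h0\<in>carrier H. eqm JJ (f h0) (e y) \<and> eqm KK (f (h0 [^]\<^bsub>H\<^esub> (p ^ s))) (e y ^ (p ^ s)) \<and> (d \<le> l \<longrightarrow> h0 \<in> H.Zk)"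
    proof (cases "d \<le> l")
      case True
      then show ?thesis
        using H.lift_central[OF pcH yI s yA] yU by (auto simp: H.Zk_def)
    next
      case False
      then show ?thesis using H.lift(2)[OF pcH yI s yA] by blast
    qed
    then obtain h0 where h0: "h0 \<in> carrier H" "eqm JJ (f h0) (e y)"
      "eqm KK (f (h0 [^]\<^bsub>H\<^esub> (p ^ s))) (e y ^ (p ^ s))" "d \<le> l \<longrightarrow> h0 \<in> H.Zk" by blast
    have "eqm KK (e (y [^]\<^bsub>G\<^esub> (p ^ s))) (f (h0 [^]\<^bsub>H\<^esub> (p ^ s)))"
      by (rule eqm_trans[OF KD(1) eqm_mono[OF K0_KK eys] eqm_sym[OF KD(1) h0(3)]])
    then show ?thesis
      using yG h0 yL yU eqm_sym[OF JD(1) h0(2)] eqm_refl[OF JD(1)] by blast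
  qed
  then obtain y0 h0 where y0: "y0 \<in> carrier G" "h0 \<in> carrier H" "eqm JJ (e y0) (f h0)"
     "e (y0 [^]\<^bsub>G\<^esub> (p ^ s)) - 1 \<in> LL" "eqm KK (e (y0 [^]\<^bsub>G\<^esub> (p ^ s))) (f (h0 [^]\<^bsub>H\<^esub> (p ^ s)))"
     "d \<le> l \<longrightarrow> e y0 - 1 \<in> UU \<and> y0 \<in> G.Zk \<and> h0 \<in> H.Zk" "eqm JJ (e y0) (e y)" by blast
  have "good r d (g(l := y0)) (h(l := h0)) (k(l := s))"
    unfolding good_def
  proof
    have "eqm JJ (e y0 - 1) (e y - 1)" by (intro eqm_diff JD(1) eqm_refl y0)
    then have "eqm JJ (e y0 - 1) (\<Sum>i<r. of_nat (b i) * (e (g i) - 1))"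
      by (rule eqm_trans[OF JD(1) _ yb])
    then have "spans ((\<lambda>i. e (g i) - 1)(l := e y0 - 1)) r" by (rule spans_exchange[where b = b, OF sp l(1,2)])
    moreover have "(\<lambda>i. e (g i) - 1)(l := e y0 - 1) = (\<lambda>i. e ((g(l := y0)) i) - 1)" by auto
    ultimately show "spans (\<lambda>i. e ((g(l := y0)) i) - 1) r" by simp
  qed (use gd y0 in \<open>auto simp: good_def\<close>)
  moreover have "(\<Sum>i<r. (k(l := s)) i) < (\<Sum>i<r. k i)"
    by (rule sum_strict_mono_ex1) (use l(1) skl in auto)
  ultimately show ?thesis by blast
qed

text \<open>At the minimum of the sum of the \<open>k i\<close> a nontrivial relation in either
  group contradicts \<open>good_reduce\<close>, for the second group after an exchange of roles.
  Independence is thus obtained in both groups for one and the same tuple.\<close>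

lemma good_minimal:
  assumes "good r d g h k"
  obtains g h k where "good r d g h k"
    "\<forall>a. (\<forall>i<r. a i < p ^ k i) \<longrightarrow> gprod G g a r \<in> lower_central G 2 \<longrightarrow> (\<forall>i<r. a i = 0)"
    "\<forall>a. (\<forall>i<r. a i < p ^ k i) \<longrightarrow> gprod H h a r \<in> lower_central H 2 \<longrightarrow> (\<forall>i<r. a i = 0)"
proof -
  let ?P = "\<lambda>(g, h, k). good r d g h k"
  obtain t where t: "?P t" "\<And>u. ?P u \<Longrightarrow> (\<Sum>i<r. (snd (snd t)) i) \<le> (\<Sum>i<r. (snd (snd u)) i)"
    using ex_has_least_nat[of ?P "(g, h, k)" "\<lambda>t. \<Sum>i<r. (snd (snd t)) i"] assms by auto
  obtain g h k where "t = (g, h, k)" by (cases t)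
  with t have gd: "good r d g h k"
    and mn: "\<And>g' h' k'. good r d g' h' k' \<Longrightarrow> (\<Sum>i<r. k i) \<le> (\<Sum>i<r. k' i)" by force+
  interpret sw: group_ring_pair K0 I p H G f e by (rule swap)
  show ?thesis
  proof (rule that[OF gd]; intro allI impI; rule ccontr)
    fix a i assume a: "\<forall>i<r. a i < p ^ k i" "gprod G g a r \<in> lower_central G 2"
      and i: "i < r" "a i \<noteq> 0"
    show False using good_reduce[OF gd a(1) i a(2)] mn by (meson not_less)
  next
    fix a i assume a: "\<forall>i<r. a i < p ^ k i" "gprod H h a r \<in> lower_central H 2"
      and i: "i < r" "a i \<noteq> 0"
    obtain g' h' k' where "sw.good r d h' g' k'" "(\<Sum>i<r. k' i) < (\<Sum>i<r. k i)"
      using sw.good_reduce[OF good_swap[OF gd] a(1) i a(2)] by blast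
    then show False using sw.good_swap mn by (meson not_less)
  qed
qed

end

text \<open>Both quotients are images of \<open>D\<close> under the two projections, and
  \<open>eq\<close> says that the two homomorphisms have the same kernel.\<close>

lemma goursat_iso:
  assumes G: "group G" and H: "group H" and NG: "NG \<lhd> G" and NH: "NH \<lhd> H"
    and D: "subgroup D (G \<times>\<times> H)"
    and pG: "\<And>x. x \<in> carrier G \<Longrightarrow> \<exists>y. (x, y) \<in> D"
    and pH: "\<And>y. y \<in> carrier H \<Longrightarrow> \<exists>x. (x, y) \<in> D"
    and eq: "\<And>x y. (x, y) \<in> D \<Longrightarrow> x \<in> NG \<longleftrightarrow> y \<in> NH"
  shows "G Mod NG \<cong> H Mod NH"
proof -
  interpret G: group G by (rule G)
  interpret H: group H by (rule H)
  let ?X = "(G \<times>\<times> H)\<lparr>carrier := D\<rparr>"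
  interpret P: group "G \<times>\<times> H" by (rule DirProd_group[OF G H])
  interpret X: group ?X by (rule subgroup.subgroup_is_group[OF D P.is_group])
  have DG: "x \<in> carrier G" "y \<in> carrier H" if "(x, y) \<in> D" for x y
    using subgroup.subset[OF D] that by auto
  have QG: "group (G Mod NG)" and QH: "group (H Mod NH)"
    using normal.factorgroup_is_group NG NH by blast+
  interpret a: group_hom ?X "G Mod NG" "\<lambda>xy. NG #>\<^bsub>G\<^esub> fst xy"
  proof (unfold group_hom_def group_hom_axioms_def, intro conjI X.is_group QG homI)
    fix u v assume "u \<in> carrier ?X" "v \<in> carrier ?X"
    then obtain x y x' y' where u: "u = (x, y)" "(x, y) \<in> D" "v = (x', y')" "(x', y') \<in> D" by (cases u, cases v) auto
    show "NG #>\<^bsub>G\<^esub> fst u \<in> carrier (G Mod NG)" using u DG by (auto simp: carrier_FactGroup)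
    show "NG #>\<^bsub>G\<^esub> fst (u \<otimes>\<^bsub>?X\<^esub> v) = (NG #>\<^bsub>G\<^esub> fst u) \<otimes>\<^bsub>G Mod NG\<^esub> (NG #>\<^bsub>G\<^esub> fst v)"
      using u DG normal.rcos_sum[OF NG, of x x'] by simp
  qed
  interpret b: group_hom ?X "H Mod NH" "\<lambda>xy. NH #>\<^bsub>H\<^esub> snd xy"
  proof (unfold group_hom_def group_hom_axioms_def, intro conjI X.is_group QH homI)
    fix u v assume "u \<in> carrier ?X" "v \<in> carrier ?X"
    then obtain x y x' y' where u: "u = (x, y)" "(x, y) \<in> D" "v = (x', y')" "(x', y') \<in> D" by (cases u, cases v) auto
    show "NH #>\<^bsub>H\<^esub> snd u \<in> carrier (H Mod NH)" using u DG by (auto simp: carrier_FactGroup)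
    show "NH #>\<^bsub>H\<^esub> snd (u \<otimes>\<^bsub>?X\<^esub> v) = (NH #>\<^bsub>H\<^esub> snd u) \<otimes>\<^bsub>H Mod NH\<^esub> (NH #>\<^bsub>H\<^esub> snd v)"
      using u DG normal.rcos_sum[OF NH, of y y'] by simp
  qed
  have sa: "(\<lambda>xy. NG #>\<^bsub>G\<^esub> fst xy) ` carrier ?X = carrier (G Mod NG)"
  proof
    show "carrier (G Mod NG) \<subseteq> (\<lambda>xy. NG #>\<^bsub>G\<^esub> fst xy) ` carrier ?X"
    proof
      fix q assume "q \<in> carrier (G Mod NG)"
      then obtain x where x: "x \<in> carrier G" "q = NG #>\<^bsub>G\<^esub> x" by (auto simp: carrier_FactGroup)
      obtain y where "(x, y) \<in> D" using pG[OF x(1)] by blast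
      then show "q \<in> (\<lambda>xy. NG #>\<^bsub>G\<^esub> fst xy) ` carrier ?X" using x(2) by (auto intro!: image_eqI[of _ _ "(x, y)"])
    qed
  qed (use a.hom_closed in blast)
  have sb: "(\<lambda>xy. NH #>\<^bsub>H\<^esub> snd xy) ` carrier ?X = carrier (H Mod NH)"
  proof
    show "carrier (H Mod NH) \<subseteq> (\<lambda>xy. NH #>\<^bsub>H\<^esub> snd xy) ` carrier ?X"
    proof
      fix q assume "q \<in> carrier (H Mod NH)"
      then obtain y where y: "y \<in> carrier H" "q = NH #>\<^bsub>H\<^esub> y" by (auto simp: carrier_FactGroup)
      obtain x where "(x, y) \<in> D" using pH[OF y(1)] by blast
      then show "q \<in> (\<lambda>xy. NH #>\<^bsub>H\<^esub> snd xy) ` carrier ?X" using y(2) by (auto intro!: image_eqI[of _ _ "(x, y)"])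
    qed
  qed (use b.hom_closed in blast)
  have kG: "NG #>\<^bsub>G\<^esub> x = \<one>\<^bsub>G Mod NG\<^esub> \<longleftrightarrow> x \<in> NG" if "x \<in> carrier G" for x
    using G.coset_eq_iff[OF normal_imp_subgroup[OF NG] that G.one_closed] that
      subgroup.subset[OF normal_imp_subgroup[OF NG]] by (simp add: G.coset_mult_one)
  have kH: "NH #>\<^bsub>H\<^esub> x = \<one>\<^bsub>H Mod NH\<^esub> \<longleftrightarrow> x \<in> NH" if "x \<in> carrier H" for x
    using H.coset_eq_iff[OF normal_imp_subgroup[OF NH] that H.one_closed] that
      subgroup.subset[OF normal_imp_subgroup[OF NH]] by (simp add: H.coset_mult_one)
  have "kernel ?X (G Mod NG) (\<lambda>xy. NG #>\<^bsub>G\<^esub> fst xy) = kernel ?X (H Mod NH) (\<lambda>xy. NH #>\<^bsub>H\<^esub> snd xy)"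
  proof -
    have "NG #>\<^bsub>G\<^esub> x = \<one>\<^bsub>G Mod NG\<^esub> \<longleftrightarrow> NH #>\<^bsub>H\<^esub> y = \<one>\<^bsub>H Mod NH\<^esub>" if "(x, y) \<in> D" for x y
      using kG[OF DG(1)[OF that]] kH[OF DG(2)[OF that]] eq[OF that] by blast
    then have "NG #>\<^bsub>G\<^esub> fst xy = \<one>\<^bsub>G Mod NG\<^esub> \<longleftrightarrow> NH #>\<^bsub>H\<^esub> snd xy = \<one>\<^bsub>H Mod NH\<^esub>" if "xy \<in> D" for xy
      using that by (cases xy) simp
    then show ?thesis unfolding kernel_def by (intro Collect_cong conj_cong refl) simp
  qed
  then have "?X Mod kernel ?X (G Mod NG) (\<lambda>xy. NG #>\<^bsub>G\<^esub> fst xy) \<cong> H Mod NH"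
    using b.FactGroup_iso[OF sb] by simp
  moreover have "G Mod NG \<cong> ?X Mod kernel ?X (G Mod NG) (\<lambda>xy. NG #>\<^bsub>G\<^esub> fst xy)"
    by (rule group.iso_sym[OF normal.factorgroup_is_group[OF a.normal_kernel] a.FactGroup_iso[OF sa]])
  ultimately show ?thesis using iso_trans by blast
qed

section \<open>Normal forms modulo a normal subgroup\<close>

context group
begin

lemma pow_mod_exponent:
  assumes "x \<in> carrier G" "x [^] (q::nat) = \<one>"
  shows "x [^] n = x [^] (n mod q)"
proof -
  have "x [^] n = x [^] (q * (n div q) + n mod q)" by simp
  also have "\<dots> = (x [^] q) [^] (n div q) \<otimes> x [^] (n mod q)"
    using assms(1) by (simp only: nat_pow_mult[symmetric] nat_pow_pow)
  finally show ?thesis using assms by simp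
qed

text \<open>Modulo \<open>B\<close> the \<open>t i\<close> commute and satisfy
  \<open>t i [^] q i = \<one>\<close>, so the ordered products form a subgroup of the quotient and
  their exponents can be reduced below the \<open>q i\<close>.\<close>

lemma normal_form:
  assumes B: "B \<lhd> G" and t: "\<forall>i<r. t i \<in> carrier G"
    and cm: "\<And>i j. i < j \<Longrightarrow> j < r \<Longrightarrow> commutator G (t i) (t j) \<in> B"
    and pw: "\<And>i. i < r \<Longrightarrow> t i [^] q i \<in> B" and q: "\<And>i. i < r \<Longrightarrow> 0 < (q i :: nat)"
    and x: "x \<in> generate G (B \<union> t ` {..<r})"
  shows "\<exists>a. (\<forall>i<r. a i < q i) \<and> x \<otimes> inv (gprod G t a r) \<in> B"
proof -
  have sB: "subgroup B G" by (rule normal_imp_subgroup[OF B])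
  have BG: "B \<subseteq> carrier G" by (rule subgroup.subset[OF sB])
  interpret Q: group "G Mod B" by (rule normal.factorgroup_is_group[OF B])
  interpret \<pi>: group_hom G "G Mod B" "\<lambda>x. B #> x"
    using normal.r_coset_hom_Mod[OF B] is_group Q.is_group by (simp add: group_hom_def group_hom_axioms_def)
  let ?T = "\<lambda>i. B #> t i"
  have T: "\<forall>i<r. ?T i \<in> carrier (G Mod B)" using t \<pi>.hom_closed by blast
  have one: "B #> x = \<one>\<^bsub>G Mod B\<^esub> \<longleftrightarrow> x \<in> B" if "x \<in> carrier G" for x
    using coset_eq_iff[OF sB that one_closed] that BG by (simp add: coset_mult_one)
  have c0: "?T i \<otimes>\<^bsub>G Mod B\<^esub> ?T j = ?T j \<otimes>\<^bsub>G Mod B\<^esub> ?T i" if ij: "i < j" "j < r" for i j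
  proof -
    have G: "t i \<in> carrier G" "t j \<in> carrier G" using t ij by auto
    have "(t j \<otimes> t i) \<otimes> commutator G (t i) (t j) \<otimes> inv (t j \<otimes> t i) \<in> B"
      using G by (intro normal_conj[OF B _ cm[OF ij]]) auto
    then have "(t i \<otimes> t j) \<otimes> inv (t j \<otimes> t i) \<in> B" using commutator_swap[OF G] by simp
    then have "B #> (t i \<otimes> t j) = B #> (t j \<otimes> t i)"
      using coset_eq_iff[OF sB m_closed[OF G] m_closed[OF G(2,1)]] by blast
    then show ?thesis using G by (simp add: \<pi>.hom_mult del: mult_FactGroup)
  qed
  have c: "\<forall>i<r. \<forall>j<r. ?T i \<otimes>\<^bsub>G Mod B\<^esub> ?T j = ?T j \<otimes>\<^bsub>G Mod B\<^esub> ?T i"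
    using c0 by (metis nat_neq_iff)
  have Tq: "?T i [^]\<^bsub>G Mod B\<^esub> q i = \<one>\<^bsub>G Mod B\<^esub>" if "i < r" for i
  proof -
    have ti: "t i \<in> carrier G" using t that by simp
    then have "B #> (t i [^] q i) = \<one>\<^bsub>G Mod B\<^esub>" using one pw[OF that] by simp
    then show ?thesis using \<pi>.hom_nat_pow[OF ti, of "q i"] by simp
  qed
  have red: "gprod (G Mod B) ?T a r = gprod (G Mod B) ?T (\<lambda>i. a i mod q i) r" for a
    by (rule Q.gprod_cong) (use T Tq Q.pow_mod_exponent in blast)
  let ?S = "{x \<in> carrier G. \<exists>a. B #> x = gprod (G Mod B) ?T a r}"
  have "subgroup ?S G"
  proof
    show "?S \<subseteq> carrier G" by blast
    have "B #> \<one> = gprod (G Mod B) ?T (\<lambda>_. 0) r"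
      using \<pi>.hom_one Q.gprod_zero[of r "\<lambda>_. 0" ?T] by simp
    then show "\<one> \<in> ?S" using one_closed by blast
    fix u assume "u \<in> ?S"
    then obtain a where u: "u \<in> carrier G" "B #> u = gprod (G Mod B) ?T a r" by blast
    \<comment> \<open>Exponents are natural numbers; reducing them first makes the subtraction
      \<open>q i - a' i\<close> a true one, so that it gives the inverse.\<close>
    define a' where "a' = (\<lambda>i. a i mod q i)"
    have u': "B #> u = gprod (G Mod B) ?T a' r" using u(2) red[of a] by (simp add: a'_def)
    have "gprod (G Mod B) ?T (\<lambda>i. q i - a' i) r \<otimes>\<^bsub>G Mod B\<^esub> gprod (G Mod B) ?T a' r
       = gprod (G Mod B) ?T (\<lambda>i. (q i - a' i) + a' i) r" by (rule Q.gprod_mult[OF T c])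
    also have "\<dots> = gprod (G Mod B) ?T (\<lambda>_. 0) r"
    proof (rule Q.gprod_cong, intro allI impI)
      fix i assume i: "i < r"
      have "a' i \<le> q i" using q[OF i] by (simp add: a'_def less_imp_le)
      then show "?T i [^]\<^bsub>G Mod B\<^esub> (q i - a' i + a' i) = ?T i [^]\<^bsub>G Mod B\<^esub> (0::nat)" using Tq[OF i] by simp
    qed
    also have "\<dots> = \<one>\<^bsub>G Mod B\<^esub>" by (rule Q.gprod_zero) simp
    finally have "inv\<^bsub>G Mod B\<^esub> (B #> u) = gprod (G Mod B) ?T (\<lambda>i. q i - a' i) r"
      unfolding u' by (intro Q.inv_equality Q.gprod_closed T)
    then have "B #> inv u = gprod (G Mod B) ?T (\<lambda>i. q i - a' i) r" using \<pi>.hom_inv[OF u(1)] by simp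
    then show "inv u \<in> ?S" using u(1) by blast
    fix v assume "v \<in> ?S"
    then obtain b where v: "v \<in> carrier G" "B #> v = gprod (G Mod B) ?T b r" by blast
    have "B #> (u \<otimes> v) = gprod (G Mod B) ?T (\<lambda>i. a i + b i) r"
      using \<pi>.hom_mult[OF u(1) v(1)] u(2) v(2) Q.gprod_mult[OF T c, of a b] by simp
    then show "u \<otimes> v \<in> ?S" using u(1) v(1) by blast
  qed
  moreover have "B \<union> t ` {..<r} \<subseteq> ?S"
  proof (intro Un_least subsetI)
    fix b assume b: "b \<in> B"
    then have bG: "b \<in> carrier G" using BG by blast
    have "B #> b = gprod (G Mod B) ?T (\<lambda>_. 0) r"
      using one[OF bG] b Q.gprod_zero[of r "\<lambda>_. 0" ?T] by simp
    then show "b \<in> ?S" using bG by blast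
  next
    fix u assume "u \<in> t ` {..<r}"
    then obtain j where j: "j < r" "u = t j" by blast
    have tj: "t j \<in> carrier G" using t j by simp
    have "B #> u = gprod (G Mod B) ?T (\<lambda>i. if i = j then 1 else 0) r"
      using Q.gprod_unit[OF T j(1), of 1] Q.nat_pow_eone \<pi>.hom_closed[OF tj] j(2) by simp
    then show "u \<in> ?S" using j tj by blast
  qed
  ultimately have "generate G (B \<union> t ` {..<r}) \<subseteq> ?S" by (rule generate_least)
  then obtain a where xG: "x \<in> carrier G" and a: "B #> x = gprod (G Mod B) ?T a r" using x by blast
  have "B #> x = gprod (G Mod B) ?T (\<lambda>i. a i mod q i) r" using a red by simp
  also have "\<dots> = B #> gprod G t (\<lambda>i. a i mod q i) r" by (rule \<pi>.hom_gprod[OF t, symmetric])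
  finally have "x \<otimes> inv (gprod G t (\<lambda>i. a i mod q i) r) \<in> B"
    using coset_eq_iff[OF sB xG gprod_closed[OF t]] by simp
  then show ?thesis using q by (intro exI[of _ "\<lambda>i. a i mod q i"]) simp
qed

end

section \<open>A spanning tuple with a central tail\<close>

context mod_group_ring
begin

lemma Phi_Dk: "Phi \<subseteq> Dk JJ"
  unfolding Phi_def
proof (rule set_mult_least)
  show s: "subgroup (Dk JJ) G" by (intro normal_imp_subgroup Dk_normal tideal_JJ K0_JJ)
  show "power_subgroup G p (carrier G) \<subseteq> Dk JJ"
    unfolding power_subgroup_def by (rule generate_least[OF s]) (use pow_p_JJ in \<open>auto simp: Dk_def\<close>)
  show "\<gamma>2 \<subseteq> Dk JJ" using gamma2_Dk AA_JJ by (auto simp: Dk_iff subset_iff)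
qed

lemma center_UU:
  assumes c: "c \<in> group_center G"
  shows "e c - 1 \<in> UU"
proof -
  have cG: "c \<in> carrier G" using c by (simp add: group_center_def)
  have "(e c - 1) * y - y * (e c - 1) \<in> K0" for y
    using center_comm[OF c, of y] by (simp add: eqm_def algebra_simps)
  then show ?thesis unfolding UU_def using e_I[OF cG] JD(2) by (auto intro!: exI[of _ "e c - 1"])
qed

lemma center_normal: "group_center G \<lhd> G"
proof (rule normal_invI[OF group_center_subgroup])
  fix g z assume g: "g \<in> carrier G" and z: "z \<in> group_center G"
  have zG: "z \<in> carrier G" using z by (simp add: group_center_def)
  have "g \<otimes> z \<otimes> inv g = z \<otimes> g \<otimes> inv g" using z g by (simp add: group_center_def)
  also have "\<dots> = z" using zG g by (simp add: m_assoc)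
  finally show "g \<otimes> z \<otimes> inv g \<in> group_center G" using z by simp
qed

lemma frattini_subgroup: "subgroup (frattini G) G"
  unfolding frattini_def
  by unfold_locales
    (auto simp: maximal_subgroup_def intro: subgroup.m_closed subgroup.m_inv_closed subgroup.one_closed)

lemma frattini_center_subgroup: "subgroup (frattini G <#> group_center G) G"
proof -
  interpret second_isomorphism_grp "group_center G" G "frattini G"
    using center_normal frattini_subgroup
    by (simp add: second_isomorphism_grp_def second_isomorphism_grp_axioms_def)
  show ?thesis using normal_set_mult_subgroup commut_normal[OF frattini_subgroup center_normal] by simp
qed

text \<open>The first d elements generate the group together with the Frattini subgroup, whose
  elements vanish in I/J, and the centre. The tail simply lists the whole centre. Redundancy is
  harmless, because the minimisation may lower an exponent \<open>k i\<close> to 0, and then that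
  entry occurs in normal forms only with exponent 0.\<close>

lemma spanning_tuple:
  assumes d: "order (G Mod (frattini G <#> group_center G)) = p ^ d"
  obtains r g where "d \<le> r" "\<forall>i<r. g i \<in> carrier G" "spans (\<lambda>i. e (g i) - 1) r"
    "\<And>i. i < r \<Longrightarrow> d \<le> i \<Longrightarrow> g i \<in> group_center G"
proof -
  let ?S = "frattini G <#> group_center G" and ?Z = "group_center G"
  note sS = frattini_center_subgroup
  have "card (rcosets ?S) = p ^ d" using d by (simp add: order_def FactGroup_def)
  then have "order G \<le> p ^ d * card ?S" using lagrange[OF sS] by simp
  then obtain x where x: "\<forall>i<d. x i \<in> carrier G"
    "\<And>T. subgroup T G \<Longrightarrow> ?S \<subseteq> T \<Longrightarrow> \<forall>i<d. x i \<in> T \<Longrightarrow> T = carrier G"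
    using few_generators[OF sS] by metis
  have ZG: "?Z \<subseteq> carrier G" by (auto simp: group_center_def)
  then have "finite ?Z" using fin finite_subset by blast
  then obtain z where z: "bij_betw z {0..<card ?Z} ?Z" using ex_bij_betw_nat_finite by blast
  define r where "r = d + card ?Z"
  define g where "g i = (if i < d then x i else z (i - d))" for i
  have gZ: "g i \<in> ?Z" if "i < r" "d \<le> i" for i
    using that bij_betwE[OF z] by (auto simp: g_def r_def)
  have gG: "\<forall>i<r. g i \<in> carrier G"
  proof (intro allI impI)
    fix i assume "i < r"
    then show "g i \<in> carrier G" using x(1) gZ ZG by (cases "d \<le> i") (auto simp: g_def)
  qed
  let ?V = "{a. \<exists>n::nat \<Rightarrow> int. eqm JJ a (\<Sum>i\<in>{..<r}. of_int (n i) * (e (g i) - 1))}"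
  have acV: "add_closed ?V" by (rule int_comb_add_closed[OF tideal_JJ])
  have Veq: "y \<in> ?V" if "eqm JJ y y'" "y' \<in> ?V" for y y' using that eqm_trans[OF JD(1)] by blast
  have JV: "y \<in> ?V" if "y \<in> JJ" for y using Veq[of y 0] that add_closedD(1)[OF acV] by (simp add: eqm_def)
  have gV: "e (g j) - 1 \<in> ?V" if j: "j < r" for j
  proof -
    have "e (g j) - 1 = (\<Sum>i<r. if i = j then e (g i) - 1 else 0)" using j by (simp add: sum.delta)
    also have "\<dots> = (\<Sum>i<r. of_int (if i = j then 1 else 0) * (e (g i) - 1))" by (intro sum.cong) auto
    finally have "eqm JJ (e (g j) - 1) (\<Sum>i<r. of_int (if i = j then 1 else 0) * (e (g i) - 1))"
      using eqm_refl[OF JD(1)] by metis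
    then show ?thesis by (intro CollectI exI[of _ "\<lambda>i. if i = j then 1 else 0"])
  qed
  let ?T = "{y \<in> carrier G. e y - 1 \<in> ?V}"
  have sT: "subgroup ?T G"
  proof
    show "?T \<subseteq> carrier G" by blast
    have "e \<one> - 1 \<in> JJ" using e_one K0_JJ by (auto simp: eqm_def)
    then show "\<one> \<in> ?T" using JV one_closed by blast
    fix u assume u: "u \<in> ?T"
    then have uG: "u \<in> carrier G" and uV: "e u - 1 \<in> ?V" by blast+
    have "e (inv u) - 1 \<in> ?V" by (rule Veq[OF e_JJ_inv[OF uG] add_closedD(3)[OF acV uV]])
    then show "inv u \<in> ?T" using uG inv_closed by blast
    fix v assume v: "v \<in> ?T"
    then have vG: "v \<in> carrier G" and vV: "e v - 1 \<in> ?V" by blast+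
    have "e (u \<otimes> v) - 1 \<in> ?V" by (rule Veq[OF e_JJ_mult[OF uG vG] add_closedD(4)[OF acV uV vV]])
    then show "u \<otimes> v \<in> ?T" using uG vG m_closed by blast
  qed
  have "frattini G \<subseteq> ?T"
    using frattini_Phi Phi_Dk JV by (auto simp: Dk_iff subset_iff)
  moreover have "?Z \<subseteq> ?T"
  proof
    fix c assume c: "c \<in> ?Z"
    then obtain i where i: "i < card ?Z" "c = z i" using bij_betw_imp_surj_on[OF z] by (metis atLeastLessThan_iff imageE)
    then have "c = g (d + i)" "d + i < r" by (auto simp: g_def r_def)
    then show "c \<in> ?T" using gV gG by blast
  qed
  ultimately have "?S \<subseteq> ?T" by (intro set_mult_least sT)
  moreover have "\<forall>i<d. x i \<in> ?T"
  proof (intro allI impI)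
    fix i assume "i < d"
    then have "x i = g i" "i < r" by (auto simp: g_def r_def)
    then show "x i \<in> ?T" using gV gG by simp
  qed
  ultimately have T: "?T = carrier G" by (intro x(2) sT)
  have "spans (\<lambda>i. e (g i) - 1) r"
    unfolding spans_def
  proof
    fix y assume y: "y \<in> I"
    have "y \<in> ?V"
      by (rule I_ind[OF acV _ _ y]) (use JV K0_JJ T in blast)+
    then show "\<exists>n::nat \<Rightarrow> int. eqm JJ y (\<Sum>i<r. of_int (n i) * (e (g i) - 1))" by blast
  qed
  then show ?thesis using that[of r g] gG gZ by (simp add: r_def)
qed

text \<open>g (m - 1) = (g m g^-1 - 1) g, and the trailing g counts as 1 modulo AI. The correction
  (g - 1)(m - 1), which lies in IA, is the trace of the commutator of g and m that survives modulo
  \<open>KK\<close>.\<close>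

lemma e_conj_KK:
  assumes g: "g \<in> carrier G" and m: "m \<in> \<gamma>2"
  shows "eqm KK (e (g \<otimes> m \<otimes> inv g) - 1) ((e m - 1) + (e g - 1) * (e m - 1))"
proof -
  have mG: "m \<in> carrier G" using m gamma2_carrier by blast
  have "e (g \<otimes> m \<otimes> inv g) - 1 \<in> AA" using gamma2_conj[OF g m] gamma2_Dk by (auto simp: Dk_iff)
  then have "(e (g \<otimes> m \<otimes> inv g) - 1) * (e g - 1) \<in> KK" by (rule AI_KK[OF _ e_I[OF g]])
  then have "eqm KK ((e (g \<otimes> m \<otimes> inv g) - 1) * e g) (e (g \<otimes> m \<otimes> inv g) - 1)"
    by (simp add: eqm_def algebra_simps)
  then have "eqm KK (e g * (e m - 1)) (e (g \<otimes> m \<otimes> inv g) - 1)"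
    using KK_trans[OF eqm_mono[OF K0_KK e_conj[OF g mG]]] by blast
  moreover have "e g * (e m - 1) = (e m - 1) + (e g - 1) * (e m - 1)" by (simp add: algebra_simps)
  ultimately show ?thesis using KK_sym by simp
qed

lemma Zk_commutator:
  assumes "x \<in> carrier G" "z \<in> Zk"
  shows "e (commutator G x z) - 1 \<in> KK"
proof -
  have z: "z \<in> carrier G" and c: "e z * e x - e x * e z \<in> KK" using assms(2) by (auto simp: Zk_def cent_def eqm_def)
  have "(e x - 1) * (e z - 1) - (e z - 1) * (e x - 1) = - (e z * e x - e x * e z)" by (simp add: algebra_simps)
  also have "\<dots> \<in> KK" by (rule KD(4)[OF c])
  finally show ?thesis using commutator_Dk[OF tideal_KK K0_KK assms(1) z] by (simp add: Dk_iff)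
qed

end

context group_ring_pair
begin

text \<open>Central elements get their partners from \<open>UU_rep\<close> and the others from
  \<open>I_rep\<close>. The common exponent n + m is large enough for both groups: all the powers
  are identities, and the conditions on them hold trivially.\<close>

lemma good_exists:
  assumes d: "order (G Mod (frattini G <#>\<^bsub>G\<^esub> group_center G)) = p ^ d"
  obtains r g h k where "d \<le> r" "good r d g h k"
proof -
  obtain r g where r: "d \<le> r" "\<forall>i<r. g i \<in> carrier G" "spans (\<lambda>i. e (g i) - 1) r"
    "\<And>i. i < r \<Longrightarrow> d \<le> i \<Longrightarrow> g i \<in> group_center G"
    using G.spanning_tuple[OF d] by metis
  have "\<exists>h. h \<in> carrier H \<and> eqm JJ (e (g i)) (f h) \<and> (d \<le> i \<longrightarrow> h \<in> H.Zk)" if i: "i < r" for i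
  proof (cases "d \<le> i")
    case True
    obtain c where c: "c \<in> group_center H" "eqm JJ (e (g i) - 1) (f c - 1)"
      using H.UU_rep[OF G.center_UU[OF r(4)[OF i True]]] by blast
    have "eqm JJ (e (g i)) (f c)" using c(2) by (simp add: eqm_def)
    then show ?thesis using c(1) H.center_Zk by (auto simp: group_center_def)
  next
    case False
    have "e (g i) - 1 \<in> I" using G.e_I r(2) i by blast
    then obtain c where c: "c \<in> carrier H" "eqm JJ (e (g i) - 1) (f c - 1)" using H.I_rep by blast
    have "eqm JJ (e (g i)) (f c)" using c(2) by (simp add: eqm_def)
    then show ?thesis using c(1) False by blast
  qed
  then obtain h where h: "\<And>i. i < r \<Longrightarrow> h i \<in> carrier H \<and> eqm JJ (e (g i)) (f (h i)) \<and> (d \<le> i \<longrightarrow> h i \<in> H.Zk)"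
    by metis
  obtain n m where n: "order G = p ^ n" and m: "order H = p ^ m" using G.ord H.ord by blast
  have gone: "g i [^]\<^bsub>G\<^esub> (p ^ (n + m)) = \<one>\<^bsub>G\<^esub>" if "i < r" for i
  proof -
    have "g i [^]\<^bsub>G\<^esub> (p ^ (n + m)) = (g i [^]\<^bsub>G\<^esub> (p ^ n)) [^]\<^bsub>G\<^esub> (p ^ m)"
      using r(2) that by (simp add: G.nat_pow_pow power_add)
    then show ?thesis using G.pow_order_eq_1[of "g i"] r(2) that n by simp
  qed
  have hone: "h i [^]\<^bsub>H\<^esub> (p ^ (n + m)) = \<one>\<^bsub>H\<^esub>" if "i < r" for i
  proof -
    have "h i [^]\<^bsub>H\<^esub> (p ^ (n + m)) = (h i [^]\<^bsub>H\<^esub> (p ^ m)) [^]\<^bsub>H\<^esub> (p ^ n)"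
      using h[OF that] by (simp add: H.nat_pow_pow power_add mult.commute)
    then show ?thesis using H.pow_order_eq_1[of "h i"] h[OF that] m by simp
  qed
  have e1: "e \<one>\<^bsub>G\<^esub> - 1 \<in> K0" and f1: "f \<one>\<^bsub>H\<^esub> - 1 \<in> K0" using G.e_one H.e_one by (auto simp: eqm_def)
  have ef: "eqm K0 (e \<one>\<^bsub>G\<^esub>) (f \<one>\<^bsub>H\<^esub>)" using K0D(3)[OF e1 f1] by (simp add: eqm_def)
  have "good r d g h (\<lambda>_. n + m)"
    unfolding good_def
  proof (intro conjI allI impI r(3))
    fix i assume i: "i < r"
    show "g i \<in> carrier G" using r(2) i by blast
    show "h i \<in> carrier H" "eqm JJ (e (g i)) (f (h i))" using h[OF i] by auto
    show "e (g i [^]\<^bsub>G\<^esub> (p ^ (n + m))) - 1 \<in> LL" unfolding gone[OF i] using e1 K0_LL by blast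
    show "eqm KK (e (g i [^]\<^bsub>G\<^esub> (p ^ (n + m)))) (f (h i [^]\<^bsub>H\<^esub> (p ^ (n + m))))"
      unfolding gone[OF i] hone[OF i] by (rule eqm_mono[OF K0_KK ef])
    assume di: "d \<le> i"
    show "e (g i) - 1 \<in> UU" by (rule G.center_UU[OF r(4)[OF i di]])
    show "g i \<in> G.Zk" using G.center_Zk r(4)[OF i di] by blast
    show "h i \<in> H.Zk" using h[OF i] di by blast
  qed
  then show ?thesis using that r(1) by blast
qed

end

section \<open>The matching subgroup of the product and the isomorphism\<close>

context group_ring_pair
begin

theorem pair_iso:
  assumes d: "order (G Mod (frattini G <#>\<^bsub>G\<^esub> group_center G)) = p ^ d"
    and crd: "order (G\<lparr>carrier := lower_central G 2\<rparr> Mod G.gN3) = p ^ (d choose 2)"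
  shows "G Mod G.gN4 \<cong> H Mod H.gN4"
proof -
  interpret sw: group_ring_pair K0 I p H G f e by (rule swap)
  obtain r g0 h0 k0 where dr: "d \<le> r" and gd0: "good r d g0 h0 k0" using good_exists[OF d] by metis
  obtain g h k where gd: "good r d g h k"
    and indG: "\<forall>a. (\<forall>i<r. a i < p ^ k i) \<longrightarrow> gprod G g a r \<in> lower_central G 2 \<longrightarrow> (\<forall>i<r. a i = 0)"
    and indH: "\<forall>a. (\<forall>i<r. a i < p ^ k i) \<longrightarrow> gprod H h a r \<in> lower_central H 2 \<longrightarrow> (\<forall>i<r. a i = 0)"
    by (rule good_minimal[OF gd0])
  have gdG: "\<And>i. i < r \<Longrightarrow> g i \<in> carrier G \<and> h i \<in> carrier H \<and> eqm JJ (e (g i)) (f (h i)) \<and>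
       e (g i [^]\<^bsub>G\<^esub> (p ^ k i)) - 1 \<in> LL \<and>
       eqm KK (e (g i [^]\<^bsub>G\<^esub> (p ^ k i))) (f (h i [^]\<^bsub>H\<^esub> (p ^ k i))) \<and>
       (d \<le> i \<longrightarrow> e (g i) - 1 \<in> UU \<and> g i \<in> G.Zk \<and> h i \<in> H.Zk)"
    and spG: "spans (\<lambda>i. e (g i) - 1) r" using gd by (auto simp: good_def)
  have gdH: "\<And>i. i < r \<Longrightarrow> f (h i [^]\<^bsub>H\<^esub> (p ^ k i)) - 1 \<in> LL \<and> (d \<le> i \<longrightarrow> f (h i) - 1 \<in> UU)"
    and spH: "spans (\<lambda>i. f (h i) - 1) r" using good_swap[OF gd] by (auto simp: sw.good_def)
  have gG: "\<forall>i<r. g i \<in> carrier G" and hH: "\<forall>i<r. h i \<in> carrier H"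
    and gU: "\<forall>i<r. d \<le> i \<longrightarrow> e (g i) - 1 \<in> UU" and hU: "\<forall>i<r. d \<le> i \<longrightarrow> f (h i) - 1 \<in> UU"
    using gdG gdH by auto
  let ?A = "lower_central G 2" and ?B = "lower_central H 2"
  let ?cG = "\<lambda>n::nat \<times> nat \<Rightarrow> int. \<Sum>ij\<in>G.Idx d. of_int (n ij) * G.Cm g ij"
  let ?cH = "\<lambda>n::nat \<times> nat \<Rightarrow> int. \<Sum>ij\<in>G.Idx d. of_int (n ij) * H.Cm h ij"
  have AG: "m \<in> carrier G" "e m - 1 \<in> AA" if "m \<in> ?A" for m
    using that G.gamma2_Dk by (auto simp: G.Dk_iff)
  have BH: "m \<in> carrier H" "f m - 1 \<in> AA" if "m \<in> ?B" for m
    using that H.gamma2_Dk by (auto simp: H.Dk_iff)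
  have Idxr: "fst ij < r \<and> snd ij < r" if "ij \<in> G.Idx d" for ij using that dr by (auto simp: G.Idx_def)
  have CC: "eqm LL (G.Cm g ij) (H.Cm h ij)" if ij: "ij \<in> G.Idx d" for ij
  proof -
    define x where "x = e (g (fst ij)) - 1"
    define y where "y = e (g (snd ij)) - 1"
    define x' where "x' = f (h (fst ij)) - 1"
    define y' where "y' = f (h (snd ij)) - 1"
    have I: "x \<in> I" "y \<in> I" "x' \<in> I" "y' \<in> I"
      using Idxr[OF ij] gG hH G.e_I H.e_I by (simp_all add: x_def y_def x'_def y'_def)
    have J: "x - x' \<in> JJ" "y - y' \<in> JJ"
      using gdG Idxr[OF ij] by (simp_all add: x_def y_def x'_def y'_def eqm_def)
    have 1: "eqm LL (G.Cm g ij) (x * y - y * x)"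
      unfolding G.Cm_def x_def y_def using Idxr[OF ij] gG by (intro G.comm_form) auto
    have 2: "eqm LL (H.Cm h ij) (x' * y' - y' * x')"
      unfolding H.Cm_def x'_def y'_def using Idxr[OF ij] hH by (intro H.comm_form) auto
    have "- (y * (x - x') - (x - x') * y) + (x' * (y - y') - (y - y') * x') \<in> LL"
      by (rule LD(5)[OF LD(4)[OF comm_IJ_LL[OF I(2) J(1)]] comm_IJ_LL[OF I(3) J(2)]])
    then have 3: "eqm LL (x * y - y * x) (x' * y' - y' * x')" by (simp add: eqm_def algebra_simps)
    show ?thesis by (rule eqm_trans[OF LD(1) eqm_trans[OF LD(1) 1 3] eqm_sym[OF LD(1) 2]])
  qed
  have cc: "eqm LL (?cG n) (?cH n)" for n
    by (intro eqm_sum LD(1) eqm_mult[OF tideal_LL eqm_refl[OF LD(1)]] CC)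
  \<comment> \<open>The coefficients \<open>n\<close> and the remainder \<open>l\<close> are the
    same on both sides; the commutators they multiply are not assumed to agree modulo
    \<open>KK\<close>.\<close>
  let ?R = "\<lambda>m m'. \<exists>n l. l \<in> LL \<and> eqm KK (e m - 1) (?cG n + l) \<and> eqm KK (f m' - 1) (?cH n + l)"
  have RI: "?R m m'" if "l \<in> LL" "eqm KK (e m - 1) (?cG n + l)" "eqm KK (f m' - 1) (?cH n + l)"
    for m m' n l using that by blast
  let ?W = "{(m, m'). m \<in> ?A \<and> m' \<in> ?B \<and> ?R m m'}"
  \<comment> \<open>Pairs that agree modulo \<open>JJ\<close>. Inside this group \<open>W\<close> is
    normal: it is agreement of the conjugating elements modulo \<open>JJ\<close> that makes both
    conjugations add the same remainder modulo \<open>KK\<close>.\<close>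
  let ?XX = "{(a, b). a \<in> carrier G \<and> b \<in> carrier H \<and> eqm JJ (e a) (f b)}"
  let ?P = "G \<times>\<times> H"
  let ?X = "?P\<lparr>carrier := ?XX\<rparr>"
  interpret P: group ?P by (rule DirProd_group[OF G.is_group H.is_group])
  have diffL: "(e m - 1) - (f m' - 1) \<in> LL" if mm: "?R m m'" for m m'
  proof -
    obtain n l where nl: "l \<in> LL" "eqm KK (e m - 1) (?cG n + l)" "eqm KK (f m' - 1) (?cH n + l)"
      using mm by blast
    have "eqm LL (e m - 1) (?cG n + l)" by (rule eqm_mono[OF KK_LL nl(2)])
    moreover have "eqm LL (?cG n + l) (?cH n + l)" by (intro eqm_add LD(1) cc eqm_refl)
    moreover have "eqm LL (?cH n + l) (f m' - 1)" by (rule eqm_sym[OF LD(1) eqm_mono[OF KK_LL nl(3)]])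
    ultimately have "eqm LL (e m - 1) (f m' - 1)" using eqm_trans[OF LD(1)] by blast
    then show ?thesis by (simp add: eqm_def)
  qed
  have sX0: "subgroup ?XX ?P"
  proof
    show "?XX \<subseteq> carrier ?P" by auto
    have "eqm K0 (e \<one>\<^bsub>G\<^esub>) (f \<one>\<^bsub>H\<^esub>)" by (rule eqm_trans[OF K0D(1) G.e_one eqm_sym[OF K0D(1) H.e_one]])
    then show "\<one>\<^bsub>?P\<^esub> \<in> ?XX" using eqm_mono[OF K0_JJ] by simp
    fix u assume "u \<in> ?XX"
    then obtain a b where u: "u = (a, b)" "a \<in> carrier G" "b \<in> carrier H" "eqm JJ (e a) (f b)" by blast
    have "eqm JJ (e (inv\<^bsub>G\<^esub> a) - 1) (- (e a - 1))" by (rule G.e_JJ_inv[OF u(2)])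
    moreover have "eqm JJ (- (e a - 1)) (- (f b - 1))"
      using eqm_diff[OF JD(1) eqm_refl[OF JD(1), of 1] u(4)] by simp
    moreover have "eqm JJ (- (f b - 1)) (f (inv\<^bsub>H\<^esub> b) - 1)" by (rule eqm_sym[OF JD(1) H.e_JJ_inv[OF u(3)]])
    ultimately have "eqm JJ (e (inv\<^bsub>G\<^esub> a) - 1) (f (inv\<^bsub>H\<^esub> b) - 1)" using eqm_trans[OF JD(1)] by blast
    then have "eqm JJ (e (inv\<^bsub>G\<^esub> a)) (f (inv\<^bsub>H\<^esub> b))" by (simp add: eqm_def)
    then show "inv\<^bsub>?P\<^esub> u \<in> ?XX" using u inv_DirProd[OF G.is_group H.is_group u(2,3)] by simp
    fix v assume "v \<in> ?XX"
    then obtain a' b' where v: "v = (a', b')" "a' \<in> carrier G" "b' \<in> carrier H" "eqm JJ (e a') (f b')" by blast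
    have "eqm JJ (e (a \<otimes>\<^bsub>G\<^esub> a')) (e a * e a')" by (rule eqm_mono[OF K0_JJ G.e_mult[OF u(2) v(2)]])
    moreover have "eqm JJ (e a * e a') (f b * f b')" by (rule eqm_mult[OF tideal_JJ u(4) v(4)])
    moreover have "eqm JJ (f b * f b') (f (b \<otimes>\<^bsub>H\<^esub> b'))"
      by (rule eqm_mono[OF K0_JJ eqm_sym[OF K0D(1) H.e_mult[OF u(3) v(3)]]])
    ultimately have "eqm JJ (e (a \<otimes>\<^bsub>G\<^esub> a')) (f (b \<otimes>\<^bsub>H\<^esub> b'))" using eqm_trans[OF JD(1)] by blast
    then show "u \<otimes>\<^bsub>?P\<^esub> v \<in> ?XX" using u v by simp
  qed
  interpret X: group ?X by (rule subgroup.subgroup_is_group[OF sX0 P.is_group])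
  have invX: "inv\<^bsub>?X\<^esub> (a, b) = (inv\<^bsub>G\<^esub> a, inv\<^bsub>H\<^esub> b)" if "(a, b) \<in> ?XX" for a b
    using P.m_inv_consistent[OF sX0 that] that inv_DirProd[OF G.is_group H.is_group] by simp
  have WX: "?W \<subseteq> ?XX"
  proof
    fix u assume "u \<in> ?W"
    then obtain m m' where u: "u = (m, m')" "m \<in> ?A" "m' \<in> ?B" "?R m m'" by blast
    have "(e m - 1) - (f m' - 1) \<in> JJ" using diffL[OF u(4)] LL_JJ by blast
    then have "eqm JJ (e m) (f m')" by (simp add: eqm_def)
    then show "u \<in> ?XX" using u AG(1) BH(1) by blast
  qed
  have nW: "?W \<lhd> ?X"
  proof (rule X.normal_invI)
    show "subgroup ?W ?X"
    proof
      show "?W \<subseteq> carrier ?X" using WX by simp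
      have "eqm KK (e \<one>\<^bsub>G\<^esub> - 1) (?cG (\<lambda>_. 0) + 0)" "eqm KK (f \<one>\<^bsub>H\<^esub> - 1) (?cH (\<lambda>_. 0) + 0)"
        using eqm_mono[OF K0_KK G.e_one] eqm_mono[OF K0_KK H.e_one] by (simp_all add: eqm_def)
      then have "?R \<one>\<^bsub>G\<^esub> \<one>\<^bsub>H\<^esub>" by (rule RI[OF LD(2)])
      then show "\<one>\<^bsub>?X\<^esub> \<in> ?W"
        using subgroup.one_closed[OF G.gamma2_sub] subgroup.one_closed[OF H.gamma2_sub] by simp
      fix u assume uW: "u \<in> ?W"
      then obtain m m' n l where u: "u = (m, m')" "m \<in> ?A" "m' \<in> ?B" "l \<in> LL"
        "eqm KK (e m - 1) (?cG n + l)" "eqm KK (f m' - 1) (?cH n + l)" by blast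
      have "eqm KK (e (inv\<^bsub>G\<^esub> m) - 1) (- (e m - 1))" using G.e_AA_inv G.gamma2_Dk u(2) by blast
      moreover have "eqm KK (- (e m - 1)) (- (?cG n + l))"
        using eqm_diff[OF KD(1) eqm_refl[OF KD(1), of 0] u(5)] by simp
      moreover have "- (?cG n + l) = ?cG (\<lambda>ij. - n ij) + (- l)" by (simp add: sum_negf)
      ultimately have 1: "eqm KK (e (inv\<^bsub>G\<^esub> m) - 1) (?cG (\<lambda>ij. - n ij) + (- l))"
        using eqm_trans[OF KD(1)] by metis
      have "eqm KK (f (inv\<^bsub>H\<^esub> m') - 1) (- (f m' - 1))" using H.e_AA_inv H.gamma2_Dk u(3) by blast
      moreover have "eqm KK (- (f m' - 1)) (- (?cH n + l))"
        using eqm_diff[OF KD(1) eqm_refl[OF KD(1), of 0] u(6)] by simp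
      moreover have "- (?cH n + l) = ?cH (\<lambda>ij. - n ij) + (- l)" by (simp add: sum_negf)
      ultimately have 2: "eqm KK (f (inv\<^bsub>H\<^esub> m') - 1) (?cH (\<lambda>ij. - n ij) + (- l))"
        using eqm_trans[OF KD(1)] by metis
      have "?R (inv\<^bsub>G\<^esub> m) (inv\<^bsub>H\<^esub> m')" by (rule RI[OF LD(4)[OF u(4)] 1 2])
      then have "(inv\<^bsub>G\<^esub> m, inv\<^bsub>H\<^esub> m') \<in> ?W"
        using subgroup.m_inv_closed[OF G.gamma2_sub u(2)] subgroup.m_inv_closed[OF H.gamma2_sub u(3)] by simp
      moreover have "inv\<^bsub>?X\<^esub> u = (inv\<^bsub>G\<^esub> m, inv\<^bsub>H\<^esub> m')"
        unfolding u(1) by (rule invX) (use uW WX u(1) in blast)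
      ultimately show "inv\<^bsub>?X\<^esub> u \<in> ?W" by simp
      fix v assume "v \<in> ?W"
      then obtain s s' n' l' where v: "v = (s, s')" "s \<in> ?A" "s' \<in> ?B" "l' \<in> LL"
        "eqm KK (e s - 1) (?cG n' + l')" "eqm KK (f s' - 1) (?cH n' + l')" by blast
      have "eqm KK (e (m \<otimes>\<^bsub>G\<^esub> s) - 1) ((e m - 1) + (e s - 1))"
        using G.e_AA_mult G.gamma2_Dk u(2) AG(1)[OF v(2)] by blast
      moreover have "eqm KK ((e m - 1) + (e s - 1)) ((?cG n + l) + (?cG n' + l'))"
        by (rule eqm_add[OF KD(1) u(5) v(5)])
      moreover have "(?cG n + l) + (?cG n' + l') = ?cG (\<lambda>ij. n ij + n' ij) + (l + l')"
        by (simp add: distrib_right sum.distrib)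
      ultimately have 3: "eqm KK (e (m \<otimes>\<^bsub>G\<^esub> s) - 1) (?cG (\<lambda>ij. n ij + n' ij) + (l + l'))"
        using eqm_trans[OF KD(1)] by metis
      have "eqm KK (f (m' \<otimes>\<^bsub>H\<^esub> s') - 1) ((f m' - 1) + (f s' - 1))"
        using H.e_AA_mult H.gamma2_Dk u(3) BH(1)[OF v(3)] by blast
      moreover have "eqm KK ((f m' - 1) + (f s' - 1)) ((?cH n + l) + (?cH n' + l'))"
        by (rule eqm_add[OF KD(1) u(6) v(6)])
      moreover have "(?cH n + l) + (?cH n' + l') = ?cH (\<lambda>ij. n ij + n' ij) + (l + l')"
        by (simp add: distrib_right sum.distrib)
      ultimately have 4: "eqm KK (f (m' \<otimes>\<^bsub>H\<^esub> s') - 1) (?cH (\<lambda>ij. n ij + n' ij) + (l + l'))"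
        using eqm_trans[OF KD(1)] by metis
      have "?R (m \<otimes>\<^bsub>G\<^esub> s) (m' \<otimes>\<^bsub>H\<^esub> s')" by (rule RI[OF LD(5)[OF u(4) v(4)] 3 4])
      then show "u \<otimes>\<^bsub>?X\<^esub> v \<in> ?W"
        using u(1) v(1) subgroup.m_closed[OF G.gamma2_sub u(2) v(2)]
          subgroup.m_closed[OF H.gamma2_sub u(3) v(3)] by simp
    qed
  next
    fix w x assume "w \<in> ?W" and "x \<in> carrier ?X"
    then obtain m m' where w: "w = (m, m')" "m \<in> ?A" "m' \<in> ?B" and R: "?R m m'" by blast
    obtain n l where nl: "l \<in> LL" "eqm KK (e m - 1) (?cG n + l)" "eqm KK (f m' - 1) (?cH n + l)"
      using R by blast
    obtain a b where x: "x = (a, b)" "a \<in> carrier G" "b \<in> carrier H" "eqm JJ (e a) (f b)"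
      using \<open>x \<in> carrier ?X\<close> by auto
    \<comment> \<open>Conjugation adds \<open>?u\<close> on one side and \<open>?v\<close> on the
      other. They agree modulo \<open>KK\<close>: the conjugating elements differ by an element of
      \<open>JJ\<close>, and JA is inside \<open>KK\<close>; m and m' differ by an element of
      \<open>LL\<close>, and IL is inside \<open>KK\<close>.\<close>
    let ?u = "(e a - 1) * (e m - 1)" and ?v = "(f b - 1) * (f m' - 1)"
    have "((e a - 1) - (f b - 1)) * (e m - 1) \<in> KK"
      using x(4) AG(2)[OF w(2)] by (intro JA_KK) (simp_all add: eqm_def)
    moreover have "(f b - 1) * ((e m - 1) - (f m' - 1)) \<in> KK"
      by (rule IL_KK[OF H.e_I[OF x(3)] diffL[OF R]])
    ultimately have "((e a - 1) - (f b - 1)) * (e m - 1) + (f b - 1) * ((e m - 1) - (f m' - 1)) \<in> KK"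
      by (rule KD(5))
    moreover have "((e a - 1) - (f b - 1)) * (e m - 1) + (f b - 1) * ((e m - 1) - (f m' - 1)) = ?u - ?v"
      by (simp add: algebra_simps)
    ultimately have uv: "eqm KK ?v ?u" using eqm_sym[OF KD(1), of ?u ?v] by (simp add: eqm_def)
    have uL: "?u \<in> LL" by (rule IA_LL[OF G.e_I[OF x(2)] AG(2)[OF w(2)]])
    have g1: "eqm KK (e (a \<otimes>\<^bsub>G\<^esub> m \<otimes>\<^bsub>G\<^esub> inv\<^bsub>G\<^esub> a) - 1) ((e m - 1) + ?u)" by (rule G.e_conj_KK[OF x(2) w(2)])
    have g2: "eqm KK ((e m - 1) + ?u) ((?cG n + l) + ?u)" by (intro eqm_add KD(1) nl(2) eqm_refl)
    have 1: "eqm KK (e (a \<otimes>\<^bsub>G\<^esub> m \<otimes>\<^bsub>G\<^esub> inv\<^bsub>G\<^esub> a) - 1) (?cG n + (l + ?u))"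
      using eqm_trans[OF KD(1) g1 g2] by (simp only: add.assoc)
    have h1: "eqm KK (f (b \<otimes>\<^bsub>H\<^esub> m' \<otimes>\<^bsub>H\<^esub> inv\<^bsub>H\<^esub> b) - 1) ((f m' - 1) + ?v)" by (rule H.e_conj_KK[OF x(3) w(3)])
    have h2: "eqm KK ((f m' - 1) + ?v) ((?cH n + l) + ?u)" by (intro eqm_add KD(1) nl(3) uv)
    have 2: "eqm KK (f (b \<otimes>\<^bsub>H\<^esub> m' \<otimes>\<^bsub>H\<^esub> inv\<^bsub>H\<^esub> b) - 1) (?cH n + (l + ?u))"
      using eqm_trans[OF KD(1) h1 h2] by (simp only: add.assoc)
    have "?R (a \<otimes>\<^bsub>G\<^esub> m \<otimes>\<^bsub>G\<^esub> inv\<^bsub>G\<^esub> a) (b \<otimes>\<^bsub>H\<^esub> m' \<otimes>\<^bsub>H\<^esub> inv\<^bsub>H\<^esub> b)"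
      by (rule RI[OF LD(5)[OF nl(1) uL] 1 2])
    then have "(a \<otimes>\<^bsub>G\<^esub> m \<otimes>\<^bsub>G\<^esub> inv\<^bsub>G\<^esub> a, b \<otimes>\<^bsub>H\<^esub> m' \<otimes>\<^bsub>H\<^esub> inv\<^bsub>H\<^esub> b) \<in> ?W"
      using G.gamma2_conj[OF x(2) w(2)] H.gamma2_conj[OF x(3) w(3)] by simp
    moreover have "inv\<^bsub>?X\<^esub> x = (inv\<^bsub>G\<^esub> a, inv\<^bsub>H\<^esub> b)" using invX[of a b] x by simp
    ultimately show "x \<otimes>\<^bsub>?X\<^esub> w \<otimes>\<^bsub>?X\<^esub> inv\<^bsub>?X\<^esub> x \<in> ?W" using x(1) w(1) by simp
  qed
  define W where "W = ?W"
  note nW = nW[folded W_def] and WX = WX[folded W_def]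
  have W_iff: "(m, m') \<in> W \<longleftrightarrow> m \<in> ?A \<and> m' \<in> ?B \<and> ?R m m'" for m m' by (simp add: W_def)
  define t where "t i = (g i, h i)" for i
  have tX: "\<forall>i<r. t i \<in> carrier ?X" using gdG by (simp add: t_def)
  have cm: "commutator ?X (t i) (t j) \<in> W" if ij: "i < j" "j < r" for i j
  proof -
    have i: "i < r" using ij by simp
    let ?c = "commutator G (g i) (g j)" and ?c' = "commutator H (h i) (h j)"
    have inv: "inv\<^bsub>?X\<^esub> (t i) = (inv\<^bsub>G\<^esub> (g i), inv\<^bsub>H\<^esub> (h i))" "inv\<^bsub>?X\<^esub> (t j) = (inv\<^bsub>G\<^esub> (g j), inv\<^bsub>H\<^esub> (h j))"
      using tX i ij(2) invX by (simp_all add: t_def)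
    have eq: "commutator ?X (t i) (t j) = (?c, ?c')"
      unfolding commutator_def inv by (simp add: t_def)
    have c2: "?c \<in> ?A" "?c' \<in> ?B"
      using gG hH i ij(2) by (auto intro: G.commutator_gamma2 H.commutator_gamma2)
    have "?R ?c ?c'"
    proof (cases "j < d")
      case True
      then have m: "(i, j) \<in> G.Idx d" using ij by (simp add: G.Idx_def)
      \<comment> \<open>The coefficient vector of this single commutator, with remainder zero;
        agreement of the two commutators modulo \<open>KK\<close> is not claimed.\<close>
      define n where "n kl = (if kl = (i, j) then 1 else 0 :: int)" for kl
      have pick: "(\<Sum>kl\<in>G.Idx d. of_int (n kl) * F kl) = F (i, j)" for F :: "nat \<times> nat \<Rightarrow> 'r"
      proof -
        have "(\<Sum>kl\<in>G.Idx d. of_int (n kl) * F kl) = (\<Sum>kl\<in>G.Idx d. if kl = (i, j) then F kl else 0)"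
          by (intro sum.cong) (auto simp: n_def)
        also have "\<dots> = F (i, j)" using m G.Idx(1) by (simp add: sum.delta)
        finally show ?thesis .
      qed
      have "eqm KK (e ?c - 1) (?cG n + 0)" "eqm KK (f ?c' - 1) (?cH n + 0)"
        unfolding pick by (simp_all add: G.Cm_def H.Cm_def eqm_refl KD(1))
      then show ?thesis by (rule RI[OF LD(2)])
    next
      case False
      then have "g j \<in> G.Zk" "h j \<in> H.Zk" using gdG[OF ij(2)] by auto
      then have "e ?c - 1 \<in> KK" "f ?c' - 1 \<in> KK"
        using G.Zk_commutator H.Zk_commutator gG hH i by blast+
      then have "eqm KK (e ?c - 1) (?cG (\<lambda>_. 0) + 0)" "eqm KK (f ?c' - 1) (?cH (\<lambda>_. 0) + 0)"
        by (simp_all add: eqm_def)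
      then show ?thesis by (rule RI[OF LD(2)])
    qed
    then show ?thesis using eq c2 by (simp add: W_iff)
  qed
  have tpow: "t i [^]\<^bsub>?X\<^esub> (n::nat) = (g i [^]\<^bsub>G\<^esub> n, h i [^]\<^bsub>H\<^esub> n)" for i n
    by (induction n) (simp_all add: t_def)
  have pw: "t i [^]\<^bsub>?X\<^esub> (p ^ k i) \<in> W" if i: "i < r" for i
  proof -
    let ?x = "g i [^]\<^bsub>G\<^esub> (p ^ k i)" and ?y = "h i [^]\<^bsub>H\<^esub> (p ^ k i)"
    have L: "e ?x - 1 \<in> LL" "f ?y - 1 \<in> LL" using gdG[OF i] gdH[OF i] by auto
    have "e ?x - 1 \<in> AA" "f ?y - 1 \<in> AA" using L LL_AA by auto
    then have x2: "?x \<in> ?A" "?y \<in> ?B"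
      using G.Dk_AA H.Dk_AA gG hH i G.Dk_iff H.Dk_iff by (metis G.nat_pow_closed, metis H.nat_pow_closed)
    have "eqm KK (f ?y) (e ?x)" using gdG[OF i] eqm_sym[OF KD(1)] by blast
    then have "eqm KK (f ?y - 1) (e ?x - 1)" by (intro eqm_diff KD(1) eqm_refl)
    then have "eqm KK (e ?x - 1) (?cG (\<lambda>_. 0) + (e ?x - 1))" "eqm KK (f ?y - 1) (?cH (\<lambda>_. 0) + (e ?x - 1))"
      using eqm_refl[OF KD(1)] by simp_all
    then have "?R ?x ?y" by (rule RI[OF L(1)])
    then show ?thesis using x2 by (simp add: tpow W_iff)
  qed
  define D where "D = generate ?X (W \<union> t ` {..<r})"
  have DX: "W \<union> t ` {..<r} \<subseteq> carrier ?X" using WX tX by auto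
  have sD: "subgroup D ?X" unfolding D_def by (rule X.generate_is_subgroup[OF DX])
  have sDP: "subgroup D ?P" by (rule P.incl_subgroup[OF sX0 sD])
  have gp: "gprod ?X t a r = (gprod G g a r, gprod H h a r)" for a
  proof -
    have "gprod ?X t a q = (gprod G g a q, gprod H h a q)" for q
      by (induction q) (simp_all add: tpow)
    then show ?thesis .
  qed
  have nf: "\<exists>a. (\<forall>i<r. a i < p ^ k i) \<and> (x \<otimes>\<^bsub>G\<^esub> inv\<^bsub>G\<^esub> gprod G g a r, y \<otimes>\<^bsub>H\<^esub> inv\<^bsub>H\<^esub> gprod H h a r) \<in> W"
    if "(x, y) \<in> D" for x y
  proof -
    have "\<exists>a. (\<forall>i<r. a i < p ^ k i) \<and> (x, y) \<otimes>\<^bsub>?X\<^esub> inv\<^bsub>?X\<^esub> (gprod ?X t a r) \<in> W"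
      by (rule X.normal_form[OF nW tX _ _ _ that[unfolded D_def]]) (assumption | rule cm pw p_pow_pos)+
    then obtain a where a: "\<forall>i<r. a i < p ^ k i" "(x, y) \<otimes>\<^bsub>?X\<^esub> inv\<^bsub>?X\<^esub> (gprod ?X t a r) \<in> W"
      by blast
    have "gprod ?X t a r \<in> ?XX" using X.gprod_closed[OF tX] by simp
    then have "inv\<^bsub>?X\<^esub> (gprod ?X t a r) = (inv\<^bsub>G\<^esub> gprod G g a r, inv\<^bsub>H\<^esub> gprod H h a r)"
      using invX gp by simp
    then show ?thesis using a by auto
  qed
  have DG: "x \<in> carrier G" "y \<in> carrier H" if "(x, y) \<in> D" for x y
    using subgroup.subset[OF sD] that by auto
  \<comment> \<open>If one coordinate lies in \<gamma>2, then so does its ordered product of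
    generators, and independence in that group makes all exponents zero. As the exponents are common
    to both coordinates, both products are trivial.\<close>
  have inW: "(x, y) \<in> W" if xy: "(x, y) \<in> D" and g2: "x \<in> ?A \<or> y \<in> ?B" for x y
  proof -
    obtain a where a: "\<forall>i<r. a i < p ^ k i"
      "(x \<otimes>\<^bsub>G\<^esub> inv\<^bsub>G\<^esub> gprod G g a r, y \<otimes>\<^bsub>H\<^esub> inv\<^bsub>H\<^esub> gprod H h a r) \<in> W" using nf[OF xy] by blast
    have gc: "gprod G g a r \<in> carrier G" "gprod H h a r \<in> carrier H"
      using G.gprod_closed[OF gG] H.gprod_closed[OF hH] by auto
    have z: "x \<otimes>\<^bsub>G\<^esub> inv\<^bsub>G\<^esub> gprod G g a r \<in> ?A" "y \<otimes>\<^bsub>H\<^esub> inv\<^bsub>H\<^esub> gprod H h a r \<in> ?B"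
      using a(2) by (auto simp: W_iff)
    have a0: "\<forall>i<r. a i = 0"
    proof (cases "x \<in> ?A")
      case True
      let ?z = "x \<otimes>\<^bsub>G\<^esub> inv\<^bsub>G\<^esub> gprod G g a r"
      have "inv\<^bsub>G\<^esub> ?z \<otimes>\<^bsub>G\<^esub> x \<in> ?A"
        by (rule subgroup.m_closed[OF G.gamma2_sub subgroup.m_inv_closed[OF G.gamma2_sub z(1)] True])
      moreover have "inv\<^bsub>G\<^esub> ?z \<otimes>\<^bsub>G\<^esub> x = gprod G g a r"
        using DG(1)[OF xy] gc by (simp add: G.inv_mult_group G.m_assoc)
      ultimately show ?thesis using indG a(1) by simp
    next
      case False
      then have y: "y \<in> ?B" using g2 by blast
      let ?z = "y \<otimes>\<^bsub>H\<^esub> inv\<^bsub>H\<^esub> gprod H h a r"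
      have "inv\<^bsub>H\<^esub> ?z \<otimes>\<^bsub>H\<^esub> y \<in> ?B"
        by (rule subgroup.m_closed[OF H.gamma2_sub subgroup.m_inv_closed[OF H.gamma2_sub z(2)] y])
      moreover have "inv\<^bsub>H\<^esub> ?z \<otimes>\<^bsub>H\<^esub> y = gprod H h a r"
        using DG(2)[OF xy] gc by (simp add: H.inv_mult_group H.m_assoc)
      ultimately show ?thesis using indH a(1) by simp
    qed
    then have "gprod G g a r = \<one>\<^bsub>G\<^esub>" "gprod H h a r = \<one>\<^bsub>H\<^esub>"
      using G.gprod_zero H.gprod_zero by blast+
    then show ?thesis using a(2) DG[OF xy] by simp
  qed
  \<comment> \<open>If either element is trivial modulo \<open>KK\<close>, its commutator
    combination is minus the remainder and so lies in \<open>LL\<close>. The combinations for the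
    two groups agree modulo \<open>LL\<close>, so independence in \<open>G\<close> makes p divide
    all the coefficients, and both elements reduce to the common remainder \<open>l\<close> modulo
    \<open>KK\<close>.\<close>
  have kereq: "e m - 1 \<in> KK \<longleftrightarrow> f m' - 1 \<in> KK" if "(m, m') \<in> W" for m m'
  proof -
    obtain n l where nl: "l \<in> LL" "eqm KK (e m - 1) (?cG n + l)" "eqm KK (f m' - 1) (?cH n + l)"
      using \<open>(m, m') \<in> W\<close> by (auto simp: W_iff)
    have zero: "e m - 1 \<in> KK \<and> f m' - 1 \<in> KK" if cL: "?cG n \<in> LL" and kk: "e m - 1 \<in> KK \<or> f m' - 1 \<in> KK"
    proof -
      have pn: "int p dvd n ij" if "ij \<in> G.Idx d" for ij
        by (rule G.commutators_indep[OF gG spG dr gU crd cL that])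
      have "?cG n \<in> KK" "?cH n \<in> KK"
        by (intro add_closed_sum KD(1,7) subsetD[OF K0_KK p_dvd_K0] pn; assumption)+
      then have "eqm KK (e m - 1) l" "eqm KK (f m' - 1) l"
        using eqm_trans[OF KD(1) nl(2), of l] eqm_trans[OF KD(1) nl(3), of l] by (simp_all add: eqm_def)
      then show ?thesis using kk eqm_mem[OF KD(1)] eqm_sym[OF KD(1)] by blast
    qed
    have inL: "x \<in> LL" if "eqm KK y (x + l)" "y \<in> KK" for x y
    proof -
      have "x + l \<in> LL" using eqm_mem[OF LD(1) eqm_mono[OF KK_LL eqm_sym[OF KD(1) that(1)]]] that(2) KK_LL by blast
      then have "x + l - l \<in> LL" by (rule LD(3)[OF _ nl(1)])
      then show ?thesis by simp
    qed
    have "?cG n \<in> LL" if "e m - 1 \<in> KK \<or> f m' - 1 \<in> KK"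
      using that inL[OF nl(2)] inL[OF nl(3)] eqm_mem[OF LD(1) cc] by blast
    then show ?thesis using zero by blast
  qed
  have dk: "x \<in> G.gN4 \<longleftrightarrow> y \<in> H.gN4" if xy: "(x, y) \<in> D" for x y
  proof -
    have c: "x \<in> carrier G" "y \<in> carrier H" using DG[OF xy] by auto
    have 1: "x \<in> G.gN4 \<longleftrightarrow> e x - 1 \<in> KK" using G.Dk_KK G.Dk_iff c by blast
    have 2: "y \<in> H.gN4 \<longleftrightarrow> f y - 1 \<in> KK" using H.Dk_KK H.Dk_iff c by blast
    have 3: "e x - 1 \<in> KK \<Longrightarrow> x \<in> ?A" using G.Dk_AA G.Dk_iff c KK_AA by blast
    have 4: "f y - 1 \<in> KK \<Longrightarrow> y \<in> ?B" using H.Dk_AA H.Dk_iff c KK_AA by blast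
    show ?thesis using 1 2 3 4 kereq[OF inW[OF xy]] by blast
  qed
  have tD: "(g i, h i) \<in> D" if "i < r" for i
    using that generate.incl[of "t i" "W \<union> t ` {..<r}" ?X] by (simp add: t_def D_def)
  have WD: "W \<subseteq> D" by (auto simp: D_def intro: generate.incl)
  have projG: "\<exists>y. (x, y) \<in> D" if x: "x \<in> carrier G" for x
  proof -
    let ?S = "{x \<in> carrier G. \<exists>y. (x, y) \<in> D}"
    have "?S = carrier G"
    proof (rule G.spans_generate[OF gG spG])
      show "subgroup ?S G"
      proof
        show "?S \<subseteq> carrier G" by blast
        have "\<one>\<^bsub>?P\<^esub> \<in> D" by (rule subgroup.one_closed[OF sDP])
        then show "\<one>\<^bsub>G\<^esub> \<in> ?S" by auto
        fix u assume "u \<in> ?S"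
        then obtain u' where u: "(u, u') \<in> D" by blast
        have uc: "u \<in> carrier G" "u' \<in> carrier H" using DG[OF u] by auto
        have "inv\<^bsub>?P\<^esub> (u, u') \<in> D" by (rule subgroup.m_inv_closed[OF sDP u])
        then show "inv\<^bsub>G\<^esub> u \<in> ?S" using inv_DirProd[OF G.is_group H.is_group uc] uc by auto
        fix v assume "v \<in> ?S"
        then obtain v' where v: "(v, v') \<in> D" by blast
        have "(u, u') \<otimes>\<^bsub>?P\<^esub> (v, v') \<in> D" by (rule subgroup.m_closed[OF sDP u v])
        then show "u \<otimes>\<^bsub>G\<^esub> v \<in> ?S" using DG[OF u] DG[OF v] by auto
      qed
      show "\<forall>i<r. g i \<in> ?S" using tD gG by blast
      show "?A \<subseteq> ?S"
      proof
        fix m assume m: "m \<in> ?A"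
        obtain n where n: "eqm LL (e m - 1) (?cG n)"
          using G.commutators_span[OF gG spG dr gU AG(2)[OF m]] by blast
        \<comment> \<open>The partner of \<open>m\<close> is obtained by carrying the coefficients
          \<open>n\<close> and the remainder \<open>l\<close> over to the commutators of
          \<open>H\<close>; \<open>AA_rep\<close> then supplies a group element in that
          class.\<close>
        define l where "l = (e m - 1) - ?cG n"
        have l: "l \<in> LL" using n by (simp add: l_def eqm_def)
        have "?cH n \<in> AA"
        proof (intro add_closed_sum AD(1,6))
          fix ij assume "ij \<in> G.Idx d"
          then have "commutator H (h (fst ij)) (h (snd ij)) \<in> ?B"
            using Idxr hH by (intro H.commutator_gamma2) auto
          then show "H.Cm h ij \<in> AA" using BH(2) by (simp add: H.Cm_def)
        qed
        then have "?cH n + l \<in> AA" using l LL_AA by (intro AD(5)) auto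
        then obtain m' where m': "m' \<in> ?B" "eqm KK (?cH n + l) (f m' - 1)" using H.AA_rep by blast
        have "eqm KK (e m - 1) (?cG n + l)" by (simp add: l_def eqm_refl KD(1))
        then have "?R m m'" by (rule RI[OF l _ eqm_sym[OF KD(1) m'(2)]])
        then have "(m, m') \<in> W" using m m'(1) by (simp add: W_iff)
        then show "m \<in> ?S" using WD AG(1)[OF m] by blast
      qed
    qed
    then show ?thesis using x by blast
  qed
  have projH: "\<exists>x. (x, y) \<in> D" if y: "y \<in> carrier H" for y
  proof -
    let ?S = "{y \<in> carrier H. \<exists>x. (x, y) \<in> D}"
    have "?S = carrier H"
    proof (rule H.spans_generate[OF hH spH])
      show "subgroup ?S H"
      proof
        show "?S \<subseteq> carrier H" by blast
        have "\<one>\<^bsub>?P\<^esub> \<in> D" by (rule subgroup.one_closed[OF sDP])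
        then show "\<one>\<^bsub>H\<^esub> \<in> ?S" by auto
        fix u assume "u \<in> ?S"
        then obtain u' where u: "(u', u) \<in> D" by blast
        have uc: "u' \<in> carrier G" "u \<in> carrier H" using DG[OF u] by auto
        have "inv\<^bsub>?P\<^esub> (u', u) \<in> D" by (rule subgroup.m_inv_closed[OF sDP u])
        then show "inv\<^bsub>H\<^esub> u \<in> ?S" using inv_DirProd[OF G.is_group H.is_group uc] uc by auto
        fix v assume "v \<in> ?S"
        then obtain v' where v: "(v', v) \<in> D" by blast
        have "(u', u) \<otimes>\<^bsub>?P\<^esub> (v', v) \<in> D" by (rule subgroup.m_closed[OF sDP u v])
        then show "u \<otimes>\<^bsub>H\<^esub> v \<in> ?S" using DG[OF u] DG[OF v] by auto
      qed
      show "\<forall>i<r. h i \<in> ?S" using tD hH by blast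
      show "?B \<subseteq> ?S"
      proof
        fix m assume m: "m \<in> ?B"
        obtain n where n: "eqm LL (f m - 1) (?cH n)"
          using H.commutators_span[OF hH spH dr hU BH(2)[OF m]] by blast
        define l where "l = (f m - 1) - ?cH n"
        have l: "l \<in> LL" using n by (simp add: l_def eqm_def)
        have "?cG n \<in> AA"
        proof (intro add_closed_sum AD(1,6))
          fix ij assume "ij \<in> G.Idx d"
          then have "commutator G (g (fst ij)) (g (snd ij)) \<in> ?A"
            using Idxr gG by (intro G.commutator_gamma2) auto
          then show "G.Cm g ij \<in> AA" using AG(2) by (simp add: G.Cm_def)
        qed
        then have "?cG n + l \<in> AA" using l LL_AA by (intro AD(5)) auto
        then obtain m' where m': "m' \<in> ?A" "eqm KK (?cG n + l) (e m' - 1)" using G.AA_rep by blast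
        have "eqm KK (f m - 1) (?cH n + l)" by (simp add: l_def eqm_refl KD(1))
        then have "?R m' m" by (rule RI[OF l eqm_sym[OF KD(1) m'(2)]])
        then have "(m', m) \<in> W" using m m'(1) by (simp add: W_iff)
        then show "m \<in> ?S" using WD BH(1)[OF m] by blast
      qed
    qed
    then show ?thesis using y by blast
  qed
  show ?thesis
    by (rule goursat_iso[OF G.is_group H.is_group G.gN_normal(2) H.gN_normal(2) sDP projG projH dk])
qed

end

section \<open>The group algebra as a quotient of an integral word ring\<close>

text \<open>In the field R / \<open>I\<close> with p elements raising to the p-th power is the
  identity, so an element of p-power order maps to 1. This places every group basis of R /
  \<open>K0\<close> formed by a p-group in 1 + I, and the isomorphism of group algebras need not be
  normalised to respect augmentations.\<close>

lemma (in ideal_tower) aug_unit: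
  assumes "eqm K0 (x ^ (p ^ s)) 1"
  shows "x - 1 \<in> I"
proof -
  obtain n where n: "x - of_int n \<in> I" using aug_ex by blast
  have "eqm I (of_int n ^ (p ^ s)) 1"
    using eqm_trans[OF ID(1) eqm_sym[OF ID(1) eqm_pow[OF tideal_I]] eqm_mono[OF K0_I assms]] n
    by (simp add: eqm_def)
  moreover have "eqm I (of_int n ^ (p ^ s)) (1 + of_int (n - 1) ^ (p ^ s))"
    using eqm_mono[OF K0_I frob_one[of "of_int (n - 1)" s]] by simp
  ultimately have "eqm I (1 + of_int (n - 1) ^ (p ^ s)) 1"
    using eqm_trans[OF ID(1) eqm_sym[OF ID(1)]] by blast
  then have "of_int ((n - 1) ^ (p ^ s)) \<in> I" by (simp add: eqm_def)
  then have "int p dvd n - 1"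
    using prime_dvd_power[of "int p" "n - 1"] prime_p by (simp only: of_int_I_iff) simp
  then have "of_int (n - 1) \<in> I" by (simp only: of_int_I_iff)
  from add_closedD[OF ID(1)] show ?thesis
    using eqm_trans[OF ID(1), of x "of_int n" 1] n \<open>of_int (n - 1) \<in> I\<close> by (simp add: eqm_def)
qed

lemma prime_field_int:
  fixes F :: "('f, 'r) ring_scheme"
  assumes F: "field F" "card (carrier F) = p" "prime p"
  shows "[(n::int)] \<cdot>\<^bsub>F\<^esub> \<one>\<^bsub>F\<^esub> = \<zero>\<^bsub>F\<^esub> \<longleftrightarrow> int p dvd n"
    and "a \<in> carrier F \<Longrightarrow> \<exists>n::int. a = [n] \<cdot>\<^bsub>F\<^esub> \<one>\<^bsub>F\<^esub>"
proof -
  interpret field F by (rule F(1))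
  have p: "[(int p)] \<cdot>\<^bsub>F\<^esub> \<one>\<^bsub>F\<^esub> = \<zero>\<^bsub>F\<^esub>"
    using add.pow_order_eq_1[OF one_closed] F(2) by (simp add: order_def add_pow_int_ge)
  have mult: "[(m * int p)] \<cdot>\<^bsub>F\<^esub> \<one>\<^bsub>F\<^esub> = \<zero>\<^bsub>F\<^esub>" for m
    using add.int_pow_pow[OF one_closed, of m "int p"] p by (simp add: mult.commute)
  have iff: "[(n::int)] \<cdot>\<^bsub>F\<^esub> \<one>\<^bsub>F\<^esub> = \<zero>\<^bsub>F\<^esub> \<longleftrightarrow> int p dvd n" for n
  proof
    assume n: "[n] \<cdot>\<^bsub>F\<^esub> \<one>\<^bsub>F\<^esub> = \<zero>\<^bsub>F\<^esub>"
    show "int p dvd n"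
    proof (rule ccontr)
      assume "\<not> int p dvd n"
      then have "coprime (int p) n" using F(3) by (simp add: prime_imp_coprime)
      then obtain u v where "u * int p + v * n = 1" using bezout_int[of "int p" n] by auto
      then have "[(u * int p + v * n)] \<cdot>\<^bsub>F\<^esub> \<one>\<^bsub>F\<^esub> = \<one>\<^bsub>F\<^esub>" by simp
      moreover have "[(v * n)] \<cdot>\<^bsub>F\<^esub> \<one>\<^bsub>F\<^esub> = \<zero>\<^bsub>F\<^esub>"
        using add.int_pow_pow[OF one_closed, of v n] n by (simp add: mult.commute)
      ultimately show False using mult[of u] by (simp add: add.int_pow_mult[OF one_closed])
    qed
  next
    assume "int p dvd n"
    then show "[n] \<cdot>\<^bsub>F\<^esub> \<one>\<^bsub>F\<^esub> = \<zero>\<^bsub>F\<^esub>" using mult by (auto simp: mult.commute)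
  qed
  then show "[(n::int)] \<cdot>\<^bsub>F\<^esub> \<one>\<^bsub>F\<^esub> = \<zero>\<^bsub>F\<^esub> \<longleftrightarrow> int p dvd n" .
  assume a: "a \<in> carrier F"
  let ?f = "\<lambda>n::int. [n] \<cdot>\<^bsub>F\<^esub> \<one>\<^bsub>F\<^esub>"
  have inj: "inj_on ?f {0..<int p}"
  proof (rule inj_onI)
    fix m n assume mn: "m \<in> {0..<int p}" "n \<in> {0..<int p}" "?f m = ?f n"
    have "?f (m - n) \<oplus>\<^bsub>F\<^esub> ?f n = ?f m" using add.int_pow_mult[OF one_closed, of "m - n" n] by simp
    then have "?f (m - n) = \<zero>\<^bsub>F\<^esub>" using mn(3) by simp
    then have "int p dvd m - n" by (simp only: iff)
    then show "m = n" using mn(1,2) zdvd_imp_le[of "int p" "m - n"] zdvd_imp_le[of "int p" "n - m"]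
      by (auto simp: dvd_diff_commute) (metis atLeastLessThan_iff mod_eq_dvd_iff mod_pos_pos_trivial)
  qed
  have "finite (carrier F)" using F(2,3) card_ge_0_finite prime_gt_0_nat by metis
  moreover have "?f ` {0..<int p} \<subseteq> carrier F" by auto
  moreover have "card (?f ` {0..<int p}) = card (carrier F)" using card_image[OF inj] F(2) by simp
  ultimately have "?f ` {0..<int p} = carrier F" by (rule card_subset_eq)
  then show "\<exists>n::int. a = ?f n" using a by blast
qed

text \<open>Applied with \<open>\<Phi>\<close> the evaluation of words in \<open>FG\<close>, and with its composition with \<open>FG \<cong> FH\<close>. Linearity of
  the isomorphism is automatic over a prime field.\<close>

lemma mod_group_ring_from_hom:
  fixes F :: "('f, 's) ring_scheme" and G :: "('a, 'm) monoid_scheme" and \<Phi> :: "'r::ring_1 \<Rightarrow> 'a \<Rightarrow> 'f"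
  defines "A \<equiv> group_algebra F G"
  assumes T: "ideal_tower K0 I p" and G: "finite_p_group p G"
    and F: "field F" "card (carrier F) = p"
    and cl: "\<And>x. \<Phi> x \<in> carrier A" and add: "\<And>x y. \<Phi> (x + y) = \<Phi> x \<oplus>\<^bsub>A\<^esub> \<Phi> y"
    and mult: "\<And>x y. \<Phi> (x * y) = \<Phi> x \<otimes>\<^bsub>A\<^esub> \<Phi> y" and one: "\<Phi> 1 = \<one>\<^bsub>A\<^esub>"
    and surj: "\<And>a. a \<in> carrier A \<Longrightarrow> \<exists>x. \<Phi> x = a"
    and ker: "K0 = {x. \<Phi> x = \<zero>\<^bsub>A\<^esub>}"
  shows "\<exists>e. mod_group_ring K0 I p G e"
proof -
  interpret ideal_tower K0 I p by (rule T)
  interpret F: field F by (rule F(1))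
  interpret G: group G using G by (simp add: finite_p_group_def)
  have fin: "finite (carrier G)" and ord: "\<exists>n. order G = p ^ n" using G by (auto simp: finite_p_group_def)
  let ?\<iota> = "\<lambda>n::int. [n] \<cdot>\<^bsub>F\<^esub> \<one>\<^bsub>F\<^esub>"
  have val: "\<Phi> x g \<in> carrier F" if "g \<in> carrier G" for x g
    using cl[of x] that by (auto simp: A_def group_algebra_def)
  have ext: "\<Phi> x = \<Phi> y \<longleftrightarrow> (\<forall>g\<in>carrier G. \<Phi> x g = \<Phi> y g)" for x y
    using cl[of x] cl[of y] by (auto simp: A_def group_algebra_def intro: PiE_ext)
  have plus: "\<Phi> (x + y) g = \<Phi> x g \<oplus>\<^bsub>F\<^esub> \<Phi> y g" if "g \<in> carrier G" for x y g
    using that by (simp add: add A_def group_algebra_def)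
  have zero: "\<Phi> 0 g = \<zero>\<^bsub>F\<^esub>" if "g \<in> carrier G" for g
    using plus[OF that, of 0 0] val[OF that, of 0] by simp
  have minus: "\<Phi> (x - y) g \<oplus>\<^bsub>F\<^esub> \<Phi> y g = \<Phi> x g" if "g \<in> carrier G" for x y g
    using plus[OF that, of "x - y" y] by simp
  have K0_iff: "x \<in> K0 \<longleftrightarrow> (\<forall>g\<in>carrier G. \<Phi> x g = \<zero>\<^bsub>F\<^esub>)" for x
  proof -
    have "0 \<in> K0" by (rule K0D(2))
    then have "\<Phi> 0 = \<zero>\<^bsub>A\<^esub>" by (simp add: ker)
    then show ?thesis using ext[of x 0] zero by (simp add: ker)
  qed
  have eqm_iff: "eqm K0 x y \<longleftrightarrow> \<Phi> x = \<Phi> y" for x y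
  proof -
    have "\<Phi> (x - y) g = \<zero>\<^bsub>F\<^esub> \<longleftrightarrow> \<Phi> x g = \<Phi> y g" if "g \<in> carrier G" for g
      using minus[OF that, of x y] val[OF that, of "x - y"] val[OF that, of y] val[OF that, of x]
      by (metis F.l_zero F.add.right_cancel F.zero_closed)
    then show ?thesis by (simp add: eqm_def K0_iff ext)
  qed
  have scale: "\<Phi> (of_int n * x) g = [n] \<cdot>\<^bsub>F\<^esub> \<Phi> x g" if g: "g \<in> carrier G" for n x g
  proof (induction n rule: int_induct[of _ 0])
    case base
    show ?case using zero[OF g] by (simp add: add_pow_int_ge add_pow_def)
  next
    case (step1 i)
    have "\<Phi> (of_int (i + 1) * x) g = \<Phi> (of_int i * x) g \<oplus>\<^bsub>F\<^esub> \<Phi> x g"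
      using plus[OF g, of "of_int i * x" x] by (simp add: distrib_right)
    then show ?case using step1 val[OF g, of x] by (simp add: F.add.int_pow_mult)
  next
    case (step2 i)
    have "\<Phi> (of_int (i - 1) * x) g \<oplus>\<^bsub>F\<^esub> \<Phi> x g = \<Phi> (of_int i * x) g"
      using minus[OF g, of "of_int i * x" x] by (simp add: left_diff_distrib)
    also have "\<dots> = [(i - 1)] \<cdot>\<^bsub>F\<^esub> \<Phi> x g \<oplus>\<^bsub>F\<^esub> \<Phi> x g"
      using step2 val[OF g, of x] F.add.int_pow_mult[of "\<Phi> x g" "i - 1" 1] by simp
    finally show ?case using val[OF g] by simp
  qed
  define \<delta> where "\<delta> g = (\<lambda>x\<in>carrier G. if x = g then \<one>\<^bsub>F\<^esub> else \<zero>\<^bsub>F\<^esub>)" for g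
  have \<delta>A: "\<delta> g \<in> carrier A" for g by (auto simp: \<delta>_def A_def group_algebra_def)
  have \<delta>_mult: "\<delta> x \<otimes>\<^bsub>A\<^esub> \<delta> y = \<delta> (x \<otimes>\<^bsub>G\<^esub> y)" if x: "x \<in> carrier G" and y: "y \<in> carrier G" for x y
  proof
    fix k
    show "(\<delta> x \<otimes>\<^bsub>A\<^esub> \<delta> y) k = \<delta> (x \<otimes>\<^bsub>G\<^esub> y) k"
    proof (cases "k \<in> carrier G")
      case k: True
      have "(\<delta> x \<otimes>\<^bsub>A\<^esub> \<delta> y) k = (\<Oplus>\<^bsub>F\<^esub>z\<in>carrier G. \<delta> x z \<otimes>\<^bsub>F\<^esub> \<delta> y (inv\<^bsub>G\<^esub> z \<otimes>\<^bsub>G\<^esub> k))"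
        using k by (simp add: A_def group_algebra_def)
      also have "\<dots> = (\<Oplus>\<^bsub>F\<^esub>z\<in>carrier G. if x = z then \<delta> y (inv\<^bsub>G\<^esub> z \<otimes>\<^bsub>G\<^esub> k) else \<zero>\<^bsub>F\<^esub>)"
        using k by (intro F.finsum_cong') (auto simp: \<delta>_def)
      also have "\<dots> = \<delta> y (inv\<^bsub>G\<^esub> x \<otimes>\<^bsub>G\<^esub> k)"
        using k by (intro F.finsum_singleton x fin) (auto simp: \<delta>_def)
      also have "\<dots> = \<delta> (x \<otimes>\<^bsub>G\<^esub> y) k"
        using x y k by (auto simp: \<delta>_def G.m_assoc[symmetric])
      finally show ?thesis .
    qed (simp add: A_def group_algebra_def \<delta>_def)
  qed
  have \<delta>_one: "\<delta> \<one>\<^bsub>G\<^esub> = \<one>\<^bsub>A\<^esub>" by (simp add: \<delta>_def A_def group_algebra_def)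
  \<comment> \<open>A preimage of the basis vector of \<open>g\<close>, determined modulo
    \<open>K0\<close>; hence the multiplicativity of \<open>e\<close> only up to
    \<open>K0\<close>.\<close>
  define e where "e g = (SOME x. \<Phi> x = \<delta> g)" for g
  have e: "\<Phi> (e g) = \<delta> g" for g unfolding e_def by (rule someI_ex[OF surj[OF \<delta>A]])
  have lin: "\<Phi> (\<Sum>g\<in>S. of_int (n g) * e g) k = (if k \<in> S then ?\<iota> (n k) else \<zero>\<^bsub>F\<^esub>)"
    if "finite S" "S \<subseteq> carrier G" "k \<in> carrier G" for n S k
    using that
  proof (induction S rule: finite_induct)
    case empty
    then show ?case by (simp add: zero)
  next
    case (insert g S)
    then have "\<Phi> (\<Sum>g\<in>insert g S. of_int (n g) * e g) k =
        [(n g)] \<cdot>\<^bsub>F\<^esub> \<delta> g k \<oplus>\<^bsub>F\<^esub> (if k \<in> S then ?\<iota> (n k) else \<zero>\<^bsub>F\<^esub>)"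
      by (simp add: plus scale e)
    also have "\<dots> = (if k \<in> insert g S then ?\<iota> (n k) else \<zero>\<^bsub>F\<^esub>)"
      using insert.hyps insert.prems by (auto simp: \<delta>_def F.add.int_pow_one)
    finally show ?case .
  qed
  have e_mult: "eqm K0 (e (x \<otimes>\<^bsub>G\<^esub> y)) (e x * e y)" if "x \<in> carrier G" "y \<in> carrier G" for x y
    using \<delta>_mult[OF that] by (simp add: eqm_iff mult e)
  have e_one: "eqm K0 (e \<one>\<^bsub>G\<^esub>) 1" by (simp add: eqm_iff e one \<delta>_one)
  have "mod_group_ring K0 I p G e"
  proof (unfold_locales)
    fix x assume x: "x \<in> carrier G"
    have pow: "eqm K0 (e (x [^]\<^bsub>G\<^esub> n)) (e x ^ n)" for n :: nat
    proof (induction n)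
      case (Suc n)
      have "eqm K0 (e (x [^]\<^bsub>G\<^esub> Suc n)) (e (x [^]\<^bsub>G\<^esub> n) * e x)" using e_mult[OF G.nat_pow_closed[OF x] x] by simp
      moreover have "eqm K0 (e (x [^]\<^bsub>G\<^esub> n) * e x) (e x ^ n * e x)"
        by (rule eqm_mult[OF tideal_K0 Suc eqm_refl[OF K0D(1)]])
      ultimately show ?case using eqm_trans[OF K0D(1)] by (metis power_Suc2)
    qed (simp add: e_one)
    obtain s where s: "order G = p ^ s" using ord by blast
    have "eqm K0 (e \<one>\<^bsub>G\<^esub>) (e x ^ (p ^ s))" using pow[of "p ^ s"] G.pow_order_eq_1[OF x] s by simp
    then have "eqm K0 (e x ^ (p ^ s)) 1"
      using eqm_trans[OF K0D(1) eqm_sym[OF K0D(1)] e_one] by blast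
    then show "e x - 1 \<in> I" by (rule aug_unit)
  next
    fix r
    have "\<forall>g. \<exists>n. g \<in> carrier G \<longrightarrow> \<Phi> r g = ?\<iota> n" using prime_field_int(2)[OF F prime_p] val by blast
    then obtain n where n: "\<forall>g. g \<in> carrier G \<longrightarrow> \<Phi> r g = ?\<iota> (n g)" by metis
    have "eqm K0 r (\<Sum>g\<in>carrier G. of_int (n g) * e g)" using n by (simp add: eqm_iff ext lin fin)
    then show "\<exists>n. eqm K0 r (\<Sum>g\<in>carrier G. of_int (n g) * e g)" by blast
  next
    fix n g assume "(\<Sum>g\<in>carrier G. of_int (n g) * e g) \<in> K0" and g: "g \<in> carrier G"
    then have "?\<iota> (n g) = \<zero>\<^bsub>F\<^esub>" by (simp add: K0_iff lin fin)
    then show "int p dvd n g" by (simp only: prime_field_int(1)[OF F prime_p])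
  qed (use fin ord e_one e_mult in auto)
  then show ?thesis by blast
qed

text \<open>The group algebra is not a type, so it is replaced by the ring \<open>'a list \<Rightarrow>\<^sub>0 int\<close> of noncommutative
  integral polynomials modulo the kernel of the evaluation of words.\<close>

instantiation list :: (type) monoid_add
begin

definition zero_list :: "'a list" where "0 = []"

definition plus_list :: "'a list \<Rightarrow> 'a list \<Rightarrow> 'a list" where "xs + ys = xs @ ys"

instance by standard (simp_all add: zero_list_def plus_list_def)

end

definition word_sum :: "('k \<Rightarrow> int) \<Rightarrow> ('k \<Rightarrow>\<^sub>0 int) \<Rightarrow> int" where
  "word_sum c x = (\<Sum>w\<in>Poly_Mapping.keys x. Poly_Mapping.lookup x w * c w)"

lemma word_sum_add: "word_sum c (x + y) = word_sum c x + word_sum c y"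
  unfolding word_sum_def
  by (rule setsum_keys_plus_distrib[where f = "\<lambda>w v. v * c w"]) (simp_all add: distrib_right)

lemma word_sum_zero [simp]: "word_sum c 0 = 0"
  by (simp add: word_sum_def)

lemma word_sum_diff: "word_sum c (x - y) = word_sum c x - word_sum c y"
  using word_sum_add[of c "x - y" y] by simp

lemma word_sum_single [simp]: "word_sum c (Poly_Mapping.single w n) = n * c w"
  by (simp add: word_sum_def)

lemma word_sum_sum: "word_sum c (sum f X) = (\<Sum>i\<in>X. word_sum c (f i))"
  by (induction X rule: infinite_finite_induct) (simp_all add: word_sum_add)

lemma sum_word_sum: "(\<Sum>i\<in>X. word_sum (c i) x) = word_sum (\<lambda>w. \<Sum>i\<in>X. c i w) x"
  by (simp add: word_sum_def sum_distrib_left) (rule sum.swap)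

text \<open>Both sides are biadditive, so single words suffice. With a one-element index set this is
  the multiplicativity of the augmentation, with the group as index set it is the convolution of
  coefficients.\<close>

lemma word_sum_mult:
  assumes c: "\<And>u v. c (u + v) = (\<Sum>i\<in>X. a i u * b i v)"
  shows "word_sum c (x * y) = (\<Sum>i\<in>X. word_sum (a i) x * word_sum (b i) y)"
  using subset_UNIV[of "Poly_Mapping.keys x"]
proof (induction x rule: frag_induction)
  case (one u)
  show ?case
    using subset_UNIV[of "Poly_Mapping.keys y"]
  proof (induction y rule: frag_induction)
    case (one v)
    show ?case by (simp add: mult_single c)
  qed (simp_all add: word_sum_diff right_diff_distrib sum_subtractf)
qed (simp_all add: word_sum_diff left_diff_distrib sum_subtractf)

text \<open>Words are formed from all elements of the type, so letters outside the carrier are read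
  as the identity to make every word evaluate in the group.\<close>

definition word_prod :: "('a, 'm) monoid_scheme \<Rightarrow> 'a list \<Rightarrow> 'a" where
  "word_prod G w = foldr (\<lambda>a b. (if a \<in> carrier G then a else \<one>\<^bsub>G\<^esub>) \<otimes>\<^bsub>G\<^esub> b) w \<one>\<^bsub>G\<^esub>"

text \<open>The coefficients of the image in the integral group ring; they are reduced modulo p only
  in \<open>word_eval\<close>, so that the kernel of the latter is described by
  divisibility.\<close>

definition word_coeff :: "('a, 'm) monoid_scheme \<Rightarrow> ('a list \<Rightarrow>\<^sub>0 int) \<Rightarrow> 'a \<Rightarrow> int" where
  "word_coeff G x g = word_sum (\<lambda>w. if word_prod G w = g then 1 else 0) x"

definition word_aug :: "('a list \<Rightarrow>\<^sub>0 int) \<Rightarrow> int" where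
  "word_aug x = word_sum (\<lambda>_. 1) x"

definition word_eval ::
    "('f, 's) ring_scheme \<Rightarrow> ('a, 'm) monoid_scheme \<Rightarrow> ('a list \<Rightarrow>\<^sub>0 int) \<Rightarrow> 'a \<Rightarrow> 'f" where
  "word_eval F G x = (\<lambda>g\<in>carrier G. [word_coeff G x g] \<cdot>\<^bsub>F\<^esub> \<one>\<^bsub>F\<^esub>)"

lemma word_aug_mult: "word_aug (x * y) = word_aug x * word_aug y"
  unfolding word_aug_def
  by (subst word_sum_mult[where X = "{()}" and a = "\<lambda>_ _. 1" and b = "\<lambda>_ _. 1"]) simp_all

lemma word_aug_diff: "word_aug (x - y) = word_aug x - word_aug y"
  by (simp add: word_aug_def word_sum_diff)

lemma word_aug_single [simp]: "word_aug (Poly_Mapping.single w n) = n"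
  by (simp add: word_aug_def)

section \<open>Evaluation of words in the group algebra\<close>

context group
begin

lemma word_prod_closed [simp]: "word_prod G w \<in> carrier G"
  by (induction w) (simp_all add: word_prod_def)

lemma word_prod_append: "word_prod G (u + v) = word_prod G u \<otimes> word_prod G v"
proof (induction u)
  case (Cons a u)
  then show ?case
    using word_prod_closed[of u] word_prod_closed[of v]
    by (simp add: word_prod_def plus_list_def m_assoc)
next
  case Nil
  show ?case using word_prod_closed[of v] by (simp add: word_prod_def plus_list_def)
qed

lemma word_coeff_mult:
  assumes fin: "finite (carrier G)" and g: "g \<in> carrier G"
  shows "word_coeff G (x * y) g = (\<Sum>h\<in>carrier G. word_coeff G x h * word_coeff G y (inv h \<otimes> g))"
  unfolding word_coeff_def
proof (rule word_sum_mult)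
  fix u v
  have "(\<Sum>h\<in>carrier G. (if word_prod G u = h then 1 else 0) * (if word_prod G v = inv h \<otimes> g then 1 else 0 :: int))
      = (\<Sum>h\<in>carrier G. if word_prod G u = h then (if word_prod G v = inv h \<otimes> g then 1 else 0) else 0)"
    by (intro sum.cong) auto
  also have "\<dots> = (if word_prod G v = inv (word_prod G u) \<otimes> g then 1 else 0)"
    using fin by (simp add: sum.delta)
  also have "\<dots> = (if word_prod G (u + v) = g then 1 else 0)"
    using inv_solve_left[of "word_prod G v" "word_prod G u" g] g by (auto simp: word_prod_append)
  finally show "(if word_prod G (u + v) = g then 1 else 0) =
    (\<Sum>h\<in>carrier G. (if word_prod G u = h then 1 else 0) * (if word_prod G v = inv h \<otimes> g then 1 else 0 :: int))"
    by simp
qed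

lemma word_aug_coeff: "finite (carrier G) \<Longrightarrow> word_aug x = (\<Sum>g\<in>carrier G. word_coeff G x g)"
  unfolding word_aug_def word_coeff_def sum_word_sum by (simp add: sum.delta)

lemma word_eval_hom:
  fixes F (structure)
  assumes fin: "finite (carrier G)" and F: "field F" "card (carrier F) = p" "prime p"
  shows "word_eval F G x \<in> carrier (group_algebra F G)"
    and "word_eval F G (x + y) = word_eval F G x \<oplus>\<^bsub>group_algebra F G\<^esub> word_eval F G y"
    and "word_eval F G (x * y) = word_eval F G x \<otimes>\<^bsub>group_algebra F G\<^esub> word_eval F G y"
    and "word_eval F G 1 = \<one>\<^bsub>group_algebra F G\<^esub>"
    and "a \<in> carrier (group_algebra F G) \<Longrightarrow> \<exists>x. word_eval F G x = a"
    and "word_eval F G x = \<zero>\<^bsub>group_algebra F G\<^esub> \<longleftrightarrow> (\<forall>g\<in>carrier G. int p dvd word_coeff G x g)"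
proof -
  interpret F: field F by (rule F(1))
  let ?\<iota> = "\<lambda>n::int. [n] \<cdot>\<^bsub>F\<^esub> \<one>\<^bsub>F\<^esub>"
  have \<iota>0: "?\<iota> 0 = \<zero>\<^bsub>F\<^esub>" by (simp add: add_pow_int_ge add_pow_def)
  have \<iota>_sum: "?\<iota> (sum n S) = (\<Oplus>\<^bsub>F\<^esub>h\<in>S. ?\<iota> (n h))" if "finite S" for S :: "'a set" and n
    using that by (induction S rule: finite_induct) (simp_all add: \<iota>0 F.add.int_pow_mult)
  have \<iota>_mult: "?\<iota> (m * n) = ?\<iota> m \<otimes>\<^bsub>F\<^esub> ?\<iota> n" for m n
    using F.add_pow_ldistr_int[of "\<one>\<^bsub>F\<^esub>" "?\<iota> n" m] F.add.int_pow_pow[of "\<one>\<^bsub>F\<^esub>" m n] by (simp add: mult.commute)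
  show "word_eval F G x \<in> carrier (group_algebra F G)"
    by (simp add: word_eval_def group_algebra_def)
  show "word_eval F G (x + y) = word_eval F G x \<oplus>\<^bsub>group_algebra F G\<^esub> word_eval F G y"
    by (auto simp: word_eval_def group_algebra_def word_coeff_def word_sum_add F.add.int_pow_mult)
  show "word_eval F G (x * y) = word_eval F G x \<otimes>\<^bsub>group_algebra F G\<^esub> word_eval F G y"
  proof
    fix g
    show "word_eval F G (x * y) g = (word_eval F G x \<otimes>\<^bsub>group_algebra F G\<^esub> word_eval F G y) g"
    proof (cases "g \<in> carrier G")
      case g: True
      have "word_eval F G (x * y) g =
          (\<Oplus>\<^bsub>F\<^esub>h\<in>carrier G. ?\<iota> (word_coeff G x h) \<otimes>\<^bsub>F\<^esub> ?\<iota> (word_coeff G y (inv h \<otimes> g)))"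
        using g by (simp add: word_eval_def word_coeff_mult[OF fin g] \<iota>_sum[OF fin] \<iota>_mult)
      also have "\<dots> = (\<Oplus>\<^bsub>F\<^esub>h\<in>carrier G. word_eval F G x h \<otimes>\<^bsub>F\<^esub> word_eval F G y (inv h \<otimes> g))"
        using g by (intro F.finsum_cong') (auto simp: word_eval_def)
      finally show ?thesis using g by (simp add: group_algebra_def)
    qed (simp add: word_eval_def group_algebra_def)
  qed
  have one: "(1 :: 'a list \<Rightarrow>\<^sub>0 int) = Poly_Mapping.single [] 1"
    by (simp flip: zero_list_def)
  have "word_coeff G 1 g = (if g = \<one> then 1 else 0)" for g
    by (auto simp: one word_coeff_def word_prod_def)
  then show "word_eval F G 1 = \<one>\<^bsub>group_algebra F G\<^esub>"
    by (auto simp: word_eval_def group_algebra_def \<iota>0)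
  show "word_eval F G x = \<zero>\<^bsub>group_algebra F G\<^esub> \<longleftrightarrow> (\<forall>g\<in>carrier G. int p dvd word_coeff G x g)"
    unfolding prime_field_int(1)[OF F, symmetric]
    by (auto simp: word_eval_def group_algebra_def fun_eq_iff)
  assume a: "a \<in> carrier (group_algebra F G)"
  have "\<forall>g. \<exists>n. g \<in> carrier G \<longrightarrow> a g = ?\<iota> n"
    using prime_field_int(2)[OF F] a by (auto simp: group_algebra_def PiE_iff)
  then obtain n where n: "\<forall>g. g \<in> carrier G \<longrightarrow> a g = ?\<iota> (n g)" by metis
  define x where "x = (\<Sum>h\<in>carrier G. Poly_Mapping.single [h] (n h))"
  have "word_coeff G x g = n g" if g: "g \<in> carrier G" for g
  proof -
    have "word_coeff G x g = (\<Sum>h\<in>carrier G. if h = g then n h else 0)"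
      by (auto simp: x_def word_coeff_def word_sum_sum word_prod_def intro!: sum.cong)
    then show ?thesis using fin g by (simp add: sum.delta)
  qed
  then have "word_eval F G x = a"
    using n a by (auto simp: word_eval_def group_algebra_def PiE_def extensional_def)
  then show "\<exists>x. word_eval F G x = a" by blast
qed

end

text \<open>Shows that the isomorphism preserves zero using only its additivity: the image of zero
  is its own double, and coefficientwise this forces zero.\<close>

lemma group_algebra_idem_zero:
  assumes "field F" and z: "z \<in> carrier (group_algebra F G)" and zz: "z \<oplus>\<^bsub>group_algebra F G\<^esub> z = z"
  shows "z = \<zero>\<^bsub>group_algebra F G\<^esub>"
proof -
  interpret F: field F by (rule assms(1))
  have "z g = \<zero>\<^bsub>F\<^esub>" if g: "g \<in> carrier G" for g
    using fun_cong[OF zz, of g] g z by (auto simp: group_algebra_def PiE_iff)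
  then show ?thesis using z by (auto simp: group_algebra_def PiE_def extensional_def)
qed

theorem theorem2:
  fixes p d :: nat
    and F :: "('f, 'r) ring_scheme"
    and G :: "('a, 'm) monoid_scheme"
    and H :: "('b, 'n) monoid_scheme"
  assumes "prime p" and "p > 2"
    and "field F" and "card (carrier F) = p"
    and "finite_p_group p G" and "finite_p_group p H"
    and "algebra_isomorphic F (group_algebra F G) (group_algebra F H)"
    and "order (G Mod (frattini G <#>\<^bsub>G\<^esub> group_center G)) = p ^ d"
    and "power_subgroup G p (carrier G) \<inter> lower_central G 2
           \<subseteq> power_subgroup G p (lower_central G 2) <#>\<^bsub>G\<^esub> lower_central G 3"
    and "order (G\<lparr>carrier := lower_central G 2\<rparr> Mod
           (power_subgroup G p (lower_central G 2) <#>\<^bsub>G\<^esub> lower_central G 3)) = p ^ (d choose 2)"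
  shows "G Mod (power_subgroup G p (lower_central G 2) <#>\<^bsub>G\<^esub> lower_central G 4)
       \<cong> H Mod (power_subgroup H p (lower_central H 2) <#>\<^bsub>H\<^esub> lower_central H 4)"
proof -
  let ?A = "group_algebra F G" and ?B = "group_algebra F H"
  interpret G: group G using assms(5) by (simp add: finite_p_group_def)
  have fin: "finite (carrier G)" using assms(5) by (simp add: finite_p_group_def)
  note E = G.word_eval_hom[OF fin assms(3,4,1)]
  define K0 where "K0 = {x. word_eval F G x = \<zero>\<^bsub>?A\<^esub>}"
  \<comment> \<open>Every word has augmentation 1, so this is the augmentation ideal with respect to
    \<open>G\<close>. That the elements of \<open>H\<close> lie in 1 + I as well comes from
    \<open>aug_unit\<close>.\<close>
  define I where "I = {x :: 'a list \<Rightarrow>\<^sub>0 int. int p dvd word_aug x}"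
  have K0_iff: "x \<in> K0 \<longleftrightarrow> (\<forall>g\<in>carrier G. int p dvd word_coeff G x g)" for x
    by (simp add: K0_def E(6))
  have K0: "tideal K0"
    unfolding tideal_def add_closed_def
  proof (intro conjI ballI allI)
    show "0 \<in> K0" by (simp add: K0_iff word_coeff_def)
    fix x y assume x: "x \<in> K0"
    show "x - y \<in> K0" if "y \<in> K0"
      using x that by (auto simp: K0_iff word_coeff_def word_sum_diff)
    show "y * x \<in> K0" "x * y \<in> K0"
      using x by (auto simp: K0_iff G.word_coeff_mult[OF fin] intro!: dvd_sum)
  qed
  have I: "tideal I"
    unfolding tideal_def add_closed_def
    by (auto simp: I_def word_aug_mult word_aug_diff) (simp add: word_aug_def)
  interpret ideal_tower K0 I p
  proof
    show "K0 \<subseteq> I"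
      by (auto simp: K0_iff I_def G.word_aug_coeff[OF fin] intro: dvd_sum)
    have "word_aug (1 :: 'a list \<Rightarrow>\<^sub>0 int) = 1"
      using word_aug_single[of 0 1] by (simp del: word_aug_single)
    then show "1 \<notin> I" using prime_gt_1_nat[OF assms(1)] by (simp add: I_def)
    have nat: "of_int n = Poly_Mapping.single (0 :: 'a list) n" for n by (simp flip: single_of_int)
    have "of_nat p = Poly_Mapping.single (0 :: 'a list) (int p)" by simp
    then show "of_nat p \<in> K0" by (simp add: K0_iff word_coeff_def del: single_of_nat)
    show "\<exists>n::int. x - of_int n \<in> I" for x
      by (rule exI[of _ "word_aug x"]) (simp add: I_def word_aug_diff nat del: single_of_int)
  qed (use K0 I assms(1,2) in auto)
  have tower: "ideal_tower K0 I p" by unfold_locales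
  obtain e where e: "mod_group_ring K0 I p G e"
    using mod_group_ring_from_hom[OF tower assms(5,3,4) E(1-5)] K0_def by blast
  obtain \<phi> where \<phi>: "\<phi> \<in> ring_iso ?A ?B"
    using assms(7) by (auto simp: algebra_isomorphic_def algebra_iso_def)
  note \<phi>D = ring_iso_memE[OF \<phi>]
  have zero: "\<phi> \<zero>\<^bsub>?A\<^esub> = \<zero>\<^bsub>?B\<^esub>"
  proof -
    have E0: "word_eval F G 0 = \<zero>\<^bsub>?A\<^esub>" using K0D(2) by (simp add: K0_def)
    show ?thesis
    proof (rule group_algebra_idem_zero[OF assms(3)])
      show "\<phi> \<zero>\<^bsub>?A\<^esub> \<in> carrier ?B" using \<phi>D(1)[OF E(1), of 0] by (simp add: E0)
      show "\<phi> \<zero>\<^bsub>?A\<^esub> \<oplus>\<^bsub>?B\<^esub> \<phi> \<zero>\<^bsub>?A\<^esub> = \<phi> \<zero>\<^bsub>?A\<^esub>"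
        using \<phi>D(3)[OF E(1) E(1), of 0 0] E(2)[of 0 0] by (simp add: E0)
    qed
  qed
  have inj: "inj_on \<phi> (carrier ?A)" and surj: "\<phi> ` carrier ?A = carrier ?B"
    using \<phi>D(5) by (auto simp: bij_betw_def)
  have "\<zero>\<^bsub>?A\<^esub> \<in> carrier ?A" using E(1)[of 0] K0D(2) by (simp add: K0_def)
  \<comment> \<open>By injectivity of \<open>\<phi>\<close>, evaluation in FG and evaluation
    followed by \<open>\<phi>\<close> have the same kernel, so both groups are bases over the same
    \<open>K0\<close>.\<close>
  then have ker: "K0 = {x. \<phi> (word_eval F G x) = \<zero>\<^bsub>?B\<^esub>}"
    using inj_on_eq_iff[OF inj E(1)] by (simp add: K0_def flip: zero)
  obtain f where f: "mod_group_ring K0 I p H f"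
  proof (rule exE[OF mod_group_ring_from_hom[OF tower assms(6,3,4), of "\<lambda>x. \<phi> (word_eval F G x)"]])
    fix x y
    show "\<phi> (word_eval F G x) \<in> carrier ?B" by (rule \<phi>D(1)[OF E(1)])
    show "\<phi> (word_eval F G (x + y)) = \<phi> (word_eval F G x) \<oplus>\<^bsub>?B\<^esub> \<phi> (word_eval F G y)"
      unfolding E(2) by (rule \<phi>D(3)[OF E(1) E(1)])
    show "\<phi> (word_eval F G (x * y)) = \<phi> (word_eval F G x) \<otimes>\<^bsub>?B\<^esub> \<phi> (word_eval F G y)"
      unfolding E(3) by (rule \<phi>D(2)[OF E(1) E(1)])
    show "\<phi> (word_eval F G 1) = \<one>\<^bsub>?B\<^esub>" unfolding E(4) by (rule \<phi>D(4))
    show "\<exists>x. \<phi> (word_eval F G x) = b" if "b \<in> carrier ?B" for b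
      using that E(5) unfolding surj[symmetric] by blast
  qed (use ker in auto)
  interpret G: mod_group_ring K0 I p G e by (rule e)
  \<comment> \<open>With \<open>Dk_LL\<close> this is hypothesis (1) as stated for \<open>G\<close>;
    its ring form then serves \<open>H\<close> as well.\<close>
  have "G.pow_cond" using assms(9) by (simp add: G.pow_cond_def G.Dk_LL)
  then have pow: "pow_span \<inter> AA \<subseteq> LL" by (simp only: G.pow_cond_iff)
  interpret group_ring_pair K0 I p G H e f
    by (intro group_ring_pair.intro group_ring_pair_axioms.intro tower e f pow)
  show ?thesis by (rule pair_iso[OF assms(8,10)])
qed

end
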